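(* For every integer $m\geq 5$, the Vietoris–Rips complex $\mathcal{VR}(Q_m;3)$ is homotopy equivalent to $$\Big(\bigvee_{2^{m-4}\binom{m}{4}} S^7\Big)\vee\Big(\bigvee_{\sum_{i=4}^{m-1}2^{i-4}\binom{i}{4}} S^4\Big).$$
   Context: $Q_m$ denotes the hypercube metric space: its points are all subsets of $[m]=\{1,\dots,m\}$, with distance $d(A,B)=|A\Delta B|$ (cardinality of the symmetric difference). For a metric space $(X,d)$ and $r\geq 0$, the Vietoris–Rips complex $\mathcal{VR}(X;r)$ is the simplicial complex with vertex set $X$ whose simplices are the nonempty finite subsets of $X$ of diameter at most $r$. $\bigvee_k S^d$ denotes a wedge sum of $k$ copies of the $d$-sphere. *)

theory Defs
  imports "HOL-Analysis.Analysis"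
begin

definition final_topology ::
    "'b set \<Rightarrow> 'i set \<Rightarrow> ('i \<Rightarrow> 'a topology) \<Rightarrow> ('i \<Rightarrow> 'a \<Rightarrow> 'b) \<Rightarrow> 'b topology" where
  "final_topology S I X f =
     topology (\<lambda>U. U \<subseteq> S \<and> (\<forall>i\<in>I. openin (X i) {x \<in> topspace (X i). f i x \<in> U}))"

lemma istopology_final_topology:
  "istopology (\<lambda>U. U \<subseteq> S \<and> (\<forall>i\<in>I. openin (X i) {x \<in> topspace (X i). f i x \<in> U}))"
proof -
  have Int: "{x \<in> topspace (X i). f i x \<in> U \<inter> V} =
      {x \<in> topspace (X i). f i x \<in> U} \<inter> {x \<in> topspace (X i). f i x \<in> V}" for i U V
    by auto
  have Un: "{x \<in> topspace (X i). f i x \<in> \<Union>\<K>} =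
      (\<Union>U\<in>\<K>. {x \<in> topspace (X i). f i x \<in> U})" for i \<K>
    by auto
  show ?thesis
    unfolding istopology_def Int Un by blast
qed

lemma openin_final_topology:
  "openin (final_topology S I X f) U \<longleftrightarrow>
     U \<subseteq> S \<and> (\<forall>i\<in>I. openin (X i) {x \<in> topspace (X i). f i x \<in> U})"
  unfolding final_topology_def by (simp add: istopology_final_topology)

lemma topspace_final_topology:
  assumes "\<And>i x. i \<in> I \<Longrightarrow> x \<in> topspace (X i) \<Longrightarrow> f i x \<in> S"
  shows "topspace (final_topology S I X f) = S"
proof -
  have "{x \<in> topspace (X i). f i x \<in> S} = topspace (X i)" if "i \<in> I" for i
    using assms that by auto
  then have "openin (final_topology S I X f) S"
    by (simp add: openin_final_topology)
  then show ?thesis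
    by (metis openin_final_topology openin_subset openin_topspace subset_antisym)
qed

text \<open>An abstract simplicial complex is represented by the set of its (nonempty, finite) simplices.
  Points of the realization are given by their barycentric coordinates.\<close>

definition simplex_space :: "'a set \<Rightarrow> ('a \<Rightarrow> real) topology" where
  "simplex_space \<sigma> = subtopology (powertop_real UNIV)
     {t. (\<forall>v. 0 \<le> t v) \<and> (\<forall>v. v \<notin> \<sigma> \<longrightarrow> t v = 0) \<and> (\<Sum>v\<in>\<sigma>. t v) = 1}"

text \<open>The weak topology: a set is open iff its intersection with every closed simplex is open
  in that simplex.\<close>

definition geometric_realization :: "'a set set \<Rightarrow> ('a \<Rightarrow> real) topology" where
  "geometric_realization K =
     final_topology (\<Union>\<sigma>\<in>K. topspace (simplex_space \<sigma>)) K simplex_space (\<lambda>\<sigma> t. t)"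

lemma topspace_geometric_realization:
  "topspace (geometric_realization K) = (\<Union>\<sigma>\<in>K. topspace (simplex_space \<sigma>))"
  unfolding geometric_realization_def by (rule topspace_final_topology) auto

definition set_diameter :: "('a \<Rightarrow> 'a \<Rightarrow> real) \<Rightarrow> 'a set \<Rightarrow> real" where
  "set_diameter d A = (SUP (x, y)\<in>A \<times> A. d x y)"

lemma set_diameter_le_iff:
  assumes "finite A" "A \<noteq> {}"
  shows "set_diameter d A \<le> r \<longleftrightarrow> (\<forall>x\<in>A. \<forall>y\<in>A. d x y \<le> r)"
proof -
  have "bdd_above ((\<lambda>(x, y). d x y) ` (A \<times> A))"
    using assms by simp
  then show ?thesis
    unfolding set_diameter_def using assms by (subst cSUP_le_iff) auto
qed

definition vietoris_rips :: "'a set \<Rightarrow> ('a \<Rightarrow> 'a \<Rightarrow> real) \<Rightarrow> real \<Rightarrow> 'a set set" where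
  "vietoris_rips X d r = {\<sigma>. \<sigma> \<subseteq> X \<and> finite \<sigma> \<and> \<sigma> \<noteq> {} \<and> set_diameter d \<sigma> \<le> r}"

definition hypercube :: "nat \<Rightarrow> nat set set" where
  "hypercube m = Pow {1..m}"

definition hypercube_dist :: "nat set \<Rightarrow> nat set \<Rightarrow> real" where
  "hypercube_dist A B = real (card (sym_diff A B))"

lemma Metric_space_hypercube: "Metric_space (hypercube m) hypercube_dist"
proof
  fix A B C :: "nat set"
  show "0 \<le> hypercube_dist A B"
    by (simp add: hypercube_dist_def)
  show "hypercube_dist A B = hypercube_dist B A"
    by (simp add: hypercube_dist_def Un_commute)
  assume AB: "A \<in> hypercube m" "B \<in> hypercube m"
  then have fin: "finite A" "finite B"
    by (auto simp: hypercube_def intro: finite_subset)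
  then show "hypercube_dist A B = 0 \<longleftrightarrow> A = B"
    by (auto simp: hypercube_dist_def)
  assume "C \<in> hypercube m"
  then have "finite C"
    by (auto simp: hypercube_def intro: finite_subset)
  with fin have "card (sym_diff A C) \<le> card (sym_diff A B \<union> sym_diff B C)"
    by (intro card_mono) auto
  also have "\<dots> \<le> card (sym_diff A B) + card (sym_diff B C)"
    by (rule card_Un_le)
  finally show "hypercube_dist A C \<le> hypercube_dist A B + hypercube_dist B C"
    by (simp add: hypercube_dist_def)
qed

text \<open>The wedge of the pointed spaces \<open>(X i, p i)\<close>, \<open>i \<in> I\<close>: the disjoint union with all the
  \<open>p i\<close> identified, with the quotient topology. The common base point is \<open>None\<close>, and \<open>Some (i, x)\<close>
  is the point \<open>x \<noteq> p i\<close> of the \<open>i\<close>-th summand. The wedge of the empty family is a point.\<close>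

definition wedge_incl :: "('i \<Rightarrow> 'a) \<Rightarrow> 'i \<Rightarrow> 'a \<Rightarrow> ('i \<times> 'a) option" where
  "wedge_incl p i x = (if x = p i then None else Some (i, x))"

definition wedge :: "'i set \<Rightarrow> ('i \<Rightarrow> 'a topology) \<Rightarrow> ('i \<Rightarrow> 'a) \<Rightarrow> ('i \<times> 'a) option topology" where
  "wedge I X p =
     final_topology (insert None (\<Union>i\<in>I. wedge_incl p i ` topspace (X i))) I X (wedge_incl p)"

lemma topspace_wedge:
  "topspace (wedge I X p) = insert None (\<Union>i\<in>I. wedge_incl p i ` topspace (X i))"
  unfolding wedge_def by (rule topspace_final_topology) auto

lemma quotient_map_wedge:
  assumes "I \<noteq> {}" and "\<And>i. i \<in> I \<Longrightarrow> p i \<in> topspace (X i)"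
  shows "quotient_map (sum_topology X I) (wedge I X p) (\<lambda>(i, x). wedge_incl p i x)"
proof -
  obtain i where "i \<in> I" using assms by blast
  with assms have "None \<in> (\<Union>i\<in>I. wedge_incl p i ` topspace (X i))"
    by (force simp: wedge_incl_def)
  then have 1: "(\<lambda>(i, x). wedge_incl p i x) ` topspace (sum_topology X I) = topspace (wedge I X p)"
    by (force simp: topspace_wedge)
  have "{x. (i, x) \<in> {z \<in> topspace (sum_topology X I). (\<lambda>(i, x). wedge_incl p i x) z \<in> U}} =
      {x \<in> topspace (X i). wedge_incl p i x \<in> U}" if "i \<in> I" for i U
    using that by auto
  then have "openin (sum_topology X I)
        {z \<in> topspace (sum_topology X I). (\<lambda>(i, x). wedge_incl p i x) z \<in> U}
      \<longleftrightarrow> openin (wedge I X p) U" if "U \<subseteq> topspace (wedge I X p)" for U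
    using that[unfolded topspace_wedge] unfolding wedge_def openin_final_topology openin_sum_topology
    by auto
  with 1 show ?thesis
    unfolding quotient_map_def by blast
qed

definition sphere_basepoint :: "nat \<Rightarrow> real" where
  "sphere_basepoint = (\<lambda>i. if i = 0 then 1 else 0)"

lemma sphere_basepoint_in_nsphere: "sphere_basepoint \<in> topspace (nsphere n)"
  by (simp add: nsphere sphere_basepoint_def if_distrib [of "\<lambda>x. x ^ 2"] cong: if_cong)

definition sphere_wedge :: "nat \<Rightarrow> nat \<Rightarrow> (nat \<times> (nat \<Rightarrow> real)) option topology" where
  "sphere_wedge k n = wedge {..<k} (\<lambda>_. nsphere n) (\<lambda>_. sphere_basepoint)"

definition wedge2 ::
    "'a topology \<Rightarrow> 'a \<Rightarrow> 'a topology \<Rightarrow> 'a \<Rightarrow> (bool \<times> 'a) option topology" where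
  "wedge2 X x Y y = wedge UNIV (\<lambda>b. if b then X else Y) (\<lambda>b. if b then x else y)"

end

theory Submission
  imports Defs
begin

text \<open>Every 4-dimensional face of the cube, a 4-cube, has diameter 4, so the simplices of
  \<open>VR(Q_m; 3)\<close> inside it are the vertex sets without antipodal pair: the boundary of a cross-polytope,
  a 7-sphere. Let \<open>L\<close> arise from the complex by deleting one suitable facet of each of these spheres.
  Adding all vertex sets of 4-cubes to \<open>L\<close> (or to the whole complex) gives a complex that collapses
  to \<open>L\<close>; it also collapses to the vertex sets of 4-cubes alone, thence to the chains of span at most
  4, a triangulation of the 4-skeleton of the cube. Deleting one 4-simplex from each of certain 4-faces
  makes that triangulation collapsible, so it is a wedge of 4-spheres. Finally the boundary of a deleted
  7-simplex is null-homotopic in \<open>L\<close>, since it can be pushed across its cross-polytope to the antipodal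
  facet. Hence the 7-simplices are attached along trivial maps and split off as 7-spheres.
  All collapses come from acyclic matchings that toggle one vertex.\<close>

section \<open>Attaching cells\<close>

text \<open>Parity supplies the vertices to toggle. Inside a simplex, distinct members of equal
  parity are at distance 2; three of them have exactly one common neighbour, and a fourth is
  adjacent to it as well unless the four form half of a 3-cube. Stars with a further member at
  distance 4 from the centre spoil this and are matched beforehand. A deleted facet must be maximal
  in the whole complex, which not every facet is: a vertex, its four neighbours and half of the
  vertices at distance 2 form a facet, but a neighbour in a fifth direction is within 3 of all of
  them. There is one 7-sphere for each 4-face. The 4-spheres belong to the 4-faces for which the
  largest coordinate vanishing at the bottom vertex, say \<open>i + 1\<close>, is not a direction:
  all coordinates above are 1, and below there is an arbitrary 4-face of the \<open>i\<close>-cube.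
  Hence the sum over \<open>i\<close>. Equivalences fix the top vertex \<open>{1..m}\<close>
  throughout, because the model spaces are wedges and attaching maps are compared with constant maps
  at the base point.\<close>

definition pointed_equivalent :: "'a topology \<Rightarrow> 'a \<Rightarrow> 'b topology \<Rightarrow> 'b \<Rightarrow> bool" where
  "pointed_equivalent X x Y y \<longleftrightarrow> x \<in> topspace X \<and> y \<in> topspace Y \<and>
     (\<exists>f g. continuous_map X Y f \<and> continuous_map Y X g \<and> f x = y \<and> g y = x \<and>
        homotopic_with (\<lambda>h. h x = x) X X (g \<circ> f) id \<and>
        homotopic_with (\<lambda>h. h y = y) Y Y (f \<circ> g) id)"

lemma pointed_equivalent_sym:
  "pointed_equivalent X x Y y \<Longrightarrow> pointed_equivalent Y y X x"
  unfolding pointed_equivalent_def by blast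

lemma pointed_equivalent_imp_homotopy_equivalent_space:
  assumes "pointed_equivalent X x Y y"
  shows "X homotopy_equivalent_space Y"
proof -
  obtain f g where fg: "continuous_map X Y f" "continuous_map Y X g"
      "homotopic_with (\<lambda>h. h x = x) X X (g \<circ> f) id" "homotopic_with (\<lambda>h. h y = y) Y Y (f \<circ> g) id"
    using assms unfolding pointed_equivalent_def by blast
  have "homotopic_with (\<lambda>h. True) X X (g \<circ> f) id" "homotopic_with (\<lambda>h. True) Y Y (f \<circ> g) id"
    by (rule homotopic_with_mono[OF fg(3)], simp) (rule homotopic_with_mono[OF fg(4)], simp)
  then show ?thesis using fg unfolding homotopy_equivalent_space_def by blast
qed

text \<open>One half of transitivity; the other half is the same argument with the two directions
  exchanged.\<close>

lemma pointed_homotopic_compose: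
  assumes f: "continuous_map X Y f" "f x = y" and g: "continuous_map Y X g" "g y = x"
    and gf: "homotopic_with (\<lambda>h. h x = x) X X (g \<circ> f) id"
    and h: "homotopic_with (\<lambda>h. h y = y) Y Y h id"
  shows "homotopic_with (\<lambda>h. h x = x) X X (g \<circ> h \<circ> f) id"
proof -
  have "homotopic_with (\<lambda>h. h x = y) X Y (h \<circ> f) (id \<circ> f)"
    by (rule homotopic_with_compose_continuous_map_right[OF h f(1)]) (simp add: f)
  then have "homotopic_with (\<lambda>h. h x = x) X X (g \<circ> (h \<circ> f)) (g \<circ> (id \<circ> f))"
    by (rule homotopic_with_compose_continuous_map_left[OF _ g(1)]) (simp add: g)
  then show ?thesis
    using gf by (auto simp: o_assoc intro: homotopic_with_trans)
qed

lemma pointed_equivalent_trans: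
  assumes "pointed_equivalent X x Y y" "pointed_equivalent Y y Z z"
  shows "pointed_equivalent X x Z z"
proof -
  obtain f g where fg: "continuous_map X Y f" "continuous_map Y X g" "f x = y" "g y = x"
      "homotopic_with (\<lambda>h. h x = x) X X (g \<circ> f) id" "homotopic_with (\<lambda>h. h y = y) Y Y (f \<circ> g) id"
    using assms(1) unfolding pointed_equivalent_def by blast
  obtain f' g' where fg': "continuous_map Y Z f'" "continuous_map Z Y g'" "f' y = z" "g' z = y"
      "homotopic_with (\<lambda>h. h y = y) Y Y (g' \<circ> f') id" "homotopic_with (\<lambda>h. h z = z) Z Z (f' \<circ> g') id"
    using assms(2) unfolding pointed_equivalent_def by blast
  have "homotopic_with (\<lambda>h. h x = x) X X ((g \<circ> g') \<circ> (f' \<circ> f)) id"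
    using pointed_homotopic_compose[OF fg(1,3,2,4,5) fg'(5)] by (simp add: o_assoc)
  moreover have "homotopic_with (\<lambda>h. h z = z) Z Z ((f' \<circ> f) \<circ> (g \<circ> g')) id"
    using pointed_homotopic_compose[OF fg'(2,4,1,3,6) fg(6)] by (simp add: o_assoc)
  moreover have "continuous_map X Z (f' \<circ> f)" "continuous_map Z X (g \<circ> g')"
    using fg fg' by (auto intro: continuous_map_compose)
  ultimately show ?thesis
    using assms fg fg' unfolding pointed_equivalent_def by (metis comp_apply)
qed

section \<open>Maps and homotopies out of a space with cones attached\<close>

abbreviation unit_interval :: "real topology" where
  "unit_interval \<equiv> top_of_set {0..1}"

text \<open>The tube lemma: the complement is the projection of a closed set along the compact
  factor \<open>J\<close>, and such projections are closed. Pulling back along \<open>\<phi>\<close>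
  allows \<open>B\<close> to be either of the two pieces from which a space is glued.\<close>

lemma openin_prod_unit_interval:
  assumes preim: "\<And>x. x \<in> topspace B \<Longrightarrow> \<phi> x \<in> topspace Y"
    and W: "openin (prod_topology unit_interval B) {(t, x). t \<in> {0..1} \<and> x \<in> topspace B \<and> (t, \<phi> x) \<in> W}"
    and J: "compactin unit_interval J"
  shows "openin B {x \<in> topspace B. \<forall>t\<in>J. (t, \<phi> x) \<in> W}"
proof -
  let ?P = "{(t, x). t \<in> {0..1} \<and> x \<in> topspace B \<and> (t, \<phi> x) \<in> W}"
  have J01: "J \<subseteq> {0..1}" using compactin_subset_topspace[OF J] by simp
  have JI: "subtopology unit_interval J = top_of_set J"
    using J01 by (simp add: subtopology_subtopology Int_absorb1)
  have "prod_topology (top_of_set J) B = subtopology (prod_topology unit_interval B) (J \<times> topspace B)"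
    by (metis JI prod_topology_subtopology(1))
  then have "openin (prod_topology (top_of_set J) B) ((J \<times> topspace B) \<inter> ?P)"
    using W by (simp add: openin_subtopology_Int2)
  then have "closedin (prod_topology (top_of_set J) B) (topspace (prod_topology (top_of_set J) B) - (J \<times> topspace B) \<inter> ?P)"
    by blast
  moreover have "topspace (prod_topology (top_of_set J) B) - (J \<times> topspace B) \<inter> ?P = J \<times> topspace B - ?P"
    by auto
  ultimately have "closedin (prod_topology (top_of_set J) B) (J \<times> topspace B - ?P)"
    by simp
  moreover have "closed_map (prod_topology (top_of_set J) B) B snd"
    using J JI by (metis closed_map_snd compact_space_subtopology)
  ultimately have "closedin B (snd ` (J \<times> topspace B - ?P))"
    by (auto simp: closed_map_def)
  then have "openin B (topspace B - snd ` (J \<times> topspace B - ?P))"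
    by blast
  moreover have "topspace B - snd ` (J \<times> topspace B - ?P) = {x \<in> topspace B. \<forall>t\<in>J. (t, \<phi> x) \<in> W}"
  proof -
    have "x \<in> snd ` (J \<times> topspace B - ?P) \<longleftrightarrow> (\<exists>t\<in>J. (t, \<phi> x) \<notin> W)" if x: "x \<in> topspace B" for x
    proof
      assume "x \<in> snd ` (J \<times> topspace B - ?P)"
      then obtain z where z: "x = snd z" "z \<in> J \<times> topspace B - ?P" by (rule imageE)
      obtain t where t: "z = (t, x)" using z(1) by (cases z) simp
      have "t \<in> J" "(t, x) \<notin> ?P" using z(2) unfolding t by simp_all
      then show "\<exists>t\<in>J. (t, \<phi> x) \<notin> W" using x J01 by auto
    next
      assume "\<exists>t\<in>J. (t, \<phi> x) \<notin> W"
      then obtain t where "t \<in> J" "(t, \<phi> x) \<notin> W" by blast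
      then have "(t, x) \<in> J \<times> topspace B - ?P" using x by simp
      then show "x \<in> snd ` (J \<times> topspace B - ?P)" by (rule image_eqI[rotated]) simp
    qed
    then show ?thesis by blast
  qed
  ultimately show ?thesis by simp
qed

text \<open>\<open>Y\<close> is \<open>A\<close> with cones attached: \<open>\<beta>\<close> sends the end \<open>s = 1\<close> of \<open>P \<times> [0, 1]\<close> to \<open>A\<close> along \<open>f\<close>, and
  collapses the end \<open>s = 0\<close> of each fibre of \<open>\<kappa>\<close> to a cone point.\<close>

definition attaches ::
  "'y topology \<Rightarrow> 'a topology \<Rightarrow> 'p topology \<Rightarrow> ('a \<Rightarrow> 'y) \<Rightarrow> ('p \<times> real \<Rightarrow> 'y) \<Rightarrow> ('p \<Rightarrow> 'a) \<Rightarrow> ('p \<Rightarrow> 'c) \<Rightarrow> bool"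
  where "attaches Y A P \<alpha> \<beta> f \<kappa> \<longleftrightarrow>
    continuous_map A Y \<alpha> \<and> inj_on \<alpha> (topspace A) \<and>
    continuous_map (prod_topology P unit_interval) Y \<beta> \<and> continuous_map P A f \<and>
    topspace Y \<subseteq> \<alpha> ` topspace A \<union> \<beta> ` (topspace P \<times> {0..1}) \<and>
    (\<forall>U. U \<subseteq> topspace Y \<longrightarrow> openin A {a \<in> topspace A. \<alpha> a \<in> U} \<longrightarrow>
      openin (prod_topology P unit_interval) {z \<in> topspace P \<times> {0..1}. \<beta> z \<in> U} \<longrightarrow> openin Y U) \<and>
    (\<forall>p\<in>topspace P. \<beta> (p, 1) = \<alpha> (f p)) \<and>
    (\<forall>p\<in>topspace P. \<forall>s\<in>{0..<1}. \<beta> (p, s) \<notin> \<alpha> ` topspace A) \<and>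
    (\<forall>p\<in>topspace P. \<forall>p'\<in>topspace P. \<forall>s\<in>{0..<1}. \<forall>s'\<in>{0..<1}. \<beta> (p, s) = \<beta> (p', s') \<longleftrightarrow>
       s = s' \<and> (if s = 0 then \<kappa> p = \<kappa> p' else p = p'))"

lemma attachesD:
  assumes "attaches Y A P \<alpha> \<beta> f \<kappa>"
  shows "continuous_map A Y \<alpha>" "inj_on \<alpha> (topspace A)"
    "continuous_map (prod_topology P unit_interval) Y \<beta>" "continuous_map P A f"
    "topspace Y \<subseteq> \<alpha> ` topspace A \<union> \<beta> ` (topspace P \<times> {0..1})"
    "\<And>p. p \<in> topspace P \<Longrightarrow> \<beta> (p, 1) = \<alpha> (f p)"
    "\<And>p s. p \<in> topspace P \<Longrightarrow> s \<in> {0..<1} \<Longrightarrow> \<beta> (p, s) \<notin> \<alpha> ` topspace A"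
    "\<And>U. U \<subseteq> topspace Y \<Longrightarrow> openin A {a \<in> topspace A. \<alpha> a \<in> U} \<Longrightarrow>
      openin (prod_topology P unit_interval) {z \<in> topspace P \<times> {0..1}. \<beta> z \<in> U} \<Longrightarrow> openin Y U"
    "\<And>p p' s s'. p \<in> topspace P \<Longrightarrow> p' \<in> topspace P \<Longrightarrow> s \<in> {0..<1} \<Longrightarrow> s' \<in> {0..<1} \<Longrightarrow>
      \<beta> (p, s) = \<beta> (p', s') \<longleftrightarrow> s = s' \<and> (if s = 0 then \<kappa> p = \<kappa> p' else p = p')"
    "\<And>x. x \<in> topspace A \<Longrightarrow> \<alpha> x \<in> topspace Y"
    "\<And>p s. p \<in> topspace P \<Longrightarrow> s \<in> {0..1} \<Longrightarrow> \<beta> (p, s) \<in> topspace Y"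
    "\<And>p. p \<in> topspace P \<Longrightarrow> f p \<in> topspace A"
proof -
  note at = assms[unfolded attaches_def]
  show "continuous_map A Y \<alpha>" "inj_on \<alpha> (topspace A)" using at by blast+
  show "continuous_map (prod_topology P unit_interval) Y \<beta>" "continuous_map P A f" using at by blast+
  show "topspace Y \<subseteq> \<alpha> ` topspace A \<union> \<beta> ` (topspace P \<times> {0..1})" using at by blast
  show "\<beta> (p, 1) = \<alpha> (f p)" if "p \<in> topspace P" for p using at that by blast
  show "\<beta> (p, s) \<notin> \<alpha> ` topspace A" if "p \<in> topspace P" "s \<in> {0..<1}" for p s using at that by blast
  show "openin Y U" if "U \<subseteq> topspace Y" "openin A {a \<in> topspace A. \<alpha> a \<in> U}"
      "openin (prod_topology P unit_interval) {z \<in> topspace P \<times> {0..1}. \<beta> z \<in> U}" for U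
    using at that by blast
  show "\<beta> (p, s) = \<beta> (p', s') \<longleftrightarrow> s = s' \<and> (if s = 0 then \<kappa> p = \<kappa> p' else p = p')"
    if "p \<in> topspace P" "p' \<in> topspace P" "s \<in> {0..<1}" "s' \<in> {0..<1}" for p p' s s'
    using at that by blast
  have cm: "continuous_map A Y \<alpha>" "continuous_map (prod_topology P unit_interval) Y \<beta>" "continuous_map P A f"
    using at by blast+
  show "\<alpha> x \<in> topspace Y" if "x \<in> topspace A" for x
    using continuous_map_image_subset_topspace[OF cm(1)] that by blast
  show "\<beta> (p, s) \<in> topspace Y" if "p \<in> topspace P" "s \<in> {0..1}" for p s
    using continuous_map_image_subset_topspace[OF cm(2)] that by (auto simp: image_subset_iff)
  show "f p \<in> topspace A" if "p \<in> topspace P" for p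
    using continuous_map_image_subset_topspace[OF cm(3)] that by blast
qed

lemma openin_unit_interval_slice:
  assumes B: "openin (prod_topology unit_interval B) {(t, x). t \<in> {0..1} \<and> x \<in> topspace B \<and> (t, \<phi> x) \<in> W}"
    and x: "x \<in> topspace B"
  shows "openin unit_interval {s \<in> {0..1}. (s, \<phi> x) \<in> W}"
proof -
    have "continuous_map unit_interval (prod_topology unit_interval B) (\<lambda>s. (s, x))"
      by (simp add: continuous_map_pairwise o_def x)
    from openin_continuous_map_preimage[OF this B]
    have "openin unit_interval {s \<in> topspace unit_interval. (s, x) \<in> {(t, x). t \<in> {0..1} \<and> x \<in> topspace B \<and> (t, \<phi> x) \<in> W}}" .
    moreover have "{s \<in> topspace unit_interval. (s, x) \<in> {(t, x). t \<in> {0..1} \<and> x \<in> topspace B \<and> (t, \<phi> x) \<in> W}} = {s \<in> {0..1}. (s, \<phi> x) \<in> W}"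
      using x by auto
    ultimately show ?thesis by simp
  qed

text \<open>The product of a quotient map with the locally compact unit interval is again a quotient
  map. Here the quotient map is the one from the disjoint union of \<open>A\<close> and the cylinder
  over \<open>P\<close> onto \<open>Y\<close>; without this, homotopies on \<open>Y\<close> could
  not be defined piecewise.\<close>

lemma attaches_openin_prod:
  assumes at: "attaches Y A P \<alpha> \<beta> f \<kappa>"
    and W: "W \<subseteq> {0..1} \<times> topspace Y"
    and WA: "openin (prod_topology unit_interval A) {(t, x). t \<in> {0..1} \<and> x \<in> topspace A \<and> (t, \<alpha> x) \<in> W}"
    and WP: "openin (prod_topology unit_interval (prod_topology P unit_interval))
        {(t, x). t \<in> {0..1} \<and> x \<in> topspace (prod_topology P unit_interval) \<and> (t, \<beta> x) \<in> W}"
  shows "openin (prod_topology unit_interval Y) W"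
  unfolding openin_prod_topology_alt
proof (intro allI impI)
  fix t y assume ty: "(t, y) \<in> W"
  let ?PI = "prod_topology P unit_interval"
  have \<alpha>: "\<And>x. x \<in> topspace A \<Longrightarrow> \<alpha> x \<in> topspace Y"
    by (rule attachesD[OF at])
  have \<beta>: "\<And>x. x \<in> topspace ?PI \<Longrightarrow> \<beta> x \<in> topspace Y"
    using attachesD(11)[OF at] by auto
  have t: "t \<in> {0..1}" and y: "y \<in> topspace Y" using W ty by auto
  have op: "openin unit_interval {s \<in> {0..1}. (s, y) \<in> W}"
  proof -
    have "y \<in> \<alpha> ` topspace A \<union> \<beta> ` (topspace P \<times> {0..1})"
      using y attachesD(5)[OF at] by blast
    then consider a where "a \<in> topspace A" "y = \<alpha> a" | z where "z \<in> topspace ?PI" "y = \<beta> z"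
      by auto
    then show ?thesis
    proof cases
      case (1 a)
      show ?thesis using openin_unit_interval_slice[OF WA 1(1)] 1(2) by simp
    next
      case (2 z)
      show ?thesis using openin_unit_interval_slice[OF WP 2(1)] 2(2) by simp
    qed
  qed
  \<comment> \<open>Some compact neighbourhood \<open>J\<close> of \<open>t\<close> stays inside the
    open slice of \<open>W\<close> over \<open>y\<close>.\<close>
  have "locally_compact_space unit_interval"
    by (simp add: compact_imp_locally_compact_space compact_space_subtopology)
  then obtain U J where UJ: "openin unit_interval U" "compactin unit_interval J" "t \<in> U" "U \<subseteq> J" "J \<subseteq> {s \<in> {0..1}. (s, y) \<in> W}"
  proof -
    have "neighbourhood_base_of (compactin unit_interval) unit_interval"
      using \<open>locally_compact_space unit_interval\<close>
      by (simp add: Hausdorff_space_subtopology locally_compact_Hausdorff_imp_regular_space locally_compact_space_neighbourhood_base)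
    moreover have "t \<in> {s \<in> {0..1}. (s, y) \<in> W}" using t ty by blast
    ultimately have "\<exists>U J. openin unit_interval U \<and> compactin unit_interval J \<and> t \<in> U \<and> U \<subseteq> J \<and> J \<subseteq> {s \<in> {0..1}. (s, y) \<in> W}"
      using op unfolding neighbourhood_base_of by presburger
    then show thesis using that by (elim exE conjE)
  qed
  \<comment> \<open>The points whose whole \<open>J\<close>-tube lies in \<open>W\<close>. Both
    preimages are open by the tube lemma, so \<open>V\<close> is open by the defining property of
    the topology of \<open>Y\<close>.\<close>
  define V where "V = {x \<in> topspace Y. \<forall>s\<in>J. (s, x) \<in> W}"
  have "openin A {a \<in> topspace A. \<alpha> a \<in> V}"
  proof -
    have "{a \<in> topspace A. \<alpha> a \<in> V} = {x \<in> topspace A. \<forall>t\<in>J. (t, \<alpha> x) \<in> W}"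
      using \<alpha> by (auto simp: V_def)
    then show ?thesis using openin_prod_unit_interval[OF \<alpha> WA UJ(2)] by simp
  qed
  moreover have "openin ?PI {a \<in> topspace ?PI. \<beta> a \<in> V}"
  proof -
    have "{a \<in> topspace ?PI. \<beta> a \<in> V} = {x \<in> topspace ?PI. \<forall>t\<in>J. (t, \<beta> x) \<in> W}"
      using \<beta> by (auto simp: V_def)
    then show ?thesis using openin_prod_unit_interval[OF \<beta> WP UJ(2)] by simp
  qed
  ultimately have "openin Y V"
    by (intro attachesD(8)[OF at]) (auto simp: V_def)
  then show "\<exists>U V. openin unit_interval U \<and> openin Y V \<and> t \<in> U \<and> y \<in> V \<and> U \<times> V \<subseteq> W"
  proof (intro exI conjI)
    show "openin unit_interval U" "t \<in> U" by fact+
    show "y \<in> V" using UJ(5) y by (auto simp: V_def)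
    show "U \<times> V \<subseteq> W" using UJ(4) by (auto simp: V_def)
  qed
qed

text \<open>Homotopies on the two pieces glue as soon as they agree at the end \<open>s = 1\<close>,
  where the cylinder meets \<open>A\<close>, and identify at \<open>s = 0\<close> whatever shares a
  cone point.\<close>

lemma attaches_homotopy:
  assumes at: "attaches Y A P \<alpha> \<beta> f \<kappa>"
    and g: "continuous_map (prod_topology unit_interval A) Z g"
    and h: "continuous_map (prod_topology unit_interval (prod_topology P unit_interval)) Z h"
    and h1: "\<And>t p. t \<in> {0..1} \<Longrightarrow> p \<in> topspace P \<Longrightarrow> h (t, (p, 1)) = g (t, f p)"
    and h0: "\<And>t p p'. t \<in> {0..1} \<Longrightarrow> p \<in> topspace P \<Longrightarrow> p' \<in> topspace P \<Longrightarrow> \<kappa> p = \<kappa> p' \<Longrightarrow>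
      h (t, (p, 0)) = h (t, (p', 0))"
  obtains H where "continuous_map (prod_topology unit_interval Y) Z H"
    "\<And>t a. t \<in> {0..1} \<Longrightarrow> a \<in> topspace A \<Longrightarrow> H (t, \<alpha> a) = g (t, a)"
    "\<And>t p s. t \<in> {0..1} \<Longrightarrow> p \<in> topspace P \<Longrightarrow> s \<in> {0..1} \<Longrightarrow> H (t, \<beta> (p, s)) = h (t, (p, s))"
proof -
  \<comment> \<open>Outside the image of \<open>A\<close> the preimage is unique except at a cone
    point, and there hypothesis \<open>h0\<close> makes the choice immaterial.\<close>
  define H where "H = (\<lambda>(t, y). if y \<in> \<alpha> ` topspace A then g (t, inv_into (topspace A) \<alpha> y)
     else h (t, SOME z. z \<in> topspace P \<times> {0..<1} \<and> \<beta> z = y))"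
  have inj: "inj_on \<alpha> (topspace A)" by (rule attachesD[OF at])
  have Ha: "H (t, \<alpha> a) = g (t, a)" if "a \<in> topspace A" for t a
    using that inj by (simp add: H_def)
  have fA: "f p \<in> topspace A" if "p \<in> topspace P" for p
    using attachesD(12)[OF at] that .
  have Hb: "H (t, \<beta> (p, s)) = h (t, (p, s))" if "t \<in> {0..1}" "p \<in> topspace P" "s \<in> {0..1}" for t p s
  proof (cases "s = 1")
    case True
    then have "\<beta> (p, s) = \<alpha> (f p)" using attachesD(6)[OF at] that by auto
    then show ?thesis using True Ha[OF fA] h1 that by simp
  next
    case False
    then have s: "s \<in> {0..<1}" using that by auto
    then have ni: "\<beta> (p, s) \<notin> \<alpha> ` topspace A" using attachesD(7)[OF at] that by blast
    define z where "z = (SOME z. z \<in> topspace P \<times> {0..<1} \<and> \<beta> z = \<beta> (p, s))"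
    have "z \<in> topspace P \<times> {0..<1} \<and> \<beta> z = \<beta> (p, s)"
      unfolding z_def by (rule someI[of _ "(p, s)"]) (use that s in auto)
    then obtain p' s' where z: "z = (p', s')" "p' \<in> topspace P" "s' \<in> {0..<1}" "\<beta> (p', s') = \<beta> (p, s)"
      by (cases z) auto
    have "\<beta> (p', s') = \<beta> (p, s) \<longleftrightarrow> s' = s \<and> (if s' = 0 then \<kappa> p' = \<kappa> p else p' = p)"
      using attachesD(9)[OF at z(2) that(2) z(3) s] .
    with z(4) have "s' = s" "if s = 0 then \<kappa> p' = \<kappa> p else p' = p"
      by auto
    then have "h (t, z) = h (t, (p, s))"
      using z(1) h0[OF that(1) z(2) that(2)] by (cases "s = 0") simp_all
    then show ?thesis using ni by (simp add: H_def z_def)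
  qed
  have "continuous_map (prod_topology unit_interval Y) Z H"
    unfolding continuous_map_def
  proof (intro conjI allI impI)
    have gZ: "g ` ({0..1} \<times> topspace A) \<subseteq> topspace Z"
      using g by (auto simp: continuous_map_def Pi_iff)
    have hZ: "h ` ({0..1} \<times> (topspace P \<times> {0..1})) \<subseteq> topspace Z"
      using h by (auto simp: continuous_map_def Pi_iff)
    have tY: "topspace Y \<subseteq> \<alpha> ` topspace A \<union> \<beta> ` (topspace P \<times> {0..1})"
      by (rule attachesD[OF at])
    show "H \<in> topspace (prod_topology unit_interval Y) \<rightarrow> topspace Z"
    proof
      fix x assume "x \<in> topspace (prod_topology unit_interval Y)"
      then obtain t y where x: "x = (t, y)" "t \<in> {0..1}" "y \<in> topspace Y" by auto
      then consider a where "a \<in> topspace A" "y = \<alpha> a" | p s where "p \<in> topspace P" "s \<in> {0..1}" "y = \<beta> (p, s)"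
        using tY by blast
      then show "H x \<in> topspace Z"
        by cases (use x Ha Hb gZ hZ in \<open>auto simp: image_subset_iff\<close>)
    qed
    fix U assume U: "openin Z U"
    show "openin (prod_topology unit_interval Y) {x \<in> topspace (prod_topology unit_interval Y). H x \<in> U}"
    proof (rule attaches_openin_prod[OF at])
      have \<alpha>: "\<And>x. x \<in> topspace A \<Longrightarrow> \<alpha> x \<in> topspace Y"
        by (rule attachesD[OF at])
      have \<beta>: "\<And>p s. p \<in> topspace P \<Longrightarrow> s \<in> {0..1} \<Longrightarrow> \<beta> (p, s) \<in> topspace Y"
        by (rule attachesD[OF at])
      have "{(t, x). t \<in> {0..1} \<and> x \<in> topspace A \<and> (t, \<alpha> x) \<in> {x \<in> topspace (prod_topology unit_interval Y). H x \<in> U}} =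
          {x \<in> topspace (prod_topology unit_interval A). g x \<in> U}"
        using Ha \<alpha> by auto
      then show "openin (prod_topology unit_interval A) {(t, x). t \<in> {0..1} \<and> x \<in> topspace A \<and> (t, \<alpha> x) \<in> {x \<in> topspace (prod_topology unit_interval Y). H x \<in> U}}"
        using openin_continuous_map_preimage[OF g U] by simp
      have "{(t, x). t \<in> {0..1} \<and> x \<in> topspace (prod_topology P unit_interval) \<and> (t, \<beta> x) \<in> {x \<in> topspace (prod_topology unit_interval Y). H x \<in> U}} =
          {x \<in> topspace (prod_topology unit_interval (prod_topology P unit_interval)). h x \<in> U}"
        using Hb \<beta> by auto
      then show "openin (prod_topology unit_interval (prod_topology P unit_interval)) {(t, x). t \<in> {0..1} \<and> x \<in> topspace (prod_topology P unit_interval) \<and> (t, \<beta> x) \<in> {x \<in> topspace (prod_topology unit_interval Y). H x \<in> U}}"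
        using openin_continuous_map_preimage[OF h U] by simp
    qed auto
  qed
  then show thesis using Ha Hb by (intro that) auto
qed

lemma continuous_map_compose_pair:
  assumes "continuous_map (prod_topology A B) Z g" "continuous_map X A a" "continuous_map X B b"
  shows "continuous_map X Z (\<lambda>x. g (a x, b x))"
  using continuous_map_compose[OF continuous_map_pairedI[OF assms(2,3)] assms(1)]
  by (simp add: o_def)

lemma continuous_map_compose_app:
  assumes "continuous_map A Z g" "continuous_map X A a"
  shows "continuous_map X Z (\<lambda>x. g (a x))"
  using continuous_map_compose[OF assms(2,1)] by (simp add: o_def)

text \<open>Truncation keeps reparametrised times inside the interval, so one formula serves before,
  during and after a stage of a homotopy.\<close>

definition clamp :: "real \<Rightarrow> real" where
  "clamp x = max 0 (min 1 x)"

lemma clamp_simps [simp]: "0 \<le> clamp x" "clamp x \<le> 1" "clamp 0 = 0" "clamp 1 = 1"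
  by (auto simp: clamp_def)

lemma clamp_id: "x \<in> {0..1} \<Longrightarrow> clamp x = x"
  by (auto simp: clamp_def)

lemma clamp_eq_1: "1 \<le> x \<Longrightarrow> clamp x = 1"
  by (auto simp: clamp_def)

lemma max_clamp_eq_1: "t \<le> 1 \<Longrightarrow> 1 \<le> x \<Longrightarrow> max t (clamp x) = 1" "x \<le> 1 \<Longrightarrow> max 1 (clamp x) = 1"
  "0 \<le> t \<Longrightarrow> max 0 (clamp x) = clamp x" "max 1 (clamp x) = 1" "max 0 (clamp x) = clamp x"
  by (auto simp: clamp_def max_def)

lemma clamp_half: "x * 2 = 1 \<Longrightarrow> clamp (2 * x) = 1" "x * 2 = 1 \<Longrightarrow> clamp (2 * x - 1) = 0"
  "x * 2 = 1 \<Longrightarrow> clamp (2 - 2 * x) = 1"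
  by (auto simp: clamp_def)

lemma continuous_map_into_unit_interval:
  assumes "continuous_map X euclideanreal e" "\<And>x. x \<in> topspace X \<Longrightarrow> e x \<in> {0..1}"
  shows "continuous_map X unit_interval e"
  using assms by (auto simp: continuous_map_in_subtopology)

lemma continuous_map_clamp:
  assumes "continuous_map X euclideanreal e"
  shows "continuous_map X unit_interval (\<lambda>x. clamp (e x))"
proof (rule continuous_map_into_unit_interval)
  show "continuous_map X euclideanreal (\<lambda>x. clamp (e x))"
    unfolding clamp_def by (intro continuous_map_real_max continuous_map_real_min assms) auto
qed auto

lemma continuous_map_if_le:
  assumes "continuous_map X Z u" "continuous_map X Z v" "continuous_map X euclideanreal r"
    and "\<And>x. x \<in> topspace X \<Longrightarrow> r x = c \<Longrightarrow> u x = v x"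
  shows "continuous_map X Z (\<lambda>x. if r x \<le> c then u x else v x)"
  by (rule continuous_map_cases_le) (use assms in \<open>auto intro: continuous_map_from_subtopology\<close>)

lemma attaches_homotopic_with:
  assumes at: "attaches Y A P \<alpha> \<beta> f \<kappa>"
    and g: "continuous_map (prod_topology unit_interval A) Z g"
    and h: "continuous_map (prod_topology unit_interval (prod_topology P unit_interval)) Z h"
    and h1: "\<And>t p. t \<in> {0..1} \<Longrightarrow> p \<in> topspace P \<Longrightarrow> h (t, (p, 1)) = g (t, f p)"
    and h0: "\<And>t p p'. t \<in> {0..1} \<Longrightarrow> p \<in> topspace P \<Longrightarrow> p' \<in> topspace P \<Longrightarrow> \<kappa> p = \<kappa> p' \<Longrightarrow>
      h (t, (p, 0)) = h (t, (p', 0))"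
    and u: "\<And>x. x \<in> topspace A \<Longrightarrow> u (\<alpha> x) = g (0, x)"
      "\<And>p s. p \<in> topspace P \<Longrightarrow> s \<in> {0..1} \<Longrightarrow> u (\<beta> (p, s)) = h (0, (p, s))"
    and v: "\<And>x. x \<in> topspace A \<Longrightarrow> v (\<alpha> x) = g (1, x)"
      "\<And>p s. p \<in> topspace P \<Longrightarrow> s \<in> {0..1} \<Longrightarrow> v (\<beta> (p, s)) = h (1, (p, s))"
    and a: "a \<in> topspace A" "\<And>t. t \<in> {0..1} \<Longrightarrow> g (t, a) = b"
  shows "homotopic_with (\<lambda>k. k (\<alpha> a) = b) Y Z u v"
proof -
  obtain H where H: "continuous_map (prod_topology unit_interval Y) Z H"
    "\<And>t a. t \<in> {0..1} \<Longrightarrow> a \<in> topspace A \<Longrightarrow> H (t, \<alpha> a) = g (t, a)"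
    "\<And>t p s. t \<in> {0..1} \<Longrightarrow> p \<in> topspace P \<Longrightarrow> s \<in> {0..1} \<Longrightarrow> H (t, \<beta> (p, s)) = h (t, (p, s))"
  proof (rule attaches_homotopy[OF at g h])
    fix H assume "continuous_map (prod_topology unit_interval Y) Z H"
      "\<And>t a. t \<in> {0..1} \<Longrightarrow> a \<in> topspace A \<Longrightarrow> H (t, \<alpha> a) = g (t, a)"
      "\<And>t p s. t \<in> {0..1} \<Longrightarrow> p \<in> topspace P \<Longrightarrow> s \<in> {0..1} \<Longrightarrow> H (t, \<beta> (p, s)) = h (t, (p, s))"
    then show thesis by (rule that)
  qed (rule h1 h0, assumption+)+
  have eq: "H (0, y) = u y \<and> H (1, y) = v y" if "y \<in> topspace Y" for y
  proof -
    have "y \<in> \<alpha> ` topspace A \<union> \<beta> ` (topspace P \<times> {0..1})"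
      using attachesD(5)[OF at] that by blast
    then consider x where "x \<in> topspace A" "y = \<alpha> x" | p s where "p \<in> topspace P" "s \<in> {0..1}" "y = \<beta> (p, s)"
      by auto
    then show ?thesis
      by cases (use H(2)[of 0] H(2)[of 1] H(3)[of 0] H(3)[of 1] u v in auto)
  qed
  have \<alpha>a: "\<alpha> a \<in> topspace Y" by (rule attachesD(10)[OF at a(1)])
  show ?thesis
  proof (subst homotopic_with)
    show "\<exists>h. continuous_map (prod_topology unit_interval Y) Z h \<and>
        (\<forall>x\<in>topspace Y. h (0, x) = u x) \<and> (\<forall>x\<in>topspace Y. h (1, x) = v x) \<and>
        (\<forall>t\<in>{0..1}. h (t, \<alpha> a) = b)"
      using H(1) H(2)[OF _ a(1)] a(2) eq by (intro exI[of _ H]) auto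
  qed (use \<alpha>a in auto)
qed

text \<open>A map is a homotopy constant in time, so the gluing argument is not repeated.\<close>

lemma attaches_lift:
  assumes at: "attaches Y A P \<alpha> \<beta> f \<kappa>"
    and g: "continuous_map A Z g" and h: "continuous_map (prod_topology P unit_interval) Z h"
    and h1: "\<And>p. p \<in> topspace P \<Longrightarrow> h (p, 1) = g (f p)"
    and h0: "\<And>p p'. p \<in> topspace P \<Longrightarrow> p' \<in> topspace P \<Longrightarrow> \<kappa> p = \<kappa> p' \<Longrightarrow> h (p, 0) = h (p', 0)"
  obtains H where "continuous_map Y Z H" "\<And>a. a \<in> topspace A \<Longrightarrow> H (\<alpha> a) = g a"
    "\<And>p s. p \<in> topspace P \<Longrightarrow> s \<in> {0..1} \<Longrightarrow> H (\<beta> (p, s)) = h (p, s)"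
proof -
  have gs: "continuous_map (prod_topology unit_interval A) Z (\<lambda>x. g (snd x))"
    by (intro continuous_map_compose_app[OF g] continuous_map_snd)
  have hs: "continuous_map (prod_topology unit_interval (prod_topology P unit_interval)) Z (\<lambda>x. h (snd x))"
    by (intro continuous_map_compose_app[OF h] continuous_map_snd)
  obtain H where H: "continuous_map (prod_topology unit_interval Y) Z H"
    "\<And>t a. t \<in> {0..1} \<Longrightarrow> a \<in> topspace A \<Longrightarrow> H (t, \<alpha> a) = g a"
    "\<And>t p s. t \<in> {0..1} \<Longrightarrow> p \<in> topspace P \<Longrightarrow> s \<in> {0..1} \<Longrightarrow> H (t, \<beta> (p, s)) = h (p, s)"
  proof (rule attaches_homotopy[OF at gs hs])
    fix H assume "continuous_map (prod_topology unit_interval Y) Z H"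
      "\<And>t a. t \<in> {0..1} \<Longrightarrow> a \<in> topspace A \<Longrightarrow> H (t, \<alpha> a) = g (snd (t, a))"
      "\<And>t p s. t \<in> {0..1} \<Longrightarrow> p \<in> topspace P \<Longrightarrow> s \<in> {0..1} \<Longrightarrow> H (t, \<beta> (p, s)) = h (snd (t, (p, s)))"
    then show thesis by (intro that[of H]) (simp_all only: snd_conv)
  qed (simp_all only: snd_conv, (rule h1 h0, assumption+)+)
  have "continuous_map Y Z (\<lambda>y. H (0, y))"
    by (rule continuous_map_compose_pair[OF H(1)]) auto
  then show thesis using H(2,3)[of 0] by (intro that[of "\<lambda>y. H (0, y)"]) auto
qed

text \<open>On each cell, \<open>u\<close> runs radially through the cell during the first quarter and then makes an
  excursion inside \<open>A\<close> along the track \<open>M\<close>, which ends where it started.\<close>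

lemma attaches_homotopic_id:
  assumes at: "attaches Y A P \<alpha> \<beta> f \<kappa>"
    and M: "continuous_map (prod_topology unit_interval P) A M" "\<And>p. p \<in> topspace P \<Longrightarrow> M (1, p) = f p"
    and e: "continuous_on UNIV e" "e (1/4) \<ge> (1::real)" "e 1 \<ge> 1"
    and u: "\<And>x. x \<in> topspace A \<Longrightarrow> u (\<alpha> x) = \<alpha> x"
      "\<And>p s. p \<in> topspace P \<Longrightarrow> s \<in> {0..1} \<Longrightarrow>
         u (\<beta> (p, s)) = (if s \<le> 1/4 then \<beta> (p, clamp (4 * s)) else \<alpha> (M (clamp (e s), p)))"
    and a: "a \<in> topspace A"
  shows "homotopic_with (\<lambda>k. k (\<alpha> a) = \<alpha> a) Y Y u id"
proof -
  let ?X = "prod_topology unit_interval (prod_topology P unit_interval)"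
  note cm = continuous_map_fst continuous_map_compose_app[OF continuous_map_fst continuous_map_snd]
    continuous_map_compose_app[OF continuous_map_snd continuous_map_snd]
  have ct: "continuous_map ?X unit_interval (\<lambda>x. fst x)" 
    and cp: "continuous_map ?X P (\<lambda>x. fst (snd x))" and cs: "continuous_map ?X unit_interval (\<lambda>x. snd (snd x))"
    by (intro cm)+
  have ct': "continuous_map ?X euclideanreal (\<lambda>x. fst x)" and cs': "continuous_map ?X euclideanreal (\<lambda>x. snd (snd x))"
    using ct cs continuous_map_into_fulltopology by blast+
  have ce: "continuous_map ?X euclideanreal (\<lambda>x. e (snd (snd x)))"
    by (rule continuous_map_compose_app[OF _ cs']) (use e in simp)
  \<comment> \<open>Raising the track parameter to at least \<open>t\<close> cuts off the part of
    the excursion that falls below \<open>t\<close>. At \<open>t = 1\<close> the track rests at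
    \<open>f p\<close>, where it starts and ends by the conditions on \<open>e\<close> at 1/4 and at
    1.\<close>
  define h where "h = (\<lambda>x. if snd (snd x) \<le> 1/4 then \<beta> (fst (snd x), clamp (4 * snd (snd x)))
    else \<alpha> (M (max (fst x) (clamp (e (snd (snd x)))), fst (snd x))))"
  \<comment> \<open>The remaining radial stretching by the factor 4 is undone by letting the factor
    decrease to 1.\<close>
  define h' where "h' = (\<lambda>x. \<beta> (fst (snd x), clamp ((4 - 3 * fst x) * snd (snd x))))"
  have ch: "continuous_map ?X Y h"
    unfolding h_def
  proof (rule continuous_map_if_le)
    show "continuous_map ?X Y (\<lambda>x. \<beta> (fst (snd x), clamp (4 * snd (snd x))))"
      by (intro continuous_map_compose_pair[OF attachesD(3)[OF at]] cp continuous_map_clamp continuous_map_real_mult_left cs')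
    show "continuous_map ?X Y (\<lambda>x. \<alpha> (M (max (fst x) (clamp (e (snd (snd x)))), fst (snd x))))"
      by (intro continuous_map_compose_app[OF attachesD(1)[OF at]] continuous_map_compose_pair[OF M(1)] cp
          continuous_map_into_unit_interval continuous_map_real_max ct'
          continuous_map_into_fulltopology[OF continuous_map_clamp[OF ce]]) auto
    show "\<beta> (fst (snd x), clamp (4 * snd (snd x))) = \<alpha> (M (max (fst x) (clamp (e (snd (snd x)))), fst (snd x)))"
      if "x \<in> topspace ?X" "snd (snd x) = 1/4" for x
    proof -
      obtain t p s where x: "x = (t, p, s)" by (cases x)
      have s: "s = 1/4" "t \<in> {0..1}" "p \<in> topspace P"
        using that x by simp_all
      show ?thesis
        using s(2,3) e(2) M(2) attachesD(6)[OF at] unfolding x s(1) by (simp add: clamp_eq_1 max_clamp_eq_1)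
    qed
  qed (rule cs')
  have ch': "continuous_map ?X Y h'"
    unfolding h'_def
    by (intro continuous_map_compose_pair[OF attachesD(3)[OF at]] cp continuous_map_clamp continuous_map_real_mult
         continuous_map_diff continuous_map_real_mult_left ct' cs') auto
  have cg: "continuous_map (prod_topology unit_interval A) Y (\<lambda>x. \<alpha> (snd x))"
    by (intro continuous_map_compose_app[OF attachesD(1)[OF at]] continuous_map_snd)
  have f0: "\<beta> (p, 0) = \<beta> (p', 0)" if "p \<in> topspace P" "p' \<in> topspace P" "\<kappa> p = \<kappa> p'" for p p'
    using attachesD(9)[OF at that(1,2), of 0 0] that(3) by simp
  \<comment> \<open>The halfway map: no excursion left, but every cell is still traversed in the
    first quarter.\<close>
  obtain w where w: "continuous_map Y Y w" "\<And>x. x \<in> topspace A \<Longrightarrow> w (\<alpha> x) = \<alpha> x"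
    "\<And>p s. p \<in> topspace P \<Longrightarrow> s \<in> {0..1} \<Longrightarrow> w (\<beta> (p, s)) = \<beta> (p, clamp (4 * s))"
  proof (rule attaches_lift[OF at attachesD(1)[OF at], of "\<lambda>z. \<beta> (fst z, clamp (4 * snd z))"])
    show "continuous_map (prod_topology P unit_interval) Y (\<lambda>z. \<beta> (fst z, clamp (4 * snd z)))"
      by (intro continuous_map_compose_pair[OF attachesD(3)[OF at]] continuous_map_fst continuous_map_clamp
           continuous_map_real_mult_left continuous_map_into_fulltopology[OF continuous_map_snd])
  qed (use attachesD(6)[OF at] in \<open>auto simp: clamp_eq_1 intro: f0\<close>)
  have "homotopic_with (\<lambda>k. k (\<alpha> a) = \<alpha> a) Y Y u w"
  proof (rule attaches_homotopic_with[OF at cg ch])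
    fix p s assume p: "p \<in> topspace P" and s: "s \<in> {0..1::real}"
    show "u (\<beta> (p, s)) = h (0, p, s)" using p s by (simp add: u h_def)
    show "w (\<beta> (p, s)) = h (1, p, s)"
      using p s M(2) attachesD(6)[OF at] by (auto simp: w h_def clamp_eq_1 max_clamp_eq_1)
  qed (use u w a e M attachesD(6)[OF at] in \<open>auto simp: h_def clamp_eq_1 max_clamp_eq_1 intro: f0\<close>)
  moreover have "homotopic_with (\<lambda>k. k (\<alpha> a) = \<alpha> a) Y Y w id"
  proof (rule attaches_homotopic_with[OF at cg ch'])
    fix p t assume p: "p \<in> topspace P" and t: "t \<in> {0..1::real}"
    have "1 \<le> (4 - 3 * t) * 1" using t by auto
    then show "h' (t, p, 1) = \<alpha> (snd (t, f p))"
      using p attachesD(6)[OF at] by (simp add: h'_def clamp_eq_1)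
  qed (use w a in \<open>auto simp: h'_def clamp_id intro: f0\<close>)
  ultimately show ?thesis by (rule homotopic_with_trans)
qed

text \<open>A cell is mapped by first running radially through the cell and then along the
  track of the null-homotopy, forwards in one direction and backwards in the other.\<close>

lemma attaches_pointed_equivalent:
  assumes Y: "attaches Y A P \<alpha> \<beta> f \<kappa>" and Y': "attaches Y' A' P \<alpha>' \<beta>' (\<lambda>_. a') \<kappa>"
    and eq: "pointed_equivalent A a A' a'"
    and null: "homotopic_with (\<lambda>_. True) P A (\<lambda>_. a) f"
  shows "pointed_equivalent Y (\<alpha> a) Y' (\<alpha>' a')"
proof -
  let ?PI = "prod_topology P unit_interval"
  let ?X = "prod_topology unit_interval (prod_topology P unit_interval)"
  obtain N where N: "continuous_map (prod_topology unit_interval P) A N"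
    "\<And>p. N (0, p) = a" "\<And>p. N (1, p) = f p"
    using null unfolding homotopic_with_def by auto
  obtain h k where hk: "continuous_map A A' h" "continuous_map A' A k" "h a = a'" "k a' = a"
      and kh: "homotopic_with (\<lambda>h. h a = a) A A (k \<circ> h) id"
      and hk': "homotopic_with (\<lambda>h. h a' = a') A' A' (h \<circ> k) id"
      and a: "a \<in> topspace A" "a' \<in> topspace A'"
    using eq unfolding pointed_equivalent_def by blast
  obtain K where K: "continuous_map (prod_topology unit_interval A) A K"
    "\<And>x. K (0, x) = k (h x)" "\<And>x. K (1, x) = x" "\<And>t. t \<in> {0..1} \<Longrightarrow> K (t, a) = a"
    using kh unfolding homotopic_with_def by auto
  obtain K' where K': "continuous_map (prod_topology unit_interval A') A' K'"
    "\<And>x. K' (0, x) = h (k x)" "\<And>x. K' (1, x) = x" "\<And>t. t \<in> {0..1} \<Longrightarrow> K' (t, a') = a'"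
    using hk' unfolding homotopic_with_def by auto
  have hA: "h x \<in> topspace A'" if "x \<in> topspace A" for x
    using continuous_map_image_subset_topspace[OF hk(1)] that by blast
  have kA: "k x \<in> topspace A" if "x \<in> topspace A'" for x
    using continuous_map_image_subset_topspace[OF hk(2)] that by blast
  have NA: "N (t, p) \<in> topspace A" if "t \<in> {0..1}" "p \<in> topspace P" for t p
    using continuous_map_image_subset_topspace[OF N(1)] that by (auto simp: image_subset_iff)
  have b0: "\<beta> (p, 0) = \<beta> (p', 0)" if "p \<in> topspace P" "p' \<in> topspace P" "\<kappa> p = \<kappa> p'" for p p'
    using attachesD(9)[OF Y that(1,2), of 0 0] that(3) by simp
  have b0': "\<beta>' (p, 0) = \<beta>' (p', 0)" if "p \<in> topspace P" "p' \<in> topspace P" "\<kappa> p = \<kappa> p'" for p p'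
    using attachesD(9)[OF Y' that(1,2), of 0 0] that(3) by simp
  note b1 = attachesD(6)[OF Y] and b1' = attachesD(6)[OF Y']
  have sc: "continuous_map ?PI euclideanreal snd"
    by (rule continuous_map_into_fulltopology[OF continuous_map_snd])
  \<comment> \<open>The cell of \<open>Y'\<close> ends at \<open>a'\<close>, which is
    \<open>h\<close> of the start \<open>a\<close> of the null-homotopy; running forwards along
    \<open>N\<close> then ends at \<open>h (f p)\<close>, as the attaching map of \<open>Y\<close>
    demands.\<close>
  define hF where "hF = (\<lambda>z. if snd z \<le> 1/2 then \<beta>' (fst z, clamp (2 * snd z))
    else \<alpha>' (h (N (clamp (2 * snd z - 1), fst z))))"
  \<comment> \<open>The cell of \<open>Y\<close> ends at \<open>f p\<close>; running backwards along
    \<open>N\<close> leads to \<open>a\<close>, which is \<open>k a'\<close>.\<close>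
  define hG where "hG = (\<lambda>z. if snd z \<le> 1/2 then \<beta> (fst z, clamp (2 * snd z))
    else \<alpha> (N (clamp (2 - 2 * snd z), fst z)))"
  have cF: "continuous_map ?PI Y' hF"
    unfolding hF_def
  proof (rule continuous_map_if_le)
    show "continuous_map ?PI Y' (\<lambda>z. \<beta>' (fst z, clamp (2 * snd z)))"
      by (intro continuous_map_compose_pair[OF attachesD(3)[OF Y']] continuous_map_fst continuous_map_clamp
           continuous_map_real_mult_left sc)
    show "continuous_map ?PI Y' (\<lambda>z. \<alpha>' (h (N (clamp (2 * snd z - 1), fst z))))"
      by (intro continuous_map_compose_app[OF attachesD(1)[OF Y']] continuous_map_compose_app[OF hk(1)]
          continuous_map_compose_pair[OF N(1)] continuous_map_fst continuous_map_clamp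
          continuous_map_diff continuous_map_real_mult_left sc) auto
  qed (use sc b1' N hk in \<open>auto simp: clamp_half\<close>)
  have cG: "continuous_map ?PI Y hG"
    unfolding hG_def
  proof (rule continuous_map_if_le)
    show "continuous_map ?PI Y (\<lambda>z. \<beta> (fst z, clamp (2 * snd z)))"
      by (intro continuous_map_compose_pair[OF attachesD(3)[OF Y]] continuous_map_fst continuous_map_clamp
           continuous_map_real_mult_left sc)
    show "continuous_map ?PI Y (\<lambda>z. \<alpha> (N (clamp (2 - 2 * snd z), fst z)))"
      by (intro continuous_map_compose_app[OF attachesD(1)[OF Y]] 
          continuous_map_compose_pair[OF N(1)] continuous_map_fst continuous_map_clamp
          continuous_map_diff continuous_map_real_mult_left sc) auto
  qed (use sc b1 N in \<open>auto simp: clamp_half\<close>)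
  obtain F where F: "continuous_map Y Y' F" "\<And>x. x \<in> topspace A \<Longrightarrow> F (\<alpha> x) = \<alpha>' (h x)"
    "\<And>p s. p \<in> topspace P \<Longrightarrow> s \<in> {0..1} \<Longrightarrow> F (\<beta> (p, s)) = hF (p, s)"
    by (rule attaches_lift[OF Y continuous_map_compose_app[OF attachesD(1)[OF Y'] hk(1)] cF])
       (auto simp: hF_def N intro: b0')
  obtain G where G: "continuous_map Y' Y G" "\<And>x. x \<in> topspace A' \<Longrightarrow> G (\<alpha>' x) = \<alpha> (k x)"
    "\<And>p s. p \<in> topspace P \<Longrightarrow> s \<in> {0..1} \<Longrightarrow> G (\<beta>' (p, s)) = hG (p, s)"
    by (rule attaches_lift[OF Y' continuous_map_compose_app[OF attachesD(1)[OF Y] hk(2)] cG])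
       (auto simp: hG_def N hk intro: b0)
  note cm = continuous_map_fst continuous_map_compose_app[OF continuous_map_fst continuous_map_snd]
    continuous_map_compose_app[OF continuous_map_snd continuous_map_snd]
  have ct: "continuous_map ?X unit_interval (\<lambda>x. fst x)" 
    and cp: "continuous_map ?X P (\<lambda>x. fst (snd x))" and cs: "continuous_map ?X unit_interval (\<lambda>x. snd (snd x))"
    by (intro cm)+
  have cs': "continuous_map ?X euclideanreal (\<lambda>x. snd (snd x))"
    using cs continuous_map_into_fulltopology by blast
  have clamp2: "(clamp (2 * s) \<le> 1/2) = (s \<le> 1/4)" "s \<le> 1/2 \<Longrightarrow> 0 \<le> s \<Longrightarrow> clamp (2 * s) = 2 * s" for s
    by (auto simp: clamp_def)
  \<comment> \<open>The time on \<open>N\<close> along a cell under \<open>G \<circ> F\<close>: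
    between 1/4 and 1/2 it falls from 1 to 0 at speed 4, the part contributed by \<open>G\<close>,
    and then rises back to 1 at speed 2, the part contributed by \<open>F\<close>. In both ranges
    the branch in force is the larger one.\<close>
  define e where "e = (\<lambda>s::real. max (2 - 4 * s) (2 * s - 1))"
  have e: "continuous_on UNIV e" "e (1/4) \<ge> 1" "e 1 \<ge> 1"
    unfolding e_def by (intro continuous_intros, auto)
  have "homotopic_with (\<lambda>k. k (\<alpha> a) = \<alpha> a) Y Y (G \<circ> F) id"
  proof -
    \<comment> \<open>On the outer half \<open>k \<circ> h\<close> is deformed to the identity by
      \<open>K\<close>. The two halves fit together because \<open>K\<close> fixes
      \<open>a\<close>.\<close>
    define h1 where "h1 = (\<lambda>x. if snd (snd x) \<le> 1/2 then hG (fst (snd x), clamp (2 * snd (snd x)))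
      else \<alpha> (K (fst x, N (clamp (2 * snd (snd x) - 1), fst (snd x)))))"
    have c1: "continuous_map ?X Y h1"
      unfolding h1_def
    proof (rule continuous_map_if_le)
      show "continuous_map ?X Y (\<lambda>x. hG (fst (snd x), clamp (2 * snd (snd x))))"
        by (intro continuous_map_compose_pair[OF cG] cp continuous_map_clamp continuous_map_real_mult_left cs')
      show "continuous_map ?X Y (\<lambda>x. \<alpha> (K (fst x, N (clamp (2 * snd (snd x) - 1), fst (snd x)))))"
        by (intro continuous_map_compose_app[OF attachesD(1)[OF Y]] continuous_map_compose_pair[OF K(1)]
            continuous_map_compose_pair[OF N(1)] ct cp continuous_map_clamp
            continuous_map_diff continuous_map_real_mult_left cs') auto
    qed (use cs' N K(4) in \<open>auto simp: hG_def clamp_half\<close>)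
    have cg: "continuous_map (prod_topology unit_interval A) Y (\<lambda>x. \<alpha> (K x))"
      by (intro continuous_map_compose_app[OF attachesD(1)[OF Y] K(1)])
    obtain w where w: "continuous_map Y Y w" "\<And>x. x \<in> topspace A \<Longrightarrow> w (\<alpha> x) = \<alpha> (K (1, x))"
      "\<And>p s. p \<in> topspace P \<Longrightarrow> s \<in> {0..1} \<Longrightarrow> w (\<beta> (p, s)) = h1 (1, (p, s))"
    proof (rule attaches_lift[OF Y, of Y "\<lambda>x. \<alpha> (K (1, x))" "\<lambda>z. h1 (1, z)"])
      show "continuous_map A Y (\<lambda>x. \<alpha> (K (1, x)))"
        by (rule continuous_map_compose_pair[OF cg]) auto
      show "continuous_map ?PI Y (\<lambda>z. h1 (1, z))"
        by (rule continuous_map_compose_pair[OF c1]) auto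
    qed (auto simp: h1_def hG_def K N intro: b0)
    have "homotopic_with (\<lambda>k. k (\<alpha> a) = \<alpha> a) Y Y (G \<circ> F) w"
    proof (rule attaches_homotopic_with[OF Y cg c1])
      fix p s assume p: "p \<in> topspace P" and s: "s \<in> {0..1::real}"
      show "(G \<circ> F) (\<beta> (p, s)) = h1 (0, p, s)"
        using p s by (auto simp: F G hF_def h1_def K hA NA)
    qed (use w F G a K N hA in \<open>auto simp: h1_def hG_def intro: b0\<close>)
    moreover have "homotopic_with (\<lambda>k. k (\<alpha> a) = \<alpha> a) Y Y w id"
    proof (rule attaches_homotopic_id[OF Y N(1) _ e])
      fix p s assume p: "p \<in> topspace P" and s: "s \<in> {0..1::real}"
      have "e s = 2 - 4 * s" if "s \<le> 1/2" using that by (simp add: e_def)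
      moreover have "e s = 2 * s - 1" if "\<not> s \<le> 1/2" using that by (simp add: e_def)
      ultimately show "w (\<beta> (p, s)) = (if s \<le> 1/4 then \<beta> (p, clamp (4 * s)) else \<alpha> (N (clamp (e s), p)))"
        using p s by (auto simp: w h1_def hG_def K clamp2)
    qed (use w K N a in auto)
    ultimately show ?thesis by (rule homotopic_with_trans)
  qed
  moreover have "homotopic_with (\<lambda>k. k (\<alpha>' a') = \<alpha>' a') Y' Y' (F \<circ> G) id"
  proof -
    \<comment> \<open>On the outer half the track lies in \<open>A\<close>, where \<open>F\<close>
      is just \<open>h\<close>; so the homotopy is constant on the cells and \<open>K'\<close> acts
      on \<open>A'\<close> only. They agree at \<open>s = 1\<close> because \<open>K'\<close> fixes
      \<open>a'\<close>.\<close>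
    define h1 where "h1 = (\<lambda>x :: real \<times> _. if snd (snd x) \<le> 1/2 then hF (fst (snd x), clamp (2 * snd (snd x)))
      else \<alpha>' (h (N (clamp (2 - 2 * snd (snd x)), fst (snd x)))))"
    have c1: "continuous_map ?X Y' h1"
      unfolding h1_def
    proof (rule continuous_map_if_le)
      show "continuous_map ?X Y' (\<lambda>x. hF (fst (snd x), clamp (2 * snd (snd x))))"
        by (intro continuous_map_compose_pair[OF cF] cp continuous_map_clamp continuous_map_real_mult_left cs')
      show "continuous_map ?X Y' (\<lambda>x. \<alpha>' (h (N (clamp (2 - 2 * snd (snd x)), fst (snd x)))))"
        by (intro continuous_map_compose_app[OF attachesD(1)[OF Y']] continuous_map_compose_app[OF hk(1)]
            continuous_map_compose_pair[OF N(1)] cp continuous_map_clamp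
            continuous_map_diff continuous_map_real_mult_left cs') auto
    qed (use cs' N in \<open>auto simp: hF_def clamp_half\<close>)
    have cg: "continuous_map (prod_topology unit_interval A') Y' (\<lambda>x. \<alpha>' (K' x))"
      by (intro continuous_map_compose_app[OF attachesD(1)[OF Y'] K'(1)])
    obtain w where w: "continuous_map Y' Y' w" "\<And>x. x \<in> topspace A' \<Longrightarrow> w (\<alpha>' x) = \<alpha>' (K' (1, x))"
      "\<And>p s. p \<in> topspace P \<Longrightarrow> s \<in> {0..1} \<Longrightarrow> w (\<beta>' (p, s)) = h1 (1, (p, s))"
    proof (rule attaches_lift[OF Y', of Y' "\<lambda>x. \<alpha>' (K' (1, x))" "\<lambda>z. h1 (1, z)"])
      show "continuous_map A' Y' (\<lambda>x. \<alpha>' (K' (1, x)))"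
        by (rule continuous_map_compose_pair[OF cg]) auto
      show "continuous_map ?PI Y' (\<lambda>z. h1 (1, z))"
        by (rule continuous_map_compose_pair[OF c1]) auto
    qed (auto simp: h1_def hF_def K' N hk intro: b0')
    have "homotopic_with (\<lambda>k. k (\<alpha>' a') = \<alpha>' a') Y' Y' (F \<circ> G) w"
    proof (rule attaches_homotopic_with[OF Y' cg c1])
      fix p s assume p: "p \<in> topspace P" and s: "s \<in> {0..1::real}"
      show "(F \<circ> G) (\<beta>' (p, s)) = h1 (0, p, s)"
        using p s by (auto simp: F G hG_def h1_def NA)
    qed (use w F G a K' N hk kA in \<open>auto simp: h1_def hF_def intro: b0'\<close>)
    moreover have "homotopic_with (\<lambda>k. k (\<alpha>' a') = \<alpha>' a') Y' Y' w id"
    proof (rule attaches_homotopic_id[OF Y' _ _ e])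
      \<comment> \<open>The track is reversed so that it ends, at time 1, at
        \<open>h a = a'\<close>, the image of the constant attaching map of
        \<open>Y'\<close>.\<close>
      show "continuous_map (prod_topology unit_interval P) A' (\<lambda>x. h (N (1 - fst x, snd x)))"
        by (intro continuous_map_compose_app[OF hk(1)] continuous_map_compose_pair[OF N(1)] continuous_map_snd
            continuous_map_into_unit_interval continuous_map_diff
            continuous_map_into_fulltopology[OF continuous_map_fst]) auto
      fix p s assume p: "p \<in> topspace P" and s: "s \<in> {0..1::real}"
      have "1 - clamp (e s) = clamp (4 * s - 1)" if "s \<le> 1/2" using that by (simp add: e_def clamp_def)
      moreover have "1 - clamp (e s) = clamp (2 - 2 * s)" if "\<not> s \<le> 1/2" using that by (simp add: e_def clamp_def)
      ultimately show "w (\<beta>' (p, s)) = (if s \<le> 1/4 then \<beta>' (p, clamp (4 * s)) else \<alpha>' (h (N (1 - fst (clamp (e s), p), snd (clamp (e s), p)))))"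
        using p s by (auto simp: w h1_def hF_def clamp2)
    qed (use w K' N a hk in auto)
    ultimately show ?thesis by (rule homotopic_with_trans)
  qed
  ultimately show ?thesis
    using F G hk a attachesD(10)[OF Y] attachesD(10)[OF Y'] unfolding pointed_equivalent_def by metis
qed

section \<open>Realizations of finite complexes\<close>

definition finite_complex :: "'a set set \<Rightarrow> bool" where
  "finite_complex K \<longleftrightarrow> finite K \<and> (\<forall>\<sigma>\<in>K. finite \<sigma> \<and> \<sigma> \<noteq> {}) \<and>
     (\<forall>\<sigma>\<in>K. \<forall>\<tau>. \<tau> \<subseteq> \<sigma> \<longrightarrow> \<tau> \<noteq> {} \<longrightarrow> \<tau> \<in> K)"

lemma finite_complexD:
  assumes "finite_complex K"
  shows "finite K" "\<sigma> \<in> K \<Longrightarrow> finite \<sigma>" "\<sigma> \<in> K \<Longrightarrow> \<sigma> \<noteq> {}"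
    "\<sigma> \<in> K \<Longrightarrow> \<tau> \<subseteq> \<sigma> \<Longrightarrow> \<tau> \<noteq> {} \<Longrightarrow> \<tau> \<in> K"
  using assms unfolding finite_complex_def by blast+

definition closed_simplex :: "'a set \<Rightarrow> ('a \<Rightarrow> real) set" where
  "closed_simplex \<sigma> = {t. (\<forall>v. 0 \<le> t v) \<and> (\<forall>v. v \<notin> \<sigma> \<longrightarrow> t v = 0) \<and> (\<Sum>v\<in>\<sigma>. t v) = 1}"

lemma simplex_space_eq: "simplex_space \<sigma> = subtopology (powertop_real UNIV) (closed_simplex \<sigma>)"
  by (simp add: simplex_space_def closed_simplex_def)

lemma topspace_simplex_space [simp]: "topspace (simplex_space \<sigma>) = closed_simplex \<sigma>"
  by (simp add: simplex_space_eq)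

lemma simplex_mono:
  assumes "\<sigma> \<subseteq> \<tau>" "finite \<tau>"
  shows "closed_simplex \<sigma> \<subseteq> closed_simplex \<tau>"
proof
  fix t assume t: "t \<in> closed_simplex \<sigma>"
  then have "sum t \<tau> = sum t \<sigma>"
    using assms by (intro sum.mono_neutral_right) (auto simp: closed_simplex_def)
  with t assms show "t \<in> closed_simplex \<tau>" by (auto simp: closed_simplex_def)
qed

lemma simplex_support:
  assumes t: "t \<in> closed_simplex \<sigma>" and "finite \<sigma>"
  shows "{v. t v \<noteq> 0} \<subseteq> \<sigma>" "{v. t v \<noteq> 0} \<noteq> {}" "t \<in> closed_simplex {v. t v \<noteq> 0}"
proof -
  show sub: "{v. t v \<noteq> 0} \<subseteq> \<sigma>" using t by (auto simp: closed_simplex_def)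
  have "sum t \<sigma> = sum t {v. t v \<noteq> 0}"
    using assms sub by (intro sum.mono_neutral_right) auto
  then have s: "sum t {v. t v \<noteq> 0} = 1" using t by (simp add: closed_simplex_def)
  then show "{v. t v \<noteq> 0} \<noteq> {}" by (metis sum.empty zero_neq_one)
  show "t \<in> closed_simplex {v. t v \<noteq> 0}" using t s by (auto simp: closed_simplex_def)
qed

definition realization_points :: "'a set set \<Rightarrow> ('a \<Rightarrow> real) set" where
  "realization_points K = (\<Union>\<sigma>\<in>K. closed_simplex \<sigma>)"

lemma realization_points_support:
  assumes "finite_complex K" "t \<in> realization_points K"
  shows "{v. t v \<noteq> 0} \<in> K" "t \<in> closed_simplex {v. t v \<noteq> 0}"
proof -
  obtain \<sigma> where \<sigma>: "\<sigma> \<in> K" "t \<in> closed_simplex \<sigma>" using assms by (auto simp: realization_points_def)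
  note fin = finite_complexD(2)[OF assms(1) \<sigma>(1)]
  show "{v. t v \<noteq> 0} \<in> K"
    using finite_complexD(4)[OF assms(1) \<sigma>(1)] simplex_support[OF \<sigma>(2) fin] by blast
  show "t \<in> closed_simplex {v. t v \<noteq> 0}"
    using simplex_support[OF \<sigma>(2) fin] by blast
qed

lemma realization_points_mono: "L \<subseteq> K \<Longrightarrow> realization_points L \<subseteq> realization_points K"
  by (auto simp: realization_points_def)

lemma topspace_realization [simp]: "topspace (geometric_realization K) = realization_points K"
  by (simp add: topspace_geometric_realization realization_points_def)

lemma continuous_map_coordinate [continuous_intros]:
  "continuous_map (subtopology (powertop_real UNIV) S) euclideanreal (\<lambda>t. t v)"
  by (intro continuous_map_from_subtopology continuous_map_product_projection) simp

lemma closedin_simplex: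
  assumes "finite \<sigma>"
  shows "closedin (powertop_real UNIV) (closed_simplex \<sigma>)"
proof -
  let ?T = "powertop_real UNIV :: ('a \<Rightarrow> real) topology"
  have c: "continuous_map ?T euclideanreal (\<lambda>t. t v)" for v
    by (intro continuous_map_product_projection) simp
  have cl: "closedin ?T {t \<in> topspace ?T. f t \<in> C}" if "continuous_map ?T euclideanreal f" "closed C" for f C
    using closedin_continuous_map_preimage[OF that(1), of C] that(2) by simp
  have "closed_simplex \<sigma> = \<Inter> ({{t \<in> topspace ?T. (\<Sum>v\<in>\<sigma>. t v) \<in> {1}}} \<union> range (\<lambda>v. {t \<in> topspace ?T. t v \<in> {0..}})
      \<union> (\<lambda>v. {t \<in> topspace ?T. t v \<in> {0}}) ` (- \<sigma>))"
    by (auto simp: closed_simplex_def)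
  moreover have "closedin ?T \<dots>"
  proof (rule closedin_Inter)
    fix S assume "S \<in> {{t \<in> topspace ?T. (\<Sum>v\<in>\<sigma>. t v) \<in> {1}}} \<union> range (\<lambda>v. {t \<in> topspace ?T. t v \<in> {0..}})
      \<union> (\<lambda>v. {t \<in> topspace ?T. t v \<in> {0}}) ` (- \<sigma>)"
    then consider "S = {t \<in> topspace ?T. (\<Sum>v\<in>\<sigma>. t v) \<in> {1}}" | v where "S = {t \<in> topspace ?T. t v \<in> {0..}}"
      | v where "S = {t \<in> topspace ?T. t v \<in> {0}}" by blast
    then show "closedin ?T S"
    proof cases
      case 1
      have "continuous_map ?T euclideanreal (\<lambda>t. \<Sum>v\<in>\<sigma>. t v)"
        by (intro continuous_map_sum assms c)
      from cl[OF this, of "{1}"] show ?thesis using 1 by simp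
    next
      case 2 then show ?thesis using cl[OF c, of "{0..}"] by simp
    next
      case 3 then show ?thesis using cl[OF c, of "{0}"] by simp
    qed
  qed auto
  ultimately show ?thesis by simp
qed

lemma closedin_realization_points:
  assumes "finite_complex K"
  shows "closedin (powertop_real UNIV) (realization_points K)"
  unfolding realization_points_def
  using finite_complexD[OF assms] by (intro closedin_Union) (auto intro: closedin_simplex)

text \<open>A set that is closed in each of the finitely many closed simplices is a finite union of
  closed sets, so the weak topology is the topology of pointwise convergence of coordinates.
  Continuity can henceforth be checked coordinatewise.\<close>

lemma geometric_realization_eq:
  assumes K: "finite_complex K"
  shows "geometric_realization K = subtopology (powertop_real UNIV) (realization_points K)" (is "_ = ?T")
proof (rule topology_eq[THEN iffD2], intro allI)
  fix U
  have tp: "(\<Union>\<sigma>\<in>K. topspace (simplex_space \<sigma>)) = realization_points K" by (simp add: realization_points_def)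
  have eq: "simplex_space \<sigma> = subtopology ?T (closed_simplex \<sigma>)" if "\<sigma> \<in> K" for \<sigma>
    unfolding simplex_space_eq subtopology_subtopology using that
    by (simp add: realization_points_def Int_absorb1 SUP_upper2 UN_upper)
  have "openin ?T U" if U: "U \<subseteq> realization_points K" "\<And>\<sigma>. \<sigma> \<in> K \<Longrightarrow> openin (simplex_space \<sigma>) (closed_simplex \<sigma> \<inter> U)"
  proof -
    have "closedin ?T (closed_simplex \<sigma> - U)" if "\<sigma> \<in> K" for \<sigma>
    proof -
      have sub: "closed_simplex \<sigma> \<subseteq> realization_points K" using that by (auto simp: realization_points_def)
      have "closedin (simplex_space \<sigma>) (topspace (simplex_space \<sigma>) - closed_simplex \<sigma> \<inter> U)"
        using U(2)[OF that] by blast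
      moreover have "topspace (simplex_space \<sigma>) - closed_simplex \<sigma> \<inter> U = closed_simplex \<sigma> - U"
        by auto
      ultimately have 1: "closedin (subtopology ?T (closed_simplex \<sigma>)) (closed_simplex \<sigma> - U)"
        using eq[OF that] by simp
      have "closedin (powertop_real UNIV) (closed_simplex \<sigma>)"
        using closedin_simplex finite_complexD(2)[OF K that] by blast
      then have "closedin ?T (closed_simplex \<sigma>)"
        using sub by (rule closedin_closed_subtopology[THEN iffD2, OF closedin_realization_points[OF K], OF conjI])
      with 1 show ?thesis by (metis closedin_trans_full)
    qed
    then have "closedin ?T (\<Union>((\<lambda>\<sigma>. closed_simplex \<sigma> - U) ` K))"
      using finite_complexD(1)[OF K] by (intro closedin_Union) auto
    moreover have "\<Union>((\<lambda>\<sigma>. closed_simplex \<sigma> - U) ` K) = topspace ?T - U"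
      by (auto simp: realization_points_def)
    ultimately show ?thesis using U(1) by (simp add: closedin_def Diff_Diff_Int Int_absorb1)
  qed
  moreover have "openin (simplex_space \<sigma>) (closed_simplex \<sigma> \<inter> U)" if "openin ?T U" "\<sigma> \<in> K" for \<sigma>
    using that eq by (metis openin_subtopology_Int2)
  moreover have "{x \<in> topspace (simplex_space \<sigma>). x \<in> U} = closed_simplex \<sigma> \<inter> U" for \<sigma> by auto
  moreover have "U \<subseteq> realization_points K" if "openin ?T U"
    using openin_subset[OF that] by simp
  ultimately show "openin (geometric_realization K) U = openin ?T U"
    unfolding geometric_realization_def openin_final_topology tp by metis
qed

lemma compactin_closed_simplex:
  assumes "finite \<sigma>"
  shows "compactin (powertop_real UNIV) (closed_simplex \<sigma>)"
proof -
  have "closed_simplex \<sigma> \<subseteq> PiE UNIV (\<lambda>_. {0..1})"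
  proof
    fix t assume t: "t \<in> closed_simplex \<sigma>"
    then have "0 \<le> t v \<and> t v \<le> 1" for v
      using assms member_le_sum[of v \<sigma> t] by (cases "v \<in> \<sigma>") (auto simp: closed_simplex_def)
    then show "t \<in> PiE UNIV (\<lambda>_. {0..1})" by auto
  qed
  moreover have "compactin (powertop_real UNIV) (PiE UNIV (\<lambda>_. {0..1::real}))"
    by (simp add: compactin_PiE)
  ultimately show ?thesis
    using closedin_simplex[OF assms] closed_compactin by blast
qed

lemma compact_space_realization:
  assumes K: "finite_complex K"
  shows "compact_space (geometric_realization K)"
proof -
  have "compactin (powertop_real UNIV) (realization_points K)"
    unfolding realization_points_def
    by (intro compactin_Union) (use finite_complexD(1,2)[OF K] compactin_closed_simplex in auto)
  then show ?thesis by (simp add: geometric_realization_eq K compact_space_subtopology)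
qed

lemma Hausdorff_space_realization:
  assumes "finite_complex K"
  shows "Hausdorff_space (geometric_realization K)"
  unfolding geometric_realization_eq[OF assms]
  by (intro Hausdorff_space_subtopology) (simp add: Hausdorff_space_product_topology)

lemma continuous_map_realization:
  assumes "finite_complex K"
  shows "continuous_map X (geometric_realization K) f \<longleftrightarrow>
    (\<forall>v. continuous_map X euclideanreal (\<lambda>x. f x v)) \<and> (\<forall>x\<in>topspace X. f x \<in> realization_points K)"
  by (auto simp: geometric_realization_eq[OF assms] continuous_map_in_subtopology continuous_map_componentwise_UNIV)

lemma continuous_map_realization_coordinate:
  assumes "finite_complex K"
  shows "continuous_map (geometric_realization K) euclideanreal (\<lambda>t. t v)"
  unfolding geometric_realization_eq[OF assms] by (rule continuous_map_coordinate)

lemma simplex_convex: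
  assumes "t \<in> closed_simplex \<sigma>" "u \<in> closed_simplex \<sigma>" "s \<in> {0..1}"
  shows "(\<lambda>v. (1 - s) * t v + s * u v) \<in> closed_simplex \<sigma>"
proof -
  have "(\<Sum>v\<in>\<sigma>. (1 - s) * t v + s * u v) = (1 - s) * (\<Sum>v\<in>\<sigma>. t v) + s * (\<Sum>v\<in>\<sigma>. u v)"
    by (simp add: sum.distrib sum_distrib_left)
  then show ?thesis using assms by (auto simp: closed_simplex_def)
qed

text \<open>The segment between two points of a common simplex stays in that simplex. The set
  \<open>S\<close> records where both maps coincide, so that the homotopy is stationary there; with
  \<open>S\<close> a single point it is a pointed homotopy.\<close>

lemma realization_straight_homotopy:
  assumes K: "finite_complex K"
    and f: "continuous_map X (geometric_realization K) f" and g: "continuous_map X (geometric_realization K) g"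
    and fg: "\<And>x. x \<in> topspace X \<Longrightarrow> \<exists>\<sigma>\<in>K. f x \<in> closed_simplex \<sigma> \<and> g x \<in> closed_simplex \<sigma>"
    and S: "\<And>x. x \<in> S \<Longrightarrow> f x = h x \<and> g x = h x"
  shows "homotopic_with (\<lambda>k. \<forall>x\<in>S. k x = h x) X (geometric_realization K) f g"
  unfolding homotopic_with_def
proof (intro exI[of _ "\<lambda>(s, x) v. (1 - s) * f x v + s * g x v"] conjI allI ballI)
  let ?I = "prod_topology unit_interval X"
  have cf: "continuous_map ?I euclideanreal (\<lambda>x. f (snd x) v)" "continuous_map ?I euclideanreal (\<lambda>x. g (snd x) v)" for v
    using f g K by (auto simp: continuous_map_realization intro!: continuous_map_compose_app[OF _ continuous_map_snd])
  have cs: "continuous_map ?I euclideanreal fst"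
    by (rule continuous_map_into_fulltopology[OF continuous_map_fst])
  have "continuous_map ?I euclideanreal (\<lambda>x. (1 - fst x) * f (snd x) v + fst x * g (snd x) v)" for v
    by (intro continuous_map_add continuous_map_real_mult continuous_map_diff cf cs) auto
  moreover have "(\<lambda>v. (1 - s) * f x v + s * g x v) \<in> realization_points K" if x: "x \<in> topspace X" and s: "s \<in> {0..1}" for s x
  proof -
    obtain \<sigma> where "\<sigma> \<in> K" "f x \<in> closed_simplex \<sigma>" "g x \<in> closed_simplex \<sigma>" using fg[OF x] by blast
    then show ?thesis using simplex_convex[of "f x" \<sigma> "g x" s] s unfolding realization_points_def by blast
  qed
  ultimately show "continuous_map ?I (geometric_realization K) (\<lambda>(s, x) v. (1 - s) * f x v + s * g x v)"
    unfolding continuous_map_realization[OF K] by (auto simp: case_prod_unfold)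
  show "(case (s, x) of (s, x) \<Rightarrow> \<lambda>v. (1 - s) * f x v + s * g x v) = h x"
    if "s \<in> {0..1}" "x \<in> S" for s x
    using S[OF that(2)] by (auto simp: algebra_simps)
qed auto

section \<open>Elementary collapses and acyclic matchings\<close>

lemma continuous_map_Min:
  assumes "finite \<sigma>" "\<sigma> \<noteq> {}" "\<And>v. v \<in> \<sigma> \<Longrightarrow> continuous_map X euclideanreal (f v)"
  shows "continuous_map X euclideanreal (\<lambda>x. Min ((\<lambda>v. f v x) ` \<sigma>))"
  using assms
proof (induction rule: finite_ne_induct)
  case (insert v \<sigma>)
  then have "(\<lambda>x. Min ((\<lambda>v. f v x) ` insert v \<sigma>)) = (\<lambda>x. min (f v x) (Min ((\<lambda>v. f v x) ` \<sigma>)))"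
    by (auto simp: Min_insert)
  then show ?case using insert by (auto intro!: continuous_map_real_min)
qed auto

lemma pointed_equivalent_refl: "x \<in> topspace X \<Longrightarrow> pointed_equivalent X x X x"
  unfolding pointed_equivalent_def by (auto intro!: exI[of _ id])

text \<open>The free face \<open>\<sigma>\<close> is pushed away from \<open>a\<close>'s opposite
  side: its least barycentric coordinate is subtracted from all coordinates of
  \<open>\<sigma>\<close>, and the mass lost is given to \<open>a\<close>. Some vertex of
  \<open>\<sigma>\<close> then has coordinate 0, and points outside the two removed simplices do not
  move.\<close>

lemma elementary_collapse:
  assumes K: "finite_complex K" and \<sigma>: "\<sigma> \<in> K" and a: "a \<notin> \<sigma>" "insert a \<sigma> \<in> K"
    and free: "\<And>\<omega>. \<omega> \<in> K \<Longrightarrow> \<sigma> \<subseteq> \<omega> \<Longrightarrow> \<omega> = \<sigma> \<or> \<omega> = insert a \<sigma>"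
    and x: "x \<in> realization_points (K - {\<sigma>, insert a \<sigma>})"
  shows "finite_complex (K - {\<sigma>, insert a \<sigma>})"
    "pointed_equivalent (geometric_realization K) x (geometric_realization (K - {\<sigma>, insert a \<sigma>})) x"
proof -
  define L where "L = K - {\<sigma>, insert a \<sigma>}"
  show L: "finite_complex (K - {\<sigma>, insert a \<sigma>})"
    unfolding finite_complex_def
  proof (intro conjI ballI allI impI)
    fix \<omega> \<tau> assume \<omega>: "\<omega> \<in> K - {\<sigma>, insert a \<sigma>}" "\<tau> \<subseteq> \<omega>" "\<tau> \<noteq> {}"
    then have "\<tau> \<in> K" using finite_complexD(4)[OF K] by blast
    moreover have "\<not> \<sigma> \<subseteq> \<tau>" using free \<omega> by blast
    ultimately show "\<tau> \<in> K - {\<sigma>, insert a \<sigma>}" by blast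
  qed (use finite_complexD[OF K] in auto)
  note L = L[folded L_def]
  have fin: "finite \<sigma>" "\<sigma> \<noteq> {}" using finite_complexD[OF K] \<sigma> by auto
  \<comment> \<open>Positive exactly where the whole of \<open>\<sigma>\<close> is in the support,
    that is in the interiors of the two removed simplices.\<close>
  define \<mu> where "\<mu> = (\<lambda>t::'a \<Rightarrow> real. Min ((\<lambda>v. t v) ` \<sigma>))"
  define r where "r = (\<lambda>t v. if v \<in> \<sigma> then t v - \<mu> t else if v = a then t a + real (card \<sigma>) * \<mu> t else t v)"
  have \<mu>_le: "\<mu> t \<le> t v" if "v \<in> \<sigma>" for t v
    unfolding \<mu>_def using that fin by (intro Min_le) auto
  have \<mu>_ex: "\<exists>v\<in>\<sigma>. \<mu> t = t v" for t
    using Min_in[of "(\<lambda>v. t v) ` \<sigma>"] fin unfolding \<mu>_def by fastforce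
  have in_L: "\<exists>\<tau>\<in>L. t \<in> closed_simplex \<tau> \<and> r t = t" if t: "t \<in> realization_points K" "\<not> \<sigma> \<subseteq> {v. t v \<noteq> 0}" for t
  proof -
    obtain v where v: "v \<in> \<sigma>" "t v = 0" using t(2) by auto
    have nn: "\<And>v. 0 \<le> t v" using t(1) by (auto simp: realization_points_def closed_simplex_def)
    have "\<mu> t = 0" using \<mu>_le[OF v(1), of t] v(2) \<mu>_ex[of t] nn by (metis order_antisym)
    then have "r t = t" by (auto simp: r_def)
    moreover have "{v. t v \<noteq> 0} \<in> L"
      using realization_points_support(1)[OF K t(1)] v a by (auto simp: L_def)
    ultimately show ?thesis using realization_points_support(2)[OF K t(1)] by blast
  qed
  have in_top: "t \<in> closed_simplex (insert a \<sigma>) \<and> (\<exists>\<tau>\<in>L. \<tau> \<subseteq> insert a \<sigma> \<and> r t \<in> closed_simplex \<tau>)"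
    if t: "t \<in> realization_points K" "\<sigma> \<subseteq> {v. t v \<noteq> 0}" for t
  proof -
    have "{v. t v \<noteq> 0} \<subseteq> insert a \<sigma>"
      using free[OF realization_points_support(1)[OF K t(1)] t(2)] by blast
    then have tin: "t \<in> closed_simplex (insert a \<sigma>)"
      using simplex_mono[of "{v. t v \<noteq> 0}" "insert a \<sigma>"] realization_points_support(2)[OF K t(1)] fin by blast
    have t1: "t a + sum t \<sigma> = 1" and nn: "\<And>v. 0 \<le> t v" and z: "\<And>v. v \<notin> insert a \<sigma> \<Longrightarrow> t v = 0"
      using tin a fin by (auto simp: closed_simplex_def)
    obtain w where w: "w \<in> \<sigma>" "\<mu> t = t w" using \<mu>_ex by blast
    have \<mu>0: "0 \<le> \<mu> t" using w nn by simp
    have "sum (r t) (insert a \<sigma> - {w}) = sum (r t) (insert a \<sigma>)"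
      using w by (intro sum.mono_neutral_left) (auto simp: fin r_def)
    also have "\<dots> = r t a + sum (r t) \<sigma>" using a fin by simp
    also have "sum (r t) \<sigma> = (\<Sum>v\<in>\<sigma>. t v - \<mu> t)" by (intro sum.cong) (auto simp: r_def)
    also have "\<dots> = sum t \<sigma> - real (card \<sigma>) * \<mu> t" by (simp add: sum_subtractf)
    finally have "sum (r t) (insert a \<sigma> - {w}) = 1" using t1 a by (simp add: r_def)
    moreover have "0 \<le> r t v" for v using nn \<mu>0 \<mu>_le by (auto simp: r_def)
    moreover have "r t v = 0" if "v \<notin> insert a \<sigma> - {w}" for v
      using that z w by (auto simp: r_def)
    ultimately have "r t \<in> closed_simplex (insert a \<sigma> - {w})" by (simp add: closed_simplex_def)
    moreover have "insert a \<sigma> - {w} \<in> L"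
      using finite_complexD(4)[OF K a(2), of "insert a \<sigma> - {w}"] w a by (auto simp: L_def)
    moreover have "insert a \<sigma> - {w} \<subseteq> insert a \<sigma>" by blast
    ultimately show ?thesis using tin by (intro conjI bexI[of _ "insert a \<sigma> - {w}"])
  qed
  have rL: "\<exists>\<tau>\<in>L. r t \<in> closed_simplex \<tau>" if "t \<in> realization_points K" for t
    using in_L[OF that] in_top[OF that] by (cases "\<sigma> \<subseteq> {v. t v \<noteq> 0}") auto
  have both: "\<exists>\<tau>\<in>K. r t \<in> closed_simplex \<tau> \<and> t \<in> closed_simplex \<tau>" if t: "t \<in> realization_points K" for t
  proof (cases "\<sigma> \<subseteq> {v. t v \<noteq> 0}")
    case True
    then obtain \<tau> where "\<tau> \<subseteq> insert a \<sigma>" "r t \<in> closed_simplex \<tau>" "t \<in> closed_simplex (insert a \<sigma>)"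
      using in_top[OF t] by blast
    then show ?thesis using simplex_mono[of \<tau> "insert a \<sigma>"] fin a by (intro bexI[of _ "insert a \<sigma>"]) auto
  next
    case False
    then show ?thesis using in_L[OF t] by (auto simp: L_def)
  qed
  have r_id: "r t = t" if "t \<in> realization_points L" for t
  proof -
    have "t \<in> realization_points K" using that by (auto simp: L_def realization_points_def)
    moreover have "\<not> \<sigma> \<subseteq> {v. t v \<noteq> 0}"
      using realization_points_support(1)[OF L that] free by (auto simp: L_def)
    ultimately show ?thesis using in_L by blast
  qed
  have cc: "continuous_map (geometric_realization K) euclideanreal (\<lambda>t. t v)" for v
    by (rule continuous_map_realization_coordinate[OF K])
  have c\<mu>: "continuous_map (geometric_realization K) euclideanreal \<mu>"
    unfolding \<mu>_def by (rule continuous_map_Min[OF fin cc])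
  have cr0: "continuous_map (geometric_realization K) euclideanreal (\<lambda>t. r t v)" for v
    unfolding r_def
    by (cases "v \<in> \<sigma>"; cases "v = a") (auto intro!: continuous_map_diff continuous_map_add continuous_map_real_mult_left cc c\<mu>)
  have cr: "continuous_map (geometric_realization K) (geometric_realization L) r"
    using cr0 rL by (auto simp: continuous_map_realization[OF L] realization_points_def)
  have ci: "continuous_map (geometric_realization L) (geometric_realization K) id"
    using continuous_map_realization_coordinate[OF L] by (auto simp: continuous_map_realization[OF K] realization_points_def L_def)
  have xL: "x \<in> realization_points L" using x by (simp add: L_def)
  have xK: "x \<in> realization_points K" using xL by (auto simp: L_def realization_points_def)
  have "homotopic_with (\<lambda>h. h x = x) (geometric_realization L) (geometric_realization L) (r \<circ> id) id"
  proof (rule homotopic_with_equal)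
    show "continuous_map (geometric_realization L) (geometric_realization L) (r \<circ> id)"
      by (rule continuous_map_compose[OF ci cr])
  qed (use r_id xL in auto)
  moreover have "homotopic_with (\<lambda>h. \<forall>y\<in>{x}. h y = id y) (geometric_realization K) (geometric_realization K) (id \<circ> r) id"
    by (rule realization_straight_homotopy[OF K continuous_map_compose[OF cr ci] continuous_map_id]) 
       (use both r_id[OF xL] in auto)
  ultimately show "pointed_equivalent (geometric_realization K) x (geometric_realization (K - {\<sigma>, insert a \<sigma>})) x"
    unfolding pointed_equivalent_def L_def[symmetric]
    using cr ci xL xK r_id[OF xL] by (intro conjI exI[of _ r] exI[of _ id]) auto
qed

definition toggle :: "'a \<Rightarrow> 'a set \<Rightarrow> 'a set" where
  "toggle a \<sigma> = (if a \<in> \<sigma> then \<sigma> - {a} else insert a \<sigma>)"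

lemma toggle_toggle [simp]: "toggle a (toggle a \<sigma>) = \<sigma>"
  by (auto simp: toggle_def)

text \<open>The toggles form a matching on \<open>K - L\<close>; a face of a matched top simplex that is itself the
  lower partner of its pair has smaller rank, so the matching is acyclic.\<close>

lemma collapse_by_toggles:
  fixes \<phi> :: "'a set \<Rightarrow> nat"
  assumes "finite_complex K" and L: "finite_complex L" "L \<subseteq> K" and x: "x \<in> realization_points L"
    and tog: "\<And>\<sigma>. \<sigma> \<in> K - L \<Longrightarrow> toggle (a \<sigma>) \<sigma> \<in> K - L" "\<And>\<sigma>. \<sigma> \<in> K - L \<Longrightarrow> a (toggle (a \<sigma>) \<sigma>) = a \<sigma>"
    and rank: "\<And>\<sigma> v. \<sigma> \<in> K - L \<Longrightarrow> a \<sigma> \<notin> \<sigma> \<Longrightarrow> v \<in> \<sigma> \<Longrightarrow> insert (a \<sigma>) (\<sigma> - {v}) \<in> K - L \<Longrightarrow>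
       a (insert (a \<sigma>) (\<sigma> - {v})) \<notin> insert (a \<sigma>) (\<sigma> - {v}) \<Longrightarrow> \<phi> (insert (a \<sigma>) (\<sigma> - {v})) < \<phi> \<sigma>"
  shows "pointed_equivalent (geometric_realization K) x (geometric_realization L) x"
  using assms(1,3) tog rank
proof (induction "card (K - L)" arbitrary: K rule: less_induct)
  case less
  note K = less.prems(1) and LK = less.prems(2) and tog = less.prems(3,4) and rank = less.prems(5)
  have finK: "finite (K - L)" using finite_complexD(1)[OF K] by blast
  show ?case
  proof (cases "K = L")
    case True
    then show ?thesis using x by (simp add: pointed_equivalent_refl)
  next
    case False
    define \<Lambda> where "\<Lambda> = {\<sigma> \<in> K - L. a \<sigma> \<notin> \<sigma>}"
    have fin\<Lambda>: "finite \<Lambda>" by (rule finite_subset[OF _ finK]) (auto simp: \<Lambda>_def)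
    obtain \<sigma>0 where \<sigma>0: "\<sigma>0 \<in> K - L" using False LK by blast
    have lower: "toggle (a \<sigma>) \<sigma> \<in> \<Lambda>" if "\<sigma> \<in> K - L" "a \<sigma> \<in> \<sigma>" for \<sigma>
      using tog[OF that(1)] that(2) by (simp add: \<Lambda>_def toggle_def)
    have ne: "\<Lambda> \<noteq> {}" using lower[OF \<sigma>0] \<sigma>0 by (cases "a \<sigma>0 \<in> \<sigma>0") (auto simp: \<Lambda>_def)
    define d where "d = Max (card ` \<Lambda>)"
    have d_max: "card \<sigma> \<le> d" if "\<sigma> \<in> \<Lambda>" for \<sigma> unfolding d_def using that fin\<Lambda> by simp
    have "d \<in> card ` \<Lambda>" unfolding d_def using fin\<Lambda> ne by (intro Max_in) auto
    then have ne': "{\<sigma> \<in> \<Lambda>. card \<sigma> = d} \<noteq> {}" by auto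
    \<comment> \<open>A lower partner of maximal size and, among these, of maximal rank: this one is
      a free face.\<close>
    obtain \<sigma> where \<sigma>: "\<sigma> \<in> \<Lambda>" "card \<sigma> = d" and max: "\<And>\<tau>. \<tau> \<in> \<Lambda> \<Longrightarrow> card \<tau> = d \<Longrightarrow> \<phi> \<tau> \<le> \<phi> \<sigma>"
    proof -
      have "finite (\<phi> ` {\<sigma> \<in> \<Lambda>. card \<sigma> = d})" using fin\<Lambda> by simp
      then have "Max (\<phi> ` {\<sigma> \<in> \<Lambda>. card \<sigma> = d}) \<in> \<phi> ` {\<sigma> \<in> \<Lambda>. card \<sigma> = d}"
        using ne' by (intro Max_in) auto
      then obtain \<sigma> where "\<sigma> \<in> \<Lambda>" "card \<sigma> = d" "\<phi> \<sigma> = Max (\<phi> ` {\<sigma> \<in> \<Lambda>. card \<sigma> = d})" by auto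
      then show thesis using that fin\<Lambda> by simp
    qed
    have \<sigma>KL: "\<sigma> \<in> K" "\<sigma> \<notin> L" "a \<sigma> \<notin> \<sigma>" using \<sigma> by (auto simp: \<Lambda>_def)
    have \<rho>: "insert (a \<sigma>) \<sigma> \<in> K - L" "a (insert (a \<sigma>) \<sigma>) = a \<sigma>"
      using tog[of \<sigma>] \<sigma>KL by (auto simp: toggle_def)
    have free: "\<omega> = \<sigma> \<or> \<omega> = insert (a \<sigma>) \<sigma>" if \<omega>: "\<omega> \<in> K" "\<sigma> \<subseteq> \<omega>" for \<omega>
    proof (rule ccontr)
      assume "\<not> ?thesis"
      then obtain v where v: "v \<in> \<omega>" "v \<notin> \<sigma>" "v \<noteq> a \<sigma>" using \<omega> by blast
      \<comment> \<open>Another coface would contain one with a single extra vertex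
        \<open>v\<close>. It is too large to be a lower partner, hence it is an upper one.\<close>
      define \<omega>1 where "\<omega>1 = insert v \<sigma>"
      have \<omega>1: "\<omega>1 \<in> K" using finite_complexD(4)[OF K \<omega>(1), of \<omega>1] \<omega> v by (auto simp: \<omega>1_def)
      moreover have "\<omega>1 \<notin> L"
        using finite_complexD(4)[OF L(1), of \<omega>1 \<sigma>] finite_complexD(3)[OF K] \<sigma>KL by (auto simp: \<omega>1_def)
      ultimately have \<omega>KL: "\<omega>1 \<in> K - L" by blast
      have "card \<omega>1 = Suc d" using \<sigma> v finite_complexD(2)[OF K \<sigma>KL(1)] by (simp add: \<omega>1_def)
      then have "\<omega>1 \<notin> \<Lambda>" using d_max by force
      then have up: "a \<omega>1 \<in> \<omega>1" using \<omega>KL by (simp add: \<Lambda>_def)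
      define b where "b = a \<omega>1"
      \<comment> \<open>The lower partner of \<open>\<omega>1\<close> has the size of
        \<open>\<sigma>\<close>, and \<open>\<sigma>\<close> arises from it by exchanging
        \<open>v\<close> for \<open>b\<close>; so its rank exceeds that of \<open>\<sigma>\<close>,
        against the choice of \<open>\<sigma>\<close>.\<close>
      define \<sigma>' where "\<sigma>' = \<omega>1 - {b}"
      have \<sigma>': "\<sigma>' \<in> \<Lambda>" "a \<sigma>' = b" using lower[OF \<omega>KL up] tog(2)[OF \<omega>KL] up by (simp_all add: \<sigma>'_def toggle_def b_def)
      have "b \<noteq> v"
      proof
        assume "b = v"
        then have "\<sigma>' = \<sigma>" using v by (auto simp: \<sigma>'_def \<omega>1_def)
        then show False using \<sigma>'(2) v \<open>b = v\<close> by simp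
      qed
      then have b: "b \<in> \<sigma>" using up[folded b_def] by (simp add: \<omega>1_def)
      have eq: "insert b (\<sigma>' - {v}) = \<sigma>" and v': "v \<in> \<sigma>'" and b': "b \<notin> \<sigma>'"
        using b v \<open>b \<noteq> v\<close> by (auto simp: \<sigma>'_def \<omega>1_def)
      have "card \<sigma>' = d"
        using \<open>card \<omega>1 = Suc d\<close> up by (simp add: \<sigma>'_def b_def card_Diff_singleton)
      moreover have "\<phi> \<sigma> < \<phi> \<sigma>'"
        using rank[of \<sigma>' v] \<sigma>' v' b' eq \<sigma> by (simp add: \<Lambda>_def)
      ultimately show False using max[OF \<sigma>'(1)] by simp
    qed
    define K' where "K' = K - {\<sigma>, insert (a \<sigma>) \<sigma>}"
    have LK': "L \<subseteq> K'" using LK \<sigma>KL \<rho> by (auto simp: K'_def)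
    then have xK': "x \<in> realization_points K'" using x realization_points_mono by blast
    have col: "finite_complex K'" "pointed_equivalent (geometric_realization K) x (geometric_realization K') x"
      using elementary_collapse[OF K \<sigma>KL(1,3) _ free] \<rho>(1) xK' by (auto simp: K'_def)
    have "pointed_equivalent (geometric_realization K') x (geometric_realization L) x"
    proof (rule less.hyps[OF _ col(1) LK'])
      have "K' - L \<subset> K - L" using \<sigma>KL by (auto simp: K'_def)
      then show "card (K' - L) < card (K - L)" using finK by (rule psubset_card_mono[rotated])
    next
      fix \<tau> assume \<tau>: "\<tau> \<in> K' - L"
      then have \<tau>K: "\<tau> \<in> K - L" by (auto simp: K'_def)
      show "a (toggle (a \<tau>) \<tau>) = a \<tau>" by (rule tog[OF \<tau>K])
      \<comment> \<open>Pairs are disjoint: a simplex paired with a removed one would have been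
        removed with it.\<close>
      have "\<tau> = toggle (a (toggle (a \<tau>) \<tau>)) (toggle (a \<tau>) \<tau>)" using tog(2)[OF \<tau>K] by simp
      moreover have "toggle (a \<sigma>) \<sigma> = insert (a \<sigma>) \<sigma>" "toggle (a \<sigma>) (insert (a \<sigma>) \<sigma>) = \<sigma>"
        using \<sigma>KL(3) by (auto simp: toggle_def)
      ultimately have "toggle (a \<tau>) \<tau> \<noteq> \<sigma>" "toggle (a \<tau>) \<tau> \<noteq> insert (a \<sigma>) \<sigma>"
        using \<tau> \<rho>(2) by (metis DiffD1 DiffD2 K'_def insertCI)+
      then show "toggle (a \<tau>) \<tau> \<in> K' - L" using tog(1)[OF \<tau>K] by (simp add: K'_def)
    next
      fix \<tau> v assume "\<tau> \<in> K' - L" "a \<tau> \<notin> \<tau>" "v \<in> \<tau>" "insert (a \<tau>) (\<tau> - {v}) \<in> K' - L"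
        "a (insert (a \<tau>) (\<tau> - {v})) \<notin> insert (a \<tau>) (\<tau> - {v})"
      then show "\<phi> (insert (a \<tau>) (\<tau> - {v})) < \<phi> \<tau>"
        by (intro rank) (auto simp: K'_def)
    qed
    with col(2) show ?thesis by (rule pointed_equivalent_trans)
  qed
qed

section \<open>Top simplices and spheres\<close>

definition simplex_boundary :: "'a set \<Rightarrow> ('a \<Rightarrow> real) set" where
  "simplex_boundary \<sigma> = {t \<in> closed_simplex \<sigma>. \<exists>v\<in>\<sigma>. t v = 0}"

text \<open>Polar coordinates on a simplex: \<open>e\<close> enumerates the vertices, \<open>y\<close> is a boundary point, and \<open>s\<close>
  is the distance from the barycentre; the boundary \<open>s = 1\<close> is mapped to the base point of the sphere.\<close>

definition polar_radius :: "(nat \<Rightarrow> 'a) \<Rightarrow> nat \<Rightarrow> ('a \<Rightarrow> real) \<Rightarrow> real" where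
  "polar_radius e n y = sqrt (\<Sum>i=1..n. (y (e i) - 1 / (real n + 1))\<^sup>2)"

text \<open>The sphere is swept out by parallels: \<open>2 * s - 1\<close> is the height and
  \<open>2 * sqrt (s * (1 - s))\<close> the radius, as their squares add up to 1. The direction
  omits the vertex \<open>e 0\<close>, because the deviations from the barycentre add up to 0 and
  the others determine it.\<close>

definition simplex_to_sphere :: "(nat \<Rightarrow> 'a) \<Rightarrow> nat \<Rightarrow> ('a \<Rightarrow> real) \<Rightarrow> real \<Rightarrow> nat \<Rightarrow> real" where
  "simplex_to_sphere e n y s i =
    (if i = 0 then 2 * s - 1
     else if i \<le> n then 2 * sqrt (s * (1 - s)) * ((y (e i) - 1 / (real n + 1)) / polar_radius e n y)
     else 0)"

lemma topspace_nsphere: "topspace (nsphere n) = {x. (\<Sum>i\<le>n. (x i)\<^sup>2) = 1 \<and> (\<forall>i>n. x i = 0)}"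
  by (simp add: nsphere)

context
  fixes e :: "nat \<Rightarrow> 'a" and n :: nat and \<sigma> :: "'a set"
  assumes e: "bij_betw e {..n} \<sigma>" and n: "n \<ge> 1"
begin

lemma sum_vertices: "(\<Sum>v\<in>\<sigma>. g v) = g (e 0) + (\<Sum>i=1..n. g (e i))" for g :: "'a \<Rightarrow> real"
proof -
  have "(\<Sum>v\<in>\<sigma>. g v) = (\<Sum>i\<le>n. g (e i))" using sum.reindex_bij_betw[OF e, of g] by simp
  also have "{..n} = insert 0 {1..n}" by auto
  finally show ?thesis by simp
qed

lemma boundary_vertex:
  assumes "y \<in> simplex_boundary \<sigma>"
  obtains i where "i \<le> n" "y (e i) = 0"
  using assms e unfolding simplex_boundary_def bij_betw_def by auto

lemma boundary_sum:
  assumes "y \<in> simplex_boundary \<sigma>"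
  shows "y (e 0) + (\<Sum>i=1..n. y (e i)) = 1" "0 \<le> y v"
  using assms sum_vertices[of y] by (auto simp: simplex_boundary_def closed_simplex_def)

text \<open>If the deviations at the vertices 1 to \<open>n\<close> vanish, so does the one at
  vertex 0; but only the barycentre has no deviation, and a boundary point has a zero
  coordinate.\<close>

lemma polar_radius_pos:
  assumes y: "y \<in> simplex_boundary \<sigma>"
  shows "polar_radius e n y > 0"
proof (rule ccontr)
  assume "\<not> ?thesis"
  moreover have "0 \<le> (\<Sum>i=1..n. (y (e i) - 1 / (real n + 1))\<^sup>2)" by (intro sum_nonneg) auto
  ultimately have "(\<Sum>i=1..n. (y (e i) - 1 / (real n + 1))\<^sup>2) = 0"
    unfolding polar_radius_def by (simp add: not_less)
  then have yi: "y (e i) = 1 / (real n + 1)" if "i \<in> {1..n}" for i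
    using that by (subst (asm) sum_nonneg_eq_0_iff) auto
  then have "(\<Sum>i=1..n. y (e i)) = real n / (real n + 1)" by simp
  then have "y (e 0) = 1 - real n / (real n + 1)" using boundary_sum(1)[OF y] by linarith
  then have "y (e 0) = 1 / (real n + 1)" by (simp add: field_simps)
  moreover obtain i where "i \<le> n" "y (e i) = 0" by (rule boundary_vertex[OF y])
  ultimately show False using yi[of i] by (cases "i = 0") (auto simp: add_eq_0_iff)
qed

lemma simplex_to_sphere_in:
  assumes y: "y \<in> simplex_boundary \<sigma>" and s: "s \<in> {0..1}"
  shows "simplex_to_sphere e n y s \<in> topspace (nsphere n)"
proof -
  let ?w = "\<lambda>i. y (e i) - 1 / (real n + 1)" and ?r = "polar_radius e n y"
  have "0 \<le> (\<Sum>i=1..n. (?w i)\<^sup>2)" by (intro sum_nonneg) auto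
  then have r2: "?r\<^sup>2 = (\<Sum>i=1..n. (?w i)\<^sup>2)" by (simp add: polar_radius_def)
  have "(\<Sum>i=1..n. (simplex_to_sphere e n y s i)\<^sup>2) = (\<Sum>i=1..n. 4 * (s * (1 - s)) / ?r\<^sup>2 * (?w i)\<^sup>2)"
    using s by (intro sum.cong) (auto simp: simplex_to_sphere_def power_mult_distrib power_divide)
  also have "\<dots> = 4 * (s * (1 - s)) / ?r\<^sup>2 * ?r\<^sup>2" by (simp only: r2 sum_distrib_left)
  also have "\<dots> = 4 * (s * (1 - s))" using polar_radius_pos[OF y] by simp
  finally have "(\<Sum>i=1..n. (simplex_to_sphere e n y s i)\<^sup>2) = 4 * (s * (1 - s))" .
  moreover have "{..n} = insert 0 {1..n}" by auto
  ultimately have "(\<Sum>i\<le>n. (simplex_to_sphere e n y s i)\<^sup>2) = (2 * s - 1)\<^sup>2 + 4 * (s * (1 - s))"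
    by (simp add: simplex_to_sphere_def)
  also have "\<dots> = 1" by (simp add: power2_eq_square algebra_simps)
  finally show ?thesis by (auto simp: topspace_nsphere simplex_to_sphere_def)
qed

text \<open>Equal directions make the deviations from the barycentre proportional with a factor
  \<open>l > 0\<close>. A vertex where \<open>y'\<close> vanishes gives \<open>l \<le> 1\<close> and
  one where \<open>y\<close> vanishes gives \<open>l \<ge> 1\<close>, since no deviation lies below
  \<open>- 1 / N\<close>.\<close>

lemma simplex_to_sphere_inj:
  assumes y: "y \<in> simplex_boundary \<sigma>" "y' \<in> simplex_boundary \<sigma>" and s: "0 < s" "s < 1"
    and eq: "simplex_to_sphere e n y s = simplex_to_sphere e n y' s"
  shows "y = y'"
proof -
  define N where "N = real n + 1"
  have N: "N > 0" by (simp add: N_def)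
  let ?w = "\<lambda>i. y (e i) - 1 / N" and ?w' = "\<lambda>i. y' (e i) - 1 / N"
  define l where "l = polar_radius e n y / polar_radius e n y'"
  have l: "l > 0" using polar_radius_pos y by (simp add: l_def)
  have wi: "?w i = l * ?w' i" if "i \<in> {1..n}" for i
  proof -
    define q where "q = 2 * sqrt (s * (1 - s))"
    have "q > 0" using s by (simp add: q_def)
    moreover have "q * (?w i / polar_radius e n y) = q * (?w' i / polar_radius e n y')"
      using fun_cong[OF eq, of i] that unfolding simplex_to_sphere_def N_def q_def by simp
    ultimately have "?w i / polar_radius e n y = ?w' i / polar_radius e n y'"
      by (metis less_irrefl mult_left_cancel)
    have "?w i = ?w i / polar_radius e n y * polar_radius e n y"
      using polar_radius_pos[OF y(1)] by simp
    also have "\<dots> = ?w' i / polar_radius e n y' * polar_radius e n y"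
      by (simp only: \<open>?w i / polar_radius e n y = _\<close>)
    finally show ?thesis by (simp add: l_def)
  qed
  have tot: "(u (e 0) - 1 / N) + (\<Sum>i=1..n. u (e i) - 1 / N) = 0" if "u \<in> simplex_boundary \<sigma>" for u
  proof -
    have "(\<Sum>i=1..n. u (e i) - 1 / N) = (\<Sum>i=1..n. u (e i)) - real n / N" by (simp add: sum_subtractf)
    moreover have "1 / N + real n / N = 1" using N by (simp add: N_def add_divide_distrib[symmetric])
    ultimately show ?thesis using boundary_sum(1)[OF that] by linarith
  qed
  have "(\<Sum>i=1..n. ?w i) = l * (\<Sum>i=1..n. ?w' i)"
    unfolding sum_distrib_left by (rule sum.cong) (use wi in auto)
  then have "?w 0 = - (l * (\<Sum>i=1..n. ?w' i))" using tot[OF y(1)] by linarith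
  moreover have "(\<Sum>i=1..n. ?w' i) = - ?w' 0" using tot[OF y(2)] by linarith
  ultimately have "?w 0 = - (l * (- ?w' 0))" by (simp only:)
  then have w0: "?w 0 = l * ?w' 0" by (simp only: mult_minus_right minus_minus)
  have w: "?w i = l * ?w' i" if "i \<le> n" for i
    using that w0 wi[of i] by (cases "i = 0") auto
  obtain i where i: "i \<le> n" "y (e i) = 0" by (rule boundary_vertex[OF y(1)])
  obtain j where j: "j \<le> n" "y' (e j) = 0" by (rule boundary_vertex[OF y(2)])
  have "l * (1 / N) \<le> 1 / N" using w[OF j(1)] j(2) boundary_sum(2)[OF y(1), of "e j"] by simp
  then have "l \<le> 1" using N by (simp add: field_simps)
  moreover have "1 \<le> l"
  proof -
    have "l * ?w' i = - (1 / N)" using w[OF i(1)] i(2) by simp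
    then have "l * y' (e i) = l / N - 1 / N" by (simp add: algebra_simps)
    moreover have "0 \<le> l * y' (e i)" using l boundary_sum(2)[OF y(2)] by simp
    ultimately have "1 / N \<le> l / N" by linarith
    then show ?thesis using N by (simp add: field_simps)
  qed
  ultimately have "l = 1" by simp
  then have ye: "y (e i) = y' (e i)" if "i \<le> n" for i using w[OF that] by simp
  show "y = y'"
  proof
    fix v
    show "y v = y' v"
    proof (cases "v \<in> \<sigma>")
      case True
      then show ?thesis using ye e by (auto simp: bij_betw_def)
    next
      case False
      then show ?thesis using y by (simp add: simplex_boundary_def closed_simplex_def)
    qed
  qed
qed

lemma simplex_boundary_nonempty: "simplex_boundary \<sigma> \<noteq> {}"
proof -
  have fin: "finite \<sigma>" using e bij_betw_finite by blast
  have "e 0 \<in> \<sigma>" "e 1 \<in> \<sigma>" "e 1 \<noteq> e 0" using e n by (auto simp: bij_betw_def inj_on_def)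
  then have "(\<lambda>v. if v = e 0 then 1 else 0) \<in> simplex_boundary \<sigma>"
    using fin by (auto simp: simplex_boundary_def closed_simplex_def sum.delta intro!: bexI[of _ "e 1"])
  then show ?thesis by blast
qed

lemma simplex_to_sphere_surj:
  assumes z: "z \<in> topspace (nsphere n)"
  obtains y s where "y \<in> simplex_boundary \<sigma>" "s \<in> {0..1}" "simplex_to_sphere e n y s = z"
proof -
  define N where "N = real n + 1"
  have N: "N > 0" by (simp add: N_def)
  define s where "s = (z 0 + 1) / 2"
  have ins: "{..n} = insert 0 {1..n}" by auto
  have z1: "(z 0)\<^sup>2 + (\<Sum>i=1..n. (z i)\<^sup>2) = 1" and z2: "\<And>i. i > n \<Longrightarrow> z i = 0"
    using z by (auto simp: topspace_nsphere ins)
  have nn: "0 \<le> (\<Sum>i=1..n. (z i)\<^sup>2)" by (intro sum_nonneg) auto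
  then have "(z 0)\<^sup>2 \<le> 1" using z1 by linarith
  then have "\<bar>z 0\<bar> \<le> 1" by (simp add: abs_square_le_1)
  then have s: "s \<in> {0..1}" by (auto simp: s_def)
  have z0: "z 0 = 2 * s - 1" by (simp add: s_def field_simps)
  have sq: "(\<Sum>i=1..n. (z i)\<^sup>2) = 4 * (s * (1 - s))"
    using z1 unfolding z0 by (simp add: power2_eq_square algebra_simps)
  show thesis
  \<comment> \<open>At the two poles the direction does not matter, and any boundary point
    serves.\<close>
  proof (cases "s * (1 - s) = 0")
    case True
    then have "(\<Sum>i=1..n. (z i)\<^sup>2) = 0" using sq by simp
    then have "z i = 0" if "i \<in> {1..n}" for i
      using that by (subst (asm) sum_nonneg_eq_0_iff) auto
    then have "simplex_to_sphere e n y s = z" for y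
      using True z0 z2 by (auto simp: simplex_to_sphere_def fun_eq_iff not_le)
    then show thesis using that s simplex_boundary_nonempty by blast
  next
    case False
    then have ss: "s * (1 - s) > 0" using s by (auto simp: less_le)
    define c where "c = 2 * sqrt (s * (1 - s))"
    have c: "c > 0" and c2: "c\<^sup>2 = 4 * (s * (1 - s))"
      using ss unfolding c_def by (simp_all add: power_mult_distrib)
    \<comment> \<open>The direction of \<open>z\<close>, completed at index 0 so that the deviations
      add up to 0.\<close>
    define w where "w = (\<lambda>i. if i = 0 then - (\<Sum>i=1..n. z i / c) else z i / c)"
    have w_sum: "(\<Sum>i\<le>n. w i) = 0"
    proof -
      have "(\<Sum>i=1..n. w i) = (\<Sum>i=1..n. z i / c)" by (rule sum.cong) (auto simp: w_def)
      then show ?thesis unfolding ins by (simp add: w_def)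
    qed
    have w_sq: "(\<Sum>i=1..n. (w i)\<^sup>2) = 1"
    proof -
      have "(\<Sum>i=1..n. (w i)\<^sup>2) = (\<Sum>i=1..n. (z i)\<^sup>2 / c\<^sup>2)"
        by (rule sum.cong) (auto simp: w_def power_divide)
      also have "\<dots> = 1" using False by (simp only: sum_divide_distrib[symmetric] c2 sq) simp
      finally show ?thesis .
    qed
    define m where "m = Min (w ` {..n})"
    have m_le: "m \<le> w i" if "i \<le> n" for i using that by (simp add: m_def)
    have "m \<in> w ` {..n}" unfolding m_def by (rule Min_in) auto
    then obtain i0 where i0: "i0 \<le> n" "w i0 = m" by auto
    have m: "m < 0"
    proof (rule ccontr)
      assume "\<not> m < 0"
      then have "0 \<le> w i" if "i \<le> n" for i using m_le[OF that] by linarith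
      then have "w i = 0" if "i \<le> n" for i
        using that w_sum by (subst (asm) sum_nonneg_eq_0_iff) auto
      then have "(\<Sum>i=1..n. (w i)\<^sup>2) = 0" by simp
      with w_sq show False by simp
    qed
    \<comment> \<open>The length at which the ray from the barycentre leaves the simplex: the
      smallest coordinate \<open>1 / N + l * m\<close> becomes 0.\<close>
    define l where "l = - 1 / (N * m)"
    have "N * m < 0" using m N by (simp add: mult_pos_neg)
    then have l: "l > 0" by (simp add: l_def zero_less_divide_iff)
    have lm: "l * m = - 1 / N" using m by (simp add: l_def)
    define y where "y = (\<lambda>v. if v \<in> \<sigma> then 1 / N + l * w (inv_into {..n} e v) else 0)"
    have ye: "y (e i) = 1 / N + l * w i" if "i \<le> n" for i
      using e that by (auto simp: y_def bij_betw_def)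
    have y0: "0 \<le> y (e i)" if "i \<le> n" for i
    proof -
      have "l * m \<le> l * w i" using l m_le[OF that] by simp
      then show ?thesis using lm ye[OF that] by simp
    qed
    have "(\<Sum>v\<in>\<sigma>. y v) = (\<Sum>i\<le>n. y (e i))" using sum.reindex_bij_betw[OF e, of y] by simp
    also have "\<dots> = (\<Sum>i\<le>n. 1 / N + l * w i)" by (rule sum.cong) (auto simp: ye)
    also have "\<dots> = (real n + 1) / N + l * (\<Sum>i\<le>n. w i)" by (simp add: sum.distrib sum_distrib_left)
    also have "\<dots> = 1" using w_sum N by (simp add: N_def)
    finally have "(\<Sum>v\<in>\<sigma>. y v) = 1" .
    moreover have "0 \<le> y v" for v
      using y0 e by (cases "v \<in> \<sigma>") (auto simp: bij_betw_def y_def)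
    moreover have "y v = 0" if "v \<notin> \<sigma>" for v using that by (simp add: y_def)
    moreover have "y (e i0) = 0" "e i0 \<in> \<sigma>" using ye[OF i0(1)] i0 lm e by (auto simp: bij_betw_def)
    ultimately have yb: "y \<in> simplex_boundary \<sigma>" by (auto simp: simplex_boundary_def closed_simplex_def)
    have "(\<Sum>i=1..n. (y (e i) - 1 / (real n + 1))\<^sup>2) = (\<Sum>i=1..n. l\<^sup>2 * (w i)\<^sup>2)"
      by (rule sum.cong) (auto simp: ye N_def power_mult_distrib)
    also have "\<dots> = l\<^sup>2" using w_sq by (simp add: sum_distrib_left[symmetric])
    finally have "polar_radius e n y = l" using l by (simp add: polar_radius_def)
    then have "simplex_to_sphere e n y s i = z i" for i
      using l c z0 z2[of i] ye[of i] by (auto simp: simplex_to_sphere_def c_def[symmetric] N_def w_def)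
    then show thesis using that[OF yb s] by auto
  qed
qed

end

text \<open>The disjoint union of the boundary spheres; a discrete first coordinate keeps the sheets
  apart. It lets all cells be attached in a single step.\<close>

definition boundary_space :: "'a set set \<Rightarrow> ('a set \<times> ('a \<Rightarrow> real)) topology" where
  "boundary_space S = subtopology (prod_topology (discrete_topology S) (powertop_real UNIV))
     (SIGMA \<sigma>:S. simplex_boundary \<sigma>)"

lemma topspace_boundary_space [simp]: "topspace (boundary_space S) = (SIGMA \<sigma>:S. simplex_boundary \<sigma>)"
  by (auto simp: boundary_space_def)

lemma simplex_boundary_eq_Union:
  assumes "finite \<sigma>"
  shows "simplex_boundary \<sigma> = (\<Union>v\<in>\<sigma>. closed_simplex (\<sigma> - {v}))"
proof -
  have "t \<in> closed_simplex \<sigma> \<and> t v = 0 \<longleftrightarrow> t \<in> closed_simplex (\<sigma> - {v})" if "v \<in> \<sigma>" for v t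
  proof -
    have "sum t \<sigma> = t v + sum t (\<sigma> - {v})" using that assms by (simp add: sum.remove)
    then show ?thesis using that by (auto simp: closed_simplex_def)
  qed
  then show ?thesis by (auto simp: simplex_boundary_def)
qed

lemma compactin_simplex_boundary:
  assumes "finite \<sigma>"
  shows "compactin (powertop_real UNIV) (simplex_boundary \<sigma>)"
  unfolding simplex_boundary_eq_Union[OF assms]
  by (intro compactin_Union) (use assms compactin_closed_simplex[of "\<sigma> - {_}"] in auto)

lemma compactin_boundary_slice:
  assumes "\<sigma> \<in> S" "finite \<sigma>"
  shows "compactin (boundary_space S) ({\<sigma>} \<times> simplex_boundary \<sigma>)"
proof -
  have "compactin (prod_topology (discrete_topology S) (powertop_real UNIV)) ({\<sigma>} \<times> simplex_boundary \<sigma>)"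
    using assms compactin_simplex_boundary[OF assms(2)] by (simp add: compactin_Times compactin_discrete_topology)
  then show ?thesis unfolding boundary_space_def compactin_subtopology using assms by auto
qed

lemma compact_space_boundary_space:
  assumes "finite S" "\<And>\<sigma>. \<sigma> \<in> S \<Longrightarrow> finite \<sigma>"
  shows "compact_space (boundary_space S)"
proof -
  have "compactin (boundary_space S) (\<Union>\<sigma>\<in>S. {\<sigma>} \<times> simplex_boundary \<sigma>)"
    using assms compactin_boundary_slice by (intro compactin_Union) auto
  moreover have "(\<Union>\<sigma>\<in>S. {\<sigma>} \<times> simplex_boundary \<sigma>) = topspace (boundary_space S)" by auto
  ultimately show ?thesis by (simp add: compact_space_def)
qed

lemma continuous_map_boundary_fst: "continuous_map (boundary_space S) (discrete_topology S) fst"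
  unfolding boundary_space_def by (intro continuous_map_from_subtopology continuous_map_fst)

lemma continuous_map_boundary_coordinate: "continuous_map (boundary_space S) euclideanreal (\<lambda>p. snd p v)"
  unfolding boundary_space_def
  by (intro continuous_map_from_subtopology continuous_map_compose_app[OF _ continuous_map_snd]
      continuous_map_product_projection) auto

text \<open>The sheets on which \<open>d\<close> is constant are open, so continuity may be checked
  on each of them, where a map chosen according to \<open>d\<close> is a single formula.\<close>

lemma continuous_map_discrete_cases:
  assumes d: "continuous_map X (discrete_topology S) d"
    and f: "\<And>\<sigma>. \<sigma> \<in> S \<Longrightarrow> continuous_map (subtopology X {x \<in> topspace X. d x = \<sigma>}) Z f"
  shows "continuous_map X Z f"
  unfolding continuous_map_def
proof (intro conjI allI impI)
  have dS: "d x \<in> S" if "x \<in> topspace X" for x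
    using continuous_map_image_subset_topspace[OF d] that by auto
  show "f \<in> topspace X \<rightarrow> topspace Z"
  proof
    fix x assume x: "x \<in> topspace X"
    then have "x \<in> topspace (subtopology X {y \<in> topspace X. d y = d x})" by simp
    then show "f x \<in> topspace Z"
      using continuous_map_image_subset_topspace[OF f[OF dS[OF x]]] by blast
  qed
  fix U assume U: "openin Z U"
  have "openin X {x \<in> topspace X. d x = \<sigma> \<and> f x \<in> U}" if \<sigma>: "\<sigma> \<in> S" for \<sigma>
  proof -
    have "openin X {x \<in> topspace X. d x \<in> {\<sigma>}}"
      using openin_continuous_map_preimage[OF d, of "{\<sigma>}"] \<sigma> by simp
    then have 1: "openin X {x \<in> topspace X. d x = \<sigma>}" by simp
    have "openin (subtopology X {x \<in> topspace X. d x = \<sigma>}) {x \<in> topspace (subtopology X {x \<in> topspace X. d x = \<sigma>}). f x \<in> U}"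
      by (rule openin_continuous_map_preimage[OF f[OF \<sigma>] U])
    then have "openin X {x \<in> topspace (subtopology X {x \<in> topspace X. d x = \<sigma>}). f x \<in> U}"
      by (rule openin_trans_full[OF _ 1])
    moreover have "{x \<in> topspace (subtopology X {x \<in> topspace X. d x = \<sigma>}). f x \<in> U} = {x \<in> topspace X. d x = \<sigma> \<and> f x \<in> U}"
      by auto
    ultimately show ?thesis by simp
  qed
  then have "openin X (\<Union>\<sigma>\<in>S. {x \<in> topspace X. d x = \<sigma> \<and> f x \<in> U})" by (intro openin_Union) auto
  moreover have "(\<Union>\<sigma>\<in>S. {x \<in> topspace X. d x = \<sigma> \<and> f x \<in> U}) = {x \<in> topspace X. f x \<in> U}"
    using dS by blast
  ultimately show "openin X {x \<in> topspace X. f x \<in> U}" by simp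
qed

lemma maximal_Diff_finite_complex:
  assumes K: "finite_complex K" and max: "\<And>\<sigma> \<omega>. \<sigma> \<in> S \<Longrightarrow> \<omega> \<in> K \<Longrightarrow> \<sigma> \<subseteq> \<omega> \<Longrightarrow> \<omega> = \<sigma>"
  shows "finite_complex (K - S)"
  unfolding finite_complex_def
  using finite_complexD[OF K] max by (intro conjI ballI allI impI) (blast intro: finite_Diff)+

definition polar_point :: "('a set \<times> ('a \<Rightarrow> real)) \<times> real \<Rightarrow> 'a \<Rightarrow> real" where
  "polar_point = (\<lambda>((\<sigma>, y), s) v. (1 - s) * (if v \<in> \<sigma> then 1 / real (card \<sigma>) else 0) + s * y v)"

text \<open>Each maximal simplex is the cone from its barycentre over its boundary, and its boundary
  lies in the remaining complex. The cone point depends on the simplex only, hence the last argument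
  \<open>fst\<close>.\<close>

lemma attaches_top_simplices:
  assumes K: "finite_complex K" and S: "S \<subseteq> K" and n: "\<And>\<sigma>. \<sigma> \<in> S \<Longrightarrow> card \<sigma> \<ge> 2"
    and max: "\<And>\<sigma> \<omega>. \<sigma> \<in> S \<Longrightarrow> \<omega> \<in> K \<Longrightarrow> \<sigma> \<subseteq> \<omega> \<Longrightarrow> \<omega> = \<sigma>"
  shows "attaches (geometric_realization K) (geometric_realization (K - S)) (boundary_space S) id polar_point snd fst"
proof -
  let ?A = "geometric_realization (K - S)" and ?P = "boundary_space S"
  let ?PI = "prod_topology ?P unit_interval"
  have K': "finite_complex (K - S)" using maximal_Diff_finite_complex[OF K max] .
  have fin: "finite \<sigma>" if "\<sigma> \<in> S" for \<sigma> using that S finite_complexD(2)[OF K] by blast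
  have finS: "finite S" using S finite_complexD(1)[OF K] finite_subset by blast
  have bd: "y \<in> realization_points (K - S)" if "\<sigma> \<in> S" "y \<in> simplex_boundary \<sigma>" for \<sigma> y
  proof -
    have y: "y \<in> closed_simplex \<sigma>" and "{v. y v \<noteq> 0} \<noteq> \<sigma>" using that(2) by (auto simp: simplex_boundary_def)
    note supp = simplex_support[OF y fin[OF that(1)]]
    have "{v. y v \<noteq> 0} \<in> K" using finite_complexD(4)[OF K _ supp(1,2)] that S by blast
    moreover have "{v. y v \<noteq> 0} \<notin> S" using max[of _ \<sigma>] supp(1) \<open>_ \<noteq> \<sigma>\<close> that S by blast
    ultimately show ?thesis using supp(3) by (auto simp: realization_points_def)
  qed
  have yS: "(\<Sum>v\<in>\<sigma>. y v) = 1" "\<And>v. 0 \<le> y v" "\<And>v. v \<notin> \<sigma> \<Longrightarrow> y v = 0" "\<exists>v\<in>\<sigma>. y v = 0" if "y \<in> simplex_boundary \<sigma>" for \<sigma> y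
    using that by (auto simp: simplex_boundary_def closed_simplex_def)
  have cpos: "real (card \<sigma>) > 0" if "\<sigma> \<in> S" for \<sigma> using n[OF that] by simp
  have polar_in: "polar_point ((\<sigma>, y), s) \<in> closed_simplex \<sigma>" if "\<sigma> \<in> S" "y \<in> simplex_boundary \<sigma>" "s \<in> {0..1}" for \<sigma> y s
  proof -
    have "(\<Sum>v\<in>\<sigma>. polar_point ((\<sigma>, y), s) v) = (\<Sum>v\<in>\<sigma>. (1 - s) / real (card \<sigma>)) + s * (\<Sum>v\<in>\<sigma>. y v)"
      by (simp add: polar_point_def sum.distrib sum_distrib_left)
    also have "\<dots> = 1" using yS[OF that(2)] cpos[OF that(1)] by simp
    finally show ?thesis using yS[OF that(2)] that(3) by (auto simp: closed_simplex_def polar_point_def)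
  qed
  \<comment> \<open>The support of a point below \<open>s = 1\<close> is the whole simplex; it
    recovers \<open>\<sigma>\<close> and shows that the point is not in the remaining
    complex.\<close>
  have supp: "{v. polar_point ((\<sigma>, y), s) v \<noteq> 0} = \<sigma>" if "\<sigma> \<in> S" "y \<in> simplex_boundary \<sigma>" "s \<in> {0..<1}" for \<sigma> y s
  proof -
    have "polar_point ((\<sigma>, y), s) v > 0" if "v \<in> \<sigma>" for v
    proof -
      have "(1 - s) * (1 / real (card \<sigma>)) > 0" using \<open>s \<in> _\<close> cpos[OF \<open>\<sigma> \<in> S\<close>] by simp
      moreover have "s * y v \<ge> 0" using yS(2)[OF \<open>y \<in> _\<close>] \<open>s \<in> _\<close> by simp
      ultimately show ?thesis using that by (simp add: polar_point_def)
    qed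
    moreover have "polar_point ((\<sigma>, y), s) v = 0" if "v \<notin> \<sigma>" for v
      using yS(3)[OF \<open>y \<in> _\<close> that] that by (simp add: polar_point_def)
    ultimately show ?thesis by (auto simp: less_le)
  qed
  \<comment> \<open>The smallest coordinate of a polar point is attained where \<open>y\<close>
    vanishes and determines \<open>s\<close>.\<close>
  have low: "(1 - s) / real (card \<sigma>) \<le> polar_point ((\<sigma>, y), s) v" if "y \<in> simplex_boundary \<sigma>" "s \<in> {0..1}" "v \<in> \<sigma>" for \<sigma> y s v
    using that yS(2)[OF that(1)] by (simp add: polar_point_def)
  have lowest: "\<exists>v\<in>\<sigma>. polar_point ((\<sigma>, y), s) v = (1 - s) / real (card \<sigma>)" if "y \<in> simplex_boundary \<sigma>" for \<sigma> y s
    using yS(4)[OF that] by (auto simp: polar_point_def)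
  have cb: "continuous_map ?PI (geometric_realization K) polar_point"
    unfolding continuous_map_realization[OF K]
  proof (intro conjI allI ballI)
    fix v
    have cs: "continuous_map ?PI euclideanreal snd"
      by (rule continuous_map_into_fulltopology[OF continuous_map_snd])
    have "continuous_map (discrete_topology S) euclideanreal (\<lambda>\<sigma>. if v \<in> \<sigma> then 1 / real (card \<sigma>) else 0)"
      by simp
    moreover have "continuous_map ?PI (discrete_topology S) (\<lambda>z. fst (fst z))"
      by (rule continuous_map_compose_app[OF continuous_map_boundary_fst continuous_map_fst])
    ultimately have c1: "continuous_map ?PI euclideanreal (\<lambda>z. if v \<in> fst (fst z) then 1 / real (card (fst (fst z))) else 0)"
      by (rule continuous_map_compose_app)
    have c2: "continuous_map ?PI euclideanreal (\<lambda>z. snd (fst z) v)"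
      by (rule continuous_map_compose_app[OF continuous_map_boundary_coordinate continuous_map_fst])
    have "continuous_map ?PI euclideanreal (\<lambda>z. (1 - snd z) * (if v \<in> fst (fst z) then 1 / real (card (fst (fst z))) else 0) + snd z * snd (fst z) v)"
      by (intro continuous_map_add continuous_map_real_mult continuous_map_diff c1 c2 cs) auto
    then show "continuous_map ?PI euclideanreal (\<lambda>z. polar_point z v)"
      by (simp add: polar_point_def case_prod_unfold)
  next
    fix z assume "z \<in> topspace ?PI"
    then show "polar_point z \<in> realization_points K" using polar_in S by (cases z) (fastforce simp: realization_points_def)
  qed
  have surj: "realization_points K \<subseteq> id ` realization_points (K - S) \<union> polar_point ` (topspace ?P \<times> {0..1})"
  proof
    fix t assume t: "t \<in> realization_points K"
    define \<sigma> where "\<sigma> = {v. t v \<noteq> 0}"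
    have \<sigma>: "\<sigma> \<in> K" "t \<in> closed_simplex \<sigma>" using realization_points_support[OF K t] by (auto simp: \<sigma>_def)
    show "t \<in> id ` realization_points (K - S) \<union> polar_point ` (topspace ?P \<times> {0..1})"
    proof (cases "\<sigma> \<in> S")
      case False
      then show ?thesis using \<sigma> by (auto simp: realization_points_def)
    next
      case True
      let ?c = "real (card \<sigma>)"
      note c = cpos[OF True]
      have ts: "(\<Sum>v\<in>\<sigma>. t v) = 1" "\<And>v. 0 \<le> t v" using \<sigma> by (auto simp: closed_simplex_def)
      define m where "m = Min (t ` \<sigma>)"
      have ne: "\<sigma> \<noteq> {}" using n[OF True] by auto
      have m_le: "m \<le> t v" if "v \<in> \<sigma>" for v using that fin[OF True] by (simp add: m_def)
      have "m \<in> t ` \<sigma>" unfolding m_def using fin[OF True] ne by (intro Min_in) auto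
      then obtain w where w: "w \<in> \<sigma>" "t w = m" by auto
      \<comment> \<open>Solves \<open>m = (1 - s) / card \<sigma>\<close>, the relation between the
        least coordinate and the radius.\<close>
      define s where "s = 1 - ?c * m"
      have "(\<Sum>v\<in>\<sigma>. m) \<le> (\<Sum>v\<in>\<sigma>. t v)" by (rule sum_mono) (rule m_le)
      then have s: "s \<in> {0..1}" using ts w c by (auto simp: s_def)
      have ms: "m = (1 - s) / ?c" using c by (simp add: s_def)
      show ?thesis
      \<comment> \<open>At the barycentre any boundary point will do; there is one because a simplex
        of \<open>S\<close> has at least two vertices.\<close>
      proof (cases "s = 0")
        case True
        have "t v = m" if "v \<in> \<sigma>" for v
        proof (rule ccontr)
          assume "t v \<noteq> m"
          then have "m < t v" using m_le[OF that] by simp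
          then have "(\<Sum>v\<in>\<sigma>. m) < (\<Sum>v\<in>\<sigma>. t v)"
            using that m_le fin[OF \<open>\<sigma> \<in> S\<close>] by (intro sum_strict_mono_ex1) auto
          then show False using True ts by (simp add: s_def)
        qed
        then have "t = polar_point ((\<sigma>, y), 0)" for y
          using True ms by (auto simp: polar_point_def fun_eq_iff \<sigma>_def)
        moreover obtain e where "bij_betw e {..card \<sigma> - 1} \<sigma>"
        proof -
          have "card {..card \<sigma> - 1} = card \<sigma>" using n[OF \<open>\<sigma> \<in> S\<close>] by simp
          then show thesis using that finite_same_card_bij[of "{..card \<sigma> - 1}" \<sigma>] fin[OF \<open>\<sigma> \<in> S\<close>] by auto
        qed
        moreover have "1 \<le> card \<sigma> - 1" using n[OF \<open>\<sigma> \<in> S\<close>] by simp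
        ultimately obtain y where "y \<in> simplex_boundary \<sigma>" "t = polar_point ((\<sigma>, y), 0)"
          using simplex_boundary_nonempty by blast
        then show ?thesis using \<open>\<sigma> \<in> S\<close> by (auto intro!: image_eqI[of _ _ "((\<sigma>, y), 0)"])
      next
        case False
        then have s0: "s > 0" using s by simp
        define y where "y = (\<lambda>v. if v \<in> \<sigma> then (t v - m) / s else 0)"
        have "(\<Sum>v\<in>\<sigma>. y v) = ((\<Sum>v\<in>\<sigma>. t v) - ?c * m) / s"
          by (simp add: y_def sum_divide_distrib[symmetric] sum_subtractf)
        then have "(\<Sum>v\<in>\<sigma>. y v) = 1" using ts s0 by (simp add: s_def)
        then have "y \<in> simplex_boundary \<sigma>"
          using m_le s0 w by (auto simp: simplex_boundary_def closed_simplex_def y_def)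
        moreover have "t = polar_point ((\<sigma>, y), s)"
        proof
          fix v
          show "t v = polar_point ((\<sigma>, y), s) v"
            using s0 ms by (cases "v \<in> \<sigma>") (auto simp: polar_point_def y_def \<sigma>_def)
        qed
        ultimately show ?thesis using \<open>\<sigma> \<in> S\<close> s by (auto intro!: image_eqI[of _ _ "((\<sigma>, y), s)"])
      qed
    qed
  qed
  have ci: "continuous_map ?A (geometric_realization K) id"
    using continuous_map_realization_coordinate[OF K'] realization_points_mono[of "K - S" K]
    by (auto simp: continuous_map_realization[OF K])
  have cf: "continuous_map ?P ?A snd"
    using continuous_map_boundary_coordinate bd by (auto simp: continuous_map_realization[OF K'])
  have op: "openin (geometric_realization K) U"
    if U: "U \<subseteq> realization_points K" "openin ?A {a \<in> topspace ?A. id a \<in> U}"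
      "openin ?PI {z \<in> topspace ?P \<times> {0..1}. polar_point z \<in> U}" for U
  proof -
    \<comment> \<open>The complement of \<open>U\<close> is the union of the images of two compact
      sets, hence closed in the Hausdorff realization.\<close>
    have "compact_space ?PI"
      using compact_space_boundary_space[OF finS fin] by (simp add: compact_space_prod_topology compact_space_subtopology)
    moreover have "closedin ?PI (topspace ?PI - {z \<in> topspace ?P \<times> {0..1}. polar_point z \<in> U})"
      using U(3) by blast
    ultimately have "compactin ?PI (topspace ?PI - {z \<in> topspace ?P \<times> {0..1}. polar_point z \<in> U})"
      by (rule closedin_compact_space)
    then have 1: "compactin (geometric_realization K) (polar_point ` (topspace ?PI - {z \<in> topspace ?P \<times> {0..1}. polar_point z \<in> U}))"
      by (rule image_compactin[OF _ cb])
    have "compactin ?A (topspace ?A - {a \<in> topspace ?A. id a \<in> U})"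
      using U(2) compact_space_realization[OF K'] by (intro closedin_compact_space) blast+
    then have 2: "compactin (geometric_realization K) (id ` (topspace ?A - {a \<in> topspace ?A. id a \<in> U}))"
      by (rule image_compactin[OF _ ci])
    have "compactin (geometric_realization K) (id ` (topspace ?A - {a \<in> topspace ?A. id a \<in> U}) \<union> polar_point ` (topspace ?PI - {z \<in> topspace ?P \<times> {0..1}. polar_point z \<in> U}))"
      by (rule compactin_Un[OF 2 1])
    moreover have "id ` (topspace ?A - {a \<in> topspace ?A. id a \<in> U}) \<union> polar_point ` (topspace ?PI - {z \<in> topspace ?P \<times> {0..1}. polar_point z \<in> U}) = realization_points K - U"
    proof (rule subset_antisym)
      have "polar_point z \<in> realization_points K" if "z \<in> topspace ?PI" for z
        using continuous_map_image_subset_topspace[OF cb] that by auto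
      moreover have "realization_points (K - S) \<subseteq> realization_points K" by (rule realization_points_mono) auto
      ultimately show "id ` (topspace ?A - {a \<in> topspace ?A. id a \<in> U}) \<union> polar_point ` (topspace ?PI - {z \<in> topspace ?P \<times> {0..1}. polar_point z \<in> U}) \<subseteq> realization_points K - U"
        by fastforce
      show "realization_points K - U \<subseteq> id ` (topspace ?A - {a \<in> topspace ?A. id a \<in> U}) \<union> polar_point ` (topspace ?PI - {z \<in> topspace ?P \<times> {0..1}. polar_point z \<in> U})"
        using surj by fastforce
    qed
    ultimately have "closedin (geometric_realization K) (realization_points K - U)"
      using compactin_imp_closedin[OF Hausdorff_space_realization[OF K]] by simp
    then show ?thesis using U(1) by (simp add: closedin_def Diff_Diff_Int Int_absorb1)
  qed
  have inj: "(polar_point (p, s) = polar_point (p', s')) = (s = s' \<and> (if s = 0 then fst p = fst p' else p = p'))"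
    if p: "p \<in> topspace ?P" "p' \<in> topspace ?P" "s \<in> {0..<1}" "s' \<in> {0..<1}" for p p' s s'
  proof -
    obtain \<sigma> y \<sigma>' y' where eq: "p = (\<sigma>, y)" "p' = (\<sigma>', y')" by (cases p, cases p') auto
    have y: "\<sigma> \<in> S" "y \<in> simplex_boundary \<sigma>" "\<sigma>' \<in> S" "y' \<in> simplex_boundary \<sigma>'" using p eq by auto
    show ?thesis
    proof
      assume same: "polar_point (p, s) = polar_point (p', s')"
      then have \<sigma>: "\<sigma>' = \<sigma>" using supp[of \<sigma> y s] supp[of \<sigma>' y' s'] y p eq by metis
      obtain v v' where v: "v \<in> \<sigma>" "polar_point (p, s) v = (1 - s) / real (card \<sigma>)"
        "v' \<in> \<sigma>" "polar_point (p', s') v' = (1 - s') / real (card \<sigma>)"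
        using lowest[OF y(2), of s] lowest[OF y(4), of s'] unfolding eq \<sigma> by blast
      have "(1 - s') / real (card \<sigma>) \<le> (1 - s) / real (card \<sigma>)"
        using low[OF y(4), of s' v] v(1,2) p(4) unfolding same[unfolded eq \<sigma>] eq \<sigma> by auto
      moreover have "(1 - s) / real (card \<sigma>) \<le> (1 - s') / real (card \<sigma>)"
        using low[OF y(2), of s v'] v(3,4) p(3) unfolding same[unfolded eq \<sigma>] eq \<sigma> by auto
      ultimately have s: "s = s'" using cpos[OF y(1)] by (simp add: field_simps)
      have "y = y'" if "s \<noteq> 0"
      proof
        fix v
        show "y v = y' v"
          using fun_cong[OF same, of v] that s unfolding eq \<sigma> by (simp add: polar_point_def)
      qed
      then show "s = s' \<and> (if s = 0 then fst p = fst p' else p = p')" using s \<sigma> eq by simp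
    qed (auto simp: eq polar_point_def split: if_splits)
  qed
  have notin: "polar_point (p, s) \<notin> id ` realization_points (K - S)" if "p \<in> topspace ?P" "s \<in> {0..<1}" for p s
  proof
    assume "polar_point (p, s) \<in> id ` realization_points (K - S)"
    then have "{v. polar_point (p, s) v \<noteq> 0} \<in> K - S" using realization_points_support(1)[OF K'] by simp
    then show False using supp that by (cases p) auto
  qed
  show ?thesis
    unfolding attaches_def
  proof (intro conjI)
    show "\<forall>p\<in>topspace ?P. polar_point (p, 1) = id (snd p)" by (auto simp: polar_point_def fun_eq_iff)
    show "\<forall>U\<subseteq>topspace (geometric_realization K).
       openin ?A {a \<in> topspace ?A. id a \<in> U} \<longrightarrow>
       openin ?PI {z \<in> topspace ?P \<times> {0..1}. polar_point z \<in> U} \<longrightarrow> openin (geometric_realization K) U"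
      using op by simp
    show "\<forall>p\<in>topspace ?P. \<forall>p'\<in>topspace ?P. \<forall>s\<in>{0..<1}. \<forall>s'\<in>{0..<1}.
       (polar_point (p, s) = polar_point (p', s')) = (s = s' \<and> (if s = 0 then fst p = fst p' else p = p'))"
      using inj by blast
    show "\<forall>p\<in>topspace ?P. \<forall>s\<in>{0..<1}. polar_point (p, s) \<notin> id ` topspace ?A"
      using notin by simp
    show "topspace (geometric_realization K) \<subseteq> id ` topspace ?A \<union> polar_point ` (topspace ?P \<times> {0..1})"
      using surj by simp
  qed (use ci cf cb in auto)
qed

section \<open>Wedges of spheres as cells attached to a point\<close>

lemma continuous_map_wedge_incl:
  assumes "i \<in> I"
  shows "continuous_map (X i) (wedge I X p) (wedge_incl p i)"
  unfolding continuous_map_def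
proof (intro conjI allI impI)
  show "wedge_incl p i \<in> topspace (X i) \<rightarrow> topspace (wedge I X p)"
    using assms by (auto simp: topspace_wedge)
  fix U assume "openin (wedge I X p) U"
  then show "openin (X i) {x \<in> topspace (X i). wedge_incl p i x \<in> U}"
    using assms by (simp add: wedge_def openin_final_topology)
qed

lemma wedge_incl_eq_iff: "wedge_incl p i x = wedge_incl p i y \<longleftrightarrow> x = y"
  by (simp add: wedge_incl_def)

lemma Hausdorff_space_nsphere: "Hausdorff_space (nsphere n)"
  by (simp add: nsphere Hausdorff_space_subtopology Hausdorff_space_product_topology)

lemma continuous_map_simplex_to_sphere:
  assumes e: "\<And>\<sigma>. \<sigma> \<in> S \<Longrightarrow> bij_betw (e \<sigma>) {..n} \<sigma>" and n: "n \<ge> 1"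
  shows "continuous_map (prod_topology (boundary_space S) unit_interval) (nsphere n)
     (\<lambda>z. simplex_to_sphere (e (fst (fst z))) n (snd (fst z)) (snd z))"
proof (rule continuous_map_discrete_cases)
  let ?PI = "prod_topology (boundary_space S) unit_interval"
  show "continuous_map ?PI (discrete_topology S) (\<lambda>z. fst (fst z))"
    by (rule continuous_map_compose_app[OF continuous_map_boundary_fst continuous_map_fst])
  fix \<sigma> assume \<sigma>: "\<sigma> \<in> S"
  let ?T = "subtopology ?PI {z \<in> topspace ?PI. fst (fst z) = \<sigma>}"
  have "continuous_map ?T (nsphere n) (\<lambda>z. simplex_to_sphere (e \<sigma>) n (snd (fst z)) (snd z))"
    unfolding nsphere continuous_map_in_subtopology continuous_map_componentwise_UNIV
  proof (intro conjI allI)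
    have cs: "continuous_map ?T euclideanreal (\<lambda>z. snd z)"
      by (rule continuous_map_from_subtopology) (rule continuous_map_into_fulltopology[OF continuous_map_snd])
    have cy: "continuous_map ?T euclideanreal (\<lambda>z. snd (fst z) v)" for v
      by (rule continuous_map_from_subtopology)
        (rule continuous_map_compose_app[OF continuous_map_boundary_coordinate continuous_map_fst])
    have c1: "continuous_map ?T euclideanreal (\<lambda>z. 2 * snd z - 1)"
      by (intro continuous_map_diff continuous_map_real_mult_left cs) auto
    have sq: "continuous_map euclideanreal euclideanreal sqrt"
      by (simp add: continuous_on_real_sqrt continuous_on_id)
    have c2: "continuous_map ?T euclideanreal (\<lambda>z. 2 * sqrt (snd z * (1 - snd z)))"
      by (intro continuous_map_real_mult_left continuous_map_compose_app[OF sq] continuous_map_real_mult continuous_map_diff cs) auto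
    have c3: "continuous_map ?T euclideanreal (\<lambda>z. snd (fst z) v - 1 / (real n + 1))" for v
      by (intro continuous_map_diff cy) auto
    have c4: "continuous_map ?T euclideanreal (\<lambda>z. polar_radius (e \<sigma>) n (snd (fst z)))"
      unfolding polar_radius_def
      by (intro continuous_map_compose_app[OF sq] continuous_map_sum continuous_map_real_pow c3) auto
    have pos: "polar_radius (e \<sigma>) n (snd (fst z)) \<noteq> 0" if "z \<in> topspace ?T" for z
      using polar_radius_pos[OF e[OF \<sigma>] n, of "snd (fst z)"] that by auto
    show "continuous_map ?T euclideanreal (\<lambda>z. simplex_to_sphere (e \<sigma>) n (snd (fst z)) (snd z) i)" for i
    proof -
      consider "i = 0" | "i \<noteq> 0" "i \<le> n" | "i > n" by linarith
      then show ?thesis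
      proof cases
        case 1 then show ?thesis using c1 by (simp add: simplex_to_sphere_def)
      next
        case 2
        have "continuous_map ?T euclideanreal (\<lambda>z. 2 * sqrt (snd z * (1 - snd z)) *
            ((snd (fst z) (e \<sigma> i) - 1 / (real n + 1)) / polar_radius (e \<sigma>) n (snd (fst z))))"
          by (intro continuous_map_real_mult c2 continuous_map_real_divide c3 c4 pos)
        then show ?thesis using 2 by (simp add: simplex_to_sphere_def)
      next
        case 3 then show ?thesis by (simp add: simplex_to_sphere_def)
      qed
    qed
    show "(\<lambda>z. simplex_to_sphere (e \<sigma>) n (snd (fst z)) (snd z)) \<in> topspace ?T \<rightarrow>
        {x. (\<Sum>i\<le>n. (x i)\<^sup>2) = 1 \<and> (\<forall>i>n. x i = 0)}"
      using simplex_to_sphere_in[OF e[OF \<sigma>] n] by (auto simp: topspace_nsphere)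
  qed
  then show "continuous_map ?T (nsphere n) (\<lambda>z. simplex_to_sphere (e (fst (fst z))) n (snd (fst z)) (snd z))"
    by (rule continuous_map_eq) auto
qed

text \<open>The wedge is presented with the same parameter space \<open>boundary_space S\<close> as
  the simplices of \<open>S\<close>, one sphere for each simplex, so that the comparison of two
  attachments applies to it. The space to which the cells are attached is a point and the attaching
  map is constant.\<close>

lemma attaches_sphere_wedge:
  assumes S: "finite S" "\<And>\<sigma>. \<sigma> \<in> S \<Longrightarrow> card \<sigma> = Suc n" and n: "n \<ge> 1"
  obtains \<beta> where "attaches (sphere_wedge (card S) n) (discrete_topology {()}) (boundary_space S)
    (\<lambda>_. None) \<beta> (\<lambda>_. ()) fst"
proof -
  let ?P = "boundary_space S"
  let ?PI = "prod_topology ?P unit_interval"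
  let ?W = "sphere_wedge (card S) n"
  let ?inc = "\<lambda>i. wedge_incl (\<lambda>_. sphere_basepoint) (i::nat)"
  have fin: "finite \<sigma>" if "\<sigma> \<in> S" for \<sigma> using S(2)[OF that] card.infinite by fastforce
  have "\<exists>e. bij_betw e {..n} \<sigma>" if "\<sigma> \<in> S" for \<sigma>
    using finite_same_card_bij[of "{..n}" \<sigma>] S(2)[OF that] fin[OF that] by simp
  then obtain e where e: "\<And>\<sigma>. \<sigma> \<in> S \<Longrightarrow> bij_betw (e \<sigma>) {..n} \<sigma>" by metis
  obtain idx where idx: "bij_betw idx S {..<card S}"
    using S(1) by (metis atLeast0LessThan ex_bij_betw_finite_nat)
  define \<theta> where "\<theta> = (\<lambda>z. simplex_to_sphere (e (fst (fst z))) n (snd (fst z)) (snd z))"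
  define \<beta> where "\<beta> = (\<lambda>z. ?inc (idx (fst (fst z))) (\<theta> z))"
  have c\<theta>: "continuous_map ?PI (nsphere n) \<theta>"
    unfolding \<theta>_def by (rule continuous_map_simplex_to_sphere[OF e n])
  have W: "?W = wedge {..<card S} (\<lambda>_. nsphere n) (\<lambda>_. sphere_basepoint)" by (simp add: sphere_wedge_def)
  have ci: "continuous_map (nsphere n) ?W (?inc i)" if "i < card S" for i
    unfolding W using continuous_map_wedge_incl[of i "{..<card S}" "\<lambda>_. nsphere n" "\<lambda>_. sphere_basepoint"] that by simp
  have idx_lt: "idx \<sigma> < card S" if "\<sigma> \<in> S" for \<sigma> using idx that by (auto simp: bij_betw_def)
  have idx_surj: "\<exists>\<sigma>\<in>S. idx \<sigma> = i" if "i < card S" for i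
  proof -
    have "i \<in> idx ` S" using idx that by (simp add: bij_betw_def)
    then show ?thesis by blast
  qed
  \<comment> \<open>The base point is the pole of height 1, and height 1 means
    \<open>s = 1\<close>.\<close>
  have base: "\<theta> (p, s) = sphere_basepoint \<longleftrightarrow> s = 1" if "p \<in> topspace ?P" "s \<in> {0..1}" for p s
  proof
    assume "\<theta> (p, s) = sphere_basepoint"
    then show "s = 1" by (auto simp: \<theta>_def simplex_to_sphere_def sphere_basepoint_def dest!: fun_cong[of _ _ 0])
  next
    assume "s = 1"
    then show "\<theta> (p, s) = sphere_basepoint"
      by (auto simp: \<theta>_def simplex_to_sphere_def sphere_basepoint_def)
  qed
  have surj: "\<exists>y s. y \<in> simplex_boundary \<sigma> \<and> s \<in> {0..1} \<and> \<theta> ((\<sigma>, y), s) = x" if "\<sigma> \<in> S" "x \<in> topspace (nsphere n)" for \<sigma> x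
    by (rule simplex_to_sphere_surj[OF e[OF that(1)] n that(2)]) (auto simp: \<theta>_def)
  have cb: "continuous_map ?PI ?W \<beta>"
  proof (rule continuous_map_discrete_cases)
    show "continuous_map ?PI (discrete_topology S) (\<lambda>z. fst (fst z))"
      by (rule continuous_map_compose_app[OF continuous_map_boundary_fst continuous_map_fst])
    fix \<sigma> assume \<sigma>: "\<sigma> \<in> S"
    have "continuous_map (subtopology ?PI {z \<in> topspace ?PI. fst (fst z) = \<sigma>}) ?W (\<lambda>z. ?inc (idx \<sigma>) (\<theta> z))"
      by (intro continuous_map_compose_app[OF ci[OF idx_lt[OF \<sigma>]]] continuous_map_from_subtopology c\<theta>)
    then show "continuous_map (subtopology ?PI {z \<in> topspace ?PI. fst (fst z) = \<sigma>}) ?W \<beta>"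
      by (rule continuous_map_eq) (auto simp: \<beta>_def)
  qed
  have op: "openin ?W U"
    if U: "U \<subseteq> topspace ?W" "openin ?PI {z \<in> topspace ?P \<times> {0..1}. \<beta> z \<in> U}" for U
    unfolding W wedge_def openin_final_topology
  proof (intro conjI ballI)
    show "U \<subseteq> insert None (\<Union>i\<in>{..<card S}. ?inc i ` topspace (nsphere n))"
      using U(1) by (simp add: W topspace_wedge)
    fix i assume "i \<in> {..<card S}"
    then have "i < card S" by simp
    then obtain \<sigma> where \<sigma>: "\<sigma> \<in> S" "idx \<sigma> = i" using idx_surj by auto
    \<comment> \<open>The sheet over \<open>\<sigma>\<close> is compact, so a closed part of it has
      closed image in the sphere; openness of the trace of \<open>U\<close> on the sphere follows by
      complements.\<close>
    have comp: "compact_space ?PI"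
      using compact_space_boundary_space[OF S(1) fin] by (simp add: compact_space_prod_topology compact_space_subtopology)
    have cd: "continuous_map ?PI (discrete_topology S) (\<lambda>z. fst (fst z))"
      by (rule continuous_map_compose_app[OF continuous_map_boundary_fst continuous_map_fst])
    have "closedin ?PI {z \<in> topspace ?PI. fst (fst z) \<in> {\<sigma>}}"
      using closedin_continuous_map_preimage[OF cd, of "{\<sigma>}"] \<sigma> by simp
    moreover have "closedin ?PI (topspace ?PI - {z \<in> topspace ?P \<times> {0..1}. \<beta> z \<in> U})"
      using U(2) by blast
    ultimately have "closedin ?PI ({z \<in> topspace ?PI. fst (fst z) \<in> {\<sigma>}} \<inter> (topspace ?PI - {z \<in> topspace ?P \<times> {0..1}. \<beta> z \<in> U}))"
      by (rule closedin_Int)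
    then have "compactin ?PI ({z \<in> topspace ?PI. fst (fst z) \<in> {\<sigma>}} \<inter> (topspace ?PI - {z \<in> topspace ?P \<times> {0..1}. \<beta> z \<in> U}))"
      by (rule closedin_compact_space[OF comp])
    then have "closedin (nsphere n) (\<theta> ` ({z \<in> topspace ?PI. fst (fst z) \<in> {\<sigma>}} \<inter> (topspace ?PI - {z \<in> topspace ?P \<times> {0..1}. \<beta> z \<in> U})))"
      by (intro compactin_imp_closedin[OF Hausdorff_space_nsphere] image_compactin[OF _ c\<theta>])
    moreover have "\<theta> ` ({z \<in> topspace ?PI. fst (fst z) \<in> {\<sigma>}} \<inter> (topspace ?PI - {z \<in> topspace ?P \<times> {0..1}. \<beta> z \<in> U})) =
        topspace (nsphere n) - {x \<in> topspace (nsphere n). ?inc i x \<in> U}" (is "?L = ?R")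
    proof (intro subset_antisym subsetI)
      fix x assume "x \<in> ?L"
      then obtain z where z: "x = \<theta> z" "z \<in> topspace ?PI" "fst (fst z) = \<sigma>" "\<beta> z \<notin> U" by auto
      then show "x \<in> ?R"
        using continuous_map_image_subset_topspace[OF c\<theta>] \<sigma> by (auto simp: \<beta>_def)
    next
      fix x assume x: "x \<in> ?R"
      then obtain y s where ys: "y \<in> simplex_boundary \<sigma>" "s \<in> {0..1}" "\<theta> ((\<sigma>, y), s) = x"
        using surj[OF \<sigma>(1), of x] by blast
      have "((\<sigma>, y), s) \<in> {z \<in> topspace ?PI. fst (fst z) \<in> {\<sigma>}} \<inter> (topspace ?PI - {z \<in> topspace ?P \<times> {0..1}. \<beta> z \<in> U})"
        using x ys \<sigma> by (simp add: \<beta>_def)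
      then show "x \<in> ?L" by (rule image_eqI[rotated]) (simp add: ys)
    qed
    ultimately have "closedin (nsphere n) (topspace (nsphere n) - {x \<in> topspace (nsphere n). ?inc i x \<in> U})" by simp
    then show "openin (nsphere n) {x \<in> topspace (nsphere n). ?inc i x \<in> U}"
      by (simp add: closedin_def Diff_Diff_Int Int_absorb1)
  qed
  have "attaches ?W (discrete_topology {()}) ?P (\<lambda>_. None) \<beta> (\<lambda>_. ()) fst"
    unfolding attaches_def
  proof (intro conjI)
    show "continuous_map (discrete_topology {()}) ?W (\<lambda>_. None)"
      by (simp add: W topspace_wedge)
    show "topspace ?W \<subseteq> (\<lambda>_. None) ` topspace (discrete_topology {()}) \<union> \<beta> ` (topspace ?P \<times> {0..1})"
    proof
      fix w assume "w \<in> topspace ?W"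
      then consider "w = None" | i x where "i < card S" "x \<in> topspace (nsphere n)" "w = ?inc i x"
        by (auto simp: W topspace_wedge)
      then show "w \<in> (\<lambda>_. None) ` topspace (discrete_topology {()}) \<union> \<beta> ` (topspace ?P \<times> {0..1})"
      proof cases
        case 2
        then obtain \<sigma> where \<sigma>: "\<sigma> \<in> S" "idx \<sigma> = i" using idx_surj by auto
        obtain y s where ys: "y \<in> simplex_boundary \<sigma>" "s \<in> {0..1}" "\<theta> ((\<sigma>, y), s) = x"
          using surj[OF \<sigma>(1) 2(2)] by blast
        then have "w = \<beta> ((\<sigma>, y), s)" using 2 \<sigma> by (simp add: \<beta>_def)
        moreover have "((\<sigma>, y), s) \<in> topspace ?P \<times> {0..1}" using ys \<sigma> by simp
        ultimately show ?thesis by blast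
      qed simp
    qed
    show "\<forall>U\<subseteq>topspace ?W. openin (discrete_topology {()}) {a \<in> topspace (discrete_topology {()}). None \<in> U} \<longrightarrow>
        openin ?PI {z \<in> topspace ?P \<times> {0..1}. \<beta> z \<in> U} \<longrightarrow> openin ?W U"
      using op by blast
    show "\<forall>p\<in>topspace ?P. \<beta> (p, 1) = None"
      using base by (simp add: \<beta>_def wedge_incl_def)
    show "\<forall>p\<in>topspace ?P. \<forall>s\<in>{0..<1}. \<beta> (p, s) \<notin> (\<lambda>_. None) ` topspace (discrete_topology {()})"
      using base by (auto simp: \<beta>_def wedge_incl_def)
    show "\<forall>p\<in>topspace ?P. \<forall>p'\<in>topspace ?P. \<forall>s\<in>{0..<1}. \<forall>s'\<in>{0..<1}.
       (\<beta> (p, s) = \<beta> (p', s')) = (s = s' \<and> (if s = 0 then fst p = fst p' else p = p'))"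
    proof (intro ballI)
      fix p p' s s' assume p: "p \<in> topspace ?P" "p' \<in> topspace ?P" and s: "s \<in> {0..<1::real}" "s' \<in> {0..<1::real}"
      obtain \<sigma> y \<sigma>' y' where eq: "p = (\<sigma>, y)" "p' = (\<sigma>', y')" by (cases p, cases p') auto
      have y: "\<sigma> \<in> S" "y \<in> simplex_boundary \<sigma>" "\<sigma>' \<in> S" "y' \<in> simplex_boundary \<sigma>'" using p eq by auto
      have nb: "\<theta> (p, s) \<noteq> sphere_basepoint" "\<theta> (p', s') \<noteq> sphere_basepoint" using base p s by auto
      show "(\<beta> (p, s) = \<beta> (p', s')) = (s = s' \<and> (if s = 0 then fst p = fst p' else p = p'))"
      proof
        assume "\<beta> (p, s) = \<beta> (p', s')"
        then have "idx \<sigma> = idx \<sigma>'" and th: "\<theta> (p, s) = \<theta> (p', s')"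
          using nb by (auto simp: \<beta>_def wedge_incl_def eq)
        then have \<sigma>: "\<sigma>' = \<sigma>" using idx y by (auto simp: bij_betw_def inj_on_def)
        have ss: "s = s'" using fun_cong[OF th, of 0] by (simp add: \<theta>_def simplex_to_sphere_def)
        have "y = y'" if "s \<noteq> 0"
          using simplex_to_sphere_inj[OF e[OF y(1)] n y(2), of y' s] y(4) s that th ss
          by (simp add: \<theta>_def eq \<sigma>)
        then show "s = s' \<and> (if s = 0 then fst p = fst p' else p = p')" using ss \<sigma> eq by simp
      next
        assume "s = s' \<and> (if s = 0 then fst p = fst p' else p = p')"
        moreover have "simplex_to_sphere (e \<sigma>) n y 0 = simplex_to_sphere (e \<sigma>) n y' 0"
          by (auto simp: simplex_to_sphere_def fun_eq_iff)
        ultimately show "\<beta> (p, s) = \<beta> (p', s')"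
          by (auto simp: \<beta>_def \<theta>_def eq split: if_splits)
      qed
    qed
  qed (use cb in auto)
  then show thesis by (rule that)
qed

text \<open>A space built from a point by attaching cells contributes the same cells to the wedge,
  where they are attached to \<open>Y\<close> by the constant map at \<open>y\<close>. The summand
  \<open>X\<close> is indexed by \<open>True\<close>, the summand \<open>Y\<close> by
  \<open>False\<close>.\<close>

lemma attaches_wedge2:
  assumes X: "attaches X (discrete_topology {()}) P (\<lambda>_. x) \<beta> (\<lambda>_. ()) \<kappa>"
    and y: "y \<in> topspace Y"
  shows "attaches (wedge2 X x Y y) Y P (wedge_incl (\<lambda>b. if b then x else y) False)
    (\<lambda>z. wedge_incl (\<lambda>b. if b then x else y) True (\<beta> z)) (\<lambda>_. y) \<kappa>"
proof -
  let ?i = "wedge_incl (\<lambda>b. if b then x else y)"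
  have x: "x \<in> topspace X" using attachesD(10)[OF X, of "()"] by simp
  have cT: "continuous_map X (wedge2 X x Y y) (?i True)"
    using continuous_map_wedge_incl[of True UNIV "\<lambda>b. if b then X else Y" "\<lambda>b. if b then x else y"]
    by (simp add: wedge2_def)
  have cF: "continuous_map Y (wedge2 X x Y y) (?i False)"
    using continuous_map_wedge_incl[of False UNIV "\<lambda>b. if b then X else Y" "\<lambda>b. if b then x else y"]
    by (simp add: wedge2_def)
  have ts: "topspace (wedge2 X x Y y) = ?i True ` topspace X \<union> ?i False ` topspace Y"
  proof -
    have "None = ?i True x" by (simp add: wedge_incl_def)
    then have "None \<in> ?i True ` topspace X" using x by blast
    then show ?thesis by (auto simp: wedge2_def topspace_wedge UNIV_bool)
  qed
  have eqF: "?i True u \<in> ?i False ` topspace Y \<longleftrightarrow> u = x" for u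
    using y by (auto simp: wedge_incl_def image_iff)
  show ?thesis
    unfolding attaches_def
  proof (intro conjI)
    show "continuous_map (prod_topology P unit_interval) (wedge2 X x Y y) (\<lambda>z. ?i True (\<beta> z))"
      by (rule continuous_map_compose_app[OF cT attachesD(3)[OF X]])
    have sX: "topspace X \<subseteq> insert x (\<beta> ` (topspace P \<times> {0..1}))"
      using attachesD(5)[OF X] by auto
    show "topspace (wedge2 X x Y y) \<subseteq> ?i False ` topspace Y \<union> (\<lambda>z. ?i True (\<beta> z)) ` (topspace P \<times> {0..1})"
      using sX eqF[of x] unfolding ts by blast
    show "\<forall>U\<subseteq>topspace (wedge2 X x Y y). openin Y {a \<in> topspace Y. ?i False a \<in> U} \<longrightarrow>
        openin (prod_topology P unit_interval) {z \<in> topspace P \<times> {0..1}. ?i True (\<beta> z) \<in> U} \<longrightarrow>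
        openin (wedge2 X x Y y) U"
    proof (intro allI impI)
      fix U assume U: "U \<subseteq> topspace (wedge2 X x Y y)" "openin Y {a \<in> topspace Y. ?i False a \<in> U}"
        "openin (prod_topology P unit_interval) {z \<in> topspace P \<times> {0..1}. ?i True (\<beta> z) \<in> U}"
      have "{z \<in> topspace P \<times> {0..1}. ?i True (\<beta> z) \<in> U} = {z \<in> topspace P \<times> {0..1}. \<beta> z \<in> {u \<in> topspace X. ?i True u \<in> U}}"
        using attachesD(11)[OF X] by auto
      then have "openin X {u \<in> topspace X. ?i True u \<in> U}"
        using U(3) by (intro attachesD(8)[OF X]) auto
      then show "openin (wedge2 X x Y y) U"
        using U(1)[unfolded wedge2_def topspace_wedge] U(2)
        unfolding wedge2_def wedge_def openin_final_topology by (auto split: if_splits)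
    qed
    show "\<forall>p\<in>topspace P. ?i True (\<beta> (p, 1)) = ?i False y"
      using attachesD(6)[OF X] by (simp add: wedge_incl_def)
    show "\<forall>p\<in>topspace P. \<forall>s\<in>{0..<1}. ?i True (\<beta> (p, s)) \<notin> ?i False ` topspace Y"
      using eqF attachesD(7)[OF X] by simp
    show "\<forall>p\<in>topspace P. \<forall>p'\<in>topspace P. \<forall>s\<in>{0..<1}. \<forall>s'\<in>{0..<1}.
       (?i True (\<beta> (p, s)) = ?i True (\<beta> (p', s'))) = (s = s' \<and> (if s = 0 then \<kappa> p = \<kappa> p' else p = p'))"
      unfolding wedge_incl_eq_iff using attachesD(9)[OF X] by blast
  qed (use y cF in \<open>auto simp: inj_on_def wedge_incl_eq_iff\<close>)
qed

text \<open>Null-homotopies are chosen for each simplex separately and combined over the open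
  sheets; they all start at the same point \<open>x\<close>.\<close>

lemma homotopic_boundary_inclusions:
  assumes K: "finite_complex L" and S: "finite S" "\<And>\<sigma>. \<sigma> \<in> S \<Longrightarrow> finite \<sigma>"
    and null: "\<And>\<sigma>. \<sigma> \<in> S \<Longrightarrow> homotopic_with (\<lambda>_. True) (subtopology (powertop_real UNIV) (simplex_boundary \<sigma>))
       (geometric_realization L) (\<lambda>_. x) id"
  shows "homotopic_with (\<lambda>_. True) (boundary_space S) (geometric_realization L) (\<lambda>_. x) snd"
proof -
  have "\<forall>\<sigma>\<in>S. \<exists>h. continuous_map (prod_topology unit_interval (subtopology (powertop_real UNIV) (simplex_boundary \<sigma>))) (geometric_realization L) h \<and>
      (\<forall>y. h (0, y) = x) \<and> (\<forall>y. h (1, y) = y)"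
    using null unfolding homotopic_with_def by simp
  then obtain h where h: "\<And>\<sigma>. \<sigma> \<in> S \<Longrightarrow> continuous_map (prod_topology unit_interval (subtopology (powertop_real UNIV) (simplex_boundary \<sigma>))) (geometric_realization L) (h \<sigma>)"
      "\<And>\<sigma> y. \<sigma> \<in> S \<Longrightarrow> h \<sigma> (0, y) = x" "\<And>\<sigma> y. \<sigma> \<in> S \<Longrightarrow> h \<sigma> (1, y) = y"
    by metis
  define H where "H = (\<lambda>z::real \<times> ('a set \<times> ('a \<Rightarrow> real)). h (fst (snd z)) (fst z, snd (snd z)))"
  let ?IP = "prod_topology unit_interval (boundary_space S)"
  have "continuous_map ?IP (geometric_realization L) H"
  proof (rule continuous_map_discrete_cases)
    show "continuous_map ?IP (discrete_topology S) (\<lambda>z. fst (snd z))"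
      by (rule continuous_map_compose_app[OF continuous_map_boundary_fst continuous_map_snd])
    fix \<sigma> assume \<sigma>: "\<sigma> \<in> S"
    let ?T = "subtopology ?IP {z \<in> topspace ?IP. fst (snd z) = \<sigma>}"
    have c1: "continuous_map ?T unit_interval (\<lambda>z. fst z)"
      by (intro continuous_map_from_subtopology continuous_map_fst)
    have "continuous_map ?T euclideanreal (\<lambda>z. snd (snd z) v)" for v
      by (rule continuous_map_from_subtopology) (rule continuous_map_compose_app[OF continuous_map_boundary_coordinate continuous_map_snd])
    then have c2: "continuous_map ?T (subtopology (powertop_real UNIV) (simplex_boundary \<sigma>)) (\<lambda>z. snd (snd z))"
      by (auto simp: continuous_map_in_subtopology continuous_map_componentwise_UNIV)
    have "continuous_map ?T (geometric_realization L) (\<lambda>z. h \<sigma> (fst z, snd (snd z)))"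
      by (rule continuous_map_compose_pair[OF h(1)[OF \<sigma>] c1 c2])
    then show "continuous_map ?T (geometric_realization L) H"
      by (rule continuous_map_eq) (auto simp: H_def)
  qed
  then show ?thesis
    by (subst homotopic_with) (use h(2,3) in \<open>auto simp: H_def intro!: exI[of _ H]\<close>)
qed

text \<open>Used twice: with \<open>A\<close> a point, for the 4-simplices of the chain complex, and
  with \<open>A\<close> the wedge of 4-spheres, for the deleted facets.\<close>

lemma pointed_equivalent_attach_simplices:
  assumes K: "finite_complex K" and S: "S \<subseteq> K" "\<And>\<sigma>. \<sigma> \<in> S \<Longrightarrow> card \<sigma> = Suc n" and n: "n \<ge> 1"
    and max: "\<And>\<sigma> \<omega>. \<sigma> \<in> S \<Longrightarrow> \<omega> \<in> K \<Longrightarrow> \<sigma> \<subseteq> \<omega> \<Longrightarrow> \<omega> = \<sigma>"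
    and null: "\<And>\<sigma>. \<sigma> \<in> S \<Longrightarrow> homotopic_with (\<lambda>_. True) (subtopology (powertop_real UNIV) (simplex_boundary \<sigma>))
       (geometric_realization (K - S)) (\<lambda>_. x) id"
    and eq: "pointed_equivalent (geometric_realization (K - S)) x A a"
    and W: "attaches W A (boundary_space S) \<alpha> \<beta> (\<lambda>_. a) fst"
  shows "pointed_equivalent (geometric_realization K) x W (\<alpha> a)"
proof -
  have finS: "finite S" using S finite_complexD(1)[OF K] finite_subset by blast
  have fin: "finite \<sigma>" if "\<sigma> \<in> S" for \<sigma> using that S finite_complexD(2)[OF K] by blast
  have at: "attaches (geometric_realization K) (geometric_realization (K - S)) (boundary_space S) id polar_point snd fst"
    using attaches_top_simplices[OF K S(1) _ max] S(2) n by simp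
  have "homotopic_with (\<lambda>_. True) (boundary_space S) (geometric_realization (K - S)) (\<lambda>_. x) snd"
    by (rule homotopic_boundary_inclusions[OF maximal_Diff_finite_complex[OF K max] finS fin null])
  from attaches_pointed_equivalent[OF at W eq this] show ?thesis by simp
qed

section \<open>The 4-skeleton of the cube\<close>

definition chain_set :: "'a set set \<Rightarrow> bool" where
  "chain_set S \<longleftrightarrow> (\<forall>x\<in>S. \<forall>y\<in>S. x \<subseteq> y \<or> y \<subseteq> x)"

text \<open>The up-closure in \<open>S\<close> of the members that are incomparable to something.
  The remaining members form a chain below it, so it marks where \<open>S\<close>, read from the
  bottom, ceases to be a chain.\<close>

definition branching_part :: "'a set set \<Rightarrow> 'a set set" where
  "branching_part S = {t \<in> S. \<exists>z\<in>S. \<exists>y\<in>S. z \<subseteq> t \<and> \<not> y \<subseteq> z \<and> \<not> z \<subseteq> y}"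

lemma branching_part_subset: "branching_part S \<subseteq> S"
  by (auto simp: branching_part_def)

lemma branching_part_mono: "S \<subseteq> T \<Longrightarrow> branching_part S \<subseteq> branching_part T"
  unfolding branching_part_def by blast

lemma branching_partI:
  "t \<in> S \<Longrightarrow> z \<in> S \<Longrightarrow> y \<in> S \<Longrightarrow> z \<subseteq> t \<Longrightarrow> \<not> y \<subseteq> z \<Longrightarrow> \<not> z \<subseteq> y \<Longrightarrow> t \<in> branching_part S"
  unfolding branching_part_def by blast

text \<open>The intersection of the branching part is comparable to every member of \<open>S\<close>, so that adding or
  removing it does not affect the branching part.\<close>

lemma branching_part_nonempty:
  "\<not> chain_set S \<Longrightarrow> branching_part S \<noteq> {}"
  unfolding chain_set_def branching_part_def by blast

text \<open>A member \<open>x\<close> outside of the branching part is comparable to everything. If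
  \<open>t\<close> lies above the incomparable \<open>z\<close>, then \<open>z \<subseteq> x\<close>
  would make \<open>x\<close> branching too, so
  \<open>x \<subseteq> z \<subseteq> t\<close>.\<close>

lemma below_branching_part:
  assumes "x \<in> S" "x \<notin> branching_part S" "t \<in> branching_part S"
  shows "x \<subseteq> t"
  using assms unfolding branching_part_def by (smt (verit) mem_Collect_eq order_refl subset_trans)

lemma comparable_Inter_branching_part:
  assumes "x \<in> S"
  shows "x \<subseteq> \<Inter> (branching_part S) \<or> \<Inter> (branching_part S) \<subseteq> x"
  using assms below_branching_part[of x S] by (cases "x \<in> branching_part S") auto

text \<open>An incomparable \<open>z\<close> below the intersection is itself branching and thus
  equal to the intersection; its partner \<open>y\<close> is branching as well, hence above the
  intersection and comparable to \<open>z\<close>.\<close>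

lemma Inter_branching_part_notin: "\<Inter> (branching_part S) \<notin> branching_part S"
proof
  let ?a = "\<Inter> (branching_part S)"
  assume a: "?a \<in> branching_part S"
  then obtain z y where zy: "z \<in> S" "y \<in> S" "z \<subseteq> ?a" "\<not> y \<subseteq> z" "\<not> z \<subseteq> y"
    unfolding branching_part_def by blast
  then have "z \<in> branching_part S" unfolding branching_part_def by blast
  then have "z = ?a" using zy(3) by blast
  moreover have "y \<in> branching_part S" using zy unfolding branching_part_def by blast
  then have "?a \<subseteq> y" by blast
  ultimately show False using zy by blast
qed

lemma branching_part_toggle:
  "branching_part (toggle (\<Inter> (branching_part S)) S) = branching_part S"
proof -
  let ?a = "\<Inter> (branching_part S)"
  have comp: "\<And>x. x \<in> S \<Longrightarrow> x \<subseteq> ?a \<or> ?a \<subseteq> x" by (rule comparable_Inter_branching_part)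
  have na: "?a \<notin> branching_part S" by (rule Inter_branching_part_notin)
  show ?thesis
  proof (intro subset_antisym subsetI)
    fix t assume "t \<in> branching_part (toggle ?a S)"
    then obtain z y where t: "t \<in> toggle ?a S" and zy: "z \<in> toggle ?a S" "y \<in> toggle ?a S" "z \<subseteq> t" "\<not> y \<subseteq> z" "\<not> z \<subseteq> y"
      unfolding branching_part_def by blast
    have sub: "x \<in> S \<or> x = ?a" if "x \<in> toggle ?a S" for x using that by (auto simp: toggle_def split: if_splits)
    have "z \<in> S" "y \<in> S" using comp sub[OF zy(1)] sub[OF zy(2)] zy(4,5) by blast+
    then have zT: "z \<in> branching_part S" using zy unfolding branching_part_def by blast
    show "t \<in> branching_part S"
    proof (cases "t = ?a")
      case True
      then have "z = ?a" using zT zy(3) by blast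
      then show ?thesis using zT na by simp
    next
      case False
      then have "t \<in> S" using sub[OF t] by blast
      then show ?thesis using \<open>z \<in> S\<close> \<open>y \<in> S\<close> zy unfolding branching_part_def by blast
    qed
  next
    fix t assume tT: "t \<in> branching_part S"
    then obtain z y where t: "t \<in> S" and zy: "z \<in> S" "y \<in> S" "z \<subseteq> t" "\<not> y \<subseteq> z" "\<not> z \<subseteq> y"
      unfolding branching_part_def by blast
    have "z \<noteq> ?a" "y \<noteq> ?a" using comp zy by blast+
    moreover have "t \<noteq> ?a" using tT na by blast
    ultimately have "t \<in> toggle ?a S" "z \<in> toggle ?a S" "y \<in> toggle ?a S"
      using t zy by (auto simp: toggle_def)
    then show "t \<in> branching_part (toggle ?a S)" using zy unfolding branching_part_def by blast
  qed
qed

text \<open>The toggled vertex is squeezed by members of \<open>S\<close> different from it: it is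
  an intersection of such members and is contained in one of them. So the smallest face around
  \<open>S\<close> is unchanged and the matching respects the bound on the span.\<close>

lemma Inter_Union_toggle_branching_part:
  assumes "\<not> chain_set S"
  shows "\<Inter> (toggle (\<Inter> (branching_part S)) S) = \<Inter> S" "\<Union> (toggle (\<Inter> (branching_part S)) S) = \<Union> S"
proof -
  let ?a = "\<Inter> (branching_part S)" and ?S = "toggle (\<Inter> (branching_part S)) S"
  obtain t where t: "t \<in> branching_part S" using branching_part_nonempty[OF assms] by blast
  have T: "branching_part S \<subseteq> S - {?a}"
    using Inter_branching_part_notin[of S] unfolding branching_part_def by blast
  have sub: "S - {?a} \<subseteq> ?S" "?S \<subseteq> insert ?a S" by (auto simp: toggle_def)
  have a: "?a \<subseteq> t" using t by blast
  have 1: "\<Inter> (S - {?a}) \<subseteq> ?a" using T by blast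
  have 2: "\<Inter> (S - {?a}) \<subseteq> \<Inter> (insert ?a S)" using 1 by blast
  have 3: "\<Inter> (insert ?a S) \<subseteq> \<Inter> ?S" "\<Inter> ?S \<subseteq> \<Inter> (S - {?a})"
    by (rule Inter_anti_mono, rule sub)+
  have 4: "\<Inter> (insert ?a S) \<subseteq> \<Inter> S" "\<Inter> S \<subseteq> \<Inter> (S - {?a})"
    by (rule Inter_anti_mono, blast)+
  show "\<Inter> ?S = \<Inter> S"
    using order_trans[OF 3(2) order_trans[OF 2 4(1)]] order_trans[OF 4(2) order_trans[OF 2 3(1)]]
    by (rule subset_antisym)
  have 5: "\<Union> (insert ?a S) \<subseteq> \<Union> (S - {?a})" using a t T by blast
  have 6: "\<Union> (S - {?a}) \<subseteq> \<Union> ?S" "\<Union> ?S \<subseteq> \<Union> (insert ?a S)"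
    by (rule Union_mono, rule sub)+
  have 7: "\<Union> (S - {?a}) \<subseteq> \<Union> S" "\<Union> S \<subseteq> \<Union> (insert ?a S)"
    by (rule Union_mono, blast)+
  show "\<Union> ?S = \<Union> S"
    using order_trans[OF 6(2) order_trans[OF 5 7(1)]] order_trans[OF 7(2) order_trans[OF 5 6(1)]]
    by (rule subset_antisym)
qed

text \<open>The dimension of the smallest face of the cube that contains \<open>S\<close>.\<close>

definition dim_span :: "'a set set \<Rightarrow> nat" where
  "dim_span S = card (\<Union> S - \<Inter> S)"

text \<open>All faces of dimension at most 4 are filled in by full simplices on their
  vertices.\<close>

definition cube_simplices :: "nat \<Rightarrow> nat set set set" where
  "cube_simplices m = {S. S \<subseteq> Pow {1..m} \<and> S \<noteq> {} \<and> dim_span S \<le> 4}"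

lemma finite_Union_Diff_Inter:
  assumes "S \<subseteq> Pow {1..m::nat}"
  shows "finite (\<Union> S - \<Inter> S)"
proof -
  have "\<Union> S \<subseteq> {1..m}" using assms by blast
  then have "finite (\<Union> S)" by (rule finite_subset) simp
  then show ?thesis by (rule finite_Diff)
qed

lemma dim_span_mono:
  assumes "S \<subseteq> T" "T \<subseteq> Pow {1..m::nat}"
  shows "dim_span S \<le> dim_span T"
proof -
  have "\<Union> S - \<Inter> S \<subseteq> \<Union> T - \<Inter> T"
    by (intro Diff_mono Union_mono Inter_anti_mono assms(1))
  then show ?thesis
    unfolding dim_span_def by (intro card_mono finite_Union_Diff_Inter[OF assms(2)])
qed

lemma finite_complexI:
  assumes "\<And>S. S \<in> K \<Longrightarrow> S \<subseteq> Pow {1..m::nat}" "{} \<notin> K"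
    and "\<And>S T. S \<in> K \<Longrightarrow> T \<subseteq> S \<Longrightarrow> T \<noteq> {} \<Longrightarrow> T \<in> K"
  shows "finite_complex K"
proof -
  have "K \<subseteq> Pow (Pow {1..m})" using assms(1) by blast
  moreover have "finite (Pow (Pow {1..m}))" by simp
  ultimately have "finite K" by (rule finite_subset)
  moreover have "finite S" if "S \<in> K" for S
    using assms(1)[OF that] by (rule finite_subset) simp
  ultimately show ?thesis unfolding finite_complex_def using assms by blast
qed

lemma finite_complex_cube_simplices: "finite_complex (cube_simplices m)"
proof (rule finite_complexI[of _ m])
  fix S T assume "S \<in> cube_simplices m" "T \<subseteq> S" "T \<noteq> {}"
  then show "T \<in> cube_simplices m"
    using dim_span_mono[of T S m] unfolding cube_simplices_def by auto
qed (auto simp: cube_simplices_def)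

definition chain_simplices :: "nat \<Rightarrow> nat set set set" where
  "chain_simplices m = {S \<in> cube_simplices m. chain_set S}"

lemma finite_complex_chain_simplices: "finite_complex (chain_simplices m)"
proof (rule finite_complexI[of _ m])
  fix S T assume S: "S \<in> chain_simplices m" and T: "T \<subseteq> S" "T \<noteq> {}"
  have "T \<in> cube_simplices m"
    using finite_complexD(4)[OF finite_complex_cube_simplices _ T] S by (simp add: chain_simplices_def)
  moreover have "chain_set T"
    using S T(1) by (auto simp: chain_simplices_def chain_set_def subset_iff)
  ultimately show "T \<in> chain_simplices m" by (simp add: chain_simplices_def)
qed (auto simp: chain_simplices_def cube_simplices_def)

definition vertex_point :: "'a \<Rightarrow> 'a \<Rightarrow> real" where
  "vertex_point w = (\<lambda>v. if v = w then 1 else 0)"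

lemma vertex_point_in:
  assumes "{w} \<in> K"
  shows "vertex_point w \<in> realization_points K"
  using assms by (auto simp: realization_points_def closed_simplex_def vertex_point_def intro!: bexI[of _ "{w}"])

text \<open>A set that is no chain is matched by toggling the intersection of its branching part,
  which both partners share. The size of the branching part is the rank.\<close>

lemma cube_simplices_collapse:
  "pointed_equivalent (geometric_realization (cube_simplices m)) (vertex_point {1..m})
     (geometric_realization (chain_simplices m)) (vertex_point {1..m})"
proof (rule collapse_by_toggles[where a = "\<lambda>S. \<Inter> (branching_part S)" and \<phi> = "\<lambda>S. card (branching_part S)"])
  show "vertex_point {1..m} \<in> realization_points (chain_simplices m)"
    by (rule vertex_point_in) (auto simp: chain_simplices_def cube_simplices_def chain_set_def dim_span_def)
  fix S assume S: "S \<in> cube_simplices m - chain_simplices m"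
  then have nc: "\<not> chain_set S" and SV: "S \<subseteq> Pow {1..m}" by (auto simp: chain_simplices_def cube_simplices_def)
  let ?a = "\<Inter> (branching_part S)"
  let ?S = "toggle ?a S"
  have T: "branching_part S \<noteq> {}" by (rule branching_part_nonempty[OF nc])
  have TS: "branching_part S \<subseteq> S" by (auto simp: branching_part_def)
  have "?a \<subseteq> {1..m}" using T TS SV by blast
  then have "?S \<subseteq> Pow {1..m}" using SV by (auto simp: toggle_def)
  moreover have "dim_span ?S = dim_span S"
    unfolding dim_span_def Inter_Union_toggle_branching_part[OF nc] ..
  moreover have "branching_part ?S \<noteq> {}" using T by (subst branching_part_toggle)
  then have "?S \<noteq> {}" "\<not> chain_set ?S"
    using branching_part_subset[of ?S] by (blast, auto simp: chain_set_def branching_part_def[of ?S])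
  ultimately show "?S \<in> cube_simplices m - chain_simplices m"
    using S by (auto simp: chain_simplices_def cube_simplices_def)
  show "\<Inter> (branching_part ?S) = ?a" by (simp only: branching_part_toggle)
  fix v assume a: "?a \<notin> S" and v: "v \<in> S" and \<tau>: "\<Inter> (branching_part (insert ?a (S - {v}))) \<notin> insert ?a (S - {v})"
  have ins: "?S = insert ?a S" using a by (simp add: toggle_def)
  have eqT: "branching_part (insert ?a S) = branching_part S" using branching_part_toggle[of S] ins by simp
  have sub: "branching_part (insert ?a (S - {v})) \<subseteq> branching_part (insert ?a S)"
    by (rule branching_part_mono) blast
  \<comment> \<open>Exchanging a non-branching vertex for the toggled one preserves the branching
    part, so the result already contains the vertex it toggles and is no lower partner. Exchanging a
    branching vertex makes the branching part smaller.\<close>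
  have vT: "v \<in> branching_part S"
  proof (rule ccontr)
    assume nv: "v \<notin> branching_part S"
    have "branching_part S \<subseteq> branching_part (insert ?a (S - {v}))"
    proof
      fix t assume t: "t \<in> branching_part S"
      then obtain z y where zy: "t \<in> S" "z \<in> S" "y \<in> S" "z \<subseteq> t" "\<not> y \<subseteq> z" "\<not> z \<subseteq> y"
        unfolding branching_part_def by blast
      have "z \<in> branching_part S" by (rule branching_partI[OF zy(2,2,3) order_refl zy(5,6)])
      moreover have "y \<in> branching_part S" by (rule branching_partI[OF zy(3,3,2) order_refl zy(6,5)])
      ultimately have "z \<noteq> v" "y \<noteq> v" "t \<noteq> v" using nv t by auto
      then have "t \<in> insert ?a (S - {v})" "z \<in> insert ?a (S - {v})" "y \<in> insert ?a (S - {v})"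
        using zy(1-3) by simp_all
      then show "t \<in> branching_part (insert ?a (S - {v}))" by (rule branching_partI[OF _ _ _ zy(4-6)])
    qed
    with sub[unfolded eqT] have "branching_part (insert ?a (S - {v})) = branching_part S" by (rule subset_antisym)
    then show False using \<tau> by simp
  qed
  have "v \<noteq> ?a" using v a by metis
  then have "v \<notin> branching_part (insert ?a (S - {v}))" using branching_part_subset[of "insert ?a (S - {v})"] by auto
  then have "branching_part (insert ?a (S - {v})) \<subset> branching_part S"
    using sub[unfolded eqT] vT by (intro psubsetI) auto
  moreover have "finite (branching_part S)"
    using TS SV by (meson finite_Pow_iff finite_atLeastAtMost finite_subset)
  ultimately show "card (branching_part (insert ?a (S - {v}))) < card (branching_part S)"
    by (rule psubset_card_mono[rotated])
qed (simp_all only: finite_complex_cube_simplices finite_complex_chain_simplices, auto simp: chain_simplices_def)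

section \<open>Collapsing chains towards the top vertex\<close>

lemma chain_setD: "chain_set S \<Longrightarrow> x \<in> S \<Longrightarrow> y \<in> S \<Longrightarrow> x \<subseteq> y \<or> y \<subseteq> x"
  by (auto simp: chain_set_def)

lemma chain_Union_in:
  assumes "chain_set S" "finite S" "S \<noteq> {}"
  shows "\<Union> S \<in> S"
  using assms(2,3,1)
proof (induction rule: finite_ne_induct)
  case (insert x F)
  then have "\<Union> F \<in> F" by (simp add: chain_set_def)
  then have "x \<subseteq> \<Union> F \<or> \<Union> F \<subseteq> x" using chain_setD[OF insert.prems, of x "\<Union> F"] by simp
  then show ?case
  proof
    assume "x \<subseteq> \<Union> F"
    then have "\<Union> (insert x F) = \<Union> F" by auto
    then show ?thesis using \<open>\<Union> F \<in> F\<close> by simp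
  next
    assume "\<Union> F \<subseteq> x"
    then have "\<Union> (insert x F) = x" by auto
    then show ?thesis by simp
  qed
qed auto

lemma chain_Inter_in:
  assumes "chain_set S" "finite S" "S \<noteq> {}"
  shows "\<Inter> S \<in> S"
  using assms(2,3,1)
proof (induction rule: finite_ne_induct)
  case (insert x F)
  then have "\<Inter> F \<in> F" by (simp add: chain_set_def)
  then have "x \<subseteq> \<Inter> F \<or> \<Inter> F \<subseteq> x" using chain_setD[OF insert.prems, of x "\<Inter> F"] by simp
  then show ?case
  proof
    assume "x \<subseteq> \<Inter> F"
    then have "\<Inter> (insert x F) = x" by auto
    then show ?thesis by simp
  next
    assume "\<Inter> F \<subseteq> x"
    then have "\<Inter> (insert x F) = \<Inter> F" by auto
    then show ?thesis using \<open>\<Inter> F \<in> F\<close> by simp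
  qed
qed auto

text \<open>The members avoiding \<open>i\<close> come first in the chain. Their largest one with
  \<open>i\<close> adjoined fits between them and the members containing \<open>i\<close>.\<close>

lemma chain_insert_above:
  assumes S: "chain_set S" "finite S" and "\<exists>x\<in>S. i \<notin> x"
  shows "chain_set (insert (insert i (\<Union> {x \<in> S. i \<notin> x})) S)"
    "\<Union> {x \<in> S. i \<notin> x} \<in> {x \<in> S. i \<notin> x}"
    "\<And>x. x \<in> S \<Longrightarrow> i \<in> x \<Longrightarrow> insert i (\<Union> {x \<in> S. i \<notin> x}) \<subseteq> x"
proof -
  let ?L = "{x \<in> S. i \<notin> x}"
  have "chain_set ?L" using S(1) by (simp add: chain_set_def)
  then show U: "\<Union> ?L \<in> ?L" using S(2) assms(3) by (intro chain_Union_in) auto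
  show above: "insert i (\<Union> ?L) \<subseteq> x" if x: "x \<in> S" "i \<in> x" for x
    using chain_setD[OF S(1), of "\<Union> ?L" x] U x by blast
  have below: "x \<subseteq> insert i (\<Union> ?L)" if "x \<in> S" "i \<notin> x" for x
    using that by blast
  have comp: "x \<subseteq> insert i (\<Union> ?L) \<or> insert i (\<Union> ?L) \<subseteq> x" if "x \<in> S" for x
    using above[OF that] below[OF that] by (cases "i \<in> x") simp_all
  show "chain_set (insert (insert i (\<Union> ?L)) S)"
    unfolding chain_set_def
  proof (intro ballI)
    fix x y assume xy: "x \<in> insert (insert i (\<Union> ?L)) S" "y \<in> insert (insert i (\<Union> ?L)) S"
    then consider "x = insert i (\<Union> ?L)" "y = x" | "x = insert i (\<Union> ?L)" "y \<in> S"
      | "x \<in> S" "y = insert i (\<Union> ?L)" | "x \<in> S" "y \<in> S" by auto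
    then show "x \<subseteq> y \<or> y \<subseteq> x"
    proof cases
      case 2 then show ?thesis using comp[of y] by auto
    next
      case 3 then show ?thesis using comp[of x] by auto
    next
      case 4 then show ?thesis by (rule chain_setD[OF S(1)])
    qed simp
  qed
qed

lemma chain_set_subset: "chain_set S \<Longrightarrow> T \<subseteq> S \<Longrightarrow> chain_set T"
  by (auto simp: chain_set_def subset_iff)

lemma chain_set_toggle:
  assumes "chain_set (insert a S)"
  shows "chain_set (toggle a S)"
  using assms by (rule chain_set_subset) (auto simp: toggle_def)

definition max_missing :: "nat \<Rightarrow> nat set set \<Rightarrow> nat" where
  "max_missing m S = Max ({1..m} - \<Inter> S)"

text \<open>Pushing a chain upwards adjoins the largest coordinate missing from its bottom. If the
  chain spans a 4-face on which this coordinate is constantly zero, the push would leave the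
  4-skeleton; these chains stay unmatched.\<close>

definition critical_span :: "nat \<Rightarrow> nat set set \<Rightarrow> bool" where
  "critical_span m S \<longleftrightarrow> dim_span S = 4 \<and> max_missing m S \<notin> \<Union> S"

definition noncritical_chains :: "nat \<Rightarrow> nat set set set" where
  "noncritical_chains m = {S \<in> chain_simplices m. \<not> critical_span m S}"

lemma chain_simplicesD:
  assumes "S \<in> chain_simplices m"
  shows "S \<subseteq> Pow {1..m}" "S \<noteq> {}" "chain_set S" "finite S" "dim_span S \<le> 4"
    "\<Inter> S \<in> S" "\<Union> S \<in> S" "\<Inter> S \<subseteq> {1..m}" "\<Union> S \<subseteq> {1..m}" "\<Inter> S \<subseteq> \<Union> S"
proof -
  show S: "S \<subseteq> Pow {1..m}" "S \<noteq> {}" "chain_set S" "dim_span S \<le> 4"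
    using assms by (auto simp: chain_simplices_def cube_simplices_def)
  show fin: "finite S" using S(1) by (rule finite_subset) simp
  show I: "\<Inter> S \<in> S" and U: "\<Union> S \<in> S"
    using chain_Inter_in[OF S(3) fin S(2)] chain_Union_in[OF S(3) fin S(2)] .
  show "\<Inter> S \<subseteq> {1..m}" "\<Union> S \<subseteq> {1..m}" using S(1) I U by blast+
  show "\<Inter> S \<subseteq> \<Union> S" using I by blast
qed

lemma dim_span_eq_imp:
  assumes "T \<subseteq> S" "T \<noteq> {}" "S \<subseteq> Pow {1..m::nat}" "dim_span T = dim_span S"
  shows "\<Inter> T = \<Inter> S" "\<Union> T = \<Union> S"
proof -
  have sub: "\<Inter> S \<subseteq> \<Inter> T" "\<Union> T \<subseteq> \<Union> S" using assms(1) by (auto intro: Inter_anti_mono Union_mono)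
  have IU: "\<Inter> T \<subseteq> \<Union> T" using assms(2) by blast
  have "\<Union> T - \<Inter> T = \<Union> S - \<Inter> S"
    using sub assms(4) unfolding dim_span_def
    by (intro card_subset_eq finite_Union_Diff_Inter[OF assms(3)]) auto
  moreover have "A = C \<and> B = D" if "B - A = D - C" "C \<subseteq> A" "B \<subseteq> D" "A \<subseteq> B" for A B C D :: "nat set"
    using that by blast
  ultimately show "\<Inter> T = \<Inter> S" "\<Union> T = \<Union> S" using sub IU by metis+
qed

text \<open>A larger chain cannot span more than four coordinates, so it spans the same face. This
  is why the noncritical chains form a subcomplex.\<close>

lemma critical_span_mono:
  assumes T: "T \<subseteq> S" "T \<noteq> {}" and S: "S \<in> chain_simplices m" and c: "critical_span m T"
  shows "critical_span m S"
proof -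
  have d: "dim_span T = dim_span S"
    using dim_span_mono[OF T(1) chain_simplicesD(1)[OF S]] chain_simplicesD(5)[OF S] c
    by (simp add: critical_span_def)
  show ?thesis
    using c dim_span_eq_imp[OF T chain_simplicesD(1)[OF S] d] d
    by (simp add: critical_span_def max_missing_def)
qed

lemma finite_complex_noncritical_chains: "finite_complex (noncritical_chains m)"
proof (rule finite_complexI[of _ m])
  fix S T assume S: "S \<in> noncritical_chains m" and T: "T \<subseteq> S" "T \<noteq> {}"
  have "T \<in> chain_simplices m"
    using finite_complexD(4)[OF finite_complex_chain_simplices _ T] S by (simp add: noncritical_chains_def)
  moreover have "\<not> critical_span m T"
    using critical_span_mono[OF T] S by (auto simp: noncritical_chains_def)
  ultimately show "T \<in> noncritical_chains m" by (simp add: noncritical_chains_def)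
next
  show "S \<subseteq> Pow {1..m}" if "S \<in> noncritical_chains m" for S
    using that chain_simplicesD(1) by (simp add: noncritical_chains_def)
  show "{} \<notin> noncritical_chains m" using chain_simplicesD(2) by (auto simp: noncritical_chains_def)
qed

lemma max_missing:
  assumes S: "S \<in> chain_simplices m" "S \<noteq> {{1..m}}"
  shows "max_missing m S \<in> {1..m}" "max_missing m S \<notin> \<Inter> S"
    "\<And>j. j \<in> {1..m} \<Longrightarrow> j > max_missing m S \<Longrightarrow> j \<in> \<Inter> S"
proof -
  note S' = chain_simplicesD[OF S(1)]
  have "\<Inter> S \<noteq> {1..m}"
  proof
    assume I: "\<Inter> S = {1..m}"
    have "x = {1..m}" if "x \<in> S" for x using I that S'(1) by blast
    then show False using S'(2) S(2) by blast
  qed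
  then have ne: "{1..m} - \<Inter> S \<noteq> {}" using S'(8) by blast
  have "Max ({1..m} - \<Inter> S) \<in> {1..m} - \<Inter> S" by (rule Max_in) (use ne in auto)
  then show "max_missing m S \<in> {1..m}" "max_missing m S \<notin> \<Inter> S" by (simp_all add: max_missing_def)
  show "j \<in> \<Inter> S" if j: "j \<in> {1..m}" "j > max_missing m S" for j
  proof (rule ccontr)
    assume "j \<notin> \<Inter> S"
    then have "j \<le> Max ({1..m} - \<Inter> S)" using j(1) by (intro Max_ge) auto
    then show False using j(2) by (simp add: max_missing_def)
  qed
qed

lemma max_missing_eqI:
  assumes "i \<in> {1..m}" "i \<notin> \<Inter> S" "\<And>j. j \<in> {1..m} \<Longrightarrow> j > i \<Longrightarrow> j \<in> \<Inter> S"
  shows "max_missing m S = i"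
  unfolding max_missing_def
proof (rule Max_eqI)
  fix j assume "j \<in> {1..m} - \<Inter> S"
  then show "j \<le> i" using assms(3)[of j] by (cases "j > i") auto
qed (use assms in auto)

text \<open>Members of a chain are told apart by the number of coordinates they have beyond the
  bottom, which is between 0 and 4.\<close>

lemma card_chain_le:
  assumes "S \<in> chain_simplices m"
  shows "card S \<le> 5"
proof -
  note S = chain_simplicesD[OF assms]
  let ?f = "\<lambda>x. card (x - \<Inter> S)"
  have "inj_on ?f S"
  proof (rule inj_onI)
    fix x y assume x: "x \<in> S" "y \<in> S" "?f x = ?f y"
    have "x \<subseteq> {1..m}" "y \<subseteq> {1..m}" using x S(1) by blast+
    then have "finite x" "finite y" by (auto intro: finite_subset)
    then have fin: "finite (x - \<Inter> S)" "finite (y - \<Inter> S)" by simp_all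
    have "x - \<Inter> S \<subseteq> y - \<Inter> S \<or> y - \<Inter> S \<subseteq> x - \<Inter> S" using chain_setD[OF S(3) x(1,2)] by blast
    then have "x - \<Inter> S = y - \<Inter> S" using x(3) card_subset_eq fin by metis
    then show "x = y" using x(1,2) by blast
  qed
  moreover have "?f ` S \<subseteq> {..4}"
  proof
    fix k assume "k \<in> ?f ` S"
    then obtain x where x: "x \<in> S" "k = card (x - \<Inter> S)" by auto
    have "card (x - \<Inter> S) \<le> dim_span S"
      unfolding dim_span_def by (rule card_mono[OF finite_Union_Diff_Inter[OF S(1)]]) (use x(1) in blast)
    then show "k \<in> {..4}" using x(2) S(5) by simp
  qed
  ultimately have "card S \<le> card {..4::nat}" by (rule card_inj_on_le) simp
  then show ?thesis by simp
qed

lemma toggle_neq: "x \<in> S \<Longrightarrow> x \<noteq> a \<Longrightarrow> x \<in> toggle a S"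
  by (simp add: toggle_def)

lemma toggle_mem: "x \<in> toggle a S \<Longrightarrow> x \<noteq> a \<Longrightarrow> x \<in> S"
  by (simp add: toggle_def split: if_splits)

lemma dim_span_insert_Union:
  assumes "S \<subseteq> Pow {1..m::nat}" "S \<noteq> {}"
  shows "dim_span (insert (insert i (\<Union> S)) S) \<le> Suc (dim_span S)"
proof -
  let ?S = "insert (insert i (\<Union> S)) S"
  have "\<Inter> S \<subseteq> insert i (\<Union> S)" using assms(2) by blast
  then have "\<Inter> ?S = \<Inter> S" by auto
  moreover have "\<Union> ?S = insert i (\<Union> S)" by auto
  ultimately have "\<Union> ?S - \<Inter> ?S \<subseteq> insert i (\<Union> S - \<Inter> S)" by auto
  then have "dim_span ?S \<le> card (insert i (\<Union> S - \<Inter> S))"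
    unfolding dim_span_def by (rule card_mono[rotated]) (use finite_Union_Diff_Inter[OF assms(1)] in simp)
  also have "\<dots> \<le> Suc (dim_span S)" unfolding dim_span_def by (rule card_insert_le_m1[of "Suc n" for n, simplified]) simp
  finally show ?thesis .
qed

text \<open>Pushing a chain towards the top vertex: with \<open>i\<close> the largest coordinate that is not constantly
  one on \<open>S\<close>, toggle the copy with \<open>i\<close> adjoined of the last member avoiding \<open>i\<close>.\<close>

lemma noncritical_chains_collapse:
  "pointed_equivalent (geometric_realization (noncritical_chains m)) (vertex_point {1..m})
     (geometric_realization {{{1..m}}}) (vertex_point {1..m})"
\<comment> \<open>The rank is lexicographic: chains have at most five members, so with the factor 6
  a drop of \<open>max_missing\<close> outweighs any growth of the second summand.\<close>
proof (rule collapse_by_toggles[where a = "\<lambda>S. insert (max_missing m S) (\<Union> {x \<in> S. max_missing m S \<notin> x})"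
      and \<phi> = "\<lambda>S. 6 * max_missing m S + card {x \<in> S. max_missing m S \<notin> x}"])
  show "finite_complex {{{1..m}}}"
    by (rule finite_complexI[of _ m]) auto
  show "vertex_point {1..m} \<in> realization_points {{{1..m}}}" by (rule vertex_point_in) simp
  have "dim_span {{1..m}} = 0" by (simp add: dim_span_def)
  then show "{{{1..m}}} \<subseteq> noncritical_chains m"
    by (simp add: noncritical_chains_def chain_simplices_def cube_simplices_def chain_set_def critical_span_def)
  fix S assume S: "S \<in> noncritical_chains m - {{{1..m}}}"
  then have SC: "S \<in> chain_simplices m" and Sne: "S \<noteq> {{1..m}}" and ncr: "\<not> critical_span m S"
    by (auto simp: noncritical_chains_def)
  note SD = chain_simplicesD[OF SC] and mm = max_missing[OF SC Sne]
  define i where "i = max_missing m S"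
  note mm = mm[folded i_def]
  define L where "L = {x \<in> S. i \<notin> x}"
  define a where "a = insert i (\<Union> L)"
  have exL: "\<exists>x\<in>S. i \<notin> x" using mm(2) by blast
  note above = chain_insert_above[OF SD(3,4) exL, folded L_def, folded a_def]
  have IL: "\<Inter> S \<in> L" using SD(6) mm(2) by (simp add: L_def)
  have ia: "i \<in> a" by (simp add: a_def)
  have aV: "a \<subseteq> {1..m}" using above(2) SD(1) mm(1) by (auto simp: a_def L_def)
  have Ia: "\<Inter> S \<subseteq> a" using IL by (auto simp: a_def)
  have aL: "a \<notin> L" by (simp add: L_def ia)
  define S' where "S' = toggle a S"
  have L': "{x \<in> S'. i \<notin> x} = L" unfolding S'_def toggle_def L_def using ia by auto
  have IS': "\<Inter> S' = \<Inter> S"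
  proof -
    have "\<Inter> S \<in> S'" unfolding S'_def by (rule toggle_neq) (use SD(6) IL aL in auto)
    moreover have "\<Inter> S \<subseteq> x" if "x \<in> S'" for x
      using toggle_mem[of x a S] that Ia unfolding S'_def by (cases "x = a") auto
    ultimately show ?thesis by blast
  qed
  have mm': "max_missing m S' = i" by (simp add: max_missing_def IS' i_def)
  have S'V: "S' \<subseteq> Pow {1..m}" using SD(1) aV by (auto simp: S'_def toggle_def)
  have S'ne: "S' \<noteq> {}" using L' IL by auto
  have S'ch: "chain_set S'" unfolding S'_def by (rule chain_set_toggle[OF above(1)])
  have S'cr: "dim_span S' \<le> 4 \<and> \<not> critical_span m S'"
  proof (cases "i \<in> \<Union> S'")
    case True
    have "dim_span S' \<le> 4"
    proof (cases "i \<in> \<Union> S")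
      case True
      then obtain x where x: "x \<in> S" "i \<in> x" by blast
      have "\<Union> S' \<subseteq> \<Union> S" using above(3)[OF x] x by (auto simp: S'_def toggle_def split: if_splits)
      then have "dim_span S' \<le> dim_span S" unfolding dim_span_def IS'
        by (intro card_mono finite_Union_Diff_Inter[OF SD(1)]) auto
      then show ?thesis using SD(5) by simp
    next
      case False
      \<comment> \<open>Only here can the toggle enlarge the span. A noncritical chain on which
        \<open>i\<close> is constantly zero spans at most three coordinates and has room for
        \<open>i\<close>.\<close>
      then have "dim_span S \<noteq> 4" using ncr by (simp add: critical_span_def i_def)
      have "L = S" using False by (auto simp: L_def)
      then have "S' = insert (insert i (\<Union> S)) S" using False ia unfolding S'_def toggle_def a_def by auto
      then have "dim_span S' \<le> Suc (dim_span S)" using dim_span_insert_Union[OF SD(1,2)] by simp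
      then show ?thesis using \<open>dim_span S \<noteq> 4\<close> SD(5) by simp
    qed
    then show ?thesis using True by (simp add: critical_span_def mm')
  next
    case False
    \<comment> \<open>The coordinate \<open>i\<close> occurred in \<open>a\<close> only; removing
      \<open>a\<close> loses this direction and takes the span below four.\<close>
    then have "a \<in> S" using ia by (auto simp: S'_def toggle_def split: if_splits)
    then have "S' \<subset> S" by (auto simp: S'_def toggle_def)
    have "\<Union> S' - \<Inter> S' \<subset> \<Union> S - \<Inter> S"
      unfolding IS' using \<open>S' \<subset> S\<close> False \<open>a \<in> S\<close> ia mm(2) by blast
    then have "dim_span S' < dim_span S" unfolding dim_span_def
      by (rule psubset_card_mono[OF finite_Union_Diff_Inter[OF SD(1)]])
    then show ?thesis using SD(5) by (simp add: critical_span_def)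
  qed
  have eqa: "insert (max_missing m S) (\<Union> {x \<in> S. max_missing m S \<notin> x}) = a"
    by (simp add: a_def L_def i_def)
  have aS': "insert (max_missing m S') (\<Union> {x \<in> S'. max_missing m S' \<notin> x}) = a"
    by (simp only: a_def mm' L')
  have "S' \<in> chain_simplices m" using S'V S'ne S'ch S'cr by (simp add: chain_simplices_def cube_simplices_def)
  moreover have "S' \<noteq> {{1..m}}" using IL L' mm(1) by fastforce
  ultimately show "toggle (insert (max_missing m S) (\<Union> {x \<in> S. max_missing m S \<notin> x})) S \<in> noncritical_chains m - {{{1..m}}}"
    using S'cr unfolding eqa S'_def[symmetric] by (simp add: noncritical_chains_def)
  show "insert (max_missing m (toggle (insert (max_missing m S) (\<Union> {x \<in> S. max_missing m S \<notin> x})) S))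
      (\<Union> {x \<in> toggle (insert (max_missing m S) (\<Union> {x \<in> S. max_missing m S \<notin> x})) S.
        max_missing m (toggle (insert (max_missing m S) (\<Union> {x \<in> S. max_missing m S \<notin> x})) S) \<notin> x}) =
      insert (max_missing m S) (\<Union> {x \<in> S. max_missing m S \<notin> x})"
    unfolding eqa S'_def[symmetric] by (rule aS')
  fix v
  assume aS: "insert (max_missing m S) (\<Union> {x \<in> S. max_missing m S \<notin> x}) \<notin> S" and v: "v \<in> S"
    and \<tau>1: "insert (insert (max_missing m S) (\<Union> {x \<in> S. max_missing m S \<notin> x})) (S - {v}) \<in> noncritical_chains m - {{{1..m}}}"
    and \<tau>2: "insert (max_missing m (insert (insert (max_missing m S) (\<Union> {x \<in> S. max_missing m S \<notin> x})) (S - {v})))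
          (\<Union> {x \<in> insert (insert (max_missing m S) (\<Union> {x \<in> S. max_missing m S \<notin> x})) (S - {v}).
              max_missing m (insert (insert (max_missing m S) (\<Union> {x \<in> S. max_missing m S \<notin> x})) (S - {v})) \<notin> x})
         \<notin> insert (insert (max_missing m S) (\<Union> {x \<in> S. max_missing m S \<notin> x})) (S - {v})"
  define \<tau> where "\<tau> = insert a (S - {v})"
  note \<tau>1 = \<tau>1[unfolded eqa \<tau>_def[symmetric]] and \<tau>2 = \<tau>2[unfolded eqa \<tau>_def[symmetric]] and aS = aS[unfolded eqa]
  have \<tau>C: "\<tau> \<in> chain_simplices m" "\<tau> \<noteq> {{1..m}}" using \<tau>1 by (auto simp: noncritical_chains_def)
  have I\<tau>: "\<Inter> S \<subseteq> \<Inter> \<tau>" using Ia by (auto simp: \<tau>_def)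
  have finL: "finite L" using SD(4) by (simp add: L_def)
  have L5: "card {x \<in> T. k \<notin> x} \<le> 5" if "T \<in> chain_simplices m" for T k
    using card_mono[OF chain_simplicesD(4)[OF that], of "{x \<in> T. k \<notin> x}"] card_chain_le[OF that] by auto
  have L\<tau>: "{x \<in> \<tau>. i \<notin> x} = L - {v}" using ia by (auto simp: \<tau>_def L_def)
  have "6 * max_missing m \<tau> + card {x \<in> \<tau>. max_missing m \<tau> \<notin> x} < 6 * i + card L"
  proof (cases "L - {v} = {}")
    case True
    \<comment> \<open>The last member avoiding \<open>i\<close> is gone, so the largest missing
      coordinate becomes smaller.\<close>
    then have "i \<in> \<Inter> \<tau>" using L\<tau> by blast
    then have "max_missing m \<tau> \<noteq> i" using max_missing(2)[OF \<tau>C] by metis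
    moreover have "\<not> max_missing m \<tau> > i" using max_missing(1,2)[OF \<tau>C] mm(3) I\<tau> by blast
    ultimately have "max_missing m \<tau> < i" by linarith
    moreover have "card {x \<in> \<tau>. max_missing m \<tau> \<notin> x} \<le> 5" by (rule L5[OF \<tau>C(1)])
    ultimately show "6 * max_missing m \<tau> + card {x \<in> \<tau>. max_missing m \<tau> \<notin> x} < 6 * i + card L" by linarith
  next
    case False
    then obtain y where y: "y \<in> \<tau>" "i \<notin> y" using L\<tau> by blast
    have m\<tau>: "max_missing m \<tau> = i"
      by (rule max_missing_eqI[OF mm(1)]) (use y mm(3) I\<tau> in blast)+
    \<comment> \<open>If \<open>v\<close> contains \<open>i\<close>, the vertex to toggle is still
      \<open>a\<close>, which is present: such a face is not a lower partner.\<close>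
    have "v \<in> L"
    proof (rule ccontr)
      assume "v \<notin> L"
      then have "L - {v} = L" by simp
      then have "a \<notin> \<tau>" using \<tau>2 unfolding m\<tau> L\<tau> by (simp add: a_def)
      then show False by (simp add: \<tau>_def)
    qed
    then have "card (L - {v}) < card L" using finL by (rule card_Diff1_less[rotated])
    then show "6 * max_missing m \<tau> + card {x \<in> \<tau>. max_missing m \<tau> \<notin> x} < 6 * i + card L"
      unfolding m\<tau> L\<tau> by simp
  qed
  moreover have "6 * i + card L = 6 * max_missing m S + card {x \<in> S. max_missing m S \<notin> x}"
    by (simp add: i_def L_def)
  ultimately show "6 * max_missing m (insert (insert (max_missing m S) (\<Union> {x \<in> S. max_missing m S \<notin> x})) (S - {v})) +
         card {x \<in> insert (insert (max_missing m S) (\<Union> {x \<in> S. max_missing m S \<notin> x})) (S - {v}).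
              max_missing m (insert (insert (max_missing m S) (\<Union> {x \<in> S. max_missing m S \<notin> x})) (S - {v})) \<notin> x}
         < 6 * max_missing m S + card {x \<in> S. max_missing m S \<notin> x}"
    unfolding eqa \<tau>_def[symmetric] by (rule ord_less_eq_trans)
qed (rule finite_complex_noncritical_chains)

text \<open>The maximal chain from \<open>q\<close> to \<open>q \<union> D\<close> that adds the
  elements of \<open>D\<close> in increasing order. The step named by \<open>e\<close> is the one
  just before \<open>e\<close> is added.\<close>

definition flag :: "nat set \<Rightarrow> nat set \<Rightarrow> nat set set" where
  "flag q D = insert (q \<union> D) ((\<lambda>e. q \<union> (D \<inter> {..<e})) ` D)"

lemma flag_Inter_Union:
  assumes "finite D" "D \<noteq> {}"
  shows "\<Inter> (flag q D) = q" "\<Union> (flag q D) = q \<union> D"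
proof -
  have "Min D \<in> D" using assms by (rule Min_in)
  moreover have "D \<inter> {..<Min D} = {}" using Min_le[OF assms(1)] by (metis Int_emptyI leD lessThan_iff)
  ultimately have "q \<in> flag q D" unfolding flag_def by (metis Un_empty_right image_eqI insertCI)
  moreover have "q \<subseteq> x" if "x \<in> flag q D" for x using that by (auto simp: flag_def)
  ultimately show "\<Inter> (flag q D) = q" by blast
  show "\<Union> (flag q D) = q \<union> D" by (auto simp: flag_def)
qed

lemma chain_set_flag: "chain_set (flag q D)"
  unfolding chain_set_def
proof (intro ballI)
  fix x y assume "x \<in> flag q D" "y \<in> flag q D"
  then consider "x = q \<union> D \<or> y = q \<union> D" | e e' where "x = q \<union> (D \<inter> {..<e})" "y = q \<union> (D \<inter> {..<e'})"
    by (auto simp: flag_def)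
  then show "x \<subseteq> y \<or> y \<subseteq> x"
  proof cases
    case 1
    then show ?thesis using \<open>x \<in> flag q D\<close> \<open>y \<in> flag q D\<close> by (auto simp: flag_def)
  next
    case 2
    then show ?thesis by (cases "e \<le> e'") auto
  qed
qed

lemma card_flag:
  assumes "finite D" "q \<inter> D = {}"
  shows "card (flag q D) = Suc (card D)"
proof -
  have "inj_on (\<lambda>e. q \<union> (D \<inter> {..<e})) D"
  proof (rule inj_onI)
    fix e e' assume e: "e \<in> D" "e' \<in> D" "q \<union> (D \<inter> {..<e}) = q \<union> (D \<inter> {..<e'})"
    then have "D \<inter> {..<e} = D \<inter> {..<e'}" using assms(2) by blast
    then show "e = e'" using e(1,2) by (metis IntI Int_iff lessThan_iff less_irrefl linorder_neqE_nat)
  qed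
  then have "card ((\<lambda>e. q \<union> (D \<inter> {..<e})) ` D) = card D" by (rule card_image)
  moreover have "q \<union> D \<notin> (\<lambda>e. q \<union> (D \<inter> {..<e})) ` D" using assms(2) by auto
  ultimately show ?thesis unfolding flag_def using assms(1) by simp
qed

text \<open>The critical 4-faces, given by bottom vertex and set of directions. One maximal chain is
  removed from each.\<close>

definition flag_index :: "nat \<Rightarrow> (nat set \<times> nat set) set" where
  "flag_index m = {(q, D). D \<subseteq> {1..m} \<and> card D = 4 \<and> q \<subseteq> {1..m} - D \<and> Max ({1..m} - q) \<notin> D}"

definition flag_simplices :: "nat \<Rightarrow> nat set set set" where
  "flag_simplices m = (\<lambda>(q, D). flag q D) ` flag_index m"

lemma flag_indexD:
  assumes "(q, D) \<in> flag_index m"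
  shows "finite D" "D \<noteq> {}" "q \<inter> D = {}" "card D = 4" "D \<subseteq> {1..m}" "q \<subseteq> {1..m}"
proof -
  show D: "card D = 4" "D \<subseteq> {1..m}" "q \<subseteq> {1..m}" "q \<inter> D = {}" using assms by (auto simp: flag_index_def)
  show "finite D" using D(2) by (rule finite_subset) simp
  show "D \<noteq> {}" using D(1) by auto
qed

lemma inj_on_flag: "inj_on (\<lambda>(q, D). flag q D) (flag_index m)"
proof (rule inj_onI, clarify)
  fix q D q' D' assume i: "(q, D) \<in> flag_index m" "(q', D') \<in> flag_index m" and eq: "flag q D = flag q' D'"
  note d = flag_indexD[OF i(1)] and d' = flag_indexD[OF i(2)]
  have "q = q'" using flag_Inter_Union(1)[OF d(1,2), of q] flag_Inter_Union(1)[OF d'(1,2), of q'] eq by simp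
  moreover have "q \<union> D = q' \<union> D'"
    using flag_Inter_Union(2)[OF d(1,2), of q] flag_Inter_Union(2)[OF d'(1,2), of q'] eq by simp
  ultimately show "q = q' \<and> D = D'" using d(3) d'(3) by blast
qed

lemma flag_simplices_chain:
  assumes "S \<in> flag_simplices m"
  shows "S \<in> chain_simplices m" "critical_span m S" "card S = 5"
proof -
  obtain q D where i: "(q, D) \<in> flag_index m" and S: "S = flag q D" using assms by (auto simp: flag_simplices_def)
  note d = flag_indexD[OF i] and IU = flag_Inter_Union[OF flag_indexD(1,2)[OF i], of q]
  have "q \<union> D - q = D" using d(3) by blast
  then have ds: "dim_span S = 4" unfolding dim_span_def S IU using d(4) by simp
  have "x \<subseteq> {1..m}" if "x \<in> S" for x
  proof -
    have "x \<subseteq> q \<union> D" using that IU(2) unfolding S by blast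
    then show ?thesis using d(5,6) by blast
  qed
  moreover have "S \<noteq> {}" by (auto simp: S flag_def)
  ultimately show "S \<in> chain_simplices m"
    using ds chain_set_flag[of q D] by (auto simp: chain_simplices_def cube_simplices_def S[symmetric])
  have ne: "{1..m} - q \<noteq> {}" using d(2,3,5) by blast
  have "Max ({1..m} - q) \<in> {1..m} - q" by (rule Max_in) (use ne in auto)
  then have "Max ({1..m} - q) \<notin> q \<union> D" using i by (auto simp: flag_index_def)
  then show "critical_span m S"
    using ds by (simp add: critical_span_def max_missing_def S IU)
  show "card S = 5" using card_flag[OF d(1,3)] d(4) S by simp
qed

lemma critical_span_index:
  assumes S: "S \<in> chain_simplices m" "critical_span m S"
  shows "(\<Inter> S, \<Union> S - \<Inter> S) \<in> flag_index m"
  using S(2) chain_simplicesD(8,9)[OF S(1)]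
  by (auto simp: critical_span_def dim_span_def max_missing_def flag_index_def)

lemma flag_simplices_maximal:
  assumes "\<sigma> \<in> flag_simplices m" "\<omega> \<in> chain_simplices m" "\<sigma> \<subseteq> \<omega>"
  shows "\<omega> = \<sigma>"
proof -
  have "card \<omega> \<le> card \<sigma>" using card_chain_le[OF assms(2)] flag_simplices_chain(3)[OF assms(1)] by simp
  then show ?thesis using assms(3) chain_simplicesD(4)[OF assms(2)] card_seteq by metis
qed

text \<open>The steps of the standard flag of the spanned face that \<open>S\<close> lacks, each
  named by the coordinate that would be added next.\<close>

definition missing_flags :: "nat set set \<Rightarrow> nat set" where
  "missing_flags S = {e \<in> \<Union> S - \<Inter> S. \<Inter> S \<union> ((\<Union> S - \<Inter> S) \<inter> {..<e}) \<notin> S}"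

definition flag_level :: "nat set set \<Rightarrow> nat" where
  "flag_level S = Max (missing_flags S)"

definition flag_toggle :: "nat set set \<Rightarrow> nat set" where
  "flag_toggle S = insert (flag_level S) (\<Union> {x \<in> S. flag_level S \<notin> x})"

text \<open>The largest missing step of the full flag is not affected by the toggle, and removing a
  larger step raises the level.\<close>

lemma chain_simplices_Diff_flags_collapse:
  "pointed_equivalent (geometric_realization (chain_simplices m - flag_simplices m)) (vertex_point {1..m})
     (geometric_realization (noncritical_chains m)) (vertex_point {1..m})"
\<comment> \<open>The level can only rise and is bounded by \<open>m\<close>, hence the difference;
  the factor 6 again makes the rank lexicographic.\<close>
proof (rule collapse_by_toggles[where a = flag_toggle
      and \<phi> = "\<lambda>S. 6 * (m - flag_level S) + card {x \<in> S. flag_level S \<notin> x}"])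
  show "finite_complex (chain_simplices m - flag_simplices m)"
    by (rule maximal_Diff_finite_complex[OF finite_complex_chain_simplices flag_simplices_maximal])
  show "vertex_point {1..m} \<in> realization_points (noncritical_chains m)"
  proof (rule vertex_point_in)
    have "dim_span {{1..m}} = 0" by (simp add: dim_span_def)
    then show "{{1..m}} \<in> noncritical_chains m"
      by (simp add: noncritical_chains_def chain_simplices_def cube_simplices_def chain_set_def critical_span_def)
  qed
  show "noncritical_chains m \<subseteq> chain_simplices m - flag_simplices m"
    using flag_simplices_chain(2) by (auto simp: noncritical_chains_def)
  fix S assume "S \<in> chain_simplices m - flag_simplices m - noncritical_chains m"
  then have SC: "S \<in> chain_simplices m" and Snf: "S \<notin> flag_simplices m" and cr: "critical_span m S"
    by (auto simp: noncritical_chains_def)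
  note SD = chain_simplicesD[OF SC] and idx = critical_span_index[OF SC cr]
  define q where "q = \<Inter> S"
  define D where "D = \<Union> S - \<Inter> S"
  note idx' = idx[folded D_def, folded q_def]
  note d = flag_indexD[OF idx']
  have top: "\<Union> S = q \<union> D" using SD(10) by (auto simp: q_def D_def)
  define fl where "fl = (\<lambda>e. q \<union> (D \<inter> {..<e}))"
  have mf: "missing_flags T = {e \<in> D. fl e \<notin> T}" if "\<Inter> T = q" "\<Union> T = q \<union> D" for T
  proof -
    have "q \<union> D - q = D" using d(3) by blast
    then show ?thesis by (simp add: missing_flags_def that fl_def)
  qed
  have mfS: "missing_flags S = {e \<in> D. fl e \<notin> S}" by (rule mf) (simp_all add: q_def top)
  have qS: "q \<in> S" and tS: "q \<union> D \<in> S" using SD(6,7) top by (simp_all add: q_def)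
  have mf_ne: "missing_flags S \<noteq> {}"
  proof
    assume "missing_flags S = {}"
    then have "flag q D \<subseteq> S" using tS by (auto simp: mfS flag_def fl_def)
    then have "S = flag q D"
      using flag_simplices_maximal[OF _ SC] idx' by (fastforce simp: flag_simplices_def)
    then show False using Snf idx' by (auto simp: flag_simplices_def)
  qed
  define e where "e = flag_level S"
  have "e \<in> missing_flags S"
    unfolding e_def flag_level_def by (rule Max_in) (use mf_ne d(1) in \<open>simp_all add: mfS\<close>)
  then have eD: "e \<in> D" and eS: "fl e \<notin> S" by (simp_all add: mfS)
  have e_max: "fl e' \<in> S" if "e' \<in> D" "e' > e" for e'
  proof (rule ccontr)
    assume "fl e' \<notin> S"
    then have "e' \<le> Max (missing_flags S)" using that d(1) by (intro Max_ge) (simp_all add: mfS)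
    then show False using that by (simp add: e_def flag_level_def)
  qed
  have eq: "e \<notin> q" using eD d(3) by blast
  define L where "L = {x \<in> S. e \<notin> x}"
  define a where "a = insert e (\<Union> L)"
  have aa: "flag_toggle S = a" by (simp add: flag_toggle_def a_def L_def e_def)
  have exL: "\<exists>x\<in>S. e \<notin> x" using qS eq by blast
  note above = chain_insert_above[OF SD(3,4) exL, folded L_def, folded a_def]
  have qL: "q \<in> L" using qS eq by (simp add: L_def)
  have LS: "\<Union> L \<in> S" and eL: "e \<notin> \<Union> L" using above(2) by (simp_all add: L_def)
  have qa: "q \<subseteq> a" using qL by (auto simp: a_def)
  have at: "a \<subseteq> q \<union> D" using LS top eD by (auto simp: a_def)
  have ea: "e \<in> a" by (simp add: a_def)
  \<comment> \<open>The step right after the missing one is present: it is the top, or the step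
    named by the next larger element of \<open>D\<close>.\<close>
  have c: "q \<union> (D \<inter> {..e}) \<in> S"
  proof (cases "{x \<in> D. x > e} = {}")
    case True
    then have "D \<inter> {..e} = D" by (auto simp: not_less)
    then show ?thesis using tS by simp
  next
    case False
    define e' where "e' = Min {x \<in> D. x > e}"
    have "e' \<in> {x \<in> D. x > e}" unfolding e'_def by (rule Min_in) (use False d(1) in auto)
    then have e': "e' \<in> D" "e' > e" by auto
    have "x \<le> e" if "x \<in> D" "x < e'" for x
    proof (rule ccontr)
      assume "\<not> x \<le> e"
      then have "e' \<le> x" unfolding e'_def using that d(1) by (intro Min_le) auto
      then show False using that by simp
    qed
    then have "D \<inter> {..<e'} = D \<inter> {..e}" using e' by fastforce
    then show ?thesis using e_max[OF e'] by (simp add: fl_def)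
  qed
  \<comment> \<open>Otherwise \<open>a\<close> would equal that next step, and the largest member
    avoiding \<open>e\<close> would be the step named by \<open>e\<close>, which is missing.\<close>
  have nca: "\<not> q \<union> (D \<inter> {..e}) \<subseteq> a"
  proof
    assume sub: "q \<union> (D \<inter> {..e}) \<subseteq> a"
    have "a \<subseteq> q \<union> (D \<inter> {..e})" by (rule above(3)[OF c]) (use eD in simp)
    then have "a = q \<union> (D \<inter> {..e})" using sub by (rule subset_antisym)
    then have "\<Union> L = (q \<union> (D \<inter> {..e})) - {e}" using eL by (auto simp: a_def)
    also have "\<dots> = fl e" using eq by (auto simp: fl_def)
    finally show False using LS eS by simp
  qed
  have afl: "fl e' \<noteq> a" if "e' \<in> D" for e'
  proof (cases "e' \<le> e")
    case True
    then have "e \<notin> fl e'" using eq by (simp add: fl_def)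
    then show ?thesis using ea by blast
  next
    case False
    then have "q \<union> (D \<inter> {..e}) \<subseteq> fl e'" by (auto simp: fl_def)
    then show ?thesis using nca by blast
  qed
  have atop: "a \<noteq> q \<union> D" using nca by blast
  have aq: "a \<noteq> q" using ea eq by blast
  define S' where "S' = toggle a S"
  have S'mem: "x \<subseteq> q \<union> D \<and> q \<subseteq> x" if "x \<in> S'" for x
  proof (cases "x = a")
    case True
    then show ?thesis using qa at by simp
  next
    case False
    then have "x \<in> S" using that toggle_mem unfolding S'_def by metis
    then show ?thesis using top by (auto simp: q_def)
  qed
  have qS': "q \<in> S'" and tS': "q \<union> D \<in> S'"
    unfolding S'_def using qS tS aq atop by (simp_all add: toggle_neq)
  have IS': "\<Inter> S' = q" and US': "\<Union> S' = q \<union> D" using S'mem qS' tS' by blast+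
  have "q \<union> D - q = D" using d(3) by blast
  then have ds': "dim_span S' = 4" unfolding dim_span_def IS' US' using d(4) by simp
  have "S' \<subseteq> Pow {1..m}"
  proof
    fix x assume "x \<in> S'"
    then have "x \<subseteq> q \<union> D" using S'mem by blast
    then show "x \<in> Pow {1..m}" using d(5,6) by blast
  qed
  moreover have "chain_set S'" unfolding S'_def by (rule chain_set_toggle[OF above(1)])
  ultimately have S'C: "S' \<in> chain_simplices m"
    using ds' qS' by (auto simp: chain_simplices_def cube_simplices_def)
  have S'cr: "critical_span m S'"
    using cr ds' unfolding critical_span_def max_missing_def IS' US' top q_def[symmetric] by simp
  \<comment> \<open>The toggled vertex is no step of the flag, so both partners miss the same steps
    and toggle the same vertex.\<close>
  have mfS': "missing_flags S' = missing_flags S"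
    unfolding mfS mf[OF IS' US'] using afl by (auto simp: S'_def toggle_def)
  have "S' \<notin> flag_simplices m"
  proof
    assume "S' \<in> flag_simplices m"
    then obtain q' D' where i': "(q', D') \<in> flag_index m" "S' = flag q' D'" by (auto simp: flag_simplices_def)
    note d' = flag_indexD[OF i'(1)]
    have "q' = q" using flag_Inter_Union(1)[OF d'(1,2), of q'] IS' i'(2) by simp
    moreover have "q' \<union> D' = q \<union> D" using flag_Inter_Union(2)[OF d'(1,2), of q'] US' i'(2) by simp
    ultimately have "S' = flag q D" using d'(3) d(3) i'(2) by (metis Diff_cancel Un_Diff Un_Diff_Int Un_empty_left inf_commute Diff_triv Un_commute)
    then have "fl e \<in> S'" using eD by (simp add: flag_def fl_def)
    moreover have "e \<in> missing_flags S'" using mfS' \<open>e \<in> missing_flags S\<close> by simp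
    ultimately show False by (simp add: mf[OF IS' US'])
  qed
  then show "toggle (flag_toggle S) S \<in> chain_simplices m - flag_simplices m - noncritical_chains m"
    using S'C S'cr unfolding aa S'_def[symmetric] by (simp add: noncritical_chains_def)
  have lev': "flag_level S' = e" by (simp add: flag_level_def mfS' e_def)
  have L': "{x \<in> S'. e \<notin> x} = L" unfolding S'_def toggle_def L_def using ea by auto
  show "flag_toggle (toggle (flag_toggle S) S) = flag_toggle S"
    unfolding aa S'_def[symmetric] by (simp only: flag_toggle_def lev' L' a_def)
  fix v assume aS: "flag_toggle S \<notin> S" and v: "v \<in> S"
    and \<tau>1: "insert (flag_toggle S) (S - {v}) \<in> chain_simplices m - flag_simplices m - noncritical_chains m"
    and \<tau>2: "flag_toggle (insert (flag_toggle S) (S - {v})) \<notin> insert (flag_toggle S) (S - {v})"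
  define \<tau> where "\<tau> = insert a (S - {v})"
  note aS = aS[unfolded aa] and \<tau>1 = \<tau>1[unfolded aa, folded \<tau>_def] and \<tau>2 = \<tau>2[unfolded aa, folded \<tau>_def]
  have \<tau>C: "\<tau> \<in> chain_simplices m" and \<tau>cr: "critical_span m \<tau>" using \<tau>1 by (auto simp: noncritical_chains_def)
  have S'eq: "S' = insert a S" using aS by (simp add: S'_def toggle_def)
  have \<tau>S': "\<tau> \<subseteq> S'" by (auto simp: \<tau>_def S'eq)
  have "dim_span \<tau> = dim_span S'" using \<tau>cr ds' by (simp add: critical_span_def)
  note IU = dim_span_eq_imp[OF \<tau>S' chain_simplicesD(2)[OF \<tau>C] chain_simplicesD(1)[OF S'C] this]
  have mf\<tau>: "missing_flags \<tau> = {e' \<in> D. fl e' \<notin> \<tau>}" by (rule mf) (simp_all add: IU IS' US')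
  \<comment> \<open>The step \<open>e\<close> remains missing, so the largest missing step of the
    face is at least \<open>e\<close>.\<close>
  have e\<tau>: "e \<in> missing_flags \<tau>" unfolding mf\<tau> using eD eS afl by (auto simp: \<tau>_def)
  have fin\<tau>: "finite (missing_flags \<tau>)" unfolding mf\<tau> using d(1) by simp
  have le: "e \<le> flag_level \<tau>" unfolding flag_level_def using e\<tau> fin\<tau> by (rule Max_ge[rotated])
  have "flag_level \<tau> \<in> missing_flags \<tau>" unfolding flag_level_def using e\<tau> fin\<tau> by (intro Max_in) auto
  then have levD: "flag_level \<tau> \<in> D" unfolding mf\<tau> by simp
  then have levm: "flag_level \<tau> \<le> m" using d(5) by auto
  have L\<tau>: "{x \<in> \<tau>. e \<notin> x} = L - {v}" using ea by (auto simp: \<tau>_def L_def)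
  have "6 * (m - flag_level \<tau>) + card {x \<in> \<tau>. flag_level \<tau> \<notin> x} < 6 * (m - e) + card L"
  proof (cases "flag_level \<tau> = e")
    case True
    have "v \<in> L"
    proof (rule ccontr)
      assume "v \<notin> L"
      then have "L - {v} = L" by simp
      then have "flag_toggle \<tau> = a" by (simp add: flag_toggle_def True L\<tau> a_def)
      then show False using \<tau>2 by (simp add: \<tau>_def)
    qed
    moreover have "finite L" using SD(4) by (simp add: L_def)
    ultimately have "card (L - {v}) < card L" by (rule card_Diff1_less[rotated])
    then show ?thesis by (simp add: True L\<tau>)
  next
    case False
    then have "flag_level \<tau> > e" using le by simp
    then have "m - flag_level \<tau> < m - e" using levm by simp
    moreover have "card {x \<in> \<tau>. flag_level \<tau> \<notin> x} \<le> card \<tau>"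
      by (rule card_mono[OF chain_simplicesD(4)[OF \<tau>C]]) auto
    ultimately show ?thesis using card_chain_le[OF \<tau>C] by linarith
  qed
  moreover have "6 * (m - e) + card L = 6 * (m - flag_level S) + card {x \<in> S. flag_level S \<notin> x}"
    by (simp add: e_def L_def)
  ultimately show "6 * (m - flag_level (insert (flag_toggle S) (S - {v}))) +
      card {x \<in> insert (flag_toggle S) (S - {v}). flag_level (insert (flag_toggle S) (S - {v})) \<notin> x}
      < 6 * (m - flag_level S) + card {x \<in> S. flag_level S \<notin> x}"
    unfolding aa \<tau>_def[symmetric] by (rule ord_less_eq_trans)
qed (rule finite_complex_noncritical_chains)

text \<open>The number of 4-faces of the \<open>i\<close>-cube: choose the directions, then the
  constant values in the other coordinates. Both sphere counts rest on it.\<close>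

lemma card_sets_with_disjoint_4_set:
  "card (SIGMA D:{D. D \<subseteq> {1..i::nat} \<and> card D = 4}. Pow ({1..i} - D)) = 2 ^ (i - 4) * (i choose 4)"
proof -
  have "card (SIGMA D:{D. D \<subseteq> {1..i} \<and> card D = 4}. Pow ({1..i} - D)) =
      (\<Sum>D\<in>{D. D \<subseteq> {1..i} \<and> card D = 4}. card (Pow ({1..i} - D)))"
    by (rule card_SigmaI) auto
  also have "\<dots> = (\<Sum>D\<in>{D. D \<subseteq> {1..i} \<and> card D = 4}. 2 ^ (i - 4))"
  proof (rule sum.cong[OF refl])
    fix D assume D: "D \<in> {D. D \<subseteq> {1..i} \<and> card D = 4}"
    then have "D \<subseteq> {1..i}" by blast
    then have "finite D" by (rule finite_subset) simp
    then have "card ({1..i} - D) = i - 4" using D by (simp add: card_Diff_subset)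
    then show "card (Pow ({1..i} - D)) = 2 ^ (i - 4)" by (simp add: card_Pow)
  qed
  also have "\<dots> = 2 ^ (i - 4) * (i choose 4)" using n_subsets[of "{1..i}" 4] by simp
  finally show ?thesis .
qed

text \<open>Sort the critical faces by the largest coordinate \<open>i + 1\<close> at which the
  bottom vertex is zero. It is not a direction and everything above it is one, so an arbitrary
  4-face of the \<open>i\<close>-cube remains.\<close>

lemma card_flag_simplices:
  "card (flag_simplices m) = (\<Sum>i = 4..m - 1. 2 ^ (i - 4) * (i choose 4))"
proof -
  define A where "A = (\<lambda>i. SIGMA D:{D. D \<subseteq> {1..i::nat} \<and> card D = 4}. Pow ({1..i} - D))"
  \<comment> \<open>Fills all coordinates above \<open>i + 1\<close> with ones and leaves
    \<open>i + 1\<close> out.\<close>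
  define g where "g = (\<lambda>(i, (D, q)). (q \<union> {i + 2..m}, D :: nat set))"
  have finA: "finite (A i)" for i
    unfolding A_def by (intro finite_SigmaI) auto
  have mx: "Max ({1..m} - (q \<union> {i + 2..m})) = i + 1" if "i < m" "q \<subseteq> {1..i}" for i q
  proof (rule Max_eqI)
    show "i + 1 \<in> {1..m} - (q \<union> {i + 2..m})" using that by auto
  qed auto
  have "bij_betw g (SIGMA i:{..<m}. A i) (flag_index m)"
  proof (rule bij_betw_imageI)
    show "inj_on g (SIGMA i:{..<m}. A i)"
    proof (rule inj_onI)
      fix x y assume x: "x \<in> (SIGMA i:{..<m}. A i)" and y: "y \<in> (SIGMA i:{..<m}. A i)" and eq: "g x = g y"
      obtain i D q j E p where xy: "x = (i, (D, q))" "y = (j, (E, p))" by (metis prod.exhaust)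
      have xi: "i < m" "q \<subseteq> {1..i}" and yj: "j < m" "p \<subseteq> {1..j}" using x y by (auto simp: xy A_def)
      have e: "q \<union> {i + 2..m} = p \<union> {j + 2..m}" "D = E" using eq by (simp_all add: xy g_def)
      have "i + 1 = j + 1" using mx[OF xi] mx[OF yj] e(1) by simp
      then have ij: "i = j" by simp
      have "q = (q \<union> {i + 2..m}) \<inter> {..i}" using xi(2) by auto
      also have "\<dots> = (p \<union> {j + 2..m}) \<inter> {..j}" using e(1) ij by simp
      also have "\<dots> = p" using yj(2) by auto
      finally show "x = y" using ij e(2) xy by simp
    qed
    show "g ` (SIGMA i:{..<m}. A i) = flag_index m"
    proof (intro subset_antisym subsetI)
      fix z assume "z \<in> g ` (SIGMA i:{..<m}. A i)"
      then obtain i D q where i: "i < m" "D \<subseteq> {1..i}" "card D = 4" "q \<subseteq> {1..i} - D" and z: "z = (q \<union> {i + 2..m}, D)"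
        by (auto simp: g_def A_def)
      have "i + 1 \<notin> D" using i(2) by auto
      moreover have "q \<subseteq> {1..i}" using i(4) by blast
      ultimately have "Max ({1..m} - (q \<union> {i + 2..m})) \<notin> D" using mx[OF i(1)] by simp
      moreover have "D \<subseteq> {1..m}" using i(1,2) by auto
      moreover have "q \<union> {i + 2..m} \<subseteq> {1..m} - D" using i by fastforce
      ultimately show "z \<in> flag_index m" using i(3) by (simp add: z flag_index_def)
    next
      fix z assume "z \<in> flag_index m"
      then obtain q D where z: "z = (q, D)" and D: "(q, D) \<in> flag_index m" by (cases z) auto
      note d = flag_indexD[OF D]
      have ne: "{1..m} - q \<noteq> {}" using d(2,3,5) by blast
      define k where "k = Max ({1..m} - q)"
      have k: "k \<in> {1..m} - q" unfolding k_def by (rule Max_in) (use ne in auto)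
      have kmax: "j \<in> q" if "j \<in> {1..m}" "j > k" for j
      proof (rule ccontr)
        assume "j \<notin> q"
        then have "j \<le> k" unfolding k_def using that by (intro Max_ge) auto
        then show False using that by simp
      qed
      have kD: "k \<notin> D" using D by (simp add: flag_index_def k_def)
      define i where "i = k - 1"
      have i: "k = i + 1" "i < m" using k by (auto simp: i_def)
      have DD: "D \<subseteq> {1..i}"
      proof
        fix x assume x: "x \<in> D"
        then have "x \<in> {1..m}" "x \<noteq> k" "x \<notin> q" using d(3,5) kD by auto
        then have "\<not> x > k" using kmax by blast
        then show "x \<in> {1..i}" using \<open>x \<noteq> k\<close> \<open>x \<in> {1..m}\<close> i by auto
      qed
      have "q = (q \<inter> {1..i}) \<union> {i + 2..m}"
      proof (intro subset_antisym subsetI)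
        fix x assume x: "x \<in> q"
        then have "x \<noteq> k" "x \<in> {1..m}" using k d(6) by auto
        then show "x \<in> (q \<inter> {1..i}) \<union> {i + 2..m}" using x i by auto
      next
        fix x assume "x \<in> (q \<inter> {1..i}) \<union> {i + 2..m}"
        then show "x \<in> q" using kmax[of x] i by auto
      qed
      then have "z = g (i, (D, q \<inter> {1..i}))" by (simp add: z g_def)
      moreover have "(i, (D, q \<inter> {1..i})) \<in> (SIGMA i:{..<m}. A i)"
        using i(2) DD d(3,4) by (auto simp: A_def)
      ultimately show "z \<in> g ` (SIGMA i:{..<m}. A i)" by blast
    qed
  qed
  then have "card (flag_index m) = card (SIGMA i:{..<m}. A i)" by (metis bij_betw_same_card)
  also have "\<dots> = (\<Sum>i<m. card (A i))" by (rule card_SigmaI) (auto simp: finA)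
  also have "\<dots> = (\<Sum>i<m. 2 ^ (i - 4) * (i choose 4))"
    unfolding A_def by (intro sum.cong refl card_sets_with_disjoint_4_set)
  \<comment> \<open>The binomial coefficient vanishes for \<open>i < 4\<close>.\<close>
  also have "\<dots> = (\<Sum>i = 4..m - 1. 2 ^ (i - 4) * (i choose 4))"
    by (rule sum.mono_neutral_right) auto
  finally show ?thesis
    using card_image[OF inj_on_flag, of m] by (simp add: flag_simplices_def)
qed

section \<open>Simplices spanning more than four coordinates\<close>

text \<open>Read in two ways: as the set of coordinates in which two vertices differ, and, with one
  argument fixed, as a reflection of the cube, which preserves distances and moves any vertex to the
  origin.\<close>

definition flip :: "nat set \<Rightarrow> nat set \<Rightarrow> nat set" where
  "flip x y = sym_diff x y"

definition ham :: "nat set \<Rightarrow> nat set \<Rightarrow> nat" where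
  "ham x y = card (flip x y)"

lemma mem_flip: "i \<in> flip x y \<longleftrightarrow> (i \<in> x) \<noteq> (i \<in> y)"
  by (auto simp: flip_def)

lemma flip_commute: "flip x y = flip y x"
  by (auto simp: mem_flip)

lemma flip_flip [simp]: "flip x (flip x y) = y"
  by (auto simp: mem_flip)

lemma flip_left_cancel: "flip (flip a x) (flip a y) = flip x y"
  by (auto simp: mem_flip)

lemma flip_eq_iff: "flip a x = flip a y \<longleftrightarrow> x = y"
  by (metis flip_flip)

lemma flip_triangle: "flip x z \<subseteq> flip x y \<union> flip y z"
  by (auto simp: mem_flip)

lemma finite_flip [simp]: "finite x \<Longrightarrow> finite y \<Longrightarrow> finite (flip x y)"
  by (simp add: flip_def)

lemma ham_commute: "ham x y = ham y x"
  by (simp add: ham_def flip_commute)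

lemma ham_flip: "ham (flip a x) (flip a y) = ham x y" "ham a (flip a x) = card x"
  "ham (flip a x) y = ham x (flip a y)"
  by (simp_all add: ham_def flip_left_cancel) (metis flip_flip flip_left_cancel)

lemma ham_self [simp]: "ham x x = 0"
  by (simp add: ham_def flip_def)

lemma ham_eq_0: "finite x \<Longrightarrow> finite y \<Longrightarrow> ham x y = 0 \<longleftrightarrow> x = y"
  unfolding ham_def by (auto simp: flip_def)

lemma ham_triangle:
  assumes "finite x" "finite y" "finite z"
  shows "ham x z \<le> ham x y + ham y z"
proof -
  have "card (flip x z) \<le> card (flip x y \<union> flip y z)"
    by (rule card_mono[OF _ flip_triangle]) (use assms in simp)
  also have "\<dots> \<le> card (flip x y) + card (flip y z)" by (rule card_Un_le)
  finally show ?thesis by (simp add: ham_def)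
qed

lemma card_flip:
  assumes "finite x" "finite y"
  shows "card (flip x y) + 2 * card (x \<inter> y) = card x + card y"
proof -
  have "card (flip x y) = card (x - y) + card (y - x)"
    unfolding flip_def using assms by (intro card_Un_disjoint) auto
  moreover have "card x = card (x - y) + card (x \<inter> y)"
    using assms card_Diff_subset_Int[of x y] card_mono[of x "x \<inter> y"] by simp
  moreover have "card y = card (y - x) + card (x \<inter> y)"
    using assms card_Diff_subset_Int[of y x] card_mono[of y "x \<inter> y"] by (simp add: Int_commute)
  ultimately show ?thesis by simp
qed

lemma card_flip_singleton:
  assumes "finite x"
  shows "i \<in> x \<Longrightarrow> card (flip x {i}) + 1 = card x" "i \<notin> x \<Longrightarrow> card (flip x {i}) = card x + 1"
  using card_flip[OF assms, of "{i}"] by auto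

lemma even_ham:
  assumes "finite x" "finite y"
  shows "even (ham x y) \<longleftrightarrow> even (card x) = even (card y)"
proof -
  have "even (card (flip x y) + 2 * card (x \<inter> y)) \<longleftrightarrow> even (card x + card y)"
    by (simp only: card_flip[OF assms])
  then show ?thesis by (simp add: ham_def)
qed

lemma ham_eq_1: "ham x y = 1 \<longleftrightarrow> (\<exists>i. y = flip x {i})"
  unfolding ham_def by (metis One_nat_def card_1_singletonE flip_flip is_singletonI is_singleton_altdef)

lemma finite_of_ham_pos:
  assumes "ham x y > 0" "finite y"
  shows "finite x"
proof -
  have "finite (flip x y)" using assms(1) by (intro card_ge_0_finite) (simp add: ham_def)
  then have "finite (flip (flip x y) y)" using assms(2) by simp
  moreover have "flip (flip x y) y = x" by (auto simp: mem_flip)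
  ultimately show ?thesis by simp
qed

text \<open>Distinct vertices with a common neighbour differ in exactly two coordinates, and a
  common neighbour arises by flipping one of these two. So there are at most two common
  neighbours.\<close>

lemma common_neighbour_unique:
  assumes Z: "card Z \<ge> 3" "\<And>z. z \<in> Z \<Longrightarrow> ham a z = 1 \<and> ham b z = 1"
    and "finite a" "finite b"
  shows "a = b"
proof (rule ccontr)
  assume ne: "a \<noteq> b"
  define U where "U = flip a b"
  have finU: "finite U" using assms by (simp add: U_def)
  have "Z \<subseteq> (\<lambda>i. flip a {i}) ` U \<and> card U = 2"
  proof -
    have *: "i \<in> U \<and> card U = 2" if z: "z \<in> Z" "z = flip a {i}" for z i
    proof -
      have "ham b z = card (flip U {i})"
        unfolding z(2) ham_def U_def by (rule arg_cong[of _ _ card]) (auto simp: mem_flip)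
      then have "card (flip U {i}) = 1" using Z(2)[OF z(1)] by simp
      moreover have "card U > 0" using ne finU unfolding U_def by (metis card_gt_0_iff ham_def ham_eq_0 assms(3,4) neq0_conv)
      ultimately show ?thesis using card_flip_singleton[OF finU, of i] by (cases "i \<in> U") auto
    qed
    have "z \<in> (\<lambda>i. flip a {i}) ` U" if "z \<in> Z" for z
      using Z(2)[OF that] *[OF that] unfolding ham_eq_1 by blast
    moreover obtain z where "z \<in> Z" using Z(1) by (metis card.empty ex_in_conv not_numeral_le_zero)
    then have "card U = 2" using Z(2)[of z] *[of z] unfolding ham_eq_1 by blast
    ultimately show ?thesis by blast
  qed
  then have "card Z \<le> card U" using finU by (meson card_image_le card_mono finite_imageI order_trans)
  then show False using Z(1) \<open>_ \<and> card U = 2\<close> by simp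
qed

definition vr :: "nat \<Rightarrow> nat set set set" where
  "vr m = {S. S \<subseteq> Pow {1..m} \<and> S \<noteq> {} \<and> (\<forall>x\<in>S. \<forall>y\<in>S. ham x y \<le> 3)}"

lemma vr_eq: "vietoris_rips (hypercube m) hypercube_dist 3 = vr m"
proof -
  have "S \<in> vietoris_rips (hypercube m) hypercube_dist 3 \<longleftrightarrow> S \<in> vr m" for S
  proof (cases "S \<subseteq> Pow {1..m} \<and> S \<noteq> {}")
    case True
    then have "finite S" by (intro finite_subset[of S "Pow {1..m}"]) auto
    then have "set_diameter hypercube_dist S \<le> 3 \<longleftrightarrow> (\<forall>x\<in>S. \<forall>y\<in>S. hypercube_dist x y \<le> 3)"
      using True by (intro set_diameter_le_iff) auto
    also have "\<dots> \<longleftrightarrow> (\<forall>x\<in>S. \<forall>y\<in>S. ham x y \<le> 3)"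
      by (simp add: hypercube_dist_def ham_def flip_def)
    finally show ?thesis using True \<open>finite S\<close> by (simp add: vietoris_rips_def hypercube_def vr_def)
  qed (auto simp: vietoris_rips_def hypercube_def vr_def)
  then show ?thesis by blast
qed

lemma vrD:
  assumes "S \<in> vr m"
  shows "S \<subseteq> Pow {1..m}" "S \<noteq> {}" "x \<in> S \<Longrightarrow> y \<in> S \<Longrightarrow> ham x y \<le> 3" "x \<in> S \<Longrightarrow> finite x" "finite S"
proof -
  show S: "S \<subseteq> Pow {1..m}" "S \<noteq> {}" "x \<in> S \<Longrightarrow> y \<in> S \<Longrightarrow> ham x y \<le> 3" using assms by (auto simp: vr_def)
  show "finite S" using S(1) by (rule finite_subset) simp
  show "x \<in> S \<Longrightarrow> finite x" using S(1) by (meson PowD finite_atLeastAtMost finite_subset subsetD)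
qed

lemma finite_complex_vr: "finite_complex (vr m)"
  by (rule finite_complexI[of _ m]) (auto simp: vr_def subset_iff)

lemma Union_Diff_Inter_flip:
  assumes "\<And>s. s \<in> S \<Longrightarrow> flip a s \<subseteq> U" "S \<noteq> {}"
  shows "\<Union> S - \<Inter> S \<subseteq> U"
proof
  fix i assume "i \<in> \<Union> S - \<Inter> S"
  then obtain s t where "s \<in> S" "i \<in> s" "t \<in> S" "i \<notin> t" by blast
  then have "i \<in> flip a s \<or> i \<in> flip a t" by (auto simp: mem_flip)
  then show "i \<in> U" using assms(1) \<open>s \<in> S\<close> \<open>t \<in> S\<close> by blast
qed

lemma dim_span_le:
  assumes "\<And>s. s \<in> S \<Longrightarrow> flip a s \<subseteq> U" "S \<noteq> {}" "finite U"
  shows "dim_span S \<le> card U"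
  unfolding dim_span_def by (rule card_mono[OF assms(3) Union_Diff_Inter_flip[OF assms(1,2)]])

text \<open>A vertex in the face spanned by other members may be added or removed without affecting
  the span.\<close>

lemma span_toggle:
  assumes "X \<subseteq> S - {c}" "X \<noteq> {}" "\<Inter> X \<subseteq> c" "c \<subseteq> \<Union> X"
  shows "dim_span (toggle c S) = dim_span S"
proof -
  have sub: "S - {c} \<subseteq> toggle c S" "toggle c S \<subseteq> insert c S" "S - {c} \<subseteq> S" "S \<subseteq> insert c S"
    by (auto simp: toggle_def)
  have "\<Inter> (S - {c}) \<subseteq> c" using assms(3) Inter_anti_mono[OF assms(1)] by (rule order_trans[rotated])
  then have I: "\<Inter> (insert c S) = \<Inter> (S - {c})"
    using Inter_insert[of c "S - {c}"] by (simp add: Int_absorb1)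
  have "c \<subseteq> \<Union> (S - {c})" using assms(4) Union_mono[OF assms(1)] by (rule order_trans)
  then have U: "\<Union> (insert c S) = \<Union> (S - {c})"
    using Union_insert[of c "S - {c}"] by (simp add: Un_absorb1)
  have "\<Inter> T = \<Inter> (S - {c}) \<and> \<Union> T = \<Union> (S - {c})" if "S - {c} \<subseteq> T" "T \<subseteq> insert c S" for T
    using Inter_anti_mono[OF that(1)] Inter_anti_mono[OF that(2)] Union_mono[OF that(1)] Union_mono[OF that(2)]
    unfolding I U by (simp add: subset_antisym)
  then show ?thesis using sub unfolding dim_span_def by metis
qed

lemma between_neighbours:
  assumes "ham a x = 1" "ham a y = 1" "x \<noteq> y"
  shows "x \<inter> y \<subseteq> a" "a \<subseteq> x \<union> y"
proof -
  obtain i j where "x = flip a {i}" "y = flip a {j}" using assms(1,2) unfolding ham_eq_1 by blast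
  then show "x \<inter> y \<subseteq> a" "a \<subseteq> x \<union> y" using assms(3) by (auto simp: mem_flip)
qed

text \<open>Three neighbours of \<open>a\<close> together with a vertex at distance 4 from \<open>a\<close>: the simplex may contain the
  vertex \<open>flip a I\<close> completing the three to a half of a 3-cube, but not \<open>a\<close>.\<close>

definition obstruction :: "nat set set \<Rightarrow> nat set \<Rightarrow> nat set \<Rightarrow> nat set \<Rightarrow> bool" where
  "obstruction S a I w \<longleftrightarrow> card I = 3 \<and> (\<lambda>i. flip a {i}) ` I \<subseteq> S \<and> w \<in> S \<and> ham a w = 4"

lemma obstruction_mono: "obstruction S a I w \<Longrightarrow> S \<subseteq> T \<Longrightarrow> obstruction T a I w"
  by (auto simp: obstruction_def)

text \<open>Seen from \<open>a\<close>, a member is the set \<open>W = flip a s\<close>. Being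
  within 3 of the neighbours forces \<open>W\<close> to have at most four elements, and to contain
  \<open>I\<close> if it has three or four; being within 3 of a 4-element set puts smaller sets
  inside it. Two different 4-element sets meet exactly in \<open>I\<close>. So \<open>W\<close> is
  \<open>I\<close> plus one element or lies inside \<open>I\<close>, and unless it is a singleton it
  is within 1 of \<open>I\<close>.\<close>

lemma obstruction_classify:
  assumes S: "S \<in> vr m" "dim_span S \<ge> 5" and ob: "obstruction S a I w" and s: "s \<in> S"
  shows "s \<in> (\<lambda>i. flip a {i}) ` I \<or> ham s (flip a I) \<le> 1"
proof -
  have I: "card I = 3" "finite I" and IS: "\<And>i. i \<in> I \<Longrightarrow> flip a {i} \<in> S" and w: "w \<in> S" "ham a w = 4"
    using ob by (auto simp: obstruction_def intro: card_ge_0_finite)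
  have fina: "finite a" by (rule finite_of_ham_pos[of a w]) (use w vrD(4)[OF S(1)] in auto)
  have finW: "finite (flip a s)" if "s \<in> S" for s using fina vrD(4)[OF S(1) that] by simp
  have near: "card (flip (flip a s) {i}) \<le> 3" if "s \<in> S" "i \<in> I" for s i
    using vrD(3)[OF S(1) that(1) IS[OF that(2)]] ham_flip(3)[of a "flip a s" "flip a {i}"] by (simp add: ham_def)
  have near': "card (flip (flip a s) (flip a t)) \<le> 3" if "s \<in> S" "t \<in> S" for s t
    using vrD(3)[OF S(1) that] by (simp add: ham_def flip_left_cancel)
  have sup: "I \<subseteq> flip a t" if "t \<in> S" "card (flip a t) = 4" for t
  proof
    fix i assume "i \<in> I"
    then show "i \<in> flip a t"
      using near[OF that(1)] card_flip_singleton(2)[OF finW[OF that(1)], of i] that(2) by fastforce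
  qed
  have cases: "flip a s \<noteq> {} \<and> (flip a s \<subseteq> flip a t \<or> I \<subseteq> flip a s \<and> card (flip a s) = 4)"
    if "s \<in> S" "t \<in> S" "card (flip a t) = 4" for s t
  proof -
    let ?W = "flip a s" and ?U = "flip a t"
    have cf: "card (flip ?W ?U) + 2 * card (?W \<inter> ?U) = card ?W + 4"
      using card_flip[OF finW[OF that(1)] finW[OF that(2)]] that(3) by simp
    have le: "card (?W \<inter> ?U) \<le> card ?W" by (rule card_mono[OF finW[OF that(1)]]) auto
    have n: "card (flip ?W ?U) \<le> 3" by (rule near'[OF that(1,2)])
    have ne: "card ?W \<noteq> 0" using cf n le by simp
    obtain i where i: "i \<in> I" using I(1) by fastforce
    have W5: "card ?W \<le> 4"
      using near[OF that(1) i] card_flip_singleton[OF finW[OF that(1)], of i] by (cases "i \<in> ?W") auto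
    consider "card ?W \<le> 2" | "card ?W = 3" | "card ?W = 4" using W5 by linarith
    then show ?thesis
    proof cases
      case 1
      then have "card (?W \<inter> ?U) = card ?W" using cf n le ne by linarith
      then have "?W \<inter> ?U = ?W" by (intro card_subset_eq finW[OF that(1)]) auto
      then show ?thesis using ne by auto
    next
      case 2
      have "I \<subseteq> ?W"
      proof
        fix i assume i: "i \<in> I"
        show "i \<in> ?W"
        proof (rule ccontr)
          assume "i \<notin> ?W"
          then have "card (flip ?W {i}) = 4" using card_flip_singleton(2)[OF finW[OF that(1)]] 2 by simp
          then show False using near[OF that(1) i] by simp
        qed
      qed
      then have "I = ?W" by (intro card_subset_eq finW[OF that(1)]) (use 2 I in auto)
      then show ?thesis using sup[OF that(2,3)] ne by auto
    next
      case 3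
      then show ?thesis using sup[OF that(1) 3] ne by auto
    qed
  qed
  have U: "card (flip a w) = 4" using w(2) by (simp add: ham_def)
  \<comment> \<open>With a single 4-element set, everything would lie inside it and the span would
    be four.\<close>
  have "\<exists>t\<in>S. card (flip a t) = 4 \<and> flip a t \<noteq> flip a w"
  proof (rule ccontr)
    assume no: "\<not> ?thesis"
    have "flip a s \<subseteq> flip a w" if "s \<in> S" for s
      using cases[OF that w(1) U] no that by blast
    then have "dim_span S \<le> card (flip a w)"
      using dim_span_le[of S a "flip a w"] vrD(2)[OF S(1)] finW[OF w(1)] by blast
    then show False using U S(2) by simp
  qed
  then obtain t where t: "t \<in> S" "card (flip a t) = 4" "flip a t \<noteq> flip a w" by blast
  have Iw: "flip a w \<inter> flip a t = I"
  proof (rule sym, rule card_seteq)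
    show "finite (flip a w \<inter> flip a t)" using finW[OF w(1)] by simp
    show "I \<subseteq> flip a w \<inter> flip a t" using sup[OF w(1) U] sup[OF t(1,2)] by blast
    have "card (flip a w \<inter> flip a t) < card (flip a w)"
    proof (rule psubset_card_mono[OF finW[OF w(1)]])
      have "\<not> flip a w \<subseteq> flip a t" using card_subset_eq[OF finW[OF t(1)], of "flip a w"] t U by auto
      then show "flip a w \<inter> flip a t \<subset> flip a w" by blast
    qed
    then show "card (flip a w \<inter> flip a t) \<le> card I" using U I by simp
  qed
  have hs: "ham s (flip a I) = card (flip (flip a s) I)"
    using ham_flip(3)[of a "flip a s" "flip a I"] by (simp add: ham_def)
  have ne: "flip a s \<noteq> {}" using cases[OF s w(1) U] by blast
  show ?thesis
  proof (cases "I \<subseteq> flip a s \<and> card (flip a s) = 4")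
    case True
    then have "flip a s \<inter> I = I" by blast
    then have "card (flip (flip a s) I) = 1" using card_flip[OF finW[OF s] I(2)] True I by simp
    then show ?thesis using hs by simp
  next
    case False
    then have sub: "flip a s \<subseteq> I" using cases[OF s w(1) U] cases[OF s t(1,2)] Iw by blast
    then have "flip a s \<inter> I = flip a s" by blast
    then have c: "card (flip (flip a s) I) + card (flip a s) = 3" using card_flip[OF finW[OF s] I(2)] I by simp
    show ?thesis
    proof (cases "card (flip a s) = 1")
      case True
      then obtain i where "flip a s = {i}" by (rule card_1_singletonE)
      then have "s = flip a {i}" "i \<in> I" using sub flip_flip[of a s] by auto
      then show ?thesis by blast
    next
      case False
      moreover have "card (flip a s) \<noteq> 0" using ne finW[OF s] by simp
      ultimately show ?thesis using c hs by linarith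
    qed
  qed
qed

lemma obstruction_dist:
  assumes S: "S \<in> vr m" and ob: "obstruction S a I w"
  shows "finite a" "i \<in> I \<Longrightarrow> ham w (flip a {i}) = 3" "i \<in> I \<Longrightarrow> ham a (flip a {i}) = 1"
    "i \<in> I \<Longrightarrow> ham (flip a I) (flip a {i}) = 2" "ham a (flip a I) = 3"
    "card ((\<lambda>i. flip a {i}) ` I) = 3"
proof -
  have I: "card I = 3" "finite I" and IS: "\<And>i. i \<in> I \<Longrightarrow> flip a {i} \<in> S" and w: "w \<in> S" "ham a w = 4"
    using ob by (auto simp: obstruction_def intro: card_ge_0_finite)
  show fina: "finite a" by (rule finite_of_ham_pos[of a w]) (use w vrD(4)[OF S] in auto)
  show a1: "ham a (flip a {i}) = 1" for i by (simp add: ham_flip)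
  show "ham a (flip a I) = 3" using I by (simp add: ham_flip)
  show "ham w (flip a {i}) = 3" if i: "i \<in> I"
    using vrD(3)[OF S w(1) IS[OF i]] ham_triangle[of a "flip a {i}" w] a1[of i] w(2) fina
      vrD(4)[OF S w(1)] by (simp add: ham_commute)
  show "ham (flip a I) (flip a {i}) = 2" if i: "i \<in> I"
    using card_flip[OF I(2), of "{i}"] i I(1) by (simp add: ham_flip) (simp add: ham_def)
  have "inj_on (\<lambda>i. flip a {i}) I" by (auto simp: inj_on_def flip_eq_iff)
  then show "card ((\<lambda>i. flip a {i}) ` I) = 3" using I by (simp add: card_image)
qed

text \<open>The vertex \<open>w'\<close> is at distance 3 from all three neighbours of
  \<open>a'\<close>. By the classification \<open>w'\<close> is within 1 of the apex; then the
  neighbours of \<open>a'\<close> are not, so they are the neighbours of \<open>a\<close> in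
  question, and three common neighbours force \<open>a' = a\<close>.\<close>

lemma obstruction_unique:
  assumes S: "S \<in> vr m" "dim_span S \<ge> 5" and ob: "obstruction S a I w" and ob': "obstruction S a' I' w'"
  shows "flip a' I' = flip a I"
proof -
  let ?X = "(\<lambda>i. flip a {i}) ` I" and ?X' = "(\<lambda>i. flip a' {i}) ` I'"
  note d = obstruction_dist[OF S(1) ob] and d' = obstruction_dist[OF S(1) ob']
  note cl = obstruction_classify[OF S ob]
  have sub: "?X \<subseteq> S" "?X' \<subseteq> S" "w' \<in> S" "ham a' w' = 4" "finite I"
    using ob ob' by (auto simp: obstruction_def intro: card_ge_0_finite)
  have fe: "finite (flip a I)" using d(1) sub by simp
  have fS: "finite s" if "s \<in> S" for s using vrD(4)[OF S(1) that] .
  have "ham w' (flip a I) \<le> 1"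
  proof (rule ccontr)
    assume far: "\<not> ?thesis"
    then have w'X: "w' \<in> ?X" using cl[OF sub(3)] by blast
    then have w'2: "ham (flip a I) w' = 2" using d(4) by auto
    \<comment> \<open>Two of the three neighbours of \<open>a\<close> are within 2 of each other,
      but \<open>z\<close> is at distance 3 from \<open>w'\<close>; so \<open>z\<close> is near the
      apex, and being 3 away from a vertex at distance 2 it is not the apex itself.\<close>
    have e1: "ham (flip a I) z = 1" if z: "z \<in> ?X'" for z
    proof -
      have zS: "z \<in> S" and w'z: "ham w' z = 3" using z sub d'(2) by auto
      have "z \<notin> ?X"
      proof
        assume "z \<in> ?X"
        then obtain i j where "z = flip a {i}" "w' = flip a {j}" using w'X by auto
        then have "ham w' z = card (flip {j} {i})" by (simp add: ham_flip) (simp add: ham_def)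
        also have "\<dots> \<le> card {i, j}" by (rule card_mono) (auto simp: mem_flip)
        also have "\<dots> \<le> 2" by (simp add: card_insert_if)
        finally have "ham w' z \<le> 2" .
        then show False using w'z by simp
      qed
      then have "ham z (flip a I) \<le> 1" using cl[OF zS] by blast
      moreover have "ham w' z \<le> ham w' (flip a I) + ham (flip a I) z"
        by (rule ham_triangle) (use fe fS zS sub in auto)
      ultimately show ?thesis using w'2 w'z by (simp add: ham_commute)
    qed
    have "flip a I = a'"
      by (rule common_neighbour_unique[of ?X']) (use d' e1 fe in auto)
    then show False using sub(4) w'2 by simp
  qed
  have "?X' \<subseteq> ?X"
  proof
    fix z assume z: "z \<in> ?X'"
    have zS: "z \<in> S" and w'z: "ham w' z = 3" using z sub d'(2) by auto
    have "ham w' z \<le> ham w' (flip a I) + ham (flip a I) z"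
      by (rule ham_triangle) (use fe fS zS sub in auto)
    then have "\<not> ham z (flip a I) \<le> 1" using w'z \<open>ham w' (flip a I) \<le> 1\<close> by (simp add: ham_commute)
    then show "z \<in> ?X" using cl[OF zS] by blast
  qed
  then have X: "?X' = ?X" using d(6) d'(6) sub(5) by (intro card_subset_eq) auto
  have "ham a' z = 1" if "z \<in> ?X" for z
    using that d'(3) unfolding X[symmetric] by blast
  then have "a = a'"
    by (intro common_neighbour_unique[of ?X]) (use d(1,3,6) d'(1) in auto)
  moreover have "inj (\<lambda>i. flip a {i})" by (auto simp: inj_def flip_eq_iff)
  ultimately have "I' = I" using X by (simp add: inj_image_eq_iff)
  then show ?thesis using \<open>a = a'\<close> by simp
qed

text \<open>A new obstruction uses \<open>c\<close>, either as the far vertex or as one of the three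
  neighbours, and these are at distance 3 from each other. Hence adding a vertex within 2 of all
  members creates no obstruction.\<close>

lemma obstruction_insert:
  assumes "insert c S \<in> vr m" "obstruction (insert c S) a I w" "\<And>a I w. \<not> obstruction S a I w"
  shows "\<exists>s\<in>S. ham c s = 3"
proof -
  note d = obstruction_dist[OF assms(1,2)]
  have wS: "w \<in> insert c S" and IS: "\<And>i. i \<in> I \<Longrightarrow> flip a {i} \<in> insert c S" and "card I = 3" "ham a w = 4"
    using assms(2) by (auto simp: obstruction_def)
  then obtain i0 where i0: "i0 \<in> I" by fastforce
  show ?thesis
  proof (cases "w = c")
    case True
    then have "flip a {i0} \<noteq> c" using d(2)[OF i0] by (metis ham_self zero_neq_numeral)
    then show ?thesis using d(2)[OF i0] IS[OF i0] True by auto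
  next
    case False
    then have "\<not> (\<lambda>i. flip a {i}) ` I \<subseteq> S"
      using assms(3)[of a I w] \<open>card I = 3\<close> \<open>ham a w = 4\<close> wS by (auto simp: obstruction_def)
    then obtain i where "i \<in> I" "flip a {i} = c" using IS by blast
    then show ?thesis using d(2)[of i] wS False by (auto simp: ham_commute)
  qed
qed

section \<open>Common neighbours in unobstructed simplices\<close>

definition unobstructed :: "nat set set \<Rightarrow> bool" where
  "unobstructed S \<longleftrightarrow> (\<forall>a I w. \<not> obstruction S a I w)"

lemma ham_even_le:
  assumes "ham x y \<le> 3" "finite x" "finite y" "even (card x) = even (card y)"
  shows "ham x y \<le> 2"
proof -
  have "even (ham x y)" using even_ham[OF assms(2,3)] assms(4) by simp
  then show ?thesis using assms(1) by (cases "ham x y = 3") auto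
qed

text \<open>Two difference sets of size 2 at distance 2 share exactly one element \<open>p\<close>;
  flipping \<open>p\<close> at the common vertex \<open>x\<close> gives the centre.\<close>

lemma three_points_star:
  assumes fin: "finite x" "finite y" "finite z" and d: "ham x y = 2" "ham x z = 2" "ham y z = 2"
  obtains a I where "card I = 3" "{x, y, z} = (\<lambda>i. flip a {i}) ` I" "finite a"
proof -
  define Y where "Y = flip x y"
  define Z where "Z = flip x z"
  have finYZ: "finite Y" "finite Z" using fin by (simp_all add: Y_def Z_def)
  have cY: "card Y = 2" "card Z = 2" using d by (simp_all add: Y_def Z_def ham_def)
  have "card (flip Y Z) = 2" using d(3) by (simp add: Y_def Z_def ham_def flip_left_cancel)
  then have "card (Y \<inter> Z) = 1" using card_flip[OF finYZ] cY by simp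
  then obtain p where p: "Y \<inter> Z = {p}" by (rule card_1_singletonE)
  have "card (Y - {p}) = 1" "card (Z - {p}) = 1" using cY p finYZ by (auto simp: card_Diff_singleton_if)
  then obtain q r where "Y - {p} = {q}" "Z - {p} = {r}" by (meson card_1_singletonE)
  then have qr: "Y = {p, q}" "Z = {p, r}" "q \<noteq> p" "r \<noteq> p" "q \<noteq> r" using p by auto
  define a where "a = flip x {p}"
  have "x = flip a {p}" by (auto simp: a_def mem_flip)
  moreover have "y = flip x Y" "z = flip x Z" by (simp_all add: Y_def Z_def)
  then have "y = flip a {q}" "z = flip a {r}" using qr by (auto simp: a_def mem_flip)
  ultimately have "{x, y, z} = (\<lambda>i. flip a {i}) ` {p, q, r}" by auto
  moreover have "card {p, q, r} = 3" using qr by simp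
  moreover have "finite a" using fin by (simp add: a_def)
  ultimately show thesis using that by blast
qed

text \<open>A member \<open>s\<close> outside the 3-cube lies at distance 4 from one of the four
  vertices adjacent to three vertices of the half: from \<open>a\<close> if it differs from
  \<open>a\<close> in all of \<open>I\<close>, otherwise from the one obtained by moving the
  centre.\<close>

lemma half_cube_obstruction:
  assumes S: "S \<in> vr m" "dim_span S \<ge> 5" and I: "card I = 3" "\<And>i. i \<in> I \<Longrightarrow> flip a {i} \<in> S"
    and e: "flip a I \<in> S" and fina: "finite a"
  shows "\<not> unobstructed S"
proof -
  have finI: "finite I" using I(1) by (intro card_ge_0_finite) simp
  have "\<exists>s\<in>S. \<not> flip a s \<subseteq> I"
  proof (rule ccontr)
    assume "\<not> ?thesis"
    then have "dim_span S \<le> card I" using dim_span_le[of S a I] vrD(2)[OF S(1)] finI by blast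
    then show False using S(2) I(1) by simp
  qed
  then obtain s where s: "s \<in> S" "\<not> flip a s \<subseteq> I" by blast
  define W where "W = flip a s"
  have finW: "finite W" using fina vrD(4)[OF S(1) s(1)] by (simp add: W_def)
  have cW: "card W = card (W \<inter> I) + card (W - I)"
    using card_Diff_subset_Int[of W I] finW card_mono[OF finW, of "W \<inter> I"] by simp
  have v: "card (W - I) \<ge> 1"
  proof -
    have "W - I \<noteq> {}" using s(2) by (auto simp: W_def)
    then show ?thesis using finW by (metis One_nat_def Suc_leI card_gt_0_iff finite_Diff)
  qed
  have "card (flip W I) = ham s (flip a I)"
    using ham_flip(3)[of a s I] by (simp add: ham_def W_def)
  then have "card (flip W I) \<le> 3" using vrD(3)[OF S(1) s(1) e] by simp
  then have vw: "card (W - I) \<le> card (W \<inter> I)" using card_flip[OF finW finI] I(1) cW by linarith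
  have near: "card (flip W {i}) \<le> 3" if "i \<in> I" for i
    using vrD(3)[OF S(1) s(1) I(2)[OF that]] ham_flip(3)[of a s "{i}"] by (simp add: ham_def W_def)
  show ?thesis
  proof (cases "I \<subseteq> W")
    case True
    then have "W \<inter> I = I" by blast
    obtain i where i: "i \<in> I" using I(1) by fastforce
    have "card W \<le> 4" using near[OF i] card_flip_singleton(1)[OF finW, of i] True i by auto
    then have "card W = 4" using cW v I(1) \<open>W \<inter> I = I\<close> by simp
    then have "obstruction S a I s" using I s by (auto simp: obstruction_def ham_def W_def)
    then show ?thesis by (auto simp: unobstructed_def)
  next
    case False
    then obtain j where "j \<in> I" "j \<notin> W" by blast
    then have "card W \<le> 2" using near[of j] card_flip_singleton(2)[OF finW, of j] by simp
    then have c1: "card (W \<inter> I) = 1" "card (W - I) = 1" using cW v vw by linarith+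
    then obtain i0 where i0: "W \<inter> I = {i0}" by (meson card_1_singletonE)
    have i0I: "i0 \<in> I" "i0 \<in> W" using i0 by blast+
    \<comment> \<open>The new centre is adjacent to \<open>flip a I\<close> and to the two spokes of
      \<open>a\<close> other than \<open>i0\<close>. From \<open>s\<close> it differs in the two
      elements of \<open>I - {i0}\<close> and in the two elements of \<open>W\<close>.\<close>
    define a' where "a' = flip a (I - {i0})"
    have c2: "card (I - {i0}) = 2" using I(1) i0I finI by simp
    have "flip a' {i} \<in> S" if i: "i \<in> I" for i
    proof (cases "i = i0")
      case True
      then have "flip a' {i} = flip a I" using i0I by (auto simp: a'_def mem_flip)
      then show ?thesis using e by simp
    next
      case False
      then have "card (I - {i0} - {i}) = 1" using c2 i by simp
      then obtain k where k: "I - {i0} - {i} = {k}" by (rule card_1_singletonE)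
      then have kI: "k \<in> I" "k \<noteq> i" by blast+
      have "I - {i0} = insert i (I - {i0} - {i})" using i False by (simp add: insert_absorb)
      then have I': "I - {i0} = {i, k}" unfolding k .
      have "flip a' {i} = flip a {k}" unfolding a'_def I' using kI(2) by (auto simp: mem_flip)
      then show ?thesis using I(2)[OF kI(1)] by simp
    qed
    moreover have "ham a' s = 4"
    proof -
      have "ham a' s = card (flip (I - {i0}) W)" using ham_flip(3)[of a "I - {i0}" s] by (simp add: a'_def ham_def W_def)
      moreover have "(I - {i0}) \<inter> W = {}" using i0 by blast
      ultimately show ?thesis using card_flip[of "I - {i0}" W] finI finW c1 c2 cW by simp
    qed
    ultimately have "obstruction S a' I s" using I(1) s(1) by (auto simp: obstruction_def)
    then show ?thesis by (auto simp: unobstructed_def)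
  qed
qed

text \<open>Members of one parity are pairwise at distance 2, so three of them have a common
  neighbour \<open>a\<close>. A further one not adjacent to \<open>a\<close> would complete half of
  a 3-cube, and a member of the other parity has even distance from \<open>a\<close>, where 4 would
  be an obstruction.\<close>

lemma star_centre:
  assumes S: "S \<in> vr m" "dim_span S \<ge> 5" "unobstructed S"
    and Z: "Z \<subseteq> S" "card Z \<ge> 3" "\<And>z. z \<in> Z \<Longrightarrow> even (card z) = c"
  obtains a where "finite a" "\<And>z. z \<in> Z \<Longrightarrow> ham a z = 1" "\<And>s. s \<in> S \<Longrightarrow> even (card s) \<noteq> c \<Longrightarrow> ham a s \<le> 2"
proof -
  obtain T where T: "T \<subseteq> Z" "card T = 3" by (metis obtain_subset_with_card_n Z(2))
  then obtain x y z where xyz: "T = {x, y, z}" "x \<noteq> y" "x \<noteq> z" "y \<noteq> z" by (auto simp: card_3_iff)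
  have inZ: "x \<in> Z" "y \<in> Z" "z \<in> Z" using T xyz by auto
  have finS: "finite s" if "s \<in> S" for s using vrD(4)[OF S(1) that] .
  have d2: "ham u v = 2" if "u \<in> Z" "v \<in> Z" "u \<noteq> v" for u v
  proof -
    have uv: "u \<in> S" "v \<in> S" using that Z(1) by auto
    have "ham u v \<le> 2" by (rule ham_even_le) (use uv vrD(3)[OF S(1)] finS Z(3) that in auto)
    moreover have "ham u v \<noteq> 0" using ham_eq_0 finS uv that by blast
    moreover have "even (ham u v)" using even_ham finS uv Z(3) that by simp
    ultimately show ?thesis by (cases "ham u v = 1") auto
  qed
  obtain a I where aI: "card I = 3" "{x, y, z} = (\<lambda>i. flip a {i}) ` I" "finite a"
    by (rule three_points_star[of x y z]) (use inZ Z(1) finS d2 xyz in auto)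
  have finI: "finite I" using aI(1) by (intro card_ge_0_finite) simp
  have IZ: "flip a {i} \<in> Z" if "i \<in> I" for i
  proof -
    have "flip a {i} \<in> {x, y, z}" unfolding aI(2) using that by (rule imageI)
    then show ?thesis using inZ by auto
  qed
  then have IS: "flip a {i} \<in> S" if "i \<in> I" for i using that Z(1) by blast
  obtain i0 where i0: "i0 \<in> I" using aI(1) by fastforce
  have "odd (ham a (flip a {i0}))" by (simp add: ham_flip)
  then have par: "even (card a) \<noteq> c"
    using even_ham[OF aI(3) finS[OF IS[OF i0]]] Z(3)[OF IZ[OF i0]] by simp
  have "ham a w = 1" if w: "w \<in> Z" for w
  proof (rule ccontr)
    assume n1: "ham a w \<noteq> 1"
    have wS: "w \<in> S" using w Z(1) by blast
    define W where "W = flip a w"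
    have finW: "finite W" using aI(3) finS[OF wS] by (simp add: W_def)
    have "odd (ham a w)" using even_ham[OF aI(3) finS[OF wS]] par Z(3)[OF w] by auto
    then have cW: "odd (card W)" "card W \<noteq> 1" using n1 by (simp_all add: W_def ham_def)
    have near: "card (flip W {i}) \<le> 2" if "i \<in> I" for i
    proof -
      have "ham w (flip a {i}) \<le> 2"
        by (rule ham_even_le) (use vrD(3)[OF S(1) wS IS[OF that]] finS wS IS[OF that] Z(3)[OF w] Z(3)[OF IZ[OF that]] in auto)
      then show ?thesis using ham_flip(3)[of a w "{i}"] by (simp add: ham_def W_def)
    qed
    have IW: "I \<subseteq> W"
    proof
      fix i assume i: "i \<in> I"
      show "i \<in> W"
      proof (rule ccontr)
        assume "i \<notin> W"
        then have "card W \<le> 1" using near[OF i] card_flip_singleton(2)[OF finW] by fastforce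
        then show False using cW by (cases "card W = 0") auto
      qed
    qed
    have "card W \<le> 3" using near[OF i0] card_flip_singleton(1)[OF finW, of i0] IW i0 by auto
    then have "I = W" using card_seteq[OF finW IW] aI(1) by simp
    then have "flip a I \<in> S" using wS by (simp add: W_def)
    then have "\<not> unobstructed S" by (intro half_cube_obstruction[OF S(1,2) aI(1) IS]) (use aI in auto)
    then show False using S(3) by simp
  qed
  moreover have "ham a s \<le> 2" if s: "s \<in> S" "even (card s) \<noteq> c" for s
  proof (rule ccontr)
    assume n: "\<not> ?thesis"
    have ev: "even (ham a s)" using even_ham[OF aI(3) finS[OF s(1)]] par s(2) by auto
    have "ham a s \<le> ham a (flip a {i0}) + ham (flip a {i0}) s"
      by (rule ham_triangle) (use aI(3) finS s(1) in auto)
    also have "\<dots> \<le> 4" using vrD(3)[OF S(1) IS[OF i0] s(1)] by (simp add: ham_flip)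
    finally have "ham a s = 4" using n ev by (cases "ham a s = 3") auto
    then have "obstruction S a I s" using aI(1) IS s(1) by (auto simp: obstruction_def)
    then show False using S(3) by (auto simp: unobstructed_def)
  qed
  ultimately show thesis by (rule that[OF aI(3)])
qed

definition evens :: "nat set set \<Rightarrow> nat set set" where
  "evens S = {x \<in> S. even (card x)}"

text \<open>The candidates for toggling: being within 2 of all members, they violate neither the
  diameter bound nor unobstructedness.\<close>

definition even_centres :: "nat set set \<Rightarrow> nat set set" where
  "even_centres S = {a. (\<forall>x\<in>evens S. ham a x = 1) \<and> (\<forall>y\<in>S - evens S. ham a y \<le> 2)}"

text \<open>Two even vertices at distance 2 have just two common neighbours. If each is too far from
  some odd member, the two witnesses confine all of \<open>S\<close> to four coordinates.\<close>

lemma even_centre_of_pair: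
  assumes S: "S \<in> vr m" "dim_span S \<ge> 5" and E: "evens S = {x, y}" "x \<noteq> y"
  shows "even_centres S \<noteq> {}"
proof (rule ccontr)
  assume "\<not> ?thesis"
  then have none: "even_centres S = {}" by simp
  have finS: "finite s" if "s \<in> S" for s using vrD(4)[OF S(1) that] .
  have xy: "x \<in> S" "y \<in> S" "even (card x)" "even (card y)" using E(1) by (auto simp: evens_def)
  have "ham x y \<le> 2" by (rule ham_even_le) (use vrD(3)[OF S(1)] xy finS in auto)
  moreover have "even (ham x y)" using even_ham finS xy by simp
  moreover have "ham x y \<noteq> 0" using ham_eq_0 finS xy E(2) by blast
  ultimately have "ham x y = 2" by (cases "ham x y = 1") auto
  then obtain i j where ij: "flip x y = {i, j}" "i \<noteq> j" by (auto simp: ham_def card_2_iff)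
  have yx: "y = flip x {i, j}" using ij(1) flip_flip[of x y] by simp
  define W where "W = (\<lambda>s. flip x s)"
  have finW: "finite (W s)" if "s \<in> S" for s using finS xy(1) that by (simp add: W_def)
  have dW: "card (flip (W s) (W t)) = ham s t" for s t by (simp add: W_def ham_def flip_left_cancel)
  have odd3: "odd (card (W s)) \<and> card (W s) \<le> 3 \<and> card (flip (W s) {i, j}) \<le> 3" if s: "s \<in> S - evens S" for s
  proof -
    have "odd (ham x s)" using even_ham[OF finS[OF xy(1)] finS[of s]] s xy(3) by (simp add: evens_def)
    moreover have "ham x s \<le> 3" "ham s y \<le> 3" using vrD(3)[OF S(1)] s xy by auto
    moreover have "W y = {i, j}" using ij by (simp add: W_def)
    ultimately show ?thesis using dW[of s y] by (simp add: W_def ham_def)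
  qed
  have dW2: "card (flip (W s) (W t)) \<le> 2" if "s \<in> S - evens S" "t \<in> S - evens S" for s t
    unfolding dW by (rule ham_even_le) (use that vrD(3)[OF S(1)] finS in \<open>auto simp: evens_def\<close>)
  \<comment> \<open>The common neighbour obtained by flipping \<open>k\<close> fails only because of
    an odd member that differs from \<open>x\<close> in exactly three coordinates, \<open>l\<close>
    among them and \<open>k\<close> not.\<close>
  have witness: "\<exists>s\<in>S - evens S. k \<notin> W s \<and> l \<in> W s \<and> card (W s) = 3" if kl: "{k, l} = {i, j}" "k \<noteq> l" for k l
  proof -
    have "ham (flip x {k}) z = 1" if "z \<in> evens S" for z
    proof -
      have "z = x \<or> z = flip (flip x {k}) {l}" using that E(1) yx kl by (auto simp: mem_flip)
      moreover have "ham (flip x {k}) x = 1" "ham (flip x {k}) (flip (flip x {k}) {l}) = 1"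
        using ham_flip(2)[of x "{k}"] ham_flip(2)[of "flip x {k}" "{l}"] by (simp_all add: ham_commute)
      ultimately show ?thesis by blast
    qed
    moreover have "flip x {k} \<notin> even_centres S" using none by blast
    ultimately obtain s where s: "s \<in> S - evens S" "\<not> ham (flip x {k}) s \<le> 2"
      unfolding even_centres_def by blast
    have "ham (flip x {k}) s = card (flip (W s) {k})"
      using ham_flip(3)[of x "{k}" s] by (simp add: ham_def W_def flip_commute)
    then have big: "card (flip (W s) {k}) \<ge> 3" using s(2) by simp
    note o = odd3[OF s(1)]
    have fW: "finite (W s)" using finW s(1) by blast
    have k: "k \<notin> W s" using big o card_flip_singleton(1)[OF fW, of k] by auto
    then have "card (W s) \<ge> 2" using big card_flip_singleton(2)[OF fW, of k] by simp
    then have c3: "card (W s) = 3" using o by (cases "card (W s) = 2") auto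
    have "card (flip (W s) {k, l}) + 2 * card (W s \<inter> {k, l}) = 5"
      using card_flip[OF fW, of "{k, l}"] c3 kl(2) by simp
    moreover have "card (flip (W s) {k, l}) \<le> 3" using o kl(1) by simp
    ultimately have "card (W s \<inter> {k, l}) \<noteq> 0" by linarith
    then have "W s \<inter> {k, l} \<noteq> {}" by (metis card.empty)
    then have "l \<in> W s" using k by blast
    then show ?thesis using k c3 s(1) by blast
  qed
  obtain s where s: "s \<in> S - evens S" "i \<notin> W s" "j \<in> W s" "card (W s) = 3" using witness[of i j] ij by blast
  obtain t where t: "t \<in> S - evens S" "j \<notin> W t" "i \<in> W t" "card (W t) = 3" using witness[of j i] ij by blast
  \<comment> \<open>The two witnesses differ from \<open>x\<close> in a common pair of coordinates
    plus \<open>j\<close> and \<open>i\<close> respectively; these four coordinates turn out to be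
    all.\<close>
  define U where "U = {i, j} \<union> (W s \<inter> W t)"
  have fWs: "finite (W s)" "finite (W t)" using finW s(1) t(1) by auto
  have cst: "card (W s \<inter> W t) \<ge> 2" using card_flip[OF fWs] dW2[OF s(1) t(1)] s t by simp
  have "card (W s - {j}) = 2" "card (W t - {i}) = 2" using s t fWs by simp_all
  then have V: "W s \<inter> W t = W s - {j}" "W s \<inter> W t = W t - {i}"
    using cst s t fWs by (intro card_seteq; auto)+
  have Ws: "W s \<subseteq> U" "W t \<subseteq> U" using V by (auto simp: U_def)
  have cV: "card (W s \<inter> W t) = 2" using V \<open>card (W s - {j}) = 2\<close> by simp
  have finU: "finite U" using fWs by (simp add: U_def)
  have cU: "card U \<le> 4" using card_Un_le[of "{i, j}" "W s \<inter> W t"] cV ij(2) by (simp add: U_def)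
  have "flip x r \<subseteq> U" if r: "r \<in> S" for r
  proof (cases "r \<in> evens S")
    case True
    then have "r = x \<or> r = y" using E by simp
    then show ?thesis using ij(1) by (auto simp: U_def flip_def)
  next
    case False
    then have r': "r \<in> S - evens S" using r by blast
    note o = odd3[OF r']
    have fr: "finite (W r)" using finW r by blast
    \<comment> \<open>Odd members are within 2 of each other, so \<open>W r\<close> has more than
      half of its elements in each of the two witnesses.\<close>
    have c1: "card (W r) + 1 \<le> 2 * card (W r \<inter> W s)" "card (W r) + 1 \<le> 2 * card (W r \<inter> W t)"
      using card_flip[OF fr fWs(1)] card_flip[OF fr fWs(2)] dW2[OF r' s(1)] dW2[OF r' t(1)] s(4) t(4) by linarith+
    have c2: "card (W r \<inter> {i, j}) \<ge> 1" if "card (W r) = 3"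
      using card_flip[OF fr, of "{i, j}"] o ij(2) that by simp
    have "card (W r) = 1 \<or> card (W r) = 3" using o by (cases "card (W r) = 2"; cases "card (W r) = 0") auto
    then have "W r \<subseteq> U"
    proof
      assume "card (W r) = 1"
      then have "card (W r) \<le> card (W r \<inter> W s)" using c1 by linarith
      then have "W r \<inter> W s = W r" by (intro card_seteq fr) auto
      then show ?thesis using Ws by blast
    next
      assume c3: "card (W r) = 3"
      show ?thesis
      proof (rule ccontr)
        assume "\<not> W r \<subseteq> U"
        then have "W r \<inter> U \<subset> W r" by blast
        then have "card (W r \<inter> U) < 3" using psubset_card_mono[OF fr] c3 by metis
        then have le: "card (W r \<inter> U) \<le> card (W r \<inter> W s)" "card (W r \<inter> U) \<le> card (W r \<inter> W t)"
          using c1 c3 by linarith+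
        \<comment> \<open>If \<open>W r\<close> left \<open>U\<close>, both intersections would
          already exhaust \<open>W r \<inter> U\<close>; then \<open>W r\<close> would avoid
          \<open>i\<close> and \<open>j\<close>, although as a 3-element set it must meet
          them.\<close>
        have "W r \<inter> W s = W r \<inter> U" "W r \<inter> W t = W r \<inter> U"
          by (rule card_seteq; use fr Ws le in auto)+
        then have "W r \<inter> {i, j} = {}" using s(2) t(2) by (auto simp: U_def)
        then show False using c2[OF c3] by simp
      qed
    qed
    then show ?thesis by (simp add: W_def)
  qed
  then have "dim_span S \<le> card U" using dim_span_le[of S x U] vrD(2)[OF S(1)] finU by blast
  then show False using cU S(2) by simp
qed

lemma even_centres_nonempty:
  assumes S: "S \<in> vr m" "dim_span S \<ge> 5" "unobstructed S" and E: "card (evens S) \<ge> 2"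
  shows "even_centres S \<noteq> {}"
proof (cases "card (evens S) = 2")
  case True
  then obtain x y where "evens S = {x, y}" "x \<noteq> y" by (auto simp: card_2_iff)
  then show ?thesis by (rule even_centre_of_pair[OF S(1,2)])
next
  case False
  then have E3: "card (evens S) \<ge> 3" using E by simp
  show ?thesis
  proof (rule star_centre[OF S _ E3, of True])
    fix a assume "\<And>z. z \<in> evens S \<Longrightarrow> ham a z = 1" "\<And>s. s \<in> S \<Longrightarrow> even (card s) \<noteq> True \<Longrightarrow> ham a s \<le> 2"
    then have "a \<in> even_centres S" by (simp add: even_centres_def evens_def)
    then show ?thesis by blast
  qed (simp_all add: evens_def)
qed

text \<open>Otherwise \<open>S\<close> has at most three vertices, with pairwise distances at most
  3, 3 and, between the two odd ones, 2. Every coordinate in which they differ counts in two of the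
  distances, so the span is at most 8/2 = 4.\<close>

lemma card_odds:
  assumes S: "S \<in> vr m" "dim_span S \<ge> 5" and E: "card (evens S) \<le> 1"
  shows "card (S - evens S) \<ge> 3"
proof (rule ccontr)
  assume "\<not> ?thesis"
  then have O: "card (S - evens S) \<le> 2" by simp
  have finS: "finite s" if "s \<in> S" for s using vrD(4)[OF S(1) that] .
  have fO: "finite (S - evens S)" "finite (evens S)" using vrD(5)[OF S(1)] by (auto simp: evens_def)
  have ES: "evens S \<subseteq> S" by (auto simp: evens_def)
  show False
  proof (cases "S - evens S = {}")
    case True
    then have "S = evens S" using ES by blast
    then have "card S = 1" using E vrD(2,5)[OF S(1)] by (metis card_0_eq le_antisym less_one linorder_not_less)
    then obtain x where "S = {x}" by (rule card_1_singletonE)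
    then show False using S(2) by (simp add: dim_span_def)
  next
    case False
    then obtain y where y: "y \<in> S - evens S" by blast
    have "card (S - evens S - {y}) \<le> 1" using O y fO by simp
    then obtain z where z: "z \<in> S - evens S" "S - evens S \<subseteq> {y, z}"
    proof (cases "S - evens S - {y} = {}")
      case True
      then show thesis using that[of y] y by blast
    next
      case False
      then have "card (S - evens S - {y}) = 1" using \<open>card (S - evens S - {y}) \<le> 1\<close> fO
        by (metis card_0_eq finite_Diff le_antisym less_one linorder_not_less)
      then obtain z where "S - evens S - {y} = {z}" by (rule card_1_singletonE)
      then show thesis using that[of z] by blast
    qed
    obtain x where x: "x \<in> S" "evens S \<subseteq> {x}"
    proof (cases "evens S = {}")
      case True
      then show thesis using that[of y] y by blast
    next
      case False
      then have "card (evens S) = 1" using E fO by (metis card_0_eq le_antisym less_one linorder_not_less)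
      then obtain x where "evens S = {x}" by (rule card_1_singletonE)
      then show thesis using that[of x] ES by blast
    qed
    define A where "A = flip y x"
    define B where "B = flip y z"
    have fin: "finite A" "finite B" using finS x y z by (auto simp: A_def B_def)
    have a: "card A \<le> 3" using vrD(3)[OF S(1), of y x] x y by (simp add: A_def ham_def)
    have "ham y z \<le> 2" by (rule ham_even_le) (use vrD(3)[OF S(1)] y z finS in \<open>auto simp: evens_def\<close>)
    then have b: "card B \<le> 2" by (simp add: B_def ham_def)
    have c: "card (flip A B) \<le> 3" using vrD(3)[OF S(1), of x z] x z by (simp add: A_def B_def ham_def flip_left_cancel)
    have "card (A \<union> B) + card (A \<inter> B) = card A + card B" using card_Un_Int[OF fin] by simp
    then have "card (A \<union> B) \<le> 4" using card_flip[OF fin] a b c by linarith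
    moreover have "dim_span S \<le> card (A \<union> B)"
    proof (rule dim_span_le[of S y])
      fix s assume "s \<in> S"
      then have "s = x \<or> s = y \<or> s = z" using x z by blast
      then show "flip y s \<subseteq> A \<union> B" by (auto simp: A_def B_def flip_def)
    qed (use vrD(2)[OF S(1)] fin in auto)
    ultimately show False using S(2) by simp
  qed
qed

section \<open>Three collapses onto the filled 4-faces\<close>

definition vr_cubes :: "nat \<Rightarrow> nat set set set" where
  "vr_cubes m = vr m \<union> cube_simplices m"

text \<open>First stage of the collapse. Sets of span at most 4 are kept throughout, as only
  simplices of larger span are matched; the next stage keeps, of those, the simplices with at most
  one even vertex.\<close>

definition vr_cubes_unobstructed :: "nat \<Rightarrow> nat set set set" where
  "vr_cubes_unobstructed m = {S \<in> vr_cubes m. dim_span S \<le> 4 \<or> unobstructed S}"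

definition vr_cubes_few_evens :: "nat \<Rightarrow> nat set set set" where
  "vr_cubes_few_evens m = {S \<in> vr_cubes m. dim_span S \<le> 4 \<or> unobstructed S \<and> card (evens S) \<le> 1}"

lemma vr_cubesD:
  assumes "S \<in> vr_cubes m"
  shows "S \<subseteq> Pow {1..m}" "S \<noteq> {}" "\<not> dim_span S \<le> 4 \<Longrightarrow> S \<in> vr m"
proof -
  have "S \<in> vr m \<or> S \<in> cube_simplices m" using assms by (simp add: vr_cubes_def)
  then have "S \<in> vr m \<or> S \<subseteq> Pow {1..m} \<and> S \<noteq> {} \<and> dim_span S \<le> 4"
    by (simp add: cube_simplices_def)
  then show "S \<subseteq> Pow {1..m}" "S \<noteq> {}" "\<not> dim_span S \<le> 4 \<Longrightarrow> S \<in> vr m"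
    using vrD(1,2)[of S m] by argo+
qed

lemma finite_complex_Un:
  assumes K: "finite_complex K" and L: "finite_complex L"
  shows "finite_complex (K \<union> L)"
  unfolding finite_complex_def
proof (intro conjI ballI allI impI)
  fix \<sigma> \<tau> assume "\<sigma> \<in> K \<union> L" "\<tau> \<subseteq> \<sigma>" "\<tau> \<noteq> {}"
  then show "\<tau> \<in> K \<union> L"
    using finite_complexD(4)[OF K, of \<sigma> \<tau>] finite_complexD(4)[OF L, of \<sigma> \<tau>] by blast
next
  show "finite (K \<union> L)" using finite_complexD(1)[OF K] finite_complexD(1)[OF L] by simp
  fix \<sigma> assume "\<sigma> \<in> K \<union> L"
  then show "finite \<sigma>" "\<sigma> \<noteq> {}"
    using finite_complexD(2,3)[OF K, of \<sigma>] finite_complexD(2,3)[OF L, of \<sigma>] by blast+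
qed

lemma finite_complex_vr_cubes: "finite_complex (vr_cubes m)"
  unfolding vr_cubes_def by (intro finite_complex_Un finite_complex_vr finite_complex_cube_simplices)

lemma unobstructed_mono: "unobstructed T \<Longrightarrow> S \<subseteq> T \<Longrightarrow> unobstructed S"
  unfolding unobstructed_def using obstruction_mono by blast

lemma evens_mono: "S \<subseteq> T \<Longrightarrow> evens S \<subseteq> evens T"
  by (auto simp: evens_def)

lemma finite_complex_subfamily:
  assumes K: "finite_complex K" and P: "\<And>S T. T \<in> K \<Longrightarrow> P T \<Longrightarrow> S \<subseteq> T \<Longrightarrow> S \<noteq> {} \<Longrightarrow> P S"
  shows "finite_complex {S \<in> K. P S}"
  unfolding finite_complex_def
proof (intro conjI ballI allI impI)
  fix T S assume T: "T \<in> {S \<in> K. P S}" and S: "S \<subseteq> T" "S \<noteq> {}"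
  then show "S \<in> {S \<in> K. P S}" using finite_complexD(4)[OF K _ S] P[OF _ _ S] by blast
qed (use finite_complexD[OF K] in auto)

lemma finite_complex_unobstructed: "finite_complex (vr_cubes_unobstructed m)"
  unfolding vr_cubes_unobstructed_def
proof (rule finite_complex_subfamily[OF finite_complex_vr_cubes])
  fix S T assume T: "T \<in> vr_cubes m" "dim_span T \<le> 4 \<or> unobstructed T" "S \<subseteq> T"
  then show "dim_span S \<le> 4 \<or> unobstructed S"
    using dim_span_mono[OF T(3) vr_cubesD(1)[OF T(1)]] unobstructed_mono[OF _ T(3)] by linarith
qed

lemma finite_complex_few_evens: "finite_complex (vr_cubes_few_evens m)"
  unfolding vr_cubes_few_evens_def
proof (rule finite_complex_subfamily[OF finite_complex_vr_cubes])
  fix S T assume T: "T \<in> vr_cubes m" "dim_span T \<le> 4 \<or> unobstructed T \<and> card (evens T) \<le> 1" "S \<subseteq> T"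
  have "finite T" using vr_cubesD(1)[OF T(1)] by (rule finite_subset) simp
  then have "finite (evens T)" by (simp add: evens_def)
  then have "card (evens S) \<le> card (evens T)" by (rule card_mono[OF _ evens_mono[OF T(3)]])
  then show "dim_span S \<le> 4 \<or> unobstructed S \<and> card (evens S) \<le> 1"
    using T(2) dim_span_mono[OF T(3) vr_cubesD(1)[OF T(1)]] unobstructed_mono[OF _ T(3)] by linarith
qed

lemma vertex_in_cube_simplices: "{{1..m}} \<in> cube_simplices m"
  by (simp add: cube_simplices_def dim_span_def)

lemma vertex_in_subcomplex:
  "cube_simplices m \<subseteq> K \<Longrightarrow> vertex_point {1..m} \<in> realization_points K"
  using vertex_in_cube_simplices by (intro vertex_point_in) blast

text \<open>What a vertex needs in order to be toggled: to lie in the face spanned by other members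
  \<open>X\<close>, and to be within 3 of every member.\<close>

lemma toggle_vr:
  assumes S: "S \<in> vr m" and X: "X \<subseteq> S - {c}" "X \<noteq> {}" "\<Inter> X \<subseteq> c" "c \<subseteq> \<Union> X"
    and d: "\<forall>s\<in>S. ham c s \<le> 3"
  shows "toggle c S \<in> vr m" "dim_span (toggle c S) = dim_span S" "insert c S \<in> vr m"
proof -
  show "dim_span (toggle c S) = dim_span S" by (rule span_toggle[OF X])
  have "\<Union> X \<subseteq> {1..m}" using X(1) vrD(1)[OF S] by blast
  then have "c \<in> Pow {1..m}" using X(4) by blast
  then show ins: "insert c S \<in> vr m"
    using S d by (auto simp: vr_def ham_commute)
  have "toggle c S \<subseteq> insert c S" by (auto simp: toggle_def)
  moreover have "toggle c S \<noteq> {}" using X(1,2) by (auto simp: toggle_def)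
  ultimately show "toggle c S \<in> vr m" using finite_complexD(4)[OF finite_complex_vr ins] by blast
qed

lemma unobstructed_toggle:
  assumes "unobstructed S" "insert c S \<in> vr m" "\<And>s. s \<in> S \<Longrightarrow> ham c s \<le> 2"
  shows "unobstructed (toggle c S)"
proof -
  have "unobstructed (insert c S)"
  proof (rule ccontr)
    assume "\<not> ?thesis"
    then obtain a I w where "obstruction (insert c S) a I w" by (auto simp: unobstructed_def)
    then obtain s where "s \<in> S" "ham c s = 3"
      using obstruction_insert[OF assms(2)] assms(1) unfolding unobstructed_def by blast
    then show False using assms(3)[of s] by simp
  qed
  then show ?thesis by (rule unobstructed_mono) (auto simp: toggle_def)
qed

definition obstruction_apex :: "nat set set \<Rightarrow> nat set" where
  "obstruction_apex S = (THE e. \<exists>a I w. obstruction S a I w \<and> e = flip a I)"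

lemma obstruction_apex_eq:
  assumes "S \<in> vr m" "dim_span S \<ge> 5" "obstruction S a I w"
  shows "obstruction_apex S = flip a I"
  unfolding obstruction_apex_def
proof (rule the_equality)
  show "\<exists>a' I' w'. obstruction S a' I' w' \<and> flip a I = flip a' I'" using assms(3) by blast
  fix e assume "\<exists>a I w. obstruction S a I w \<and> e = flip a I"
  then show "e = flip a I" using obstruction_unique[OF assms] by blast
qed

text \<open>All obstructions of a simplex have the same apex, which is within 2 of every member.
  Since the apex also survives the exchange of a member for it, no two lower partners are related as
  in the rank condition, and the constant rank suffices.\<close>

lemma collapse_obstructed:
  "pointed_equivalent (geometric_realization (vr_cubes m)) (vertex_point {1..m})
     (geometric_realization (vr_cubes_unobstructed m)) (vertex_point {1..m})"
proof (rule collapse_by_toggles[where a = obstruction_apex and \<phi> = "\<lambda>_. 0"])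
  show "vertex_point {1..m} \<in> realization_points (vr_cubes_unobstructed m)"
    by (rule vertex_in_subcomplex) (auto simp: vr_cubes_unobstructed_def vr_cubes_def cube_simplices_def)
  fix S assume S: "S \<in> vr_cubes m - vr_cubes_unobstructed m"
  then have SV: "S \<in> vr m" and span: "dim_span S \<ge> 5" and "\<not> unobstructed S"
    using vr_cubesD(3)[of S m] by (auto simp: vr_cubes_unobstructed_def)
  then obtain a I w where ob: "obstruction S a I w" by (auto simp: unobstructed_def)
  note d = obstruction_dist[OF SV ob]
  have I: "card I = 3" and IS: "(\<lambda>i. flip a {i}) ` I \<subseteq> S" and w: "w \<in> S" "ham a w = 4"
    using ob by (auto simp: obstruction_def)
  define e where "e = flip a I"
  have apex: "obstruction_apex S = e" unfolding e_def by (rule obstruction_apex_eq[OF SV span ob])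
  have eX: "e \<notin> (\<lambda>i. flip a {i}) ` I"
  proof
    assume "e \<in> (\<lambda>i. flip a {i}) ` I"
    then obtain i where "i \<in> I" "e = flip a {i}" by blast
    then show False using d(4)[of i] by (simp add: e_def[symmetric])
  qed
  have ew: "e \<noteq> w" using d(5) w(2) by (auto simp: e_def)
  have other: "\<exists>j\<in>I. j \<noteq> i" for i
  proof (rule ccontr)
    assume "\<not> ?thesis"
    then have "I \<subseteq> {i}" by blast
    then have "card I \<le> 1" using card_mono[of "{i}" I] by simp
    then show False using I by simp
  qed
  have between: "\<Inter> ((\<lambda>i. flip a {i}) ` I) \<subseteq> e" "e \<subseteq> \<Union> ((\<lambda>i. flip a {i}) ` I)"
  proof -
    show "\<Inter> ((\<lambda>i. flip a {i}) ` I) \<subseteq> e"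
    proof
      fix p assume p: "p \<in> \<Inter> ((\<lambda>i. flip a {i}) ` I)"
      obtain j where j: "j \<in> I" "j \<noteq> p" using other by blast
      then have pa: "p \<in> a" using p by (auto simp: mem_flip)
      then have "p \<notin> I" using p by (auto simp: mem_flip)
      then show "p \<in> e" using pa by (simp add: e_def mem_flip)
    qed
    show "e \<subseteq> \<Union> ((\<lambda>i. flip a {i}) ` I)"
    proof
      fix p assume p: "p \<in> e"
      obtain j where j: "j \<in> I" "j \<noteq> p" using other by blast
      show "p \<in> \<Union> ((\<lambda>i. flip a {i}) ` I)"
      proof (cases "p \<in> I")
        case True
        then have "p \<in> flip a {p}" using p by (simp add: e_def mem_flip)
        then show ?thesis using True by blast
      next
        case False
        then have "p \<in> flip a {j}" using p j by (simp add: e_def mem_flip)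
        then show ?thesis using j by blast
      qed
    qed
  qed
  have near: "\<forall>s\<in>S. ham e s \<le> 3"
  proof
    fix s assume "s \<in> S"
    then show "ham e s \<le> 3"
      using obstruction_classify[OF SV span ob, of s] d(4) by (auto simp: e_def ham_commute)
  qed
  have ne: "(\<lambda>i. flip a {i}) ` I \<noteq> {}" using I by auto
  have sub: "(\<lambda>i. flip a {i}) ` I \<subseteq> S - {e}" using IS eX by blast
  note tv = toggle_vr[OF SV sub ne between near]
  have ob': "obstruction (toggle e S) a I w"
    unfolding obstruction_def
  proof (intro conjI)
    show "(\<lambda>i. flip a {i}) ` I \<subseteq> toggle e S"
      using sub by (auto simp: toggle_def)
    show "w \<in> toggle e S" using w(1) ew by (simp add: toggle_neq)
  qed (fact I w)+
  have span': "dim_span (toggle e S) \<ge> 5" using tv(2) span by simp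
  then show "toggle (obstruction_apex S) S \<in> vr_cubes m - vr_cubes_unobstructed m"
    using tv(1) ob' unfolding apex by (auto simp: vr_cubes_unobstructed_def vr_cubes_def unobstructed_def)
  show "obstruction_apex (toggle (obstruction_apex S) S) = obstruction_apex S"
    unfolding apex using obstruction_apex_eq[OF tv(1) span' ob'] by (simp add: e_def)
  fix v assume eS: "obstruction_apex S \<notin> S" and v: "v \<in> S"
    and \<tau>1: "insert (obstruction_apex S) (S - {v}) \<in> vr_cubes m - vr_cubes_unobstructed m"
    and \<tau>2: "obstruction_apex (insert (obstruction_apex S) (S - {v})) \<notin> insert (obstruction_apex S) (S - {v})"
  note eS = eS[unfolded apex] and \<tau>1 = \<tau>1[unfolded apex] and \<tau>2 = \<tau>2[unfolded apex]
  have \<tau>V: "insert e (S - {v}) \<in> vr m" and \<tau>s: "dim_span (insert e (S - {v})) \<ge> 5"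
    using \<tau>1 vr_cubesD(3)[of "insert e (S - {v})" m] by (auto simp: vr_cubes_unobstructed_def)
  obtain a' I' w' where o: "obstruction (insert e (S - {v})) a' I' w'"
    using \<tau>1 by (auto simp: vr_cubes_unobstructed_def unobstructed_def)
  have eqt: "toggle e S = insert e S" using eS by (simp add: toggle_def)
  \<comment> \<open>Any obstruction of the smaller set is one of the larger set, so it has the apex
    \<open>e\<close>, which is present.\<close>
  have "obstruction (toggle e S) a' I' w'" unfolding eqt by (rule obstruction_mono[OF o]) blast
  then have "flip a' I' = e"
    using obstruction_unique[OF tv(1) span' ob'] by (simp add: e_def)
  then have "obstruction_apex (insert e (S - {v})) = e" using obstruction_apex_eq[OF \<tau>V \<tau>s o] by simp
  then show "(0::nat) < 0" using \<tau>2 by simp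
next
  show "vr_cubes_unobstructed m \<subseteq> vr_cubes m" by (auto simp: vr_cubes_unobstructed_def)
qed (rule finite_complex_vr_cubes finite_complex_unobstructed)+

text \<open>The binary code \<open>set_encode\<close> serves as a linear order on finite sets of
  numbers: it makes the choice canonical and provides the rank.\<close>

definition first_even_centre :: "nat set set \<Rightarrow> nat set" where
  "first_even_centre S = arg_min set_encode (\<lambda>a. a \<in> even_centres S)"

text \<open>Centres are odd, as neighbours of even vertices, so toggling one leaves the even members
  alone, and it leaves the set of centres unchanged. Removing members only adds centres, so the
  first centre can only move forward in the order.\<close>

lemma collapse_many_evens:
  "pointed_equivalent (geometric_realization (vr_cubes_unobstructed m)) (vertex_point {1..m})
     (geometric_realization (vr_cubes_few_evens m)) (vertex_point {1..m})"
proof (rule collapse_by_toggles[where a = first_even_centre and \<phi> = "\<lambda>S. set_encode (first_even_centre S)"])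
  show "vertex_point {1..m} \<in> realization_points (vr_cubes_few_evens m)"
    by (rule vertex_in_subcomplex) (auto simp: vr_cubes_few_evens_def vr_cubes_def cube_simplices_def)
  have family: "S \<in> vr m \<and> dim_span S \<ge> 5 \<and> unobstructed S \<and> card (evens S) \<ge> 2 \<longleftrightarrow>
      S \<in> vr_cubes_unobstructed m - vr_cubes_few_evens m" for S
    using vr_cubesD(3)[of S m]
    by (auto simp: vr_cubes_few_evens_def vr_cubes_unobstructed_def vr_cubes_def)
  have centre_in: "first_even_centre S \<in> even_centres S"
    and centre_min: "\<And>b. b \<in> even_centres S \<Longrightarrow> set_encode (first_even_centre S) \<le> set_encode b"
    if "S \<in> vr_cubes_unobstructed m - vr_cubes_few_evens m" for S
  proof -
    have "even_centres S \<noteq> {}"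
      using that even_centres_nonempty[of S m] unfolding family[symmetric] by blast
    then obtain b0 where b0: "b0 \<in> even_centres S" by blast
    show "first_even_centre S \<in> even_centres S"
      unfolding first_even_centre_def by (rule arg_min_natI[of "\<lambda>a. a \<in> even_centres S", OF b0])
    show "set_encode (first_even_centre S) \<le> set_encode b" if "b \<in> even_centres S" for b
      unfolding first_even_centre_def by (rule arg_min_nat_le[of "\<lambda>a. a \<in> even_centres S", OF that])
  qed
  have centre_fin: "finite b \<and> odd (card b)" 
    if S: "S \<in> vr m" "card (evens S) \<ge> 2" and b: "b \<in> even_centres S" for S b
  proof -
    obtain x where x: "x \<in> evens S" using S(2) by fastforce
    then have x': "x \<in> S" "even (card x)" "ham b x = 1" using b by (auto simp: evens_def even_centres_def)
    have fx: "finite x" using vrD(4)[OF S(1) x'(1)] .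
    have fb: "finite b" by (rule finite_of_ham_pos[of b x]) (use x'(3) fx in auto)
    then show ?thesis using even_ham[OF fb fx] x' by simp
  qed
  fix S assume S: "S \<in> vr_cubes_unobstructed m - vr_cubes_few_evens m"
  then have SV: "S \<in> vr m" and span: "dim_span S \<ge> 5" and un: "unobstructed S" and E: "card (evens S) \<ge> 2"
    unfolding family[symmetric] by auto
  define c where "c = first_even_centre S"
  have cC: "c \<in> even_centres S" unfolding c_def by (rule centre_in[OF S])
  have fc: "finite c" "odd (card c)" using centre_fin[OF SV E cC] by auto
  have c1: "\<And>x. x \<in> evens S \<Longrightarrow> ham c x = 1" and c2: "\<And>y. y \<in> S - evens S \<Longrightarrow> ham c y \<le> 2"
    using cC by (auto simp: even_centres_def)
  have near: "ham c s \<le> 2" if "s \<in> S" for s using c1[of s] c2[of s] that by (cases "s \<in> evens S") auto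
  obtain x y where xy: "x \<in> evens S" "y \<in> evens S" "x \<noteq> y"
  proof -
    have "\<exists>T\<subseteq>evens S. card T = 2" using E by (metis obtain_subset_with_card_n)
    then show thesis using that by (auto simp: card_2_iff)
  qed
  have "x \<noteq> c" "y \<noteq> c" using c1[OF xy(1)] c1[OF xy(2)] by auto
  then have X: "{x, y} \<subseteq> S - {c}" using xy by (auto simp: evens_def)
  have btw: "\<Inter> {x, y} \<subseteq> c" "c \<subseteq> \<Union> {x, y}"
    using between_neighbours[OF c1[OF xy(1)] c1[OF xy(2)] xy(3)] by auto
  have near3: "\<forall>s\<in>S. ham c s \<le> 3" using near by fastforce
  note tv = toggle_vr[OF SV X insert_not_empty btw near3]
  have ev: "evens (toggle c S) = evens S" using fc(2) by (auto simp: evens_def toggle_def)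
  have un': "unobstructed (toggle c S)" by (rule unobstructed_toggle[OF un tv(3) near])
  have fam': "toggle c S \<in> vr_cubes_unobstructed m - vr_cubes_few_evens m"
    unfolding family[symmetric] using tv(1,2) span un' E ev by simp
  \<comment> \<open>Two centres share the neighbour \<open>x\<close>, so the presence of one never
    disqualifies the other.\<close>
  have ham_cc: "ham b c \<le> 2" if "finite b" "ham b x = 1" for b
  proof -
    have "ham b c \<le> ham b x + ham x c"
      by (rule ham_triangle) (use that fc vrD(4)[OF SV] xy in \<open>auto simp: evens_def\<close>)
    then show ?thesis using that(2) c1[OF xy(1)] by (simp add: ham_commute)
  qed
  have C': "even_centres (toggle c S) = even_centres S"
  proof (intro subset_antisym subsetI)
    fix b assume b: "b \<in> even_centres (toggle c S)"
    have b1: "ham b x = 1" if "x \<in> evens S" for x using b that ev by (simp add: even_centres_def)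
    have fb: "finite b" by (rule finite_of_ham_pos[of b x]) (use b1[OF xy(1)] vrD(4)[OF SV] xy(1) in \<open>auto simp: evens_def\<close>)
    have "ham b z \<le> 2" if z: "z \<in> S - evens S" for z
    proof (cases "z = c")
      case True
      then show ?thesis using ham_cc[OF fb b1[OF xy(1)]] by simp
    next
      case False
      then have "z \<in> toggle c S - evens (toggle c S)" using z ev by (simp add: toggle_neq)
      then show ?thesis using b by (simp add: even_centres_def)
    qed
    then show "b \<in> even_centres S" using b1 by (simp add: even_centres_def)
  next
    fix b assume b: "b \<in> even_centres S"
    have b1: "ham b x = 1" if "x \<in> evens S" for x using b that by (simp add: even_centres_def)
    have fb: "finite b" using centre_fin[OF SV E b] by simp
    have "ham b z \<le> 2" if z: "z \<in> toggle c S - evens (toggle c S)" for z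
    proof (cases "z = c")
      case True
      then show ?thesis using ham_cc[OF fb b1[OF xy(1)]] by simp
    next
      case False
      then have "z \<in> S - evens S" using z ev toggle_mem[of z c S] by simp
      then show ?thesis using b by (simp add: even_centres_def)
    qed
    then show "b \<in> even_centres (toggle c S)" using b1 ev by (simp add: even_centres_def)
  qed
  show "toggle (first_even_centre S) S \<in> vr_cubes_unobstructed m - vr_cubes_few_evens m"
    using fam' by (simp only: c_def)
  show "first_even_centre (toggle (first_even_centre S) S) = first_even_centre S"
    using C' unfolding c_def first_even_centre_def by metis
  fix v assume \<tau>1: "insert (first_even_centre S) (S - {v}) \<in> vr_cubes_unobstructed m - vr_cubes_few_evens m"
    and \<tau>2: "first_even_centre (insert (first_even_centre S) (S - {v})) \<notin> insert (first_even_centre S) (S - {v})"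
  define \<tau> where "\<tau> = insert c (S - {v})"
  note \<tau>1 = \<tau>1[folded c_def, folded \<tau>_def] and \<tau>2 = \<tau>2[folded c_def, folded \<tau>_def]
  \<comment> \<open>The old centre is still one. As a lower partner \<open>\<tau>\<close> toggles a
    different vertex, whose code is therefore smaller.\<close>
  have "c \<in> even_centres \<tau>"
  proof -
    have "evens \<tau> \<subseteq> evens S" using fc(2) by (auto simp: evens_def \<tau>_def)
    moreover have "ham c z \<le> 2" if "z \<in> \<tau>" for z using that near by (auto simp: \<tau>_def)
    ultimately show ?thesis using c1 by (auto simp: even_centres_def)
  qed
  then have le: "set_encode (first_even_centre \<tau>) \<le> set_encode c" by (rule centre_min[OF \<tau>1])
  have "\<tau> \<in> vr m" "card (evens \<tau>) \<ge> 2" using \<tau>1 unfolding family[symmetric] by auto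
  then have "finite (first_even_centre \<tau>)" using centre_fin centre_in[OF \<tau>1] by blast
  moreover have "first_even_centre \<tau> \<noteq> c" using \<tau>2 by (auto simp: \<tau>_def)
  ultimately have "set_encode (first_even_centre \<tau>) \<noteq> set_encode c" using fc(1) by (simp add: set_encode_eq)
  then have "set_encode (first_even_centre \<tau>) < set_encode c" using le by simp
  then show "set_encode (first_even_centre (insert (first_even_centre S) (S - {v}))) < set_encode (first_even_centre S)"
    by (simp only: c_def \<tau>_def)
next
  show "vr_cubes_few_evens m \<subseteq> vr_cubes_unobstructed m"
    by (auto simp: vr_cubes_few_evens_def vr_cubes_unobstructed_def)
qed (rule finite_complex_unobstructed finite_complex_few_evens)+

definition odd_centre :: "nat set set \<Rightarrow> nat set" where
  "odd_centre S = (THE b. finite b \<and> (\<forall>y\<in>S - evens S. ham b y = 1))"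

text \<open>If an even member other than the centre is present, toggling the even centre would
  produce a second even vertex and leave the family. Instead the odd neighbour of the centre one
  step towards that member is toggled; the minimum picks one of the two.\<close>

definition last_toggle :: "nat set set \<Rightarrow> nat set" where
  "last_toggle S = (if evens S \<subseteq> {odd_centre S} then odd_centre S
     else flip (odd_centre S) {Min (flip (odd_centre S) (the_elem (evens S)))})"

lemma odd_centre_eq:
  assumes "card (S - evens S) \<ge> 3" "finite b" "\<And>y. y \<in> S - evens S \<Longrightarrow> ham b y = 1"
  shows "odd_centre S = b"
  unfolding odd_centre_def
proof (rule the_equality)
  fix b' assume b': "finite b' \<and> (\<forall>y\<in>S - evens S. ham b' y = 1)"
  show "b' = b" by (rule common_neighbour_unique[OF assms(1)]) (use b' assms in auto)
qed (use assms in auto)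

text \<open>With at most one even vertex there are at least three odd ones, and these determine the
  centre \<open>b\<close>. The toggled vertex depends only on \<open>b\<close> and on the even
  members, so a lower partner can follow another only if the sole even vertex was dropped.\<close>

lemma collapse_few_evens:
  "pointed_equivalent (geometric_realization (vr_cubes_few_evens m)) (vertex_point {1..m})
     (geometric_realization (cube_simplices m)) (vertex_point {1..m})"
proof (rule collapse_by_toggles[where a = last_toggle and \<phi> = "\<lambda>S. card (evens S)"])
  show "vertex_point {1..m} \<in> realization_points (cube_simplices m)"
    by (rule vertex_in_subcomplex) simp
  have family: "S \<in> vr m \<and> dim_span S \<ge> 5 \<and> unobstructed S \<and> card (evens S) \<le> 1 \<longleftrightarrow>
      S \<in> vr_cubes_few_evens m - cube_simplices m" for S
  proof
    assume "S \<in> vr m \<and> dim_span S \<ge> 5 \<and> unobstructed S \<and> card (evens S) \<le> 1"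
    then show "S \<in> vr_cubes_few_evens m - cube_simplices m"
      by (simp add: vr_cubes_few_evens_def vr_cubes_def cube_simplices_def)
  next
    assume S: "S \<in> vr_cubes_few_evens m - cube_simplices m"
    then have "S \<in> vr_cubes m" by (simp add: vr_cubes_few_evens_def)
    note D = vr_cubesD[OF this]
    have "\<not> dim_span S \<le> 4" using S D(1,2) by (simp add: cube_simplices_def)
    then show "S \<in> vr m \<and> dim_span S \<ge> 5 \<and> unobstructed S \<and> card (evens S) \<le> 1"
      using S D(3) by (simp add: vr_cubes_few_evens_def)
  qed
  have centre: "\<exists>b. finite b \<and> even (card b) \<and> (\<forall>y\<in>S - evens S. ham b y = 1) \<and> (\<forall>x\<in>evens S. ham b x \<le> 2) \<and>
      odd_centre S = b \<and> card (S - evens S) \<ge> 3"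
    if fam: "S \<in> vr_cubes_few_evens m - cube_simplices m" for S
  proof -
    have S: "S \<in> vr m" "dim_span S \<ge> 5" "unobstructed S" "card (evens S) \<le> 1"
      using fam unfolding family[symmetric] by auto
    have O3: "card (S - evens S) \<ge> 3" by (rule card_odds[OF S(1,2,4)])
    show ?thesis
    proof (rule star_centre[OF S(1-3) _ O3, of False])
      fix b assume b: "finite b" "\<And>z. z \<in> S - evens S \<Longrightarrow> ham b z = 1"
        "\<And>s. s \<in> S \<Longrightarrow> even (card s) \<noteq> False \<Longrightarrow> ham b s \<le> 2"
      have "S - evens S \<noteq> {}" using O3 by (metis card.empty not_numeral_le_zero)
      then obtain y where y: "y \<in> S - evens S" by blast
      have "even (card b)" using even_ham[OF b(1) vrD(4)[OF S(1), of y]] b(2)[OF y] y by (auto simp: evens_def)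
      moreover have "odd_centre S = b" by (rule odd_centre_eq[OF O3 b(1,2)])
      ultimately show ?thesis using b O3 by (auto simp: evens_def)
    qed (auto simp: evens_def)
  qed
  fix S assume S: "S \<in> vr_cubes_few_evens m - cube_simplices m"
  then have SV: "S \<in> vr m" and span: "dim_span S \<ge> 5" and un: "unobstructed S" and E: "card (evens S) \<le> 1"
    unfolding family[symmetric] by auto
  obtain b where b: "finite b" "even (card b)" "\<And>y. y \<in> S - evens S \<Longrightarrow> ham b y = 1"
    "\<And>x. x \<in> evens S \<Longrightarrow> ham b x \<le> 2" "odd_centre S = b" and O3: "card (S - evens S) \<ge> 3"
    using centre[OF S] by blast
  have finS: "finite s" if "s \<in> S" for s using vrD(4)[OF SV that] .
  have finO: "finite (S - evens S)" using vrD(5)[OF SV] by simp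
  have finE: "finite (evens S)" using vrD(5)[OF SV] by (simp add: evens_def)
  have bO: "b \<notin> S - evens S" using b(2) by (auto simp: evens_def)
  define c where "c = last_toggle S"
  have key: "toggle c S \<in> vr m \<and> dim_span (toggle c S) = dim_span S \<and> insert c S \<in> vr m \<and>
      (\<forall>s\<in>S. ham c s \<le> 2) \<and> card (evens (toggle c S)) \<le> 1 \<and> last_toggle (toggle c S) = c \<and>
      (c \<notin> S \<longrightarrow> (\<forall>v\<in>S. insert c (S - {v}) \<in> vr_cubes_few_evens m - cube_simplices m \<longrightarrow>
         last_toggle (insert c (S - {v})) \<notin> insert c (S - {v}) \<longrightarrow> card (evens (insert c (S - {v}))) < card (evens S)))"
  proof (cases "evens S \<subseteq> {b}")
    case True
    have cb: "c = b" by (simp add: c_def last_toggle_def b(5) True)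
    have near: "ham c s \<le> 2" if "s \<in> S" for s
      using b(3,4)[of s] that cb by (cases "s \<in> evens S") auto
    obtain x y where xy: "x \<in> S - evens S" "y \<in> S - evens S" "x \<noteq> y"
    proof -
      have "2 \<le> card (S - evens S)" using O3 by simp
      then have "\<exists>T\<subseteq>S - evens S. card T = 2" by (metis obtain_subset_with_card_n)
      then show thesis using that by (auto simp: card_2_iff)
    qed
    have X: "{x, y} \<subseteq> S - {c}" using xy bO cb by auto
    have btw: "\<Inter> {x, y} \<subseteq> c" "c \<subseteq> \<Union> {x, y}"
      using between_neighbours[OF b(3)[OF xy(1)] b(3)[OF xy(2)] xy(3)] cb by auto
    have near3: "\<forall>s\<in>S. ham c s \<le> 3" using near by fastforce
    note tv = toggle_vr[OF SV X insert_not_empty btw near3]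
    have evT: "evens (toggle c S) \<subseteq> {b}" using True cb by (auto simp: evens_def toggle_def split: if_splits)
    have odT: "toggle c S - evens (toggle c S) = S - evens S"
      using b(2) cb by (auto simp: evens_def toggle_def)
    have oc: "odd_centre (toggle c S) = b"
      by (rule odd_centre_eq) (use odT O3 b in auto)
    have lt: "last_toggle (toggle c S) = c" using evT oc by (simp add: last_toggle_def cb)
    have "card (evens (toggle c S)) \<le> 1" using card_mono[OF _ evT] by simp
    moreover have "card (evens (insert c (S - {v}))) < card (evens S)"
      if cS: "c \<notin> S" and v: "v \<in> S" and fam: "insert c (S - {v}) \<in> vr_cubes_few_evens m - cube_simplices m"
        and up: "last_toggle (insert c (S - {v})) \<notin> insert c (S - {v})" for v
    proof -
      have ev\<tau>: "evens (insert c (S - {v})) \<subseteq> {b}" using True cb by (auto simp: evens_def)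
      have od\<tau>: "insert c (S - {v}) - evens (insert c (S - {v})) \<subseteq> S - evens S"
        using b(2) cb by (auto simp: evens_def)
      have "odd_centre (insert c (S - {v})) = b"
        by (rule odd_centre_eq) (use centre[OF fam] od\<tau> b in auto)
      then have "last_toggle (insert c (S - {v})) = c" using ev\<tau> by (simp add: last_toggle_def cb)
      then show ?thesis using up by simp
    qed
    ultimately show ?thesis using tv near lt by blast
  next
    case False
    then have "card (evens S) = 1" using E finE by (metis card_0_eq empty_subsetI le_antisym less_one linorder_not_less)
    then obtain x where Ex: "evens S = {x}" by (rule card_1_singletonE)
    then have xS: "x \<in> S" "even (card x)" by (auto simp: evens_def)
    have xb: "x \<noteq> b" using False Ex by auto
    have "even (ham b x)" using even_ham[OF b(1) finS[OF xS(1)]] b(2) xS(2) by simp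
    moreover have "ham b x \<noteq> 0" using ham_eq_0[OF b(1) finS[OF xS(1)]] xb by simp
    ultimately have "ham b x = 2" using b(4)[of x] Ex by (cases "ham b x = 1") auto
    then have c2: "card (flip b x) = 2" by (simp add: ham_def)
    define j where "j = Min (flip b x)"
    have fbx: "finite (flip b x)" using b(1) finS[OF xS(1)] by simp
    have "flip b x \<noteq> {}" using c2 by auto
    then have j: "j \<in> flip b x" unfolding j_def by (rule Min_in[OF fbx])
    have cb: "c = flip b {j}" using False Ex by (simp add: c_def last_toggle_def b(5) j_def)
    have cbj: "ham b c = 1" using cb by (simp add: ham_flip)
    have fc: "finite c" using b(1) cb by simp
    have oc: "odd (card c)" using even_ham[OF b(1) fc] cbj b(2) by simp
    have cx: "ham c x = 1"
    proof -
      have "ham c x = card (flip (flip b x) {j})"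
        unfolding cb ham_flip(3) by (simp add: ham_def flip_commute)
      then show ?thesis using card_flip_singleton(1)[OF fbx j] c2 by simp
    qed
    have cy: "ham c y \<le> 2" if "y \<in> S - evens S" for y
    proof -
      have "ham c y \<le> ham c b + ham b y" by (rule ham_triangle) (use fc b(1) finS that in auto)
      then show ?thesis using b(3)[OF that] cbj by (simp add: ham_commute)
    qed
    have near: "ham c s \<le> 2" if "s \<in> S" for s
      using cx cy[of s] Ex that by (cases "s \<in> evens S") auto
    \<comment> \<open>The span is covered by the two coordinates leading to \<open>x\<close> and by
      the directions of the odd members. At least three odd members thus point in other directions,
      so \<open>b\<close> and the span survive the removal of \<open>c\<close>.\<close>
    have O3': "card (S - evens S - {c}) \<ge> 3"
    proof -
      define J where "J = {i. flip b {i} \<in> S - evens S}"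
      have imJ: "(\<lambda>i. flip b {i}) ` J = S - evens S"
      proof (intro subset_antisym subsetI)
        fix y assume "y \<in> S - evens S"
        moreover obtain i where "y = flip b {i}" using b(3)[OF \<open>y \<in> S - evens S\<close>] unfolding ham_eq_1 by blast
        ultimately show "y \<in> (\<lambda>i. flip b {i}) ` J" by (auto simp: J_def)
      qed (auto simp: J_def)
      have injJ: "inj_on (\<lambda>i. flip b {i}) T" for T by (auto simp: inj_on_def flip_eq_iff)
      have finJ: "finite J" using finO finite_imageD[OF _ injJ, of J] imJ by simp
      have "dim_span S \<le> card (J \<union> flip b x)"
      proof (rule dim_span_le[of S b])
        fix s assume s: "s \<in> S"
        show "flip b s \<subseteq> J \<union> flip b x"
        proof (cases "s \<in> evens S")
          case True
          then show ?thesis using Ex by auto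
        next
          case False
          then obtain i where "s = flip b {i}" "i \<in> J" using s imJ by blast
          then show ?thesis by simp
        qed
      qed (use vrD(2)[OF SV] finJ fbx in auto)
      also have "J \<union> flip b x = (J - flip b x) \<union> flip b x" by blast
      also have "card \<dots> \<le> card (J - flip b x) + card (flip b x)" by (rule card_Un_le)
      finally have "card (J - flip b x) \<ge> 3" using span c2 by simp
      moreover have "(\<lambda>i. flip b {i}) ` (J - flip b x) \<subseteq> S - evens S - {c}"
        using imJ j cb by (auto simp: flip_eq_iff)
      then have "card ((\<lambda>i. flip b {i}) ` (J - flip b x)) \<le> card (S - evens S - {c})"
        using finO by (intro card_mono) auto
      ultimately show ?thesis by (simp add: card_image[OF injJ])
    qed
    obtain y z where yz: "y \<in> S - evens S - {c}" "z \<in> S - evens S - {c}" "y \<noteq> z"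
    proof -
      have "2 \<le> card (S - evens S - {c})" using O3' by simp
      then have "\<exists>T\<subseteq>S - evens S - {c}. card T = 2" by (metis obtain_subset_with_card_n)
      then show thesis using that by (auto simp: card_2_iff)
    qed
    have yz1: "ham b y = 1" "ham b z = 1" using b(3) yz by auto
    note bt = between_neighbours[OF yz1 yz(3)]
    have "x \<noteq> c" using cx by auto
    then have X: "{x, y, z} \<subseteq> S - {c}" using xS yz by auto
    have btw: "\<Inter> {x, y, z} \<subseteq> c" "c \<subseteq> \<Union> {x, y, z}"
      using bt j unfolding cb by (auto simp: mem_flip)
    have near3: "\<forall>s\<in>S. ham c s \<le> 3" using near by fastforce
    note tv = toggle_vr[OF SV X insert_not_empty btw near3]
    have evT: "evens (toggle c S) = evens S" using oc by (auto simp: evens_def toggle_def)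
    have same: "last_toggle T = c"
      if T: "evens T = evens S" "T - evens T \<subseteq> insert c (S - evens S)" "card (T - evens T) \<ge> 3" for T
    proof -
      have "odd_centre T = b"
        by (rule odd_centre_eq[OF T(3) b(1)]) (use T(2) b(3) cbj in auto)
      then show ?thesis using False Ex T(1) by (simp add: last_toggle_def cb j_def)
    qed
    have "last_toggle (toggle c S) = c"
    proof (rule same[OF evT])
      show "toggle c S - evens (toggle c S) \<subseteq> insert c (S - evens S)"
        unfolding evT by (auto simp: toggle_def split: if_splits)
      have "S - evens S - {c} \<subseteq> toggle c S - evens (toggle c S)" unfolding evT by (auto simp: toggle_def)
      moreover have "finite (toggle c S - evens (toggle c S))" using vrD(5)[OF tv(1)] by simp
      ultimately show "3 \<le> card (toggle c S - evens (toggle c S))" using O3' card_mono le_trans by metis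
    qed
    moreover have "card (evens (insert c (S - {v}))) < card (evens S)"
      if cS: "c \<notin> S" and v: "v \<in> S" and fam: "insert c (S - {v}) \<in> vr_cubes_few_evens m - cube_simplices m"
        and up: "last_toggle (insert c (S - {v})) \<notin> insert c (S - {v})" for v
    proof (cases "v = x")
      case True
      \<comment> \<open>Dropping \<open>x\<close> leads to the other case of the definition, with
        the number of even vertices fallen from one to zero.\<close>
      then have "evens (insert c (S - {v})) = {}" using Ex oc by (auto simp: evens_def)
      then show ?thesis using Ex by simp
    next
      case v: False
      have ev\<tau>: "evens (insert c (S - {v})) = evens S"
        using oc v Ex by (auto simp: evens_def)
      have "last_toggle (insert c (S - {v})) = c"
        by (rule same[OF ev\<tau>]) (use centre[OF fam] ev\<tau> in auto)
      then show ?thesis using up by simp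
    qed
    ultimately show ?thesis using tv near E evT by auto
  qed
  have un': "unobstructed (toggle c S)" by (rule unobstructed_toggle[OF un]) (use key in blast)+
  then have "toggle c S \<in> vr_cubes_few_evens m - cube_simplices m"
    unfolding family[symmetric] using key span by simp
  then show "toggle (last_toggle S) S \<in> vr_cubes_few_evens m - cube_simplices m" by (simp only: c_def)
  show "last_toggle (toggle (last_toggle S) S) = last_toggle S"
    using key unfolding c_def by blast
  fix v assume "last_toggle S \<notin> S" "v \<in> S" "insert (last_toggle S) (S - {v}) \<in> vr_cubes_few_evens m - cube_simplices m"
    "last_toggle (insert (last_toggle S) (S - {v})) \<notin> insert (last_toggle S) (S - {v})"
  then show "card (evens (insert (last_toggle S) (S - {v}))) < card (evens S)"
    using key unfolding c_def by blast
next
  show "cube_simplices m \<subseteq> vr_cubes_few_evens m"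
    by (auto simp: vr_cubes_few_evens_def vr_cubes_def cube_simplices_def)
qed (rule finite_complex_few_evens finite_complex_cube_simplices)+

section \<open>Cross-polytopes in the 4-cubes\<close>

text \<open>The sixteen vertices of a 4-cube span the boundary of a cross-polytope. Its facets select one
  vertex from each antipodal pair; the one chosen here has its antipodes so spread out that no vertex
  outside of the 4-cube is close to all of it.\<close>

definition selected :: "nat set \<Rightarrow> nat set \<Rightarrow> bool" where
  "selected D y \<longleftrightarrow> card y = 0 \<or> card y = 3 \<or> card y = 2 \<and> Min D \<in> y"

definition facet :: "nat set \<Rightarrow> nat set \<Rightarrow> nat set set" where
  "facet q D = (\<lambda>y. q \<union> y) ` {y. y \<subseteq> D \<and> selected D y}"

definition cube_index :: "nat \<Rightarrow> (nat set \<times> nat set) set" where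
  "cube_index m = {(q, D). D \<subseteq> {1..m} \<and> card D = 4 \<and> q \<subseteq> {1..m} - D}"

definition facets :: "nat \<Rightarrow> nat set set set" where
  "facets m = (\<lambda>(q, D). facet q D) ` cube_index m"

definition cube :: "nat set \<Rightarrow> nat set \<Rightarrow> nat set set" where
  "cube q D = {x. q \<subseteq> x \<and> x \<subseteq> q \<union> D}"

lemma cube_indexD:
  assumes "(q, D) \<in> cube_index m"
  shows "card D = 4" "finite D" "q \<inter> D = {}" "q \<union> D \<subseteq> {1..m}" "finite q" "D \<noteq> {}"
proof -
  show D: "card D = 4" "q \<inter> D = {}" "q \<union> D \<subseteq> {1..m}" using assms by (auto simp: cube_index_def)
  then have "finite (q \<union> D)" by (meson finite_atLeastAtMost finite_subset)
  then show "finite D" "finite q" by auto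
  show "D \<noteq> {}" using D(1) by auto
qed

context
  fixes q D :: "nat set"
  assumes D4: "card D = 4" and finD: "finite D" and qD: "q \<inter> D = {}" and finq: "finite q"
begin

text \<open>Sizes of antipodes add up to 4: size 0 is taken and not 4, size 3 and not 1, and of two
  complementary pairs the one containing the least direction.\<close>

lemma selected_antipode:
  assumes "y \<subseteq> D"
  shows "selected D (D - y) \<longleftrightarrow> \<not> selected D y"
proof -
  have fy: "finite y" using assms finD by (rule finite_subset)
  have "card (D - y) = 4 - card y" using card_Diff_subset[OF fy assms] D4 by simp
  moreover have "card y \<le> 4" using card_mono[OF finD assms] D4 by simp
  moreover have "Min D \<in> D" using finD D4 by (intro Min_in) auto
  ultimately show ?thesis unfolding selected_def by auto
qed

lemma cube_flip:
  assumes "x \<in> cube q D"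
  shows "flip x D \<in> cube q D" "flip (flip x D) D = x" "x \<inter> flip x D = q" "x \<union> flip x D = q \<union> D"
    "flip x D = q \<union> (D - (x - q))" "x = q \<union> (x - q)" "x - q \<subseteq> D"
  using assms qD by (auto simp: cube_def mem_flip)

lemma facet_mem: "x \<in> facet q D \<longleftrightarrow> x \<in> cube q D \<and> selected D (x - q)"
proof
  assume "x \<in> facet q D"
  then obtain y where y: "y \<subseteq> D" "selected D y" "x = q \<union> y" by (auto simp: facet_def)
  then have "x - q = y" using qD by blast
  then show "x \<in> cube q D \<and> selected D (x - q)" using y by (auto simp: cube_def)
next
  assume "x \<in> cube q D \<and> selected D (x - q)"
  then show "x \<in> facet q D" using cube_flip(6,7)[of x] unfolding facet_def by blast
qed

lemma facet_subset_cube: "facet q D \<subseteq> cube q D"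
  using facet_mem by blast

lemma facet_flip:
  assumes "x \<in> cube q D"
  shows "flip x D \<in> facet q D \<longleftrightarrow> x \<notin> facet q D"
proof -
  have "flip x D - q = D - (x - q)" using cube_flip(5)[OF assms] qD by auto
  then show ?thesis
    using facet_mem[of x] facet_mem[of "flip x D"] cube_flip(1,7)[OF assms] selected_antipode[of "x - q"] assms by simp
qed

lemma bottom_top: "q \<in> facet q D" "q \<union> D \<in> cube q D" "q \<union> D \<notin> facet q D" "q \<in> cube q D" "flip q D = q \<union> D"
  "q \<noteq> q \<union> D"
proof -
  show q: "q \<in> facet q D" "q \<in> cube q D" "q \<union> D \<in> cube q D" by (auto simp: facet_mem selected_def cube_def)
  show f: "flip q D = q \<union> D" using qD by (auto simp: mem_flip)
  show "q \<union> D \<notin> facet q D" using facet_flip[OF q(2)] q(1) f by simp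
  have "D \<noteq> {}" using D4 by auto
  then show "q \<noteq> q \<union> D" using qD by blast
qed

lemma ham_cube:
  assumes "x \<in> cube q D" "y \<in> cube q D"
  shows "ham x y \<le> 4" "ham x y = 4 \<longleftrightarrow> y = flip x D" "finite x"
proof -
  have sub: "flip x y \<subseteq> D" using assms by (auto simp: cube_def mem_flip subset_iff)
  show "ham x y \<le> 4" using card_mono[OF finD sub] D4 by (simp add: ham_def)
  have "ham x y = 4 \<longleftrightarrow> flip x y = D" using card_subset_eq[OF finD sub] D4 by (auto simp: ham_def)
  also have "\<dots> \<longleftrightarrow> y = flip x D" by (metis flip_flip)
  finally show "ham x y = 4 \<longleftrightarrow> y = flip x D" .
  show "finite x" using assms(1) finD finq by (auto simp: cube_def intro: finite_subset[of _ "q \<union> D"])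
qed

lemma finite_cube: "finite (cube q D)" "card (facet q D) = 8"
proof -
  have eq: "cube q D = (\<lambda>y. q \<union> y) ` Pow D"
  proof (intro subset_antisym subsetI)
    fix x assume "x \<in> cube q D"
    then show "x \<in> (\<lambda>y. q \<union> y) ` Pow D" using cube_flip(6,7)[of x] by blast
  qed (auto simp: cube_def)
  show fin: "finite (cube q D)" unfolding eq using finD by simp
  have "inj_on (\<lambda>y. q \<union> y) (Pow D)" using qD by (auto simp: inj_on_def)
  then have "card (cube q D) = 16" unfolding eq using finD D4 by (simp add: card_image card_Pow)
  moreover have "cube q D - facet q D = (\<lambda>x. flip x D) ` facet q D"
  proof (intro subset_antisym subsetI)
    fix x assume "x \<in> cube q D - facet q D"
    then show "x \<in> (\<lambda>x. flip x D) ` facet q D"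
      using facet_flip[of x] cube_flip(2)[of x] by (metis DiffD1 DiffD2 imageI)
  next
    fix x assume "x \<in> (\<lambda>x. flip x D) ` facet q D"
    then obtain z where z: "z \<in> facet q D" "x = flip z D" by blast
    then have "z \<in> cube q D" using facet_subset_cube by blast
    then show "x \<in> cube q D - facet q D" using z facet_flip[of z] cube_flip(1)[of z] by simp
  qed
  moreover have "inj_on (\<lambda>x. flip x D) (facet q D)"
    using cube_flip(2) facet_subset_cube by (metis inj_on_inverseI subsetD)
  ultimately have "card (cube q D - facet q D) = card (facet q D)" by (simp add: card_image)
  then show "card (facet q D) = 8"
    using card_Diff_subset[OF finite_subset[OF facet_subset_cube fin] facet_subset_cube]
      card_mono[OF fin facet_subset_cube] \<open>card (cube q D) = 16\<close> by linarith
qed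

text \<open>The bottom is selected and the 3-element sets cover \<open>D\<close>; so a facet spans
  its 4-face and determines it.\<close>

lemma facet_Inter_Union: "\<Inter> (facet q D) = q" "\<Union> (facet q D) = q \<union> D"
proof -
  have sub: "q \<subseteq> x \<and> x \<subseteq> q \<union> D" if "x \<in> facet q D" for x
    using that facet_subset_cube by (auto simp: cube_def)
  then show "\<Inter> (facet q D) = q" using bottom_top(1) by blast
  have "d \<in> \<Union> (facet q D)" if d: "d \<in> D" for d
  proof -
    have "D - {d} \<noteq> {}"
    proof
      assume "D - {d} = {}"
      then have "D \<subseteq> {d}" by blast
      then have "card D \<le> 1" using card_mono[of "{d}" D] by simp
      then show False using D4 by simp
    qed
    then obtain d' where d': "d' \<in> D" "d' \<noteq> d" by blast
    have "card (D - {d'}) = 3" using d' D4 finD by simp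
    then have "q \<union> (D - {d'}) \<in> facet q D" by (auto simp: facet_def selected_def)
    then show ?thesis using d d' by blast
  qed
  then show "\<Union> (facet q D) = q \<union> D" using sub bottom_top(1) by blast
qed

text \<open>Inside the 4-face the antipode of an unselected vertex is selected and at distance 4.
  Outside, at least one unit of distance is spent off the face, so the projection \<open>V\<close>
  would have to be within 2 of every selected set, which is impossible.\<close>

lemma facet_extension:
  assumes z: "finite z" "\<And>x. x \<in> facet q D \<Longrightarrow> ham x z \<le> 3"
  shows "z \<in> facet q D"
proof -
  define W where "W = flip q z"
  have finW: "finite W" using finq z(1) by (simp add: W_def)
  have near: "card (flip W y) \<le> 3" if y: "y \<subseteq> D" "selected D y" for y
  proof -
    have "q \<union> y = flip q y" using y(1) qD by (auto simp: mem_flip)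
    then have "ham (flip q y) z \<le> 3" using z(2)[of "q \<union> y"] y by (auto simp: facet_def)
    then show ?thesis unfolding ham_flip(3) by (simp add: ham_def W_def flip_commute)
  qed
  show ?thesis
  proof (cases "W \<subseteq> D")
    case True
    have zc: "z = q \<union> W" using True qD flip_flip[of q z] by (auto simp: W_def mem_flip)
    have "selected D W"
    proof (rule ccontr)
      assume "\<not> ?thesis"
      then have "selected D (D - W)" using selected_antipode[OF True] by simp
      then have "card (flip W (D - W)) \<le> 3" by (intro near) auto
      moreover have "flip W (D - W) = D" using True by (auto simp: mem_flip)
      ultimately show False using D4 by simp
    qed
    then show ?thesis using True zc by (auto simp: facet_def)
  next
    case False
    define V where "V = W \<inter> D"
    have finV: "finite V" using finD by (simp add: V_def)
    have "card (W - D) \<noteq> 0" using False finW by auto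
    moreover have "card (flip W y) = card (flip V y) + card (W - D)" if "y \<subseteq> D" for y
    proof -
      have fy: "finite y" using that finD by (rule finite_subset)
      have "flip W y = flip V y \<union> (W - D)" using that by (auto simp: mem_flip V_def)
      moreover have "flip V y \<inter> (W - D) = {}" using that by (auto simp: mem_flip V_def)
      ultimately show ?thesis using finV fy finW by (simp add: card_Un_disjoint)
    qed
    ultimately have small: "card (flip V y) \<le> 2" if "y \<subseteq> D" "selected D y" for y
      using near[OF that] that(1) by fastforce
    have "card (flip V {}) \<le> 2" by (rule small) (auto simp: selected_def)
    moreover have "flip V {} = V" by (auto simp: mem_flip)
    ultimately have V2: "card V \<le> 2" by simp
    have three: "card (D - {d}) = 3" if "d \<in> D" for d using that D4 finD by simp
    have "\<exists>d\<in>D. V = {} \<or> d \<in> V"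
    proof (cases "V = {}")
      case True
      moreover have "D \<noteq> {}" using D4 by auto
      ultimately show ?thesis by blast
    next
      case False
      then show ?thesis by (auto simp: V_def)
    qed
    \<comment> \<open>The 3-element set \<open>D - {d}\<close> is at distance 3 from the empty set
      and at distance \<open>5 - card V\<close> from a set \<open>V\<close> containing
      \<open>d\<close>. The selected empty set bounds \<open>card V\<close> by 2, so the distance is
      at least 3.\<close>
    then obtain d where d: "d \<in> D" "V = {} \<or> d \<in> V" by blast
    have "V \<inter> (D - {d}) = V - {d}" by (auto simp: V_def)
    then have "card (flip V (D - {d})) + 2 * card (V - {d}) = card V + 3"
      using card_flip[OF finV, of "D - {d}"] three[OF d(1)] finD by simp
    moreover have "card (flip V (D - {d})) \<le> 2" by (rule small) (use three[OF d(1)] in \<open>auto simp: selected_def\<close>)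
    moreover have "card V = 0 \<or> card (V - {d}) + 1 = card V"
    proof (cases "V = {}")
      case False
      then have "d \<in> V" using d(2) by blast
      then show ?thesis using card_Suc_Diff1[OF finV] by simp
    qed simp
    moreover have "card V = 0 \<longrightarrow> card (V - {d}) = 0" using finV by simp
    ultimately show ?thesis using V2 by auto
  qed
qed

lemma antipode_free_vr:
  assumes T: "T \<subseteq> cube q D" "T \<noteq> {}" "\<And>x. x \<in> T \<Longrightarrow> flip x D \<notin> T" and V: "q \<union> D \<subseteq> {1..m}"
  shows "T \<in> vr m"
proof -
  have "ham x y \<le> 3" if "x \<in> T" "y \<in> T" for x y
  proof -
    have "y \<noteq> flip x D" using T(3) that by blast
    then have "ham x y \<noteq> 4" "ham x y \<le> 4" using ham_cube[of x y] T(1) that by auto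
    then show ?thesis by simp
  qed
  moreover have "T \<subseteq> Pow {1..m}"
  proof
    fix x assume "x \<in> T"
    then have "x \<subseteq> q \<union> D" using T(1) by (auto simp: cube_def)
    then show "x \<in> Pow {1..m}" using V by blast
  qed
  ultimately show ?thesis using T(2) by (simp add: vr_def)
qed

end

text \<open>Since a facet spans its 4-face, the only deleted simplex inside a given 4-face is the
  one chosen for that face.\<close>

lemma facets_eq_facet:
  assumes i: "(q, D) \<in> cube_index m" and T: "T \<in> facets m" "T \<subseteq> cube q D"
  shows "T = facet q D"
proof -
  obtain q' D' where i': "(q', D') \<in> cube_index m" "T = facet q' D'" using T(1) by (auto simp: facets_def)
  note d = cube_indexD[OF i] and d' = cube_indexD[OF i'(1)]
  note IU = facet_Inter_Union[OF d'(1,2,3,5)]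
  have "q' \<in> cube q D" using bottom_top(1)[OF d'(1,2,3,5)] T(2) i'(2) by blast
  then have "q \<subseteq> q'" by (simp add: cube_def)
  have "x \<subseteq> q \<union> D" if "x \<in> facet q' D'" for x using that T(2) i'(2) by (auto simp: cube_def)
  then have "q' \<union> D' \<subseteq> q \<union> D" unfolding IU(2)[symmetric] by blast
  then have "D' \<subseteq> D" using d'(3) \<open>q \<subseteq> q'\<close> by blast
  then have "D' = D" by (rule card_subset_eq[OF d(2)]) (simp add: d d')
  then have "q' = q" using \<open>q \<subseteq> q'\<close> \<open>q' \<union> D' \<subseteq> q \<union> D\<close> d'(3) by blast
  then show ?thesis using \<open>D' = D\<close> i'(2) by simp
qed

lemma facets_vr:
  assumes "\<sigma> \<in> facets m"
  shows "\<sigma> \<in> vr m" "card \<sigma> = 8" "\<And>\<omega>. \<omega> \<in> vr m \<Longrightarrow> \<sigma> \<subseteq> \<omega> \<Longrightarrow> \<omega> = \<sigma>"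
proof -
  obtain q D where i: "(q, D) \<in> cube_index m" and \<sigma>: "\<sigma> = facet q D" using assms by (auto simp: facets_def)
  note d = cube_indexD[OF i]
  note ctx = d(1,2,3,5)
  show "\<sigma> \<in> vr m" unfolding \<sigma>
    by (rule antipode_free_vr[OF ctx facet_subset_cube[OF ctx] _ _ d(4)])
       (use bottom_top(1)[OF ctx] facet_flip[OF ctx] facet_subset_cube[OF ctx] in auto)
  show "card \<sigma> = 8" unfolding \<sigma> by (rule finite_cube(2)[OF ctx])
  fix \<omega> assume \<omega>: "\<omega> \<in> vr m" "\<sigma> \<subseteq> \<omega>"
  have "z \<in> \<sigma>" if z: "z \<in> \<omega>" for z
    unfolding \<sigma> by (rule facet_extension[OF ctx vrD(4)[OF \<omega>(1) z]])
      (use vrD(3)[OF \<omega>(1) _ z] \<omega>(2) \<sigma> in blast)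
  then show "\<omega> = \<sigma>" using \<omega>(2) by blast
qed

lemma card_facets: "card (facets m) = 2 ^ (m - 4) * (m choose 4)"
proof -
  have "inj_on (\<lambda>(q, D). facet q D) (cube_index m)"
  proof (rule inj_onI, clarify)
    fix q D q' D' assume i: "(q, D) \<in> cube_index m" "(q', D') \<in> cube_index m" and eq: "facet q D = facet q' D'"
    note d = cube_indexD[OF i(1)] and d' = cube_indexD[OF i(2)]
    have "q = q'" using facet_Inter_Union(1)[OF d(1,2,3,5)] facet_Inter_Union(1)[OF d'(1,2,3,5)] eq by simp
    moreover have "q \<union> D = q' \<union> D'"
      using facet_Inter_Union(2)[OF d(1,2,3,5)] facet_Inter_Union(2)[OF d'(1,2,3,5)] eq by simp
    ultimately show "q = q' \<and> D = D'" using d(3) d'(3) by blast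
  qed
  then have "card (facets m) = card (cube_index m)" by (simp add: facets_def card_image)
  also have "cube_index m = prod.swap ` (SIGMA D:{D. D \<subseteq> {1..m} \<and> card D = 4}. Pow ({1..m} - D))"
    by (auto simp: cube_index_def image_iff)
  also have "card \<dots> = card (SIGMA D:{D. D \<subseteq> {1..m} \<and> card D = 4}. Pow ({1..m} - D))"
    by (rule card_image) (auto simp: inj_on_def)
  also have "\<dots> = 2 ^ (m - 4) * (m choose 4)" by (rule card_sets_with_disjoint_4_set)
  finally show ?thesis .
qed

text \<open>An antipodal pair other than bottom and top, or a full facet, is insensitive to toggling the top.
  In all other cases bottom and top are present, and toggling the antipode of the first vertex missing
  from the facet creates no new antipodal pair.\<close>

definition has_side_pair :: "nat set set \<Rightarrow> bool" where
  "has_side_pair S \<longleftrightarrow> (\<exists>x\<in>S. flip x (\<Union> S - \<Inter> S) \<in> S \<and> x \<noteq> \<Inter> S \<and> x \<noteq> \<Union> S) \<or>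
     facet (\<Inter> S) (\<Union> S - \<Inter> S) \<subseteq> S"

definition first_unselected :: "nat set set \<Rightarrow> nat set" where
  "first_unselected S = arg_min set_encode (\<lambda>w. w \<in> facet (\<Inter> S) (\<Union> S - \<Inter> S) - S)"

definition antipodal_toggle :: "nat set set \<Rightarrow> nat set" where
  "antipodal_toggle S = (if has_side_pair S then \<Union> S else flip (first_unselected S) (\<Union> S - \<Inter> S))"

text \<open>A set in a 4-face fails to be a simplex exactly if two of its members are at distance 4,
  and such a pair already spans the 4-face. So every set to be collapsed has its own 4-face, and the
  matching can be built face by face.\<close>

lemma cubes_not_vr_facets_iff:
  "S \<in> vr_cubes m - (vr m - facets m) \<longleftrightarrow>
    (\<exists>q D. (q, D) \<in> cube_index m \<and> S \<subseteq> cube q D \<and> ((\<exists>x\<in>S. flip x D \<in> S) \<or> S = facet q D))"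
proof
  assume S: "S \<in> vr_cubes m - (vr m - facets m)"
  show "\<exists>q D. (q, D) \<in> cube_index m \<and> S \<subseteq> cube q D \<and> ((\<exists>x\<in>S. flip x D \<in> S) \<or> S = facet q D)"
  proof (cases "S \<in> facets m")
    case True
    then obtain q D where i: "(q, D) \<in> cube_index m" "S = facet q D" by (auto simp: facets_def)
    then show ?thesis using facet_subset_cube[OF cube_indexD(1,2,3,5)[OF i(1)]] by blast
  next
    case False
    then have Sv: "S \<notin> vr m" and "S \<in> cube_simplices m" using S by (auto simp: vr_cubes_def)
    then have SV: "S \<subseteq> Pow {1..m}" "S \<noteq> {}" "dim_span S \<le> 4" by (auto simp: cube_simplices_def)
    then obtain x y where xy: "x \<in> S" "y \<in> S" "\<not> ham x y \<le> 3" using Sv by (auto simp: vr_def)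
    let ?D = "\<Union> S - \<Inter> S"
    have sub: "flip x y \<subseteq> ?D" using xy(1,2) by (auto simp: mem_flip)
    have finD: "finite ?D" by (rule finite_Union_Diff_Inter[OF SV(1)])
    have le: "card (flip x y) \<le> card ?D" "card ?D \<le> 4" "card (flip x y) \<ge> 4"
      using card_mono[OF finD sub] SV(3) xy(3) by (simp_all add: dim_span_def ham_def)
    have eq: "flip x y = ?D" by (rule card_seteq[OF finD sub]) (use le in linarith)
    have c4: "card ?D = 4" using le by linarith
    have "flip x ?D = y" using eq flip_flip[of x y] by simp
    moreover have "\<Inter> S \<subseteq> \<Union> S" using SV(2) by blast
    then have "S \<subseteq> cube (\<Inter> S) ?D" by (auto simp: cube_def)
    moreover have "\<Union> S \<subseteq> {1..m}" using SV(1) by blast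
    then have "(\<Inter> S, ?D) \<in> cube_index m" using c4 \<open>\<Inter> S \<subseteq> \<Union> S\<close> by (auto simp: cube_index_def)
    ultimately show ?thesis using xy(1,2) by blast
  qed
next
  assume "\<exists>q D. (q, D) \<in> cube_index m \<and> S \<subseteq> cube q D \<and> ((\<exists>x\<in>S. flip x D \<in> S) \<or> S = facet q D)"
  then obtain q D where i: "(q, D) \<in> cube_index m" and S: "S \<subseteq> cube q D"
    and or: "(\<exists>x\<in>S. flip x D \<in> S) \<or> S = facet q D" by blast
  note d = cube_indexD[OF i]
  show "S \<in> vr_cubes m - (vr m - facets m)"
  proof (cases "S = facet q D")
    case True
    then have "S \<in> facets m" using i by (auto simp: facets_def)
    then show ?thesis using facets_vr(1)[of S m] by (simp add: vr_cubes_def)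
  next
    case False
    then obtain x where x: "x \<in> S" "flip x D \<in> S" using or by blast
    then have "ham x (flip x D) = 4" using d(1) by (simp add: ham_flip)
    then have "S \<notin> vr m" using vrD(3)[of S m x "flip x D"] x by auto
    moreover have "dim_span S \<le> card D"
    proof (rule dim_span_le[of S q])
      show "flip q s \<subseteq> D" if "s \<in> S" for s using S that by (auto simp: cube_def mem_flip subset_iff)
    qed (use x d in auto)
    moreover have "s \<subseteq> q \<union> D" if "s \<in> S" for s using S that by (auto simp: cube_def)
    then have "S \<subseteq> Pow {1..m}" using d(4) by blast
    ultimately have "S \<in> cube_simplices m" using x(1) d(1) by (auto simp: cube_simplices_def)
    with \<open>S \<notin> vr m\<close> show ?thesis by (simp add: vr_cubes_def)
  qed
qed

lemma cubes_not_vr_facets_span: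
  assumes i: "(q, D) \<in> cube_index m" and S: "S \<subseteq> cube q D" "(\<exists>x\<in>S. flip x D \<in> S) \<or> S = facet q D"
  shows "\<Inter> S = q" "\<Union> S = q \<union> D" "\<Union> S - \<Inter> S = D"
proof -
  note ctx = cube_indexD(1,2,3,5)[OF i]
  have sub: "q \<subseteq> x \<and> x \<subseteq> q \<union> D" if "x \<in> S" for x using S(1) that by (auto simp: cube_def)
  show IU: "\<Inter> S = q" "\<Union> S = q \<union> D"
  proof (use S(2) in \<open>atomize(full), elim disjE bexE\<close>)
    fix x assume x: "x \<in> S" "flip x D \<in> S"
    have xc: "x \<in> cube q D" using x(1) S(1) by blast
    note cf = cube_flip(3,4)[OF ctx xc]
    have "\<Inter> S \<subseteq> x \<inter> flip x D" "x \<union> flip x D \<subseteq> \<Union> S" using x by auto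
    moreover have "q \<subseteq> \<Inter> S" "\<Union> S \<subseteq> q \<union> D" using sub by auto
    ultimately show "\<Inter> S = q \<and> \<Union> S = q \<union> D" unfolding cf by blast
  next
    assume "S = facet q D"
    then show "\<Inter> S = q \<and> \<Union> S = q \<union> D" using facet_Inter_Union[OF ctx] by simp
  qed
  show "\<Union> S - \<Inter> S = D" unfolding IU using ctx(3) by blast
qed

lemma finite_complex_vr_Diff_facets: "finite_complex (vr m - facets m)"
  by (rule maximal_Diff_finite_complex[OF finite_complex_vr facets_vr(3)])

lemma vr_vertices_edges:
  assumes "S \<in> vr m" "card S < 8"
  shows "S \<in> vr m - facets m"
  using assms facets_vr(2)[of S m] by auto

text \<open>Sets with a pair besides bottom and top, or with a full facet, are matched by toggling
  the top; in particular the deleted facet is matched with itself plus the top. The others contain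
  bottom and top and miss some facet vertex, whose antipode is toggled.\<close>

lemma collapse_antipodal:
  "pointed_equivalent (geometric_realization (vr_cubes m)) (vertex_point {1..m})
     (geometric_realization (vr m - facets m)) (vertex_point {1..m})"
\<comment> \<open>Every vertex is a subset of \<open>{1..m}\<close>, so the value for sets toggling
  the top exceeds all codes used for the other sets.\<close>
proof (rule collapse_by_toggles[where a = antipodal_toggle
      and \<phi> = "\<lambda>S. if has_side_pair S then Suc (set_encode {1..m}) else set_encode (first_unselected S)"])
  show "vertex_point {1..m} \<in> realization_points (vr m - facets m)"
    by (intro vertex_point_in vr_vertices_edges) (auto simp: vr_def)
  have pick: "first_unselected S \<in> facet q D - S"
    "\<And>w. w \<in> facet q D - S \<Longrightarrow> set_encode (first_unselected S) \<le> set_encode w"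
    if pk: "\<Inter> S = q" "\<Union> S - \<Inter> S = D" "\<not> facet q D \<subseteq> S" for S q D
  proof -
    have eq: "first_unselected S = arg_min set_encode (\<lambda>w. w \<in> facet q D - S)"
      using pk(1,2) unfolding first_unselected_def by simp
    obtain w0 where w0: "w0 \<in> facet q D - S" using pk(3) by blast
    show "first_unselected S \<in> facet q D - S"
      unfolding eq by (rule arg_min_natI[of "\<lambda>w. w \<in> facet q D - S", OF w0])
    show "set_encode (first_unselected S) \<le> set_encode w" if "w \<in> facet q D - S" for w
      unfolding eq by (rule arg_min_nat_le[of "\<lambda>w. w \<in> facet q D - S", OF that])
  qed
  fix S assume "S \<in> vr_cubes m - (vr m - facets m)"
  then obtain q D where i: "(q, D) \<in> cube_index m" and S: "S \<subseteq> cube q D"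
    "(\<exists>x\<in>S. flip x D \<in> S) \<or> S = facet q D" unfolding cubes_not_vr_facets_iff by blast
  note d = cube_indexD[OF i]
  note ctx = d(1,2,3,5)
  note bt = bottom_top[OF ctx] and cf = cube_flip[OF ctx] and ff = facet_flip[OF ctx]
  define top where "top = q \<union> D"
  note bt = bt[folded top_def]
  have tq: "top - q = D" using ctx(3) by (auto simp: top_def)
  have fam: "T \<in> vr_cubes m - (vr m - facets m)" if "T \<subseteq> cube q D" "(\<exists>x\<in>T. flip x D \<in> T) \<or> T = facet q D" for T
    unfolding cubes_not_vr_facets_iff using i that by blast
  have span: "\<Inter> T = q" "\<Union> T = top" "\<Union> T - \<Inter> T = D" if "T \<subseteq> cube q D" "(\<exists>x\<in>T. flip x D \<in> T) \<or> T = facet q D" for T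
    using cubes_not_vr_facets_span[OF i that] by (simp_all add: top_def)
  have side: "has_side_pair T \<longleftrightarrow> (\<exists>x\<in>T. flip x D \<in> T \<and> x \<noteq> q \<and> x \<noteq> top) \<or> facet q D \<subseteq> T"
    if "T \<subseteq> cube q D" "(\<exists>x\<in>T. flip x D \<in> T) \<or> T = facet q D" for T
    unfolding has_side_pair_def span(1,2)[OF that] tq by blast
  have tog: "antipodal_toggle T = (if has_side_pair T then top else flip (first_unselected T) D)"
    if "T \<subseteq> cube q D" "(\<exists>x\<in>T. flip x D \<in> T) \<or> T = facet q D" for T
    unfolding antipodal_toggle_def span(1,2)[OF that] tq by simp
  \<comment> \<open>A set of the family inside this 4-face has this very 4-face as its own, for a
    4-face contains no other.\<close>
  have small: "T \<subseteq> cube q D \<and> ((\<exists>x\<in>T. flip x D \<in> T) \<or> T = facet q D)"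
    if T: "T \<in> vr_cubes m - (vr m - facets m)" "T \<subseteq> cube q D" for T
  proof -
    obtain q' D' where i': "(q', D') \<in> cube_index m" and T': "T \<subseteq> cube q' D'"
      "(\<exists>x\<in>T. flip x D' \<in> T) \<or> T = facet q' D'" using T(1) unfolding cubes_not_vr_facets_iff by blast
    note d' = cube_indexD[OF i']
    have IU: "\<Inter> T = q'" "\<Union> T = q' \<union> D'" using cubes_not_vr_facets_span[OF i' T'] by auto
    have "T \<noteq> {}" using T'(2) bottom_top(1)[OF d'(1,2,3,5)] by auto
    then have "q \<subseteq> \<Inter> T" "\<Union> T \<subseteq> q \<union> D" using T(2) by (auto simp: cube_def)
    then have qq: "q \<subseteq> q'" "q' \<union> D' \<subseteq> q \<union> D" unfolding IU by blast+
    then have "D' \<subseteq> D" using d'(3) by blast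
    then have "D' = D" by (rule card_subset_eq[OF d(2)]) (simp add: d d')
    moreover have "q' = q" using qq \<open>D' = D\<close> d'(3) by blast
    ultimately show ?thesis using T(2) T'(2) by simp
  qed
  have side_mono: "has_side_pair T'" if "T \<subseteq> T'" "has_side_pair T"
    "T \<subseteq> cube q D" "(\<exists>x\<in>T. flip x D \<in> T) \<or> T = facet q D"
    "T' \<subseteq> cube q D" "(\<exists>x\<in>T'. flip x D \<in> T') \<or> T' = facet q D" for T T'
    using that(1,2) unfolding side[OF that(3,4)] side[OF that(5,6)] by blast
  have enc: "set_encode w \<le> set_encode {1..m}" if "w \<in> cube q D" for w
  proof -
    have "w \<subseteq> {1..m}" using that d(4) by (auto simp: cube_def)
    then show ?thesis unfolding set_encode_def by (intro sum_mono2) auto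
  qed
  define c where "c = antipodal_toggle S"
  have key: "toggle c S \<in> vr_cubes m - (vr m - facets m) \<and> antipodal_toggle (toggle c S) = c \<and>
    (c \<notin> S \<longrightarrow> (\<forall>v\<in>S. insert c (S - {v}) \<in> vr_cubes m - (vr m - facets m) \<longrightarrow>
      antipodal_toggle (insert c (S - {v})) \<notin> insert c (S - {v}) \<longrightarrow>
      (if has_side_pair (insert c (S - {v})) then Suc (set_encode {1..m}) else set_encode (first_unselected (insert c (S - {v}))))
      < (if has_side_pair S then Suc (set_encode {1..m}) else set_encode (first_unselected S))))"
  proof (cases "has_side_pair S")
    case True
    then have cS: "c = top" unfolding c_def tog[OF S] by simp
    have T: "toggle c S \<subseteq> cube q D" using S(1) bt(2) by (auto simp: cS toggle_def)
    have T2: "((\<exists>x\<in>toggle c S. flip x D \<in> toggle c S) \<or> toggle c S = facet q D) \<and> has_side_pair (toggle c S)"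
    proof -
      consider x where "x \<in> S" "flip x D \<in> S" "x \<noteq> q" "x \<noteq> top" | "facet q D \<subseteq> S"
        using True unfolding side[OF S] by blast
      then show ?thesis
      proof cases
        case 1
        have xc: "x \<in> cube q D" using 1(1) S(1) by blast
        have "flip x D \<noteq> top" using 1(3) cf(2)[OF xc] cf(2)[OF bt(4)] bt(5) by metis
        then have x: "x \<in> toggle c S" "flip x D \<in> toggle c S" using 1 by (simp_all add: toggle_neq cS)
        then have or: "(\<exists>x\<in>toggle c S. flip x D \<in> toggle c S) \<or> toggle c S = facet q D" by blast
        then show ?thesis using x 1(3,4) unfolding side[OF T or] by blast
      next
        case 2
        have sub: "facet q D \<subseteq> toggle c S" using 2 bt(3) by (auto simp: toggle_def cS)
        \<comment> \<open>Toggling the top may leave exactly the facet, which is in the family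
          because it was deleted. Any further vertex is antipodal to a facet vertex.\<close>
        have or: "(\<exists>x\<in>toggle c S. flip x D \<in> toggle c S) \<or> toggle c S = facet q D"
        proof (cases "toggle c S = facet q D")
          case False
          then obtain z where z: "z \<in> toggle c S" "z \<notin> facet q D" using sub by blast
          then have "flip z D \<in> facet q D" using ff[of z] T by blast
          then show ?thesis using z sub by blast
        qed simp
        then show ?thesis using sub unfolding side[OF T or] by blast
      qed
    qed
    then have or: "(\<exists>x\<in>toggle c S. flip x D \<in> toggle c S) \<or> toggle c S = facet q D" by blast
    have "antipodal_toggle (toggle c S) = c" unfolding tog[OF T or] using T2 cS by simp
    \<comment> \<open>A lower partner containing the top cannot be one that toggles the top, so its
      rank is a mere code.\<close>
    moreover have "\<not> has_side_pair \<tau> \<and> set_encode (first_unselected \<tau>) < Suc (set_encode {1..m})"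
      if \<tau>: "\<tau> \<in> vr_cubes m - (vr m - facets m)" "\<tau> \<subseteq> cube q D" "c \<in> \<tau>" "antipodal_toggle \<tau> \<notin> \<tau>" for \<tau>
    proof -
      note sm = small[OF \<tau>(1,2)]
      have ns: "\<not> has_side_pair \<tau>" using \<tau>(3,4) tog[of \<tau>] sm cS by auto
      then have "\<not> facet q D \<subseteq> \<tau>" using side[of \<tau>] sm by blast
      then have "first_unselected \<tau> \<in> facet q D - \<tau>" using pick(1)[of \<tau> q D] span[of \<tau>] sm by blast
      then have "first_unselected \<tau> \<in> cube q D" using facet_subset_cube[OF ctx] by blast
      then show ?thesis using ns enc by (simp add: le_imp_less_Suc)
    qed
    moreover have "insert c (S - {v}) \<subseteq> cube q D" for v using S(1) bt(2) cS by auto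
    ultimately show ?thesis using fam[OF T or] True by simp
  next
    case False
    then have nside: "\<not> facet q D \<subseteq> S" "\<And>x. x \<in> S \<Longrightarrow> flip x D \<in> S \<Longrightarrow> x = q \<or> x = top"
      unfolding side[OF S] by blast+
    then obtain x where x: "x \<in> S" "flip x D \<in> S" using S(2) by auto
    then have "x = q \<or> x = top" using nside(2) by blast
    then have qtS: "q \<in> S" "top \<in> S" using x bt(5) cf(2)[OF bt(4)] by auto
    define w where "w = first_unselected S"
    have w: "w \<in> facet q D" "w \<notin> S" using pick(1)[OF span(1)[OF S] span(3)[OF S] nside(1)] by (simp_all add: w_def)
    have wc: "w \<in> cube q D" using w(1) facet_subset_cube[OF ctx] by blast
    have cw: "c = flip w D" unfolding c_def tog[OF S] using False by (simp add: w_def)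
    have cc: "c \<in> cube q D" "flip c D = w" using cf(1,2)[OF wc] cw by auto
    have cnf: "c \<notin> facet q D" using ff[OF wc] w(1) cw by simp
    have cq: "c \<noteq> q" using cnf bt(1) by blast
    have ct: "c \<noteq> top" using cc(2) cf(2)[OF bt(4)] bt(5) qtS(1) w(2) by metis
    have T: "insert c S \<subseteq> cube q D" "toggle c S \<subseteq> cube q D" using S(1) cc(1) by (auto simp: toggle_def)
    \<comment> \<open>The only antipodal pair that \<open>c\<close> could create needs
      \<open>w\<close>, which is absent, and the absence of \<open>w\<close> also prevents a full
      facet.\<close>
    have noside: "\<not> has_side_pair \<tau>" if \<tau>: "\<tau> \<subseteq> insert c S" "q \<in> \<tau>" "top \<in> \<tau>" for \<tau>
    proof -
      have or: "(\<exists>x\<in>\<tau>. flip x D \<in> \<tau>) \<or> \<tau> = facet q D" using \<tau>(2,3) bt(5) by metis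
      have "w \<notin> \<tau>" using \<tau>(1) w(2) cnf w(1) by blast
      then have "\<not> facet q D \<subseteq> \<tau>" using w(1) by blast
      moreover have "x = q \<or> x = top" if x: "x \<in> \<tau>" "flip x D \<in> \<tau>" for x
      proof (cases "x = c \<or> flip x D = c")
        case True
        have xc: "x \<in> cube q D" using x(1) \<tau>(1) T(1) by blast
        have "x = w \<or> flip x D = w" using True cc(2) cf(2)[OF xc] by metis
        then show ?thesis using x \<open>w \<notin> \<tau>\<close> by blast
      next
        case False
        then show ?thesis using nside(2)[of x] x \<tau>(1) by blast
      qed
      ultimately show ?thesis unfolding side[OF order_trans[OF \<tau>(1) T(1)] or] by blast
    qed
    have qt: "q \<in> toggle c S" "top \<in> toggle c S" using qtS cq ct by (simp_all add: toggle_neq)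
    have or: "(\<exists>x\<in>toggle c S. flip x D \<in> toggle c S) \<or> toggle c S = facet q D" using qt bt(5) by metis
    have tsub: "toggle c S \<subseteq> insert c S" by (auto simp: toggle_def)
    have ns: "\<not> has_side_pair (toggle c S)" by (rule noside[OF tsub qt])
    have "facet q D - toggle c S = facet q D - S" using cnf by (auto simp: toggle_def)
    then have "first_unselected (toggle c S) = w"
      unfolding w_def first_unselected_def span(1,2)[OF T(2) or] span(1,2)[OF S] tq by (simp only:)
    then have "antipodal_toggle (toggle c S) = c" unfolding tog[OF T(2) or] using ns cw by simp
    moreover have "\<not> has_side_pair \<tau> \<and> set_encode (first_unselected \<tau>) < set_encode w"
      if \<tau>: "\<tau> \<in> vr_cubes m - (vr m - facets m)" "\<tau> \<subseteq> insert c S" "c \<in> \<tau>" "antipodal_toggle \<tau> \<notin> \<tau>" for \<tau>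
    proof -
      note sm = small[OF \<tau>(1) order_trans[OF \<tau>(2) T(1)]]
      have wt: "w \<notin> \<tau>" using \<tau>(2) w(2) cnf w(1) by blast
      then have nf: "\<not> facet q D \<subseteq> \<tau>" using w(1) by blast
      obtain x where x: "x \<in> \<tau>" "flip x D \<in> \<tau>" using sm nf by blast
      have xc: "x \<in> cube q D" using x(1) sm by blast
      have "x \<noteq> c" "flip x D \<noteq> c" using x wt cc(2) cf(2)[OF xc] by metis+
      then have "x \<in> S" "flip x D \<in> S" using x \<tau>(2) by auto
      then have "x = q \<or> x = top" using nside(2) by blast
      then have "q \<in> \<tau>" "top \<in> \<tau>" using x bt(5) cf(2)[OF bt(4)] by auto
      then have ns: "\<not> has_side_pair \<tau>" by (rule noside[OF \<tau>(2)])
      have sp: "\<Inter> \<tau> = q" "\<Union> \<tau> - \<Inter> \<tau> = D" using span[of \<tau>] sm by blast+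
      \<comment> \<open>The vertex \<open>w\<close> is still missing. It is not the first missing
        one, or the vertex to toggle would be \<open>c\<close>, which is present.\<close>
      have "set_encode (first_unselected \<tau>) \<le> set_encode w" by (rule pick(2)[OF sp nf]) (use w(1) wt in blast)
      moreover have "first_unselected \<tau> \<noteq> w"
        using \<tau>(3,4) tog[of \<tau>] sm ns cw by auto
      moreover have "first_unselected \<tau> \<in> cube q D"
        using pick(1)[OF sp nf] facet_subset_cube[OF ctx] by blast
      then have "finite (first_unselected \<tau>)" "finite w" using ham_cube(3)[OF ctx] wc by blast+
      ultimately show ?thesis using ns set_encode_eq[of "first_unselected \<tau>" w] by (simp add: less_le)
    qed
    moreover have "insert c (S - {v}) \<subseteq> insert c S" for v by blast
    ultimately show ?thesis using fam[OF T(2) or] False by (simp add: w_def)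
  qed
  show "toggle (antipodal_toggle S) S \<in> vr_cubes m - (vr m - facets m)"
    "antipodal_toggle (toggle (antipodal_toggle S) S) = antipodal_toggle S"
    using key unfolding c_def by blast+
  fix v assume "antipodal_toggle S \<notin> S" "v \<in> S"
    "insert (antipodal_toggle S) (S - {v}) \<in> vr_cubes m - (vr m - facets m)"
    "antipodal_toggle (insert (antipodal_toggle S) (S - {v})) \<notin> insert (antipodal_toggle S) (S - {v})"
  then show "(if has_side_pair (insert (antipodal_toggle S) (S - {v})) then Suc (set_encode {1..m})
      else set_encode (first_unselected (insert (antipodal_toggle S) (S - {v}))))
      < (if has_side_pair S then Suc (set_encode {1..m}) else set_encode (first_unselected S))"
    using key unfolding c_def by blast
next
  show "vr m - facets m \<subseteq> vr_cubes m" by (auto simp: vr_cubes_def)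
qed (rule finite_complex_vr_cubes finite_complex_vr_Diff_facets)+

section \<open>Null-homotopies of the boundaries of the deleted simplices\<close>

lemma simplex_boundary_support:
  assumes "x \<in> simplex_boundary \<sigma>" "finite \<sigma>"
  shows "{v. x v \<noteq> 0} \<subset> \<sigma>" "{v. x v \<noteq> 0} \<noteq> {}" "x \<in> closed_simplex {v. x v \<noteq> 0}"
proof -
  obtain v where x: "x \<in> closed_simplex \<sigma>" and v: "v \<in> \<sigma>" "x v = 0" using assms(1) by (auto simp: simplex_boundary_def)
  show "{v. x v \<noteq> 0} \<subset> \<sigma>" using simplex_support(1)[OF x assms(2)] v by blast
  show "{v. x v \<noteq> 0} \<noteq> {}" "x \<in> closed_simplex {v. x v \<noteq> 0}" using simplex_support(2,3)[OF x assms(2)] by blast+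
qed

lemma simplex_boundary_in_Diff:
  assumes K: "finite_complex K" and \<sigma>: "\<sigma> \<in> S" "\<sigma> \<in> K"
    and max: "\<And>\<sigma> \<omega>. \<sigma> \<in> S \<Longrightarrow> \<omega> \<in> K \<Longrightarrow> \<sigma> \<subseteq> \<omega> \<Longrightarrow> \<omega> = \<sigma>"
  shows "simplex_boundary \<sigma> \<subseteq> realization_points (K - S)"
proof
  fix x assume x: "x \<in> simplex_boundary \<sigma>"
  note sup = simplex_boundary_support[OF x finite_complexD(2)[OF K \<sigma>(2)]]
  have "{v. x v \<noteq> 0} \<in> K" by (rule finite_complexD(4)[OF K \<sigma>(2) _ sup(2)]) (use sup(1) in blast)
  moreover have "{v. x v \<noteq> 0} \<notin> S" using max[OF _ \<sigma>(2), of "{v. x v \<noteq> 0}"] sup(1) by blast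
  ultimately show "x \<in> realization_points (K - S)" using sup(3) unfolding realization_points_def by blast
qed

lemma contractible_null_homotopic:
  assumes eq: "pointed_equivalent Y y (discrete_topology {()}) ()"
    and f: "continuous_map X Y f"
  shows "homotopic_with (\<lambda>_. True) X Y (\<lambda>_. y) f"
proof -
  obtain h k where h: "continuous_map Y (discrete_topology {()}) h" and k: "k () = y"
    and kh: "homotopic_with (\<lambda>k. k y = y) Y Y (k \<circ> h) id"
    using eq unfolding pointed_equivalent_def by blast
  have "homotopic_with (\<lambda>_. True) Y Y (k \<circ> h) id" by (rule homotopic_with_mono[OF kh]) simp
  then have "homotopic_with (\<lambda>_. True) X Y ((k \<circ> h) \<circ> f) (id \<circ> f)"
    by (rule homotopic_with_compose_continuous_map_right[OF _ f]) simp
  moreover have "(k \<circ> h) \<circ> f = (\<lambda>_. y)" using k by (auto simp: fun_eq_iff)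
  ultimately show ?thesis by simp
qed

text \<open>On the boundary of the simplex \<open>\<sigma>\<close>, the level \<open>t\<close> cuts every barycentric coordinate; what is
  missing up to \<open>t\<close> is put onto the antipodal vertex.\<close>

lemma boundary_homotopic_antipodal:
  assumes K: "finite_complex K" and fin: "finite \<sigma>" and inj: "inj_on g \<sigma>" and g: "g ` \<sigma> \<inter> \<sigma> = {}"
    and sub: "\<And>T. T \<subseteq> \<sigma> \<union> g ` \<sigma> \<Longrightarrow> T \<noteq> {} \<Longrightarrow> (\<And>v. v \<in> \<sigma> \<Longrightarrow> v \<in> T \<Longrightarrow> g v \<notin> T) \<Longrightarrow> T \<noteq> \<sigma> \<Longrightarrow> T \<in> K"
    and w: "w \<in> \<sigma>"
  shows "homotopic_with (\<lambda>_. True) (subtopology (powertop_real UNIV) (simplex_boundary \<sigma>))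
    (geometric_realization K) id (\<lambda>_. vertex_point (g w))"
proof -
  let ?X = "subtopology (powertop_real UNIV) (simplex_boundary \<sigma>)"
  define g' where "g' = inv_into \<sigma> g"
  \<comment> \<open>Excess on \<open>v\<close> and deficit on its antipode are never both positive,
    so no antipodal pair enters the support.\<close>
  define N where "N = (\<lambda>(t::real, x) v. if v \<in> \<sigma> then max (x v - t) 0
    else if v \<in> g ` \<sigma> then max (t - x (g' v)) 0 else 0)"
  \<comment> \<open>The total mass, as excess plus deficit is the absolute difference.\<close>
  define T where "T = (\<lambda>(t::real, x). \<Sum>w\<in>\<sigma>. \<bar>x w - t\<bar>)"
  define h where "h = (\<lambda>z v. N z v / T z)"
  have g'g: "g' (g v) = v" if "v \<in> \<sigma>" for v using that inj by (simp add: g'_def)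
  have sumN: "sum (N (t, x)) (\<sigma> \<union> g ` \<sigma>) = T (t, x)" for t x
  proof -
    have "sum (N (t, x)) (\<sigma> \<union> g ` \<sigma>) = sum (N (t, x)) \<sigma> + sum (N (t, x)) (g ` \<sigma>)"
      using fin g by (intro sum.union_disjoint) auto
    also have "sum (N (t, x)) (g ` \<sigma>) = (\<Sum>v\<in>\<sigma>. N (t, x) (g v))" by (simp add: sum.reindex[OF inj])
    also have "\<dots> = (\<Sum>v\<in>\<sigma>. max (t - x v) 0)"
      using g by (intro sum.cong) (auto simp: N_def g'g)
    also have "sum (N (t, x)) \<sigma> = (\<Sum>v\<in>\<sigma>. max (x v - t) 0)" by (intro sum.cong) (auto simp: N_def)
    finally have "sum (N (t, x)) (\<sigma> \<union> g ` \<sigma>) = (\<Sum>v\<in>\<sigma>. max (x v - t) 0 + max (t - x v) 0)" by (simp add: sum.distrib)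
    also have "\<dots> = T (t, x)" unfolding T_def split by (intro sum.cong) auto
    finally show ?thesis .
  qed
  have bnd: "x \<in> closed_simplex \<sigma>" "\<exists>v\<in>\<sigma>. x v = 0" "\<And>v. 0 \<le> x v" "\<And>v. v \<notin> \<sigma> \<Longrightarrow> x v = 0" "sum x \<sigma> = 1"
    if "x \<in> simplex_boundary \<sigma>" for x
    using that by (auto simp: simplex_boundary_def closed_simplex_def)
  have Tpos: "T (t, x) > 0" if t: "0 \<le> t" and x: "x \<in> simplex_boundary \<sigma>" for t x
  proof -
    \<comment> \<open>A boundary point has a zero coordinate; if all coordinates were equal to
      \<open>t\<close> they would vanish, but they add up to 1.\<close>
    have "\<exists>w\<in>\<sigma>. x w \<noteq> t"
    proof (rule ccontr)
      assume c: "\<not> ?thesis"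
      then have "t = 0" using bnd(2)[OF x] by auto
      then have "sum x \<sigma> = 0" using c by (intro sum.neutral) auto
      then show False using bnd(5)[OF x] by simp
    qed
    then obtain w where "w \<in> \<sigma>" "x w \<noteq> t" by blast
    then show ?thesis unfolding T_def split by (intro sum_pos2[OF fin]) auto
  qed
  have simp: "h (t, x) \<in> closed_simplex (\<sigma> \<union> g ` \<sigma>)" if t: "0 \<le> t" and x: "x \<in> simplex_boundary \<sigma>" for t x
  proof -
    have "sum (h (t, x)) (\<sigma> \<union> g ` \<sigma>) = 1"
      unfolding h_def sum_divide_distrib[symmetric] sumN using Tpos[OF that] by simp
    moreover have "0 \<le> h (t, x) v" for v using Tpos[OF that] by (auto simp: h_def N_def)
    ultimately show ?thesis by (auto simp: closed_simplex_def h_def N_def)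
  qed
  have poly: "h (t, x) \<in> realization_points K" if t: "0 \<le> t" and x: "x \<in> simplex_boundary \<sigma>" for t x
  proof -
    let ?T = "{v. h (t, x) v \<noteq> 0}"
    have "finite (\<sigma> \<union> g ` \<sigma>)" using fin by simp
    note s = simplex_support[OF simp[OF that] this]
    have "?T \<in> K"
    proof (rule sub[OF s(1,2)])
      fix v assume v: "v \<in> \<sigma>" "v \<in> ?T"
      then have "N (t, x) v \<noteq> 0" by (auto simp: h_def)
      then have "x v > t" using v(1) by (auto simp: N_def max_def split: if_splits)
      moreover have "g v \<notin> \<sigma>" using g v(1) by blast
      ultimately have "N (t, x) (g v) = 0" using v(1) by (auto simp: N_def g'g)
      then show "g v \<notin> ?T" by (simp add: h_def)
    next
      \<comment> \<open>A vertex where \<open>x\<close> vanishes has no excess at any level, so the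
        support is never the deleted simplex itself.\<close>
      obtain v where v: "v \<in> \<sigma>" "x v = 0" using bnd(2)[OF x] by blast
      then have "v \<notin> ?T" using t by (auto simp: h_def N_def)
      then show "?T \<noteq> \<sigma>" using v(1) by blast
    qed
    then show ?thesis using s(3) unfolding realization_points_def by blast
  qed
  let ?I = "prod_topology unit_interval ?X"
  have ch: "continuous_map ?I (geometric_realization K) h"
    unfolding continuous_map_realization[OF K]
  proof (intro conjI allI ballI)
    fix v
    have c1: "continuous_map ?I euclideanreal (\<lambda>z. snd z u)" for u
      by (intro continuous_map_compose_app[OF _ continuous_map_snd] continuous_map_coordinate)
    have c0: "continuous_map ?I euclideanreal fst"
      using continuous_map_fst[of unit_interval ?X] by (simp add: continuous_map_in_subtopology)
    have "continuous_map ?I euclideanreal (\<lambda>z. N z v)"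
    proof (cases "v \<in> \<sigma>")
      case True
      then have "(\<lambda>z. N z v) = (\<lambda>z. max (snd z v - fst z) 0)" by (auto simp: N_def fun_eq_iff)
      then show ?thesis by (simp only:) (intro continuous_map_real_max continuous_map_diff c0 c1; simp)
    next
      case False
      show ?thesis
      proof (cases "v \<in> g ` \<sigma>")
        case True
        then have "(\<lambda>z. N z v) = (\<lambda>z. max (fst z - snd z (g' v)) 0)" using False by (auto simp: N_def fun_eq_iff)
        then show ?thesis by (simp only:) (intro continuous_map_real_max continuous_map_diff c0 c1; simp)
      next
        case f: False
        then have "(\<lambda>z. N z v) = (\<lambda>z. 0)" using False by (auto simp: N_def fun_eq_iff)
        then show ?thesis by simp
      qed
    qed
    moreover have "continuous_map ?I euclideanreal T"
    proof -
      have "T = (\<lambda>z. \<Sum>w\<in>\<sigma>. \<bar>snd z w - fst z\<bar>)" by (auto simp: T_def fun_eq_iff)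
      then show ?thesis by (simp only:) (intro continuous_map_sum continuous_map_real_abs continuous_map_diff c0 c1 fin)
    qed
    moreover have "T z \<noteq> 0" if "z \<in> topspace ?I" for z using that Tpos[of "fst z" "snd z"] by fastforce
    ultimately show "continuous_map ?I euclideanreal (\<lambda>z. h z v)"
      unfolding h_def by (intro continuous_map_real_divide)
  next
    fix z assume "z \<in> topspace ?I"
    then show "h z \<in> realization_points K" using poly[of "fst z" "snd z"] by auto
  qed
  have h0: "h (0, x) = x" if x: "x \<in> simplex_boundary \<sigma>" for x
  proof
    fix v
    have "T (0, x) = sum x \<sigma>" unfolding T_def split using bnd(3)[OF x] by (intro sum.cong) auto
    then show "h (0, x) v = x v"
      using bnd(3,4,5)[OF x] by (simp add: h_def N_def max_absorb1 max_absorb2)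
  qed
  have "homotopic_with (\<lambda>_. True) ?X (geometric_realization K) id (\<lambda>x. h (1, x))"
    by (subst homotopic_with) (use ch h0 in \<open>auto intro!: exI[of _ h]\<close>)
  moreover have "homotopic_with (\<lambda>k. \<forall>x\<in>{}. k x = x) ?X (geometric_realization K) (\<lambda>x. h (1, x)) (\<lambda>_. vertex_point (g w))"
  proof (rule realization_straight_homotopy[OF K])
    show "continuous_map ?X (geometric_realization K) (\<lambda>x. h (1, x))"
      by (rule continuous_map_compose_app[OF ch]) (auto simp: continuous_map_pairwise o_def)
    have gK: "g ` \<sigma> \<in> K"
      by (rule sub) (use g w in auto)
    then have "{g w} \<in> K" by (rule finite_complexD(4)[OF K]) (use w in auto)
    then show "continuous_map ?X (geometric_realization K) (\<lambda>_. vertex_point (g w))"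
      using vertex_point_in[of "g w" K] by simp
    fix x assume "x \<in> topspace ?X"
    then have x: "x \<in> simplex_boundary \<sigma>" by simp
    have le: "x v \<le> 1" if "v \<in> \<sigma>" for v using member_le_sum[of v \<sigma> x] that fin bnd(3,5)[OF x] by auto
    \<comment> \<open>At level 1 no coordinate exceeds the level: the image lies in the simplex of
      all antipodes, which can be contracted along segments.\<close>
    have zero: "h (1, x) v = 0" if "v \<notin> g ` \<sigma>" for v using that le[of v] by (auto simp: h_def N_def max_def)
    have "sum (h (1, x)) (g ` \<sigma>) = sum (h (1, x)) (\<sigma> \<union> g ` \<sigma>)"
      by (rule sum.mono_neutral_left) (use fin zero in auto)
    then have "h (1, x) \<in> closed_simplex (g ` \<sigma>)"
      using simp[of 1 x] x zero by (auto simp: closed_simplex_def)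
    moreover have "vertex_point (g w) \<in> closed_simplex (g ` \<sigma>)"
      using simplex_mono[of "{g w}" "g ` \<sigma>"] w fin by (auto simp: closed_simplex_def vertex_point_def)
    ultimately show "\<exists>\<sigma>\<in>K. h (1, x) \<in> closed_simplex \<sigma> \<and> vertex_point (g w) \<in> closed_simplex \<sigma>"
      using gK by blast
  qed simp
  then have "homotopic_with (\<lambda>_. True) ?X (geometric_realization K) (\<lambda>x. h (1, x)) (\<lambda>_. vertex_point (g w))"
    by simp
  ultimately show ?thesis by (rule homotopic_with_trans)
qed

lemma vertices_homotopic:
  assumes K: "finite_complex K" and uw: "{u, w} \<in> K"
  shows "homotopic_with (\<lambda>_. True) X (geometric_realization K) (\<lambda>_. vertex_point u) (\<lambda>_. vertex_point w)"
proof -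
  have in1: "{u} \<in> K" "{w} \<in> K" using finite_complexD(4)[OF K uw] by auto
  have c: "vertex_point a \<in> closed_simplex {u, w}" if "a \<in> {u, w}" for a
    using that simplex_mono[of "{a}" "{u, w}"] by (auto simp: closed_simplex_def vertex_point_def)
  have "homotopic_with (\<lambda>k. \<forall>x\<in>{}. k x = undefined) X (geometric_realization K) (\<lambda>_. vertex_point u) (\<lambda>_. vertex_point w)"
    by (rule realization_straight_homotopy[OF K]) (use in1 uw c vertex_point_in[of _ K] in auto)
  then show ?thesis by simp
qed

text \<open>A path along edges of the cube up to the base point, adding one coordinate at a time.
  Edges have fewer than eight vertices, so none of them was deleted.\<close>

lemma cube_vertices_homotopic:
  assumes "u \<subseteq> {1..m}"
  shows "homotopic_with (\<lambda>_. True) X (geometric_realization (vr m - facets m))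
    (\<lambda>_. vertex_point u) (\<lambda>_. vertex_point {1..m})"
  using assms
proof (induction "card ({1..m} - u)" arbitrary: u)
  case 0
  then have "u = {1..m}" by simp
  then show ?case using vertices_homotopic[OF finite_complex_vr_Diff_facets, of "{1..m}" "{1..m}" m X]
      vr_vertices_edges[of "{{1..m}}" m] by (simp add: vr_def)
next
  case (Suc k)
  then obtain i where i: "i \<in> {1..m}" "i \<notin> u" by (metis Diff_iff card.empty equals0I nat.distinct(1))
  have "homotopic_with (\<lambda>_. True) X (geometric_realization (vr m - facets m))
    (\<lambda>_. vertex_point u) (\<lambda>_. vertex_point (insert i u))"
  proof (rule vertices_homotopic[OF finite_complex_vr_Diff_facets vr_vertices_edges])
    have fl: "flip u (insert i u) = {i}" "flip (insert i u) u = {i}" "\<And>x. flip x x = {}"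
      using i by (auto simp: mem_flip)
    then show "{u, insert i u} \<in> vr m" using Suc.prems i by (auto simp: vr_def ham_def)
    show "card {u, insert i u} < 8" by (simp add: card_insert_if)
  qed
  moreover have "card ({1..m} - insert i u) = card ({1..m} - u) - 1"
    using i by (simp add: Diff_insert[of _ i u])
  then have "k = card ({1..m} - insert i u)" using Suc.hyps(2) by linarith
  then have "homotopic_with (\<lambda>_. True) X (geometric_realization (vr m - facets m))
    (\<lambda>_. vertex_point (insert i u)) (\<lambda>_. vertex_point {1..m})"
    by (rule Suc.hyps(1)) (use Suc.prems i in auto)
  ultimately show ?case by (rule homotopic_with_trans)
qed

text \<open>All other antipode-free sets of the 4-face are still simplices, in particular the
  antipodal facet; the boundary is contracted there to the top \<open>q \<union> D\<close> of the
  4-face, which is then moved to the base point.\<close>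

lemma facet_boundary_null_homotopic:
  assumes "\<sigma> \<in> facets m"
  shows "homotopic_with (\<lambda>_. True) (subtopology (powertop_real UNIV) (simplex_boundary \<sigma>))
    (geometric_realization (vr m - facets m)) (\<lambda>_. vertex_point {1..m}) id"
proof -
  obtain q D where i: "(q, D) \<in> cube_index m" and \<sigma>: "\<sigma> = facet q D" using assms by (auto simp: facets_def)
  note d = cube_indexD[OF i]
  note ctx = d(1,2,3,5)
  have sc: "v \<in> cube q D" if "v \<in> \<sigma>" for v using that facet_subset_cube[OF ctx] \<sigma> by blast
  have ff: "flip v D \<notin> \<sigma>" "flip v D \<in> cube q D" if "v \<in> \<sigma>" for v
    using that facet_flip[OF ctx sc] cube_flip(1)[OF ctx sc] \<sigma> by auto
  have qs: "q \<in> \<sigma>" "flip q D = q \<union> D" using bottom_top(1,5)[OF ctx] \<sigma> by auto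
  have "homotopic_with (\<lambda>_. True) (subtopology (powertop_real UNIV) (simplex_boundary \<sigma>))
    (geometric_realization (vr m - facets m)) id (\<lambda>_. vertex_point (flip q D))"
  proof (rule boundary_homotopic_antipodal[OF finite_complex_vr_Diff_facets _ _ _ _ qs(1)])
    show "finite \<sigma>" using finite_subset[OF facet_subset_cube[OF ctx] finite_cube(1)[OF ctx]] \<sigma> by simp
    show "inj_on (\<lambda>v. flip v D) \<sigma>" by (rule inj_on_inverseI[of _ "\<lambda>v. flip v D"]) (use cube_flip(2)[OF ctx sc] in simp)
    show "(\<lambda>v. flip v D) ` \<sigma> \<inter> \<sigma> = {}" using ff(1) by auto
    fix T assume T: "T \<subseteq> \<sigma> \<union> (\<lambda>v. flip v D) ` \<sigma>" "T \<noteq> {}" "\<And>v. v \<in> \<sigma> \<Longrightarrow> v \<in> T \<Longrightarrow> flip v D \<notin> T" "T \<noteq> \<sigma>"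
    have Tc: "T \<subseteq> cube q D" using T(1) sc ff(2) by blast
    have "T \<in> vr m"
    proof (rule antipode_free_vr[OF ctx Tc T(2) _ d(4)])
      fix x assume x: "x \<in> T"
      show "flip x D \<notin> T"
      proof (cases "x \<in> \<sigma>")
        case False
        then obtain v where v: "v \<in> \<sigma>" "x = flip v D" using x T(1) by blast
        then have "flip x D = v" using cube_flip(2)[OF ctx sc] by simp
        then show ?thesis using T(3)[OF v(1)] v(2) x by metis
      qed (use T(3) x in blast)
    qed
    moreover have "T \<notin> facets m" using facets_eq_facet[OF i _ Tc] T(4) \<sigma> by blast
    ultimately show "T \<in> vr m - facets m" by blast
  qed
  moreover have "homotopic_with (\<lambda>_. True) (subtopology (powertop_real UNIV) (simplex_boundary \<sigma>))
    (geometric_realization (vr m - facets m)) (\<lambda>_. vertex_point (flip q D)) (\<lambda>_. vertex_point {1..m})"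
    unfolding qs(2) by (rule cube_vertices_homotopic[OF d(4)])
  ultimately show ?thesis using homotopic_with_trans homotopic_with_symD by blast
qed

lemma vertex_realization_pointed_equivalent:
  "pointed_equivalent (geometric_realization {{w}}) (vertex_point w) (discrete_topology {()}) ()"
proof -
  have K: "finite_complex {{w}}" by (auto simp: finite_complex_def)
  have "realization_points {{w}} = {vertex_point w}"
    by (auto simp: realization_points_def closed_simplex_def vertex_point_def fun_eq_iff)
  then have top: "topspace (geometric_realization {{w}}) = {vertex_point w}" by simp
  have "homotopic_with (\<lambda>h. h (vertex_point w) = vertex_point w) (geometric_realization {{w}})
      (geometric_realization {{w}}) ((\<lambda>_. vertex_point w) \<circ> (\<lambda>_. ())) id"
    by (rule homotopic_with_equal) (use top in auto)
  moreover have "homotopic_with (\<lambda>h. h () = ()) (discrete_topology {()}) (discrete_topology {()})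
      ((\<lambda>_. ()) \<circ> (\<lambda>_. vertex_point w)) id"
    by (rule homotopic_with_equal) auto
  ultimately show ?thesis unfolding pointed_equivalent_def using top
    by (intro conjI exI[of _ "\<lambda>_. ()"] exI[of _ "\<lambda>_. vertex_point w"]) auto
qed

text \<open>Without the flags the complex is contractible, so the boundaries of the flags are
  null-homotopic there and each flag contributes a 4-sphere.\<close>

lemma chain_simplices_sphere_wedge:
  "pointed_equivalent (geometric_realization (chain_simplices m)) (vertex_point {1..m})
     (sphere_wedge (card (flag_simplices m)) 4) None"
proof -
  have S: "flag_simplices m \<subseteq> chain_simplices m" using flag_simplices_chain(1) by blast
  have fin: "finite (flag_simplices m)"
    using finite_subset[OF S finite_complexD(1)[OF finite_complex_chain_simplices]] .
  have c5: "card \<sigma> = Suc 4" if "\<sigma> \<in> flag_simplices m" for \<sigma> using flag_simplices_chain(3)[OF that] by simp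
  obtain \<beta> where W: "attaches (sphere_wedge (card (flag_simplices m)) 4) (discrete_topology {()})
      (boundary_space (flag_simplices m)) (\<lambda>_. None) \<beta> (\<lambda>_. ()) fst"
    using attaches_sphere_wedge[OF fin c5] by auto
  have eq: "pointed_equivalent (geometric_realization (chain_simplices m - flag_simplices m)) (vertex_point {1..m})
      (discrete_topology {()}) ()"
    by (rule pointed_equivalent_trans[OF chain_simplices_Diff_flags_collapse
          pointed_equivalent_trans[OF noncritical_chains_collapse vertex_realization_pointed_equivalent]])
  have K': "finite_complex (chain_simplices m - flag_simplices m)"
    by (rule maximal_Diff_finite_complex[OF finite_complex_chain_simplices flag_simplices_maximal])
  show ?thesis
  proof (rule pointed_equivalent_attach_simplices[OF finite_complex_chain_simplices S c5 _ flag_simplices_maximal _ eq W])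
    fix \<sigma> assume \<sigma>: "\<sigma> \<in> flag_simplices m"
    show "homotopic_with (\<lambda>_. True) (subtopology (powertop_real UNIV) (simplex_boundary \<sigma>))
        (geometric_realization (chain_simplices m - flag_simplices m)) (\<lambda>_. vertex_point {1..m}) id"
    proof (rule contractible_null_homotopic[OF eq])
      show "continuous_map (subtopology (powertop_real UNIV) (simplex_boundary \<sigma>))
          (geometric_realization (chain_simplices m - flag_simplices m)) id"
        unfolding continuous_map_realization[OF K']
        using simplex_boundary_in_Diff[OF finite_complex_chain_simplices \<sigma> flag_simplices_chain(1)[OF \<sigma>] flag_simplices_maximal[of _ m]]
        by (auto intro: continuous_map_coordinate)
    qed
  qed simp_all
qed

text \<open>A zigzag: the first collapse is read backwards, up to the complex with all 4-faces
  filled, from which the others lead down.\<close>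

lemma vr_Diff_facets_sphere_wedge:
  "pointed_equivalent (geometric_realization (vr m - facets m)) (vertex_point {1..m})
     (sphere_wedge (card (flag_simplices m)) 4) None"
  by (rule pointed_equivalent_trans[OF pointed_equivalent_sym[OF collapse_antipodal]
      pointed_equivalent_trans[OF collapse_obstructed pointed_equivalent_trans[OF collapse_many_evens
      pointed_equivalent_trans[OF collapse_few_evens pointed_equivalent_trans[OF cube_simplices_collapse
      chain_simplices_sphere_wedge]]]]])

theorem theorem5p2:
  fixes m :: nat
  assumes "m \<ge> 5"
  shows "geometric_realization (vietoris_rips (hypercube m) hypercube_dist 3)
    homotopy_equivalent_space
      wedge2 (sphere_wedge (2 ^ (m - 4) * (m choose 4)) 7) None
             (sphere_wedge (\<Sum>i = 4..m - 1. 2 ^ (i - 4) * (i choose 4)) 4) None"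
proof -
  let ?V = "sphere_wedge (card (flag_simplices m)) 4"
  have S: "facets m \<subseteq> vr m" using facets_vr(1) by blast
  have fin: "finite (facets m)" using finite_subset[OF S finite_complexD(1)[OF finite_complex_vr]] .
  have c8: "card \<sigma> = Suc 7" if "\<sigma> \<in> facets m" for \<sigma> using facets_vr(2)[OF that] by simp
  obtain \<beta> where W: "attaches (sphere_wedge (card (facets m)) 7) (discrete_topology {()})
      (boundary_space (facets m)) (\<lambda>_. None) \<beta> (\<lambda>_. ()) fst"
    using attaches_sphere_wedge[OF fin c8] by auto
  have "None \<in> topspace ?V" using vr_Diff_facets_sphere_wedge[of m] by (simp add: pointed_equivalent_def)
  \<comment> \<open>The same boundaries, attached at the base point of the wedge of 4-spheres, form
    the model with which the complex is compared.\<close>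
  note W2 = attaches_wedge2[OF W this]
  have "pointed_equivalent (geometric_realization (vr m)) (vertex_point {1..m})
      (wedge2 (sphere_wedge (card (facets m)) 7) None ?V None)
      (wedge_incl (\<lambda>b. if b then None else None) False None)"
    by (rule pointed_equivalent_attach_simplices[OF finite_complex_vr S c8 _ facets_vr(3)
          facet_boundary_null_homotopic vr_Diff_facets_sphere_wedge W2]) simp_all
  then show ?thesis
    unfolding vr_eq card_facets card_flag_simplices by (rule pointed_equivalent_imp_homotopy_equivalent_space)
qed

end
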